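(* If $I^{\sigma,\alpha}:=\int_{\mathbb{R}} \sigma(x)^{-\alpha}|x|^{\alpha-1}\,dx<\infty$, then the killed semigroup $(P_t^0)_{t>0}$ is compact on $L^2(\mathbb{R}^0;\mu)$, i.e. $P_t^0$ is a compact operator on $L^2(\mathbb{R}^0;\mu)$ for every $t>0$.
   Context: Let $\alpha\in(1,2)$ and let $X=(X_t)_{t\ge 0}$ be a symmetric $\alpha$-stable process on $\mathbb{R}$ with generator $-(-\Delta)^{\alpha/2}$ (fractional Laplacian). Let $\sigma$ be a strictly positive continuous function on $\mathbb{R}$ such that $\mu(dx):=\sigma(x)^{-\alpha}dx$ is a probability measure on $\mathbb{R}$. Let $Y=(Y_t)_{t\ge 0}$ be the time-changed process $Y_t:=X_{\zeta_t}$, where $\zeta_t:=\inf\{s>0:\int_0^s\sigma(X_u)^{-\alpha}\,du>t\}$; it is the unique weak solution of the SDE $dY_t=\sigma(Y_{t-})\,dX_t$. $\mathbb{P}_x$ is the law with $Y_0=x$. Put $\mathbb{R}^0:=\mathbb{R}\setminus\{0\}$ and $T_0:=\inf\{t>0:Y_t=0\}$. The process $Y$ killed upon hitting $0$ has transition function $P_t^0(x,A)=\mathbb{P}_x[Y_t\in A,\ t<T_0]$ for $x\in\mathbb{R}^0$ and Borel $A\subseteq\mathbb{R}^0$; this is symmetric with respect to $\mu$ and acts as a semigroup on $L^2(\mathbb{R}^0;\mu)$, the space of $\mu$-square integrable functions on $\mathbb{R}^0$. *)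

theory Defs
  imports "HOL-Probability.Probability"
begin

subsection \<open>Symmetric stable processes\<close>

definition cadlag :: "(real \<Rightarrow> real) \<Rightarrow> bool" where
  "cadlag w \<longleftrightarrow>
     (\<forall>t\<ge>0. continuous (at_right t) w) \<and>
     (\<forall>t>0. \<exists>l. (w \<longlongrightarrow> l) (at_left t))"

text \<open>Paths are functions on the whole real line of which only the restriction to nonnegative
  times is relevant.  The factor 1 in front of \<open>\<bar>\<xi>\<bar> powr \<alpha>\<close> is the normalisation that makes
  the generator the Fourier multiplier with symbol \<open>- \<bar>\<xi>\<bar> powr \<alpha>\<close>, that is, minus the fractional
  Laplacian of order \<open>\<alpha> / 2\<close>.\<close>

definition symmetric_stable_process ::
    "real \<Rightarrow> 'a measure \<Rightarrow> (real \<Rightarrow> 'a \<Rightarrow> real) \<Rightarrow> bool" where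
  "symmetric_stable_process \<alpha> M X \<longleftrightarrow>
     prob_space M \<and>
     (\<forall>t\<ge>0. X t \<in> borel_measurable M) \<and>
     (AE \<omega> in M. X 0 \<omega> = 0) \<and>
     (AE \<omega> in M. cadlag (\<lambda>t. X t \<omega>)) \<and>
     (\<forall>(n::nat) t. 0 \<le> t 0 \<and> incseq t \<longrightarrow>
        prob_space.indep_vars M (\<lambda>_. borel) (\<lambda>i \<omega>. X (t (Suc i)) \<omega> - X (t i) \<omega>) {..<n}) \<and>
     (\<forall>s t \<xi>. 0 \<le> s \<and> s \<le> t \<longrightarrow>
        char (distr M borel (\<lambda>\<omega>. X t \<omega> - X s \<omega>)) \<xi> =
          of_real (exp (- (t - s) * \<bar>\<xi>\<bar> powr \<alpha>)))"

subsection \<open>The time change and the killed semigroup\<close>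

definition clock :: "(real \<Rightarrow> real) \<Rightarrow> real \<Rightarrow> (real \<Rightarrow> real) \<Rightarrow> real \<Rightarrow> real" where
  "clock \<sigma> \<alpha> w s = (LBINT u:{0..s}. \<sigma> (w u) powr (- \<alpha>))"

text \<open>For \<open>\<alpha> > 1\<close> the stable process is recurrent, so almost surely the clock tends to infinity
  and the set below is nonempty for every \<open>t\<close>; the arbitrary value of \<^term>\<open>Inf {}\<close> therefore
  only matters on a null set.\<close>

definition inverse_clock :: "(real \<Rightarrow> real) \<Rightarrow> real \<Rightarrow> (real \<Rightarrow> real) \<Rightarrow> real \<Rightarrow> real" where
  "inverse_clock \<sigma> \<alpha> w t = Inf {s. 0 < s \<and> clock \<sigma> \<alpha> w s > t}"

definition time_changed :: "(real \<Rightarrow> real) \<Rightarrow> real \<Rightarrow> (real \<Rightarrow> real) \<Rightarrow> real \<Rightarrow> real" where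
  "time_changed \<sigma> \<alpha> w t = w (inverse_clock \<sigma> \<alpha> w t)"

definition hitting_time_zero :: "(real \<Rightarrow> real) \<Rightarrow> ereal" where
  "hitting_time_zero y = Inf (ereal ` {t. 0 < t \<and> y t = 0})"

text \<open>Under the law with starting point \<open>x\<close> the stable process is \<open>x + X\<close>, where \<open>X\<close> starts
  at 0.\<close>

definition Y_process ::
    "(real \<Rightarrow> real) \<Rightarrow> real \<Rightarrow> (real \<Rightarrow> 'a \<Rightarrow> real) \<Rightarrow> real \<Rightarrow> real \<Rightarrow> 'a \<Rightarrow> real" where
  "Y_process \<sigma> \<alpha> X x t \<omega> = time_changed \<sigma> \<alpha> (\<lambda>s. x + X s \<omega>) t"

abbreviation R0 :: "real set" where
  "R0 \<equiv> - {0}"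

text \<open>Hitting times of points by right-continuous processes are in general measurable only with
  respect to the completed sigma-algebra, whence \<^term>\<open>completion M\<close>.\<close>

definition killed_kernel ::
    "(real \<Rightarrow> real) \<Rightarrow> real \<Rightarrow> 'a measure \<Rightarrow> (real \<Rightarrow> 'a \<Rightarrow> real) \<Rightarrow> real \<Rightarrow> real \<Rightarrow> real measure"
  where
  "killed_kernel \<sigma> \<alpha> M X t x =
     measure_of R0 (sets (restrict_space borel R0))
       (\<lambda>A. emeasure (completion M)
          {\<omega> \<in> space M. Y_process \<sigma> \<alpha> X x t \<omega> \<in> A \<and>
             ereal t < hitting_time_zero (\<lambda>s. Y_process \<sigma> \<alpha> X x s \<omega>)})"

definition killed_semigroup ::
    "(real \<Rightarrow> real) \<Rightarrow> real \<Rightarrow> 'a measure \<Rightarrow> (real \<Rightarrow> 'a \<Rightarrow> real) \<Rightarrow>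
      real \<Rightarrow> (real \<Rightarrow> real) \<Rightarrow> real \<Rightarrow> real" where
  "killed_semigroup \<sigma> \<alpha> M X t f x = (\<integral>y. f y \<partial>killed_kernel \<sigma> \<alpha> M X t x)"

definition speed_measure :: "(real \<Rightarrow> real) \<Rightarrow> real \<Rightarrow> real measure" where
  "speed_measure \<sigma> \<alpha> = density lborel (\<lambda>x. ennreal (\<sigma> x powr (- \<alpha>)))"

subsection \<open>The space of square integrable functions and compact operators on it\<close>

definition square_integrable :: "'b measure \<Rightarrow> ('b \<Rightarrow> real) set" where
  "square_integrable N = {f \<in> borel_measurable N. integrable N (\<lambda>x. (f x)\<^sup>2)}"

definition L2_norm :: "'b measure \<Rightarrow> ('b \<Rightarrow> real) \<Rightarrow> real" where
  "L2_norm N f = sqrt (\<integral>x. (f x)\<^sup>2 \<partial>N)"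

definition AE_equal :: "'b measure \<Rightarrow> (('b \<Rightarrow> real) \<times> ('b \<Rightarrow> real)) set" where
  "AE_equal N = {(f, g). f \<in> square_integrable N \<and> g \<in> square_integrable N \<and>
     (AE x in N. f x = g x)}"

definition L2_space :: "'b measure \<Rightarrow> ('b \<Rightarrow> real) set set" where
  "L2_space N = square_integrable N // AE_equal N"

definition L2_class :: "'b measure \<Rightarrow> ('b \<Rightarrow> real) \<Rightarrow> ('b \<Rightarrow> real) set" where
  "L2_class N f = AE_equal N `` {f}"

definition L2_dist :: "'b measure \<Rightarrow> ('b \<Rightarrow> real) set \<Rightarrow> ('b \<Rightarrow> real) set \<Rightarrow> real" where
  "L2_dist N F G = L2_norm N (\<lambda>x. (SOME f. f \<in> F) x - (SOME g. g \<in> G) x)"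

abbreviation L2_topology :: "'b measure \<Rightarrow> ('b \<Rightarrow> real) set topology" where
  "L2_topology N \<equiv> Metric_space.mtopology (L2_space N) (L2_dist N)"

text \<open>A map \<open>T\<close> on functions acts linearly on \<open>L\<^sup>2\<close> if it preserves square integrability, respects
  almost everywhere equality, and is linear up to null sets.\<close>

definition acts_linearly_on_L2 :: "'b measure \<Rightarrow> (('b \<Rightarrow> real) \<Rightarrow> 'b \<Rightarrow> real) \<Rightarrow> bool" where
  "acts_linearly_on_L2 N T \<longleftrightarrow>
     (\<forall>f \<in> square_integrable N. T f \<in> square_integrable N) \<and>
     (\<forall>f \<in> square_integrable N. \<forall>g \<in> square_integrable N.
        (AE x in N. f x = g x) \<longrightarrow> (AE x in N. T f x = T g x)) \<and>
     (\<forall>f \<in> square_integrable N. \<forall>g \<in> square_integrable N. \<forall>a b.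
        AE x in N. T (\<lambda>y. a * f y + b * g y) x = a * T f x + b * T g x)"

definition compact_operator_on_L2 :: "'b measure \<Rightarrow> (('b \<Rightarrow> real) \<Rightarrow> 'b \<Rightarrow> real) \<Rightarrow> bool" where
  "compact_operator_on_L2 N T \<longleftrightarrow>
     acts_linearly_on_L2 N T \<and>
     compactin (L2_topology N)
       (L2_topology N closure_of
          ((\<lambda>f. L2_class N (T f)) ` {f \<in> square_integrable N. L2_norm N f \<le> 1}))"

text \<open>\<^const>\<open>L2_dist\<close> is the \<open>L\<^sup>2\<close> metric, independent of the chosen representatives.\<close>

lemma square_integrable_measurable:
  "f \<in> square_integrable N \<Longrightarrow> f \<in> borel_measurable N"
  by (simp add: square_integrable_def)

lemma square_integrable_mult:
  assumes "f \<in> square_integrable N" "g \<in> square_integrable N"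
  shows "integrable N (\<lambda>x. f x * g x)"
proof (rule Bochner_Integration.integrable_bound)
  show "integrable N (\<lambda>x. (f x)\<^sup>2 + (g x)\<^sup>2)"
    using assms by (simp add: square_integrable_def)
  show "(\<lambda>x. f x * g x) \<in> borel_measurable N"
    by (rule borel_measurable_times[OF square_integrable_measurable[OF assms(1)]
          square_integrable_measurable[OF assms(2)]])
  have "\<bar>a * b\<bar> \<le> a\<^sup>2 + b\<^sup>2" for a b :: real
  proof -
    have "2 * \<bar>a * b\<bar> \<le> a\<^sup>2 + b\<^sup>2"
      using sum_squares_bound[of "\<bar>a\<bar>" "\<bar>b\<bar>"] by (simp add: abs_mult mult.assoc)
    then show ?thesis by linarith
  qed
  then show "AE x in N. norm (f x * g x) \<le> norm ((f x)\<^sup>2 + (g x)\<^sup>2)"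
    by simp
qed

lemma square_integrable_lincomb:
  assumes "f \<in> square_integrable N" "g \<in> square_integrable N"
  shows "(\<lambda>x. a * f x + b * g x) \<in> square_integrable N"
proof -
  have "integrable N (\<lambda>x. a\<^sup>2 * (f x)\<^sup>2 + b\<^sup>2 * (g x)\<^sup>2 + 2 * a * b * (f x * g x))"
    using assms square_integrable_mult[OF assms] by (simp add: square_integrable_def)
  moreover have "(\<lambda>x. a\<^sup>2 * (f x)\<^sup>2 + b\<^sup>2 * (g x)\<^sup>2 + 2 * a * b * (f x * g x)) =
      (\<lambda>x. (a * f x + b * g x)\<^sup>2)"
    by (auto simp: power2_eq_square algebra_simps)
  ultimately have "integrable N (\<lambda>x. (a * f x + b * g x)\<^sup>2)" by simp
  moreover have "(\<lambda>x. a * f x + b * g x) \<in> borel_measurable N"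
    by (rule borel_measurable_add[OF
        borel_measurable_times[OF borel_measurable_const square_integrable_measurable[OF assms(1)]]
        borel_measurable_times[OF borel_measurable_const square_integrable_measurable[OF assms(2)]]])
  ultimately show ?thesis by (simp add: square_integrable_def)
qed

lemma square_integrable_diff:
  assumes "f \<in> square_integrable N" "g \<in> square_integrable N"
  shows "(\<lambda>x. f x - g x) \<in> square_integrable N"
  using square_integrable_lincomb[OF assms, of 1 "-1"] by simp

lemma L2_Cauchy_Schwarz:
  assumes f: "f \<in> square_integrable N" and g: "g \<in> square_integrable N"
  shows "(\<integral>x. f x * g x \<partial>N) \<le> L2_norm N f * L2_norm N g"
proof -
  define A where "A = (\<integral>x. (f x)\<^sup>2 \<partial>N)"
  define B where "B = (\<integral>x. (g x)\<^sup>2 \<partial>N)"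
  define C where "C = (\<integral>x. f x * g x \<partial>N)"
  have i: "integrable N (\<lambda>x. (f x)\<^sup>2)" "integrable N (\<lambda>x. (g x)\<^sup>2)" "integrable N (\<lambda>x. f x * g x)"
    using f g square_integrable_mult[OF f g] by (simp_all add: square_integrable_def)
  have AB: "A \<ge> 0" "B \<ge> 0" by (simp_all add: A_def B_def)
  have quad: "0 \<le> a\<^sup>2 * A + b\<^sup>2 * B - 2 * a * b * C" for a b
  proof -
    have "0 \<le> (\<integral>x. (a * f x - b * g x)\<^sup>2 \<partial>N)" by simp
    also have "\<dots> = (\<integral>x. a\<^sup>2 * (f x)\<^sup>2 + b\<^sup>2 * (g x)\<^sup>2 - 2 * a * b * (f x * g x) \<partial>N)"
      by (rule Bochner_Integration.integral_cong) (auto simp: power2_eq_square algebra_simps)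
    also have "\<dots> = a\<^sup>2 * A + b\<^sup>2 * B - 2 * a * b * C"
      using i by (simp add: A_def B_def C_def)
    finally show ?thesis .
  qed
  have "C\<^sup>2 \<le> A * B"
  proof (cases "A = 0")
    case True
    have "C = 0"
    proof (rule ccontr)
      assume "C \<noteq> 0"
      have "0 \<le> C\<^sup>2 * B - 2 * ((B + 1) / 2) * C * C"
        using quad[of "(B + 1) / 2" C] True by (simp add: algebra_simps)
      then have "C\<^sup>2 \<le> 0" by (simp add: power2_eq_square algebra_simps)
      with \<open>C \<noteq> 0\<close> show False by simp
    qed
    then show ?thesis using AB by simp
  next
    case False
    have "0 \<le> C\<^sup>2 * A + A\<^sup>2 * B - 2 * C * A * C" by (rule quad)
    then have "0 \<le> A * (A * B - C\<^sup>2)" by (simp add: power2_eq_square algebra_simps)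
    then show ?thesis using False AB by (simp add: zero_le_mult_iff)
  qed
  then have "\<bar>C\<bar> \<le> sqrt (A * B)" using real_sqrt_le_mono by fastforce
  then show ?thesis by (simp add: C_def A_def B_def L2_norm_def real_sqrt_mult)
qed

lemma L2_norm_triangle:
  assumes f: "f \<in> square_integrable N" and g: "g \<in> square_integrable N"
  shows "L2_norm N (\<lambda>x. f x + g x) \<le> L2_norm N f + L2_norm N g"
proof -
  have i: "integrable N (\<lambda>x. (f x)\<^sup>2)" "integrable N (\<lambda>x. (g x)\<^sup>2)" "integrable N (\<lambda>x. f x * g x)"
    using f g square_integrable_mult[OF f g] by (simp_all add: square_integrable_def)
  have "(\<integral>x. (f x + g x)\<^sup>2 \<partial>N) = (\<integral>x. (f x)\<^sup>2 + (g x)\<^sup>2 + 2 * (f x * g x) \<partial>N)"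
    by (rule Bochner_Integration.integral_cong) (auto simp: power2_eq_square algebra_simps)
  also have "\<dots> = (L2_norm N f)\<^sup>2 + (L2_norm N g)\<^sup>2 + 2 * (\<integral>x. f x * g x \<partial>N)"
    using i by (simp add: L2_norm_def)
  also have "\<dots> \<le> (L2_norm N f)\<^sup>2 + (L2_norm N g)\<^sup>2 + 2 * (L2_norm N f * L2_norm N g)"
    using L2_Cauchy_Schwarz[OF f g] by simp
  also have "\<dots> = (L2_norm N f + L2_norm N g)\<^sup>2"
    by (simp add: power2_eq_square algebra_simps)
  finally show ?thesis
    unfolding L2_norm_def[of N "\<lambda>x. f x + g x"]
    by (intro real_le_lsqrt) (simp_all add: L2_norm_def)
qed

lemma equiv_AE_equal: "equiv (square_integrable N) (AE_equal N)"
proof (rule equivI)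
  show "AE_equal N \<subseteq> square_integrable N \<times> square_integrable N"
    by (auto simp: AE_equal_def)
  show "refl_on (square_integrable N) (AE_equal N)"
    by (auto simp: refl_on_def AE_equal_def)
  show "sym (AE_equal N)"
  proof (rule symI)
    fix f g assume "(f, g) \<in> AE_equal N"
    moreover from this have "AE x in N. f x = g x" by (simp add: AE_equal_def)
    then have "AE x in N. g x = f x" by eventually_elim simp
    ultimately show "(g, f) \<in> AE_equal N" by (simp add: AE_equal_def)
  qed
  show "trans (AE_equal N)"
  proof (rule transI)
    fix f g h assume fg: "(f, g) \<in> AE_equal N" and gh: "(g, h) \<in> AE_equal N"
    then have "AE x in N. f x = g x" "AE x in N. g x = h x" by (simp_all add: AE_equal_def)
    then have "AE x in N. f x = h x" by eventually_elim simp
    with fg gh show "(f, h) \<in> AE_equal N" by (simp add: AE_equal_def)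
  qed
qed

lemma L2_class_iff:
  assumes "f \<in> square_integrable N"
  shows "g \<in> L2_class N f \<longleftrightarrow> g \<in> square_integrable N \<and> (AE x in N. f x = g x)"
  using assms by (auto simp: L2_class_def AE_equal_def)

lemma L2_space_cases:
  assumes "F \<in> L2_space N"
  obtains f where "f \<in> square_integrable N" "F = L2_class N f"
  using assms by (auto simp: L2_space_def L2_class_def quotient_def)

lemma L2_dist_class:
  assumes f: "f \<in> square_integrable N" and g: "g \<in> square_integrable N"
  shows "L2_dist N (L2_class N f) (L2_class N g) = L2_norm N (\<lambda>x. f x - g x)"
proof -
  define f' where "f' = (SOME h. h \<in> L2_class N f)"
  define g' where "g' = (SOME h. h \<in> L2_class N g)"
  have "f' \<in> L2_class N f"
    unfolding f'_def by (rule someI[where x = f]) (simp add: L2_class_iff f)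
  then have f': "f' \<in> square_integrable N" "AE x in N. f x = f' x"
    by (simp_all add: L2_class_iff f)
  have "g' \<in> L2_class N g"
    unfolding g'_def by (rule someI[where x = g]) (simp add: L2_class_iff g)
  then have g': "g' \<in> square_integrable N" "AE x in N. g x = g' x"
    by (simp_all add: L2_class_iff g)
  have "(\<integral>x. (f' x - g' x)\<^sup>2 \<partial>N) = (\<integral>x. (f x - g x)\<^sup>2 \<partial>N)"
  proof (rule integral_cong_AE)
    show "(\<lambda>x. (f' x - g' x)\<^sup>2) \<in> borel_measurable N"
      by (rule borel_measurable_power[OF borel_measurable_diff[OF
          square_integrable_measurable[OF f'(1)] square_integrable_measurable[OF g'(1)]]])
    show "(\<lambda>x. (f x - g x)\<^sup>2) \<in> borel_measurable N"
      by (rule borel_measurable_power[OF borel_measurable_diff[OF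
          square_integrable_measurable[OF f] square_integrable_measurable[OF g]]])
    show "AE x in N. (f' x - g' x)\<^sup>2 = (f x - g x)\<^sup>2"
      using f'(2) g'(2) by eventually_elim simp
  qed
  then show ?thesis
    unfolding L2_dist_def f'_def[symmetric] g'_def[symmetric] by (simp add: L2_norm_def)
qed

lemma Metric_space_L2: "Metric_space (L2_space N) (L2_dist N)"
proof
  show "0 \<le> L2_dist N F G" for F G
    by (simp add: L2_dist_def L2_norm_def)
  show "L2_dist N F G = L2_dist N G F" for F G
    by (simp add: L2_dist_def L2_norm_def power2_commute)
next
  fix F G assume "F \<in> L2_space N" "G \<in> L2_space N"
  then obtain f g where f: "f \<in> square_integrable N" "F = L2_class N f"
    and g: "g \<in> square_integrable N" "G = L2_class N g"
    by (auto elim!: L2_space_cases)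
  have i: "integrable N (\<lambda>x. (f x - g x)\<^sup>2)"
    using square_integrable_diff[OF f(1) g(1)] by (simp add: square_integrable_def)
  have "L2_dist N F G = 0 \<longleftrightarrow> (\<integral>x. (f x - g x)\<^sup>2 \<partial>N) = 0"
    by (simp add: f(2) g(2) L2_dist_class[OF f(1) g(1)] L2_norm_def)
  also have "\<dots> \<longleftrightarrow> (AE x in N. f x = g x)"
    by (subst integral_nonneg_eq_0_iff_AE[OF i]) auto
  also have "\<dots> \<longleftrightarrow> (f, g) \<in> AE_equal N"
    using f g by (simp add: AE_equal_def)
  also have "\<dots> \<longleftrightarrow> F = G"
    unfolding f(2) g(2) L2_class_def
    by (rule eq_equiv_class_iff[OF equiv_AE_equal f(1) g(1), symmetric])
  finally show "L2_dist N F G = 0 \<longleftrightarrow> F = G" .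
next
  fix F G H assume "F \<in> L2_space N" "G \<in> L2_space N" "H \<in> L2_space N"
  then obtain f g h where f: "f \<in> square_integrable N" "F = L2_class N f"
    and g: "g \<in> square_integrable N" "G = L2_class N g"
    and h: "h \<in> square_integrable N" "H = L2_class N h"
    by (auto elim!: L2_space_cases)
  show "L2_dist N F H \<le> L2_dist N F G + L2_dist N G H"
    using L2_norm_triangle[OF square_integrable_diff[OF f(1) g(1)] square_integrable_diff[OF g(1) h(1)]]
    by (simp add: f g h L2_dist_class)
qed

end

theory Submission
  imports Defs "HOL-Complex_Analysis.Great_Picard"
begin

text \<open>Because \<open>\<alpha> > 1\<close>, the stable process sampled at an independent exponential time of rate \<open>l\<close>
  has a continuous density \<open>l u\<^sub>l\<close> that is Hoelder of order \<open>\<alpha> - 1\<close> uniformly in \<open>l\<close>, and points are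
  hit. The strong Markov property at the hitting time of 0 gives the killed resolvent kernel
  \<open>u\<^sub>l(y - x) - u\<^sub>l(x) u\<^sub>l(y) / u\<^sub>l(0)\<close>; as \<open>l\<close> tends to 0 the Green function \<open>g(x, y)\<close> is bounded by
  a multiple of \<open>\<bar>x y\<bar>\<close> to the power \<open>(\<alpha> - 1) / 2\<close> and Hoelder in \<open>x\<close> uniformly in \<open>y\<close>. By the time
  change, the potential of the killed process \<open>Y\<close> is \<open>G f(x) = \<integral> g(x, y) f(y) \<mu>(dy)\<close>. The moment
  condition and the Hoelder bound make \<open>G\<close> compact from bounded sets of \<open>L\<^sup>2(\<mu>)\<close> to \<open>L\<^sup>2(\<mu>)\<close>, and
  symmetry gives \<open>4 t \<parallel>P\<^sub>t f\<parallel>\<^sup>2 \<le> \<langle>f, G f\<rangle>\<close>, so compactness passes from \<open>G\<close> to \<open>P\<^sub>t\<close>.\<close>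

subsection \<open>Fourier inversion and the potential kernel\<close>

text \<open>At a fixed time the time-changed process sits at a random time of the stable process, so
  neither regularity nor symmetry of P_t can be read off the stable process time by time. The
  computations therefore run over occupation integrals: exponential times for the stable process,
  test functions of two times for the time-changed one. Symmetry and the semigroup law enter
  together, as <P_t f, P_s h> = <f, P_(t+s) h>.

  The strong Markov property at the hitting time of 0 is replaced by the one at entrance into (-e,
  e) along grids; letting e tend to 0 costs only the oscillation of the resolvent near 0.

  As l tends to 0, u_l(0) diverges, which is recurrence. Every estimate of the Green function is
  therefore arranged in differences of u_l. They give the bounds |x|^(\<alpha>-1) and
  |y|^(\<alpha>-1); the smaller is at most the geometric mean of the two, whence the exponent
  (\<alpha>-1)/2, and the moment condition says exactly that |x|^((\<alpha>-1)/2) lies in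
  L^2(mu).\<close>

lemma Re_inversion_kernel:
  fixes a b t :: real
  assumes "t \<noteq> 0"
  shows "Re ((iexp (-(t * a)) - iexp (-(t * b))) / (\<i> * t)) = (sin (t * b) - sin (t * a)) / t"
  using assms by (simp add: Re_divide power2_eq_square exp_eq_polar cis.ctr field_simps)

lemma integral_cos_interval:
  fixes a b t :: real
  assumes "t \<noteq> 0" "a \<le> b"
  shows "(LBINT y:{a..b}. cos (t * y)) = (sin (t * b) - sin (t * a)) / t"
proof -
  have "(LBINT y:{a..b}. cos (t * y)) = sin (t * b) / t - sin (t * a) / t"
    unfolding set_lebesgue_integral_def real_scaleR_def mult.commute[of "indicator _ _"]
    using assms
    by (intro integral_FTC_Icc_real)
       (auto intro!: derivative_eq_intros continuous_intros simp: mult.commute)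
  then show ?thesis by (simp add: diff_divide_distrib)
qed

text \<open>Levy's formula gives the mass of an interval as a limit over truncated frequencies. Its
  kernel is bounded by \<open>b - a\<close>, so integrability of \<open>g\<close> removes the
  truncation by dominated convergence. The real part of the kernel is the integral of cos(t y) over
  [a, b], and Fubini exchanges the two integrals.\<close>

lemma (in real_distribution) inversion_integrable_char:
  fixes g :: "real \<Rightarrow> real" and a b :: real
  assumes char: "\<And>t. char M t = of_real (g t)" and g: "integrable lborel g"
    and ab: "a \<le> b" and atoms: "measure M {a} = 0" "measure M {b} = 0"
  shows "measure M {a<..b} = (LBINT y:{a..b}. 1 / (2 * pi) * (\<integral>t. cos (t * y) * g t \<partial>lborel))"
proof -
  define F where "F t = (iexp (-(t * a)) - iexp (-(t * b))) / (\<i> * t)" for t :: real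
  have [measurable]: "g \<in> borel_measurable borel" using g by simp
  have [measurable]: "F \<in> borel_measurable borel" unfolding F_def by measurable
  have Fle: "cmod (F t) \<le> b - a" for t
  proof (cases "t = 0")
    case True then show ?thesis using ab by (simp add: F_def)
  next
    case False
    have "F t = (iexp ((-t) * b) - iexp ((-t) * a)) / (\<i> * of_real (-t))"
      unfolding F_def using False by (simp add: field_simps)
    then show ?thesis using Levy_Inversion_aux2[of a b "-t"] ab False by simp
  qed
  define h where "h t = F t * of_real (g t)" for t
  have hle: "norm (h t) \<le> (b - a) * \<bar>g t\<bar>" for t
    unfolding h_def norm_mult using mult_right_mono[OF Fle, of "\<bar>g t\<bar>" t] by simp
  have gint: "integrable lborel (\<lambda>t. (b - a) * \<bar>g t\<bar>)" using g by simp
  have [measurable]: "h \<in> borel_measurable borel" unfolding h_def by measurable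
  have h: "integrable lborel h"
    by (rule Bochner_Integration.integrable_bound[OF gint])
      (use hle ab in \<open>auto simp: intro: order_trans\<close>)
  have lim1: "(\<lambda>T::nat. 1 / (2 * pi) * (CLBINT t=-T..T. F t * char M t)) \<longlonglongrightarrow> of_real (measure M {a<..b})"
    unfolding F_def using Levy_Inversion[OF ab atoms] by simp
  have eq: "(CLBINT t=-(real T)..real T. F t * char M t) = (\<integral>t. indicator {-real T<..<real T} t *\<^sub>R h t \<partial>lborel)" for T
    by (simp add: interval_lebesgue_integral_def set_lebesgue_integral_def h_def char)
  have lim2: "(\<lambda>T::nat. (\<integral>t. indicator {-real T<..<real T} t *\<^sub>R h t \<partial>lborel)) \<longlonglongrightarrow> (\<integral>t. h t \<partial>lborel)"
  proof (rule integral_dominated_convergence[where w = "\<lambda>t. norm (h t)"])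
    show "AE t in lborel. (\<lambda>T::nat. indicator {- real T<..<real T} t *\<^sub>R h t) \<longlonglongrightarrow> h t"
    proof (intro AE_I2 tendsto_eventually)
      fix t :: real
      obtain n :: nat where "\<bar>t\<bar> < n" using reals_Archimedean2 by blast
      then show "\<forall>\<^sub>F T::nat in sequentially. indicator {- real T<..<real T} t *\<^sub>R h t = h t"
        unfolding eventually_sequentially by (intro exI[of _ n]) (auto simp: indicator_def)
    qed
  qed (use h in \<open>auto split: split_indicator\<close>)
  have "(\<lambda>T::nat. 1 / (2 * pi) * (CLBINT t=-T..T. F t * char M t)) \<longlonglongrightarrow> 1 / (2 * pi) * (\<integral>t. h t \<partial>lborel)"
    using tendsto_mult[OF tendsto_const lim2, of "1 / (2 * of_real pi)"] by (simp add: eq)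
  from LIMSEQ_unique[OF lim1 this]
  have "of_real (measure M {a<..b}) = 1 / (2 * pi) * (\<integral>t. h t \<partial>lborel)" .
  then have "measure M {a<..b} = Re (of_real (1 / (2 * pi)) * (\<integral>t. h t \<partial>lborel))"
    by (metis Re_complex_of_real of_real_1 of_real_divide of_real_mult of_real_numeral)
  also have "\<dots> = 1 / (2 * pi) * (\<integral>t. Re (h t) \<partial>lborel)"
    using h by simp
  also have "(\<integral>t. Re (h t) \<partial>lborel) = (\<integral>t. (\<integral>y. indicator {a..b} y * (cos (t * y) * g t) \<partial>lborel) \<partial>lborel)"
  proof (rule integral_cong_AE)
    show "AE t in lborel. Re (h t) = (\<integral>y. indicator {a..b} y * (cos (t * y) * g t) \<partial>lborel)"
      using AE_lborel_singleton[of 0]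
    proof eventually_elim
      case (elim t)
      have "Re (h t) = (sin (t * b) - sin (t * a)) / t * g t"
        unfolding h_def F_def Re_inversion_kernel[OF elim, symmetric]
        by (simp add: times_divide_eq_left[symmetric] del: times_divide_eq_left)
      also have "\<dots> = (\<integral>y. indicator {a..b} y * cos (t * y) \<partial>lborel) * g t"
        using integral_cos_interval[OF elim ab] by (simp add: set_lebesgue_integral_def)
      also have "\<dots> = (\<integral>y. indicator {a..b} y * (cos (t * y) * g t) \<partial>lborel)"
        by (simp add: mult.assoc[symmetric])
      finally show ?case .
    qed
  qed auto
  also have "\<dots> = (\<integral>y. (\<integral>t. indicator {a..b} y * (cos (t * y) * g t) \<partial>lborel) \<partial>lborel)"
  proof (rule lborel_pair.Fubini_integral)
    show "integrable (lborel \<Otimes>\<^sub>M lborel) (\<lambda>(y, t). indicator {a..b} y * (cos (t * y) * g t))"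
    proof (rule lborel_pair.Fubini_integrable)
      have "integrable lborel (\<lambda>y. indicator {a..b} y * (\<integral>t. \<bar>cos (t * y) * g t\<bar> \<partial>lborel))"
      proof (rule Bochner_Integration.integrable_bound)
        show "integrable lborel (\<lambda>y. indicator {a..b} y * (\<integral>t. \<bar>g t\<bar> \<partial>lborel))"
          by (intro integrable_mult_left integrable_real_indicator) (auto simp: emeasure_lborel_Icc_eq)
        have "(\<integral>t. \<bar>cos (t * y) * g t\<bar> \<partial>lborel) \<le> (\<integral>t. \<bar>g t\<bar> \<partial>lborel)" for y
          by (rule integral_mono_AE')
             (use g in \<open>auto simp: abs_mult intro!: mult_left_le_one_le\<close>)
        then show "AE y in lborel. norm (indicator {a..b} y * (\<integral>t. \<bar>cos (t * y) * g t\<bar> \<partial>lborel))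
            \<le> norm (indicator {a..b} y * (\<integral>t. \<bar>g t\<bar> \<partial>lborel))"
          by (auto split: split_indicator)
      qed simp
      then show "integrable lborel (\<lambda>y. \<integral>t. norm (case (y, t) of (y, t) \<Rightarrow> indicator {a..b} y * (cos (t * y) * g t)) \<partial>lborel)"
        by (simp add: abs_mult mult.assoc)
      show "AE y in lborel. integrable lborel (\<lambda>t. case (y, t) of (y, t) \<Rightarrow> indicator {a..b} y * (cos (t * y) * g t))"
        by (intro AE_I2)
          (auto intro!: integrable_mult_right Bochner_Integration.integrable_bound[OF g] simp: abs_mult mult_left_le_one_le)
    qed simp
  qed
  finally show ?thesis
    by (simp add: set_lebesgue_integral_def)
qed

text \<open>The inversion applies only at endpoints without mass. Atoms are countable, so such
  endpoints are dense, and squeezing a point between two of them shows that it has no mass. Then the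
  formula holds for all intervals, and continuity of \<open>p\<close> makes it nonnegative at every
  point.\<close>

lemma (in real_distribution) density_integrable_char:
  fixes g :: "real \<Rightarrow> real"
  defines "p \<equiv> \<lambda>y. 1 / (2 * pi) * (\<integral>t. cos (t * y) * g t \<partial>lborel)"
  assumes char: "\<And>t. char M t = of_real (g t)" and g: "integrable lborel g"
    and cont: "continuous_on UNIV p"
  shows density_integrable_char_nonneg: "\<And>y. 0 \<le> p y"
    and density_integrable_char_eq: "M = density lborel (\<lambda>y. ennreal (p y))"
proof -
  define K where "K = 1 / (2 * pi) * (\<integral>t. \<bar>g t\<bar> \<partial>lborel)"
  have [measurable]: "p \<in> borel_measurable borel"
    using cont by (rule borel_measurable_continuous_onI)
  have pK: "\<bar>p y\<bar> \<le> K" for y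
  proof -
    have "\<bar>\<integral>t. cos (t * y) * g t \<partial>lborel\<bar> \<le> (\<integral>t. \<bar>cos (t * y) * g t\<bar> \<partial>lborel)"
      by (rule integral_abs_bound)
    also have "\<dots> \<le> (\<integral>t. \<bar>g t\<bar> \<partial>lborel)"
      by (rule integral_mono_AE')
        (use g in \<open>auto simp: abs_mult intro!: mult_left_le_one_le\<close>)
    finally show ?thesis
      by (simp add: p_def K_def abs_mult divide_right_mono)
  qed
  have inv: "measure M {a<..b} = (LBINT y:{a..b}. p y)"
    if "a \<le> b" "measure M {a} = 0" "measure M {b} = 0" for a b
    unfolding p_def by (rule inversion_integrable_char[OF char g that])
  have pint: "set_integrable lborel {a..b} p" for a b
    by (rule borel_integrable_atLeastAtMost') (use cont in \<open>auto intro: continuous_on_subset\<close>)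
  have cnt: "countable {x. measure M {x} \<noteq> 0}"
    by (rule countable_support)
  have gen: "\<exists>z\<in>{a<..<b}. measure M {z} = 0" if "a < b" for a b :: real
  proof (rule ccontr)
    assume "\<not> ?thesis"
    then have "{a<..<b} \<subseteq> {x. measure M {x} \<noteq> 0}" by auto
    then have "countable {a<..<b}" using cnt by (rule countable_subset)
    then show False using that uncountable_open_interval[of a b] by simp
  qed
  have inv_le: "measure M {a<..b} \<le> K * (b - a)"
    if "a \<le> b" "measure M {a} = 0" "measure M {b} = 0" for a b
  proof -
    have "(LBINT y:{a..b}. p y) \<le> (LBINT y:{a..b}. K)"
      using pK by (intro set_integral_mono pint) (auto simp: abs_le_iff set_integrable_def emeasure_lborel_Icc_eq)
    also have "\<dots> = K * (b - a)" using that(1) by (simp add: set_lebesgue_integral_def)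
    finally show ?thesis using inv[OF that] by simp
  qed
  have atom: "measure M {c} = 0" for c
  proof (rule ccontr)
    define m where "m = measure M {c}"
    assume "measure M {c} \<noteq> 0"
    then have m: "m > 0" by (simp add: m_def less_le)
    have K: "K \<ge> 0" using pK[of 0] by linarith
    \<comment> \<open>Chosen so that an interval of length at most 2 d around \<open>c\<close> has
      mass at most m / 2, a contradiction; \<open>K + 1\<close> keeps the denominator positive when
      \<open>K\<close> is 0.\<close>
    define d where "d = m / (4 * (K + 1))"
    have d: "d > 0" using m K by (simp add: d_def)
    obtain a where a: "a \<in> {c - d<..<c}" "measure M {a} = 0" using gen[of "c - d" c] d by auto
    obtain b where b: "b \<in> {c<..<c + d}" "measure M {b} = 0" using gen[of c "c + d"] d by auto
    note ab = a(1) b(1) a(2) b(2)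
    have "m \<le> measure M {a<..b}"
      unfolding m_def using ab by (intro finite_measure_mono) auto
    also have "\<dots> \<le> K * (b - a)" using ab by (intro inv_le) auto
    also have "\<dots> \<le> (K + 1) * (2 * d)" using ab K d by (intro mult_mono) auto
    also have "\<dots> = m / 2" using K by (simp add: d_def field_simps)
    finally show False using m by simp
  qed
  show nonneg: "0 \<le> p y" for y
  proof (rule ccontr)
    assume neg: "\<not> 0 \<le> p y"
    have "isCont p y" using cont by (simp add: continuous_on_eq_continuous_at)
    then have "\<exists>d>0. \<forall>z. dist z y < d \<longrightarrow> dist (p z) (p y) < - p y / 2"
      unfolding continuous_at_eps_delta using neg by (elim allE[of _ "- p y / 2"]) simp
    then obtain d where d: "d > 0" "\<And>z. dist z y < d \<Longrightarrow> dist (p z) (p y) < - p y / 2" by blast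
    have "(LBINT z:{y..y + d / 2}. p z) \<le> (LBINT z:{y..y + d / 2}. p y / 2)"
    proof (intro set_integral_mono pint)
      fix z assume "z \<in> {y..y + d / 2}"
      then have "dist z y < d" using d(1) by (auto simp: dist_real_def)
      then show "p z \<le> p y / 2" using d(2)[of z] by (auto simp: dist_real_def)
    qed (auto simp: set_integrable_def emeasure_lborel_Icc_eq)
    also have "\<dots> = p y / 2 * (d / 2)" using d(1) by (simp add: set_lebesgue_integral_def)
    also have "\<dots> < 0" using neg d(1) by (simp add: mult_less_0_iff)
    finally have "measure M {y<..y + d / 2} < 0"
      using inv[of y "y + d / 2"] atom d(1) by simp
    then show False using measure_nonneg[of M "{y<..y + d / 2}"] by linarith
  qed
  have Ioc: "emeasure M {a<..b} = emeasure (density lborel (\<lambda>y. ennreal (p y))) {a<..b}" if "a \<le> b" for a b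
  proof -
    have "emeasure (density lborel (\<lambda>y. ennreal (p y))) {a<..b}
        = (\<integral>\<^sup>+y. ennreal (indicator {a<..b} y * p y) \<partial>lborel)"
      by (simp add: emeasure_density) (auto intro!: nn_integral_cong split: split_indicator)
    also have "\<dots> = (\<integral>\<^sup>+y. ennreal (indicator {a..b} y * p y) \<partial>lborel)"
      using AE_lborel_singleton[of a]
      by (intro nn_integral_cong_AE) (auto elim!: eventually_mono split: split_indicator)
    also have "\<dots> = ennreal (LBINT y:{a..b}. p y)"
      using pint[of a b] nonneg
      by (subst nn_integral_eq_integral) (auto simp: set_integrable_def set_lebesgue_integral_def)
    finally show ?thesis using inv[OF that atom atom] by (simp add: emeasure_eq_measure)
  qed
  show "M = density lborel (\<lambda>y. ennreal (p y))"
  proof (rule measure_eqI_lessThan)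
    fix x :: real
    have U: "(\<Union>n::nat. {x<..x + real n}) = {x<..}"
    proof -
      have "\<exists>n::nat. y \<le> x + real n" for y
        using real_arch_simple[of "y - x"] by (simp add: algebra_simps)
      then show ?thesis by (auto simp: set_eq_iff)
    qed
    have inc: "incseq (\<lambda>n::nat. {x<..x + real n})" by (auto simp: incseq_def)
    have "emeasure M {x<..} = (SUP n::nat. emeasure M {x<..x + real n})"
      unfolding U[symmetric] by (rule SUP_emeasure_incseq[symmetric, OF _ inc]) auto
    also have "\<dots> = (SUP n::nat. emeasure (density lborel (\<lambda>y. ennreal (p y))) {x<..x + real n})"
      by (simp add: Ioc)
    also have "\<dots> = emeasure (density lborel (\<lambda>y. ennreal (p y))) {x<..}"
      unfolding U[symmetric] by (rule SUP_emeasure_incseq[OF _ inc]) auto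
    finally show "emeasure M {x<..} = emeasure (density lborel (\<lambda>y. ennreal (p y))) {x<..}" .
  qed (auto simp: less_top[symmetric])
qed

section \<open>The resolvent density of the stable process and its bounds\<close>

lemma integrable_powr_atLeastAtMost_0_1:
  fixes e :: real assumes "e > -1"
  shows "integrable lborel (\<lambda>x::real. indicator {0..1} x * x powr e)"
proof -
  have "(\<lambda>x::real. x powr e) absolutely_integrable_on {0..1}"
    using assms by (intro nonnegative_absolutely_integrable_1 integrable_on_powr_from_0) auto
  then show ?thesis
    by (simp add: set_integrable_def integrable_completion)
qed

lemma integrable_powr_atLeast_1:
  fixes e :: real assumes "e < -1"
  shows "integrable lborel (\<lambda>x::real. indicator {1..} x * x powr e)"
proof -
  have "(\<lambda>x::real. x powr e) absolutely_integrable_on {1..}"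
    using has_integral_powr_to_inf[OF assms, of 1]
    by (intro nonnegative_absolutely_integrable_1) (auto simp: integrable_on_def)
  then show ?thesis
    by (simp add: set_integrable_def integrable_completion)
qed

lemma integrable_even_extension:
  fixes f :: "real \<Rightarrow> real"
  assumes "integrable lborel (\<lambda>x. indicator {0..} x * f x)" "f \<in> borel_measurable borel"
  shows "integrable lborel (\<lambda>x. f \<bar>x\<bar>)"
proof (rule Bochner_Integration.integrable_bound)
  have "integrable lborel (\<lambda>x. indicator {0..} (-x) * f (-x))"
    using lborel_integrable_real_affine[OF assms(1), of "-1" 0] by simp
  then show "integrable lborel (\<lambda>x. \<bar>indicator {0..} x * f x\<bar> + \<bar>indicator {0..} (-x) * f (-x)\<bar>)"
    using assms by (intro Bochner_Integration.integrable_add integrable_abs)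
  show "(\<lambda>x. f \<bar>x\<bar>) \<in> borel_measurable lborel" using assms(2) by measurable
qed (auto split: split_indicator)

text \<open>Near 0 the bound is 1 / l, and in the tail t powr (-\<alpha>), which is integrable
  because \<alpha> > 1. This integrability gives the process a bounded density at an exponential
  time.\<close>

lemma integrable_resolvent_symbol:
  fixes l \<alpha> :: real assumes "l > 0" "\<alpha> > 1"
  shows "integrable lborel (\<lambda>t. 1 / (l + \<bar>t\<bar> powr \<alpha>))"
proof (rule integrable_even_extension[where f = "\<lambda>t. 1 / (l + t powr \<alpha>)"])
  show "integrable lborel (\<lambda>t. indicator {0..} t * (1 / (l + t powr \<alpha>)))"
  proof (rule Bochner_Integration.integrable_bound)
    show "integrable lborel (\<lambda>x::real. indicator {0..1} x * (1 / l) + indicator {1..} x * x powr (-\<alpha>))"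
      using assms by (intro Bochner_Integration.integrable_add integrable_powr_atLeast_1 integrable_mult_left integrable_real_indicator)
         (auto simp: emeasure_lborel_Icc_eq)
    show "AE t in lborel. norm (indicator {0..} t * (1 / (l + t powr \<alpha>)))
        \<le> norm (indicator {0..1} t * (1 / l) + indicator {1..} t * t powr (-\<alpha>))"
    proof (intro AE_I2)
      fix t :: real
      have "1 / (l + t powr \<alpha>) \<le> 1 / l"
        using assms by (intro divide_left_mono mult_pos_pos add_pos_nonneg) auto
      moreover have "1 / (l + t powr \<alpha>) \<le> t powr (-\<alpha>)" if "t \<ge> 1"
        using assms that by (simp add: powr_minus field_simps add_pos_nonneg)
      moreover have "0 \<le> 1 / (l + t powr \<alpha>)" using assms by (simp add: add_pos_nonneg less_imp_le)
      ultimately show "norm (indicator {0..} t * (1 / (l + t powr \<alpha>)))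
        \<le> norm (indicator {0..1} t * (1 / l) + indicator {1..} t * t powr (-\<alpha>))"
        using assms by (auto split: split_indicator intro: order_trans)
    qed
  qed simp
qed simp

text \<open>The resolvent density u_l: the Fourier inverse of the Laplace transform in time of the
  characteristic function exp(- s |t| powr \<alpha>). Multiplied by \<open>l\<close> it is the
  density of the position at an independent exponential time of rate \<open>l\<close>.\<close>

definition pot_kernel :: "real \<Rightarrow> real \<Rightarrow> real \<Rightarrow> real" where
  "pot_kernel \<alpha> l x = 1 / (2 * pi) * (\<integral>t. cos (t * x) * (1 / (l + \<bar>t\<bar> powr \<alpha>)) \<partial>lborel)"

lemma abs_cos_diff_le: "\<bar>cos a - cos b\<bar> \<le> min 2 \<bar>a - b\<bar>" for a b :: real
proof -
  have "\<bar>cos a - cos b\<bar> = 2 * \<bar>sin ((a + b) / 2)\<bar> * \<bar>sin ((b - a) / 2)\<bar>"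
    by (simp add: cos_diff_cos abs_mult)
  also have "\<dots> \<le> 2 * 1 * \<bar>sin ((b - a) / 2)\<bar>" by (intro mult_mono) auto
  also have "\<dots> \<le> 2 * 1 * \<bar>(b - a) / 2\<bar>" by (intro mult_left_mono abs_sin_x_le_abs_x) auto
  finally have "\<bar>cos a - cos b\<bar> \<le> \<bar>a - b\<bar>" by simp
  moreover have "\<bar>cos a - cos b\<bar> \<le> 2"
    using cos_ge_minus_one[of a] cos_ge_minus_one[of b] cos_le_one[of a] cos_le_one[of b] by linarith
  ultimately show ?thesis by simp
qed

text \<open>Near 0 the integrand is |t| powr (1 - \<alpha>), integrable because \<alpha> < 2; at
  infinity it is 2 |t| powr (-\<alpha>), integrable because \<alpha> > 1.\<close>

lemma integrable_min_powr:
  fixes \<alpha> :: real assumes "1 < \<alpha>" "\<alpha> < 2"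
  shows "integrable lborel (\<lambda>t. min 2 \<bar>t\<bar> * \<bar>t\<bar> powr (-\<alpha>))"
proof (rule integrable_even_extension[where f = "\<lambda>t. min 2 t * t powr (-\<alpha>)"])
  show "integrable lborel (\<lambda>t. indicator {0..} t * (min 2 t * t powr (-\<alpha>)))"
  proof (rule Bochner_Integration.integrable_bound)
    show "integrable lborel (\<lambda>x::real. indicator {0..1} x * x powr (1 - \<alpha>) + 2 * (indicator {1..} x * x powr (-\<alpha>)))"
      using assms by (intro Bochner_Integration.integrable_add integrable_powr_atLeast_1
          integrable_powr_atLeastAtMost_0_1 integrable_mult_right) auto
    show "AE t in lborel. norm (indicator {0..} t * (min 2 t * t powr (-\<alpha>)))
        \<le> norm (indicator {0..1} t * t powr (1 - \<alpha>) + 2 * (indicator {1..} t * t powr (-\<alpha>)))"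
    proof (intro AE_I2)
      fix t :: real
      have "t \<ge> 0 \<Longrightarrow> t * t powr (-\<alpha>) = t powr (1 - \<alpha>)"
        by (cases "t = 0") (auto simp: powr_diff powr_minus field_simps)
      moreover have "min 2 t * t powr (-\<alpha>) \<le> 2 * t powr (-\<alpha>)" by (intro mult_right_mono) auto
      moreover have "0 \<le> t \<Longrightarrow> 0 \<le> min 2 t * t powr (-\<alpha>)" by simp
      ultimately show "norm (indicator {0..} t * (min 2 t * t powr (-\<alpha>)))
        \<le> norm (indicator {0..1} t * t powr (1 - \<alpha>) + 2 * (indicator {1..} t * t powr (-\<alpha>)))"
        by (auto split: split_indicator simp: min_def)
    qed
  qed simp
qed simp

text \<open>The constant is uniform in \<open>l\<close> because the symbol is at most |t| powr
  (-\<alpha>) for every \<open>l\<close>. With z = |x - y| the cosine difference is at most min 2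
  (|t| z), and rescaling t by z pulls out the factor z powr (\<alpha> - 1).\<close>

lemma pot_kernel_Hoelder:
  fixes \<alpha> :: real assumes "1 < \<alpha>" "\<alpha> < 2"
  obtains C where "C \<ge> 0" "\<And>l x y. l > 0 \<Longrightarrow> \<bar>pot_kernel \<alpha> l x - pot_kernel \<alpha> l y\<bar> \<le> C * \<bar>x - y\<bar> powr (\<alpha> - 1)"
proof
  define k where "k t = min 2 \<bar>t\<bar> * \<bar>t\<bar> powr (-\<alpha>)" for t :: real
  define C where "C = 1 / (2 * pi) * (\<integral>t. k t \<partial>lborel)"
  have k: "integrable lborel k" unfolding k_def by (rule integrable_min_powr[OF assms])
  show "C \<ge> 0" unfolding C_def k_def by simp
  fix l x y :: real assume l: "l > 0"
  let ?s = "\<lambda>t. 1 / (l + \<bar>t\<bar> powr \<alpha>)"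
  have s: "integrable lborel ?s" using l assms by (intro integrable_resolvent_symbol) auto
  have i: "integrable lborel (\<lambda>t. cos (t * x) * ?s t)" for x
    by (rule Bochner_Integration.integrable_bound[OF s]) (auto simp: abs_mult intro!: divide_right_mono)
  show "\<bar>pot_kernel \<alpha> l x - pot_kernel \<alpha> l y\<bar> \<le> C * \<bar>x - y\<bar> powr (\<alpha> - 1)"
  proof (cases "x = y")
    case False
    define z where "z = \<bar>x - y\<bar>"
    have z: "z > 0" using False by (simp add: z_def)
    have ks: "(\<lambda>t. z powr \<alpha> * k (z * t)) = (\<lambda>t. min 2 (\<bar>t\<bar> * z) * \<bar>t\<bar> powr (-\<alpha>))"
      using z by (auto simp: k_def abs_mult powr_mult powr_minus field_simps)
    have k': "integrable lborel (\<lambda>t. z powr \<alpha> * k (z * t))"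
      using lborel_integrable_real_affine[OF k, of z 0] z by simp
    have "\<bar>(\<integral>t. cos (t * x) * ?s t \<partial>lborel) - (\<integral>t. cos (t * y) * ?s t \<partial>lborel)\<bar>
        = \<bar>\<integral>t. (cos (t * x) - cos (t * y)) * ?s t \<partial>lborel\<bar>"
      using i[of x] i[of y] by (simp add: left_diff_distrib diff_divide_distrib)
    also have "\<dots> \<le> (\<integral>t. \<bar>(cos (t * x) - cos (t * y)) * ?s t\<bar> \<partial>lborel)"
      by (rule integral_abs_bound)
    also have "\<dots> \<le> (\<integral>t. z powr \<alpha> * k (z * t) \<partial>lborel)"
    proof (rule integral_mono_AE'[OF k'])
      show "AE t in lborel. \<bar>(cos (t * x) - cos (t * y)) * ?s t\<bar> \<le> z powr \<alpha> * k (z * t)"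
        using AE_lborel_singleton[of 0]
      proof eventually_elim
        case (elim t)
        have "\<bar>cos (t * x) - cos (t * y)\<bar> \<le> min 2 (\<bar>t\<bar> * z)"
          using abs_cos_diff_le[of "t * x" "t * y"] by (simp add: z_def abs_mult[symmetric] right_diff_distrib)
        moreover have "?s t \<le> \<bar>t\<bar> powr (-\<alpha>)"
          using l elim by (simp add: powr_minus field_simps add_pos_pos)
        moreover have "?s t \<ge> 0" using l by (simp add: add_pos_nonneg less_imp_le)
        ultimately have "\<bar>cos (t * x) - cos (t * y)\<bar> * ?s t \<le> min 2 (\<bar>t\<bar> * z) * \<bar>t\<bar> powr (-\<alpha>)"
          using z by (intro mult_mono) auto
        then show ?case
          unfolding ks[THEN fun_cong] using \<open>?s t \<ge> 0\<close> by (simp only: abs_mult abs_of_nonneg)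
      qed
    qed (simp add: k_def)
    also have "\<dots> = z powr (\<alpha> - 1) * (\<integral>t. k t \<partial>lborel)"
      using lborel_integral_real_affine[of z k 0] z by (simp add: powr_diff field_simps)
    finally show ?thesis
      by (simp add: pot_kernel_def C_def z_def right_diff_distrib[symmetric] abs_mult divide_right_mono field_simps)
  qed simp
qed

lemma continuous_pot_kernel:
  fixes \<alpha> l :: real assumes "1 < \<alpha>" "\<alpha> < 2" "l > 0"
  shows "continuous_on UNIV (pot_kernel \<alpha> l)"
proof -
  obtain C where C: "C \<ge> 0" "\<And>l x y. l > 0 \<Longrightarrow> \<bar>pot_kernel \<alpha> l x - pot_kernel \<alpha> l y\<bar> \<le> C * \<bar>x - y\<bar> powr (\<alpha> - 1)"
    using pot_kernel_Hoelder[OF assms(1,2)] by blast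
  have "((\<lambda>y. pot_kernel \<alpha> l y) \<longlongrightarrow> pot_kernel \<alpha> l x) (at x)" for x
  proof (rule Lim_null_comparison[THEN LIM_zero_cancel])
    show "\<forall>\<^sub>F y in at x. norm (pot_kernel \<alpha> l y - pot_kernel \<alpha> l x) \<le> C * \<bar>y - x\<bar> powr (\<alpha> - 1)"
      using C(2)[OF assms(3)] by (auto intro!: always_eventually)
    have "((\<lambda>y. C * \<bar>y - x\<bar> powr (\<alpha> - 1)) \<longlongrightarrow> C * \<bar>x - x\<bar> powr (\<alpha> - 1)) (at x)"
      using assms by (intro tendsto_intros tendsto_powr2) auto
    then show "((\<lambda>y. C * \<bar>y - x\<bar> powr (\<alpha> - 1)) \<longlongrightarrow> 0) (at x)" by simp
  qed
  then show ?thesis by (simp add: continuous_on_eq_continuous_at isCont_def)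
qed

lemma pot_kernel_minus: "pot_kernel \<alpha> l (-x) = pot_kernel \<alpha> l x"
  by (simp add: pot_kernel_def)

text \<open>Recurrence in analytic form: for t up to l powr (1 / \<alpha>) the symbol is at least 1
  / (2 l), so the integral is at least of order l powr (1 / \<alpha> - 1), whose exponent is
  negative.\<close>

lemma pot_kernel_0_large:
  fixes \<alpha> B :: real assumes "1 < \<alpha>"
  shows "\<forall>\<^sub>F l in at_right 0. pot_kernel \<alpha> l 0 \<ge> B"
proof -
  have "\<forall>\<^sub>F l in at_right 0. 1 / (4 * pi) * l powr (1 / \<alpha> - 1) \<ge> B"
  proof -
    \<comment> \<open>For l below D powr (- 1 / e) one has l powr (- e) at least \<open>D\<close>;
      the maximum with 1 makes \<open>D\<close> positive whatever \<open>B\<close> is.\<close>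
    define e D where "e = 1 - 1 / \<alpha>" and "D = max 1 (4 * pi * B)"
    have e: "e > 0" and D: "D > 0" using assms by (auto simp: e_def D_def field_simps)
    have "\<forall>\<^sub>F l in at_right 0. l < D powr (- 1 / e) \<and> l > 0"
      unfolding eventually_conj_iff using D by (auto intro!: eventually_at_right_less order_tendstoD(2)[of "\<lambda>l. l"])
    then show ?thesis
    proof eventually_elim
      case (elim l)
      have "D = (D powr (- 1 / e)) powr (- e)" using D e by (simp add: powr_powr)
      also have "\<dots> \<le> l powr (- e)" using elim e by (intro powr_mono2') auto
      finally have "4 * pi * B \<le> l powr (- e)" unfolding D_def by simp
      then show ?case by (simp add: e_def field_simps)
    qed
  qed
  moreover have "\<forall>\<^sub>F l in at_right (0::real). l > 0" by (simp add: eventually_at_right_less)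
  ultimately show ?thesis
  proof eventually_elim
    case (elim l)
    let ?s = "\<lambda>t. 1 / (l + \<bar>t\<bar> powr \<alpha>)"
    have s: "integrable lborel ?s" using elim assms by (intro integrable_resolvent_symbol) auto
    define r where "r = l powr (1 / \<alpha>)"
    have "1 / (2 * l) * r = (\<integral>t. 1 / (2 * l) * indicator {0..r} t \<partial>lborel)"
      by (simp add: r_def del: divide_self_if)
    also have "\<dots> \<le> (\<integral>t. ?s t \<partial>lborel)"
    proof (rule integral_mono_AE'[OF s])
      show "AE t in lborel. 1 / (2 * l) * indicator {0..r} t \<le> ?s t"
      proof (intro AE_I2)
        fix t
        have "t powr \<alpha> \<le> l" if "0 \<le> t" "t \<le> r"
        proof -
          have "t powr \<alpha> \<le> r powr \<alpha>" using that assms by (intro powr_mono2) auto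
          then show ?thesis using \<open>l > 0\<close> assms by (simp add: r_def powr_powr split: if_splits)
        qed
        then show "1 / (2 * l) * indicator {0..r} t \<le> ?s t"
          using elim by (auto split: split_indicator simp: add_pos_nonneg less_imp_le intro!: divide_left_mono)
      qed
    qed (use elim in \<open>simp add: add_pos_nonneg less_imp_le\<close>)
    also have "\<dots> = 2 * pi * pot_kernel \<alpha> l 0" by (simp add: pot_kernel_def)
    finally have "1 / (4 * pi) * (r / l) \<le> pot_kernel \<alpha> l 0" using elim by (simp add: field_simps)
    moreover have "r / l = l powr (1 / \<alpha> - 1)" using \<open>l > 0\<close> by (simp add: r_def powr_diff)
    ultimately show ?case using elim by simp
  qed
qed

text \<open>Nonnegativity is not visible in the oscillating integral: it holds because
  \<open>l\<close> times the kernel is the density of a probability measure with the given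
  characteristic function.\<close>

lemma (in real_distribution) density_resolvent_char:
  assumes "1 < \<alpha>" "\<alpha> < 2" "l > 0"
    and char: "\<And>t. char M t = of_real (l / (l + \<bar>t\<bar> powr \<alpha>))"
  shows "0 \<le> pot_kernel \<alpha> l x" "M = density lborel (\<lambda>y. ennreal (l * pot_kernel \<alpha> l y))"
proof -
  let ?g = "\<lambda>t. l / (l + \<bar>t\<bar> powr \<alpha>)"
  have g: "integrable lborel ?g"
    using integrable_mult_right[OF integrable_resolvent_symbol[OF assms(3,1)], of l] by simp
  have eq: "1 / (2 * pi) * (\<integral>t. cos (t * y) * ?g t \<partial>lborel) = l * pot_kernel \<alpha> l y" for y

  proof -
    have "(\<integral>t. cos (t * y) * ?g t \<partial>lborel) = (\<integral>t. l * (cos (t * y) * (1 / (l + \<bar>t\<bar> powr \<alpha>))) \<partial>lborel)"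
      by (intro Bochner_Integration.integral_cong) auto
    also have "\<dots> = l * (\<integral>t. cos (t * y) * (1 / (l + \<bar>t\<bar> powr \<alpha>)) \<partial>lborel)"
      by (rule integral_mult_right_zero)
    finally show ?thesis by (simp add: pot_kernel_def)
  qed
  have cont: "continuous_on UNIV (\<lambda>y. 1 / (2 * pi) * (\<integral>t. cos (t * y) * ?g t \<partial>lborel))"
    unfolding eq using assms by (intro continuous_intros continuous_pot_kernel)
  show "M = density lborel (\<lambda>y. ennreal (l * pot_kernel \<alpha> l y))"
    using density_integrable_char_eq[OF char g cont] unfolding eq .
  show "0 \<le> pot_kernel \<alpha> l x"
    using density_integrable_char_nonneg[OF char g cont, of x] assms(3) unfolding eq
    by (simp add: zero_le_mult_iff)
qed

subsection \<open>Markov property and time reversal\<close>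

lemma measure_eqI_PiM_rectangles:
  assumes "finite I" "sets P = sets (PiM I M)" "sets Q = sets (PiM I M)"
    and eq: "\<And>A. (\<And>i. i \<in> I \<Longrightarrow> A i \<in> sets (M i)) \<Longrightarrow> emeasure P (Pi\<^sub>E I A) = emeasure Q (Pi\<^sub>E I A)"
    and fin: "emeasure P (space P) \<noteq> \<infinity>"
  shows "P = Q"
proof (rule measure_eqI_generator_eq[OF Int_stable_prod_algebra prod_algebra_sets_into_space])
  show "emeasure P X = emeasure Q X" if "X \<in> prod_algebra I M" for X
    using that eq unfolding prod_algebra_eq_finite[OF assms(1)] by auto
  show "sets P = sigma_sets (\<Pi>\<^sub>E i\<in>I. space (M i)) (prod_algebra I M)"
    "sets Q = sigma_sets (\<Pi>\<^sub>E i\<in>I. space (M i)) (prod_algebra I M)"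
    using assms(2,3) by (simp_all add: sets_PiM)
  show "range (\<lambda>_::nat. \<Pi>\<^sub>E i\<in>I. space (M i)) \<subseteq> prod_algebra I M"
    unfolding prod_algebra_eq_finite[OF assms(1)] by auto
  show "(\<Union>i::nat. \<Pi>\<^sub>E i\<in>I. space (M i)) = (\<Pi>\<^sub>E i\<in>I. space (M i))" by simp
  show "emeasure P (\<Pi>\<^sub>E i\<in>I. space (M i)) \<noteq> \<infinity>" for i :: nat
    using fin sets_eq_imp_space_eq[OF assms(2)] by (simp add: space_PiM)
qed

text \<open>A finite set of times, enlarged by 0 and \<open>u\<close> and sorted, is a grid along
  which each position is a partial sum of increments, so laws of increments along grids determine
  the law of the process. Forcing \<open>u\<close> into every grid ensures that no increment
  straddles the time at which a path is cut and continued by another.\<close>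

lemma process_law_eqI:
  fixes Z1 :: "real \<Rightarrow> 'a \<Rightarrow> real" and Z2 :: "real \<Rightarrow> 'b \<Rightarrow> real" and I :: "real set"
  assumes M1: "prob_space M1" and M2: "prob_space M2"
    and m1 [measurable]: "\<And>i. i \<in> I \<Longrightarrow> Z1 i \<in> borel_measurable M1"
    and m2 [measurable]: "\<And>i. i \<in> I \<Longrightarrow> Z2 i \<in> borel_measurable M2"
    and I: "0 \<in> I" "u \<in> I" "I \<subseteq> {0..}"
    and zero: "\<And>\<omega>. \<omega> \<in> space M1 \<Longrightarrow> Z1 0 \<omega> = 0" "\<And>\<omega>. \<omega> \<in> space M2 \<Longrightarrow> Z2 0 \<omega> = 0"
    and incr: "\<And>n t A. incseq t \<Longrightarrow> t 0 = 0 \<Longrightarrow> (\<And>i. t i \<in> I) \<Longrightarrow> u \<in> t ` {..n} \<Longrightarrow> (\<And>i. A i \<in> sets borel) \<Longrightarrow>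
        emeasure M1 {\<omega> \<in> space M1. \<forall>i<n. Z1 (t (Suc i)) \<omega> - Z1 (t i) \<omega> \<in> A i} =
        emeasure M2 {\<omega> \<in> space M2. \<forall>i<n. Z2 (t (Suc i)) \<omega> - Z2 (t i) \<omega> \<in> A i}"
  shows "distr M1 (PiM I (\<lambda>_. borel)) (\<lambda>\<omega>. \<lambda>i\<in>I. Z1 i \<omega>) = distr M2 (PiM I (\<lambda>_. borel)) (\<lambda>\<omega>. \<lambda>i\<in>I. Z2 i \<omega>)"
    (is "?P1 = ?P2")
proof -
  interpret M1: prob_space M1 by fact
  interpret M2: prob_space M2 by fact
  show ?thesis
  proof (rule measure_eqI_PiM_infinite)
    show "sets ?P1 = sets (PiM I (\<lambda>_. borel))" "sets ?P2 = sets (PiM I (\<lambda>_. borel))" by simp_all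
    show "finite_measure ?P1"
      by (intro prob_space.finite_measure M1.prob_space_distr) measurable
    fix A :: "real \<Rightarrow> real set" and J assume J: "finite J" "J \<subseteq> I" and A: "\<And>j. j \<in> J \<Longrightarrow> A j \<in> sets borel"
    define L where "L = sorted_list_of_set (J \<union> {0, u})"
    define n where "n = length L - 1"
    have setL: "set L = J \<union> {0, u}" unfolding L_def using J by (intro set_sorted_list_of_set) auto
    have ne: "length L > 0" using setL by (metis Un_insert_right insert_not_empty length_greater_0_conv list.set(1))
    \<comment> \<open>\<open>min i n\<close> freezes the sequence at the last entry of
      \<open>L\<close>, so that it is defined and increasing for all indices.\<close>
    define t where "t i = L ! min i n" for i
    have tL: "t i \<in> set L" for i unfolding t_def by (rule nth_mem) (use ne in \<open>cases L; simp add: n_def min_def\<close>)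
    have sorted: "sorted L" by (simp add: L_def)
    have inc: "incseq t"
    proof (intro incseq_SucI)
      show "t i \<le> t (Suc i)" for i
        unfolding t_def by (rule sorted_nth_mono[OF sorted]) (use ne in \<open>auto simp: n_def min_def\<close>)
    qed
    have tI: "t i \<in> I" for i using tL[of i] setL I J by auto
    have range: "s \<in> t ` {..n}" if s: "s \<in> set L" for s
    proof -
      obtain k where "k < length L" "L ! k = s" using s unfolding in_set_conv_nth by blast
      then show ?thesis by (intro image_eqI[of _ _ k]) (auto simp: t_def n_def)
    qed
    have t0: "t 0 = 0"
    proof -
      obtain k where "k \<le> n" "t k = 0" using range[of 0] setL by auto
      then have "t 0 \<le> 0" using inc by (metis incseqD le0)
      moreover have "t 0 \<ge> 0" using tI[of 0] I by auto
      ultimately show ?thesis by simp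
    qed
    define E1 where "E1 = distr M1 (PiM {..<n} (\<lambda>_. borel)) (\<lambda>\<omega>. \<lambda>i\<in>{..<n}. Z1 (t (Suc i)) \<omega> - Z1 (t i) \<omega>)"
    define E2 where "E2 = distr M2 (PiM {..<n} (\<lambda>_. borel)) (\<lambda>\<omega>. \<lambda>i\<in>{..<n}. Z2 (t (Suc i)) \<omega> - Z2 (t i) \<omega>)"
    have mZ [measurable]: "(\<lambda>\<omega>. \<lambda>i\<in>{..<n}. Z1 (t (Suc i)) \<omega> - Z1 (t i) \<omega>) \<in> measurable M1 (PiM {..<n} (\<lambda>_. borel))"
      "(\<lambda>\<omega>. \<lambda>i\<in>{..<n}. Z2 (t (Suc i)) \<omega> - Z2 (t i) \<omega>) \<in> measurable M2 (PiM {..<n} (\<lambda>_. borel))"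
      using tI by (auto intro!: measurable_restrict borel_measurable_diff m1 m2)
    have E: "E1 = E2"
    proof (rule measure_eqI_PiM_rectangles[where I = "{..<n}" and M = "\<lambda>_. borel"])
      show "emeasure E1 (space E1) \<noteq> \<infinity>"
        using prob_space.emeasure_space_1[OF M1.prob_space_distr[OF mZ(1)]] by (simp add: E1_def)
      fix B :: "nat \<Rightarrow> real set" assume B: "\<And>i. i \<in> {..<n} \<Longrightarrow> B i \<in> sets borel"
      define B' where "B' i = (if i < n then B i else UNIV)" for i
      have B': "B' i \<in> sets borel" for i using B by (auto simp: B'_def)
      have R: "Pi\<^sub>E {..<n} B \<in> sets (PiM {..<n} (\<lambda>_. borel))" using B by (intro sets_PiM_I_finite) auto
      have 1: "emeasure E1 (Pi\<^sub>E {..<n} B) = emeasure M1 {\<omega> \<in> space M1. \<forall>i<n. Z1 (t (Suc i)) \<omega> - Z1 (t i) \<omega> \<in> B' i}"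
        unfolding E1_def by (subst emeasure_distr[OF mZ(1) R]) (auto simp: B'_def PiE_def Pi_def intro!: arg_cong2[where f = emeasure])
      have 2: "emeasure E2 (Pi\<^sub>E {..<n} B) = emeasure M2 {\<omega> \<in> space M2. \<forall>i<n. Z2 (t (Suc i)) \<omega> - Z2 (t i) \<omega> \<in> B' i}"
        unfolding E2_def by (subst emeasure_distr[OF mZ(2) R]) (auto simp: B'_def PiE_def Pi_def intro!: arg_cong2[where f = emeasure])
      show "emeasure E1 (Pi\<^sub>E {..<n} B) = emeasure E2 (Pi\<^sub>E {..<n} B)"
        unfolding 1 2 using setL by (intro incr inc t0 tI B' range) auto
    qed (auto simp: E1_def E2_def)
    \<comment> \<open>The event about positions, rewritten as a set of increment vectors; it is the
      same set for both processes.\<close>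
    define S where "S = {d \<in> space (PiM {..<n} (\<lambda>_. borel)). \<forall>k\<in>{..n}. t k \<in> J \<longrightarrow> (\<Sum>i<k. d i) \<in> A (t k)}"
    have S: "S \<in> sets (PiM {..<n} (\<lambda>_. borel))"
      unfolding S_def
    proof (rule sets.sets_Collect_finite_All)
      fix k assume k: "k \<in> {..n}"
      show "{d \<in> space (PiM {..<n} (\<lambda>_. borel)). t k \<in> J \<longrightarrow> (\<Sum>i<k. d i) \<in> A (t k)} \<in> sets (PiM {..<n} (\<lambda>_. borel))"
      proof (cases "t k \<in> J")
        case True
        have [measurable]: "A (t k) \<in> sets borel" using A True by auto
        have [measurable]: "(\<lambda>d. \<Sum>i<k. d i) \<in> borel_measurable (PiM {..<n} (\<lambda>_. borel :: real measure))"
          using k by (intro borel_measurable_sum measurable_component_singleton) auto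
        show ?thesis using True by simp
      qed simp
    qed simp
    define D1 where "D1 \<omega> = (\<lambda>i\<in>{..<n}. Z1 (t (Suc i)) \<omega> - Z1 (t i) \<omega>)" for \<omega>
    define D2 where "D2 \<omega> = (\<lambda>i\<in>{..<n}. Z2 (t (Suc i)) \<omega> - Z2 (t i) \<omega>)" for \<omega>
    have D1: "(\<Sum>i<k. D1 \<omega> i) = Z1 (t k) \<omega>" if "\<omega> \<in> space M1" "k \<le> n" for k \<omega>
    proof -
      have "(\<Sum>i<k. D1 \<omega> i) = (\<Sum>i<k. Z1 (t (Suc i)) \<omega> - Z1 (t i) \<omega>)"
        using that by (intro sum.cong) (auto simp: D1_def)
      also have "\<dots> = Z1 (t k) \<omega>"
        using zero(1)[OF that(1)] t0 sum_lessThan_telescope[of "\<lambda>i. Z1 (t i) \<omega>" k] by simp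
      finally show ?thesis .
    qed
    have D2: "(\<Sum>i<k. D2 \<omega> i) = Z2 (t k) \<omega>" if "\<omega> \<in> space M2" "k \<le> n" for k \<omega>
    proof -
      have "(\<Sum>i<k. D2 \<omega> i) = (\<Sum>i<k. Z2 (t (Suc i)) \<omega> - Z2 (t i) \<omega>)"
        using that by (intro sum.cong) (auto simp: D2_def)
      also have "\<dots> = Z2 (t k) \<omega>"
        using zero(2)[OF that(1)] t0 sum_lessThan_telescope[of "\<lambda>i. Z2 (t i) \<omega>" k] by simp
      finally show ?thesis .
    qed
    have Dsp: "D1 \<omega> \<in> space (PiM {..<n} (\<lambda>_. borel))" "D2 \<omega>' \<in> space (PiM {..<n} (\<lambda>_. borel))" for \<omega> \<omega>'
      by (auto simp: space_PiM D1_def D2_def)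
    have cov: "(\<forall>j\<in>J. z j \<in> A j) \<longleftrightarrow> (\<forall>k\<le>n. t k \<in> J \<longrightarrow> z (t k) \<in> A (t k))" for z :: "real \<Rightarrow> real"
    proof safe
      fix j assume j: "j \<in> J" and *: "\<forall>k\<le>n. t k \<in> J \<longrightarrow> z (t k) \<in> A (t k)"
      obtain k where "k \<le> n" "t k = j" using range[of j] setL j by auto
      then show "z j \<in> A j" using * j by auto
    qed auto
    have JI: "j \<in> J \<Longrightarrow> j \<in> I" for j using J by auto
    have PE: "prod_emb I (\<lambda>_. borel) J (Pi\<^sub>E J A) \<in> sets (PiM I (\<lambda>_. borel))"
      using J A by (intro sets_PiM_I) auto
    have "emeasure ?P1 (prod_emb I (\<lambda>_. borel) J (Pi\<^sub>E J A)) = emeasure M1 {\<omega> \<in> space M1. \<forall>j\<in>J. Z1 j \<omega> \<in> A j}"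
      by (subst emeasure_distr[OF _ PE])
         (auto simp: prod_emb_def PiE_iff space_PiM JI intro!: arg_cong2[where f = emeasure])
    also have "\<dots> = emeasure E1 S"
      unfolding E1_def cov
      by (subst emeasure_distr[OF mZ(1) S], intro arg_cong2[where f = emeasure])
         (auto simp: S_def Dsp D1 simp flip: D1_def)
    also have "\<dots> = emeasure E2 S" by (simp add: E)
    also have "\<dots> = emeasure M2 {\<omega> \<in> space M2. \<forall>j\<in>J. Z2 j \<omega> \<in> A j}"
      unfolding E2_def cov
      by (subst emeasure_distr[OF mZ(2) S], intro arg_cong2[where f = emeasure])
         (auto simp: S_def Dsp D2 simp flip: D2_def)
    also have "\<dots> = emeasure ?P2 (prod_emb I (\<lambda>_. borel) J (Pi\<^sub>E J A))"
      by (subst emeasure_distr[OF _ PE])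
         (auto simp: prod_emb_def PiE_iff space_PiM JI intro!: arg_cong2[where f = emeasure])
    finally show "emeasure ?P1 (prod_emb I (\<lambda>_. borel) J (Pi\<^sub>E J A)) = emeasure ?P2 (prod_emb I (\<lambda>_. borel) J (Pi\<^sub>E J A))" .
  qed
qed

text \<open>Path regularity is demanded for every sample and at all real times, so later arguments
  can be made path by path and paths can be shifted in time. \<open>stable_levy_modification\<close>
  supplies such a version of the given process.\<close>

locale cadlag_levy = prob_space M for M :: "'a measure" +
  fixes W :: "real \<Rightarrow> 'a \<Rightarrow> real"
  assumes W_meas [measurable]: "\<And>t. W t \<in> borel_measurable M"
    and W_nonpos: "\<And>t \<omega>. t \<le> 0 \<Longrightarrow> W t \<omega> = 0"
    and W_right: "\<And>t \<omega>. continuous (at_right t) (\<lambda>s. W s \<omega>)"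
    and W_left: "\<And>t \<omega>. \<exists>l. ((\<lambda>s. W s \<omega>) \<longlongrightarrow> l) (at_left t)"
    and W_indep: "\<And>(n::nat) t. 0 \<le> t 0 \<Longrightarrow> incseq t \<Longrightarrow>
        indep_vars (\<lambda>_. borel) (\<lambda>i \<omega>. W (t (Suc i)) \<omega> - W (t i) \<omega>) {..<n}"
    and W_stationary: "\<And>s t. 0 \<le> s \<Longrightarrow> s \<le> t \<Longrightarrow>
        distr M borel (\<lambda>\<omega>. W t \<omega> - W s \<omega>) = distr M borel (W (t - s))"
    and W_symmetric: "\<And>t. distr M borel (\<lambda>\<omega>. - W t \<omega>) = distr M borel (W t)"
begin

lemma increments_rectangle:
  assumes t: "0 \<le> t 0" "incseq t" and A: "\<And>i. A i \<in> sets borel"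
  shows "emeasure M {\<omega> \<in> space M. \<forall>i\<in>{..<n::nat}. W (t (Suc i)) \<omega> - W (t i) \<omega> \<in> A i} =
    (\<Prod>i<n. emeasure (distr M borel (W (t (Suc i) - t i))) (A i))"
proof (cases "n = 0")
  case True then show ?thesis by (simp add: emeasure_space_1)
next
  case False
  have le: "0 \<le> t i" "t i \<le> t (Suc i)" for i
    using order_trans[OF t(1) incseqD[OF t(2), of 0 i]] incseq_SucD[OF t(2)] by auto
  have [measurable]: "A i \<in> sets borel" for i by (rule A)
  have "prob (\<Inter>i\<in>{..<n}. (\<lambda>\<omega>. W (t (Suc i)) \<omega> - W (t i) \<omega>) -` A i \<inter> space M) =
      (\<Prod>i<n. prob ((\<lambda>\<omega>. W (t (Suc i)) \<omega> - W (t i) \<omega>) -` A i \<inter> space M))"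
    using False A by (intro indep_varsD_finite[OF W_indep[OF t]]) auto
  also have "(\<Inter>i\<in>{..<n}. (\<lambda>\<omega>. W (t (Suc i)) \<omega> - W (t i) \<omega>) -` A i \<inter> space M)
      = {\<omega> \<in> space M. \<forall>i\<in>{..<n}. W (t (Suc i)) \<omega> - W (t i) \<omega> \<in> A i}"
    using False by auto
  finally have "emeasure M {\<omega> \<in> space M. \<forall>i\<in>{..<n}. W (t (Suc i)) \<omega> - W (t i) \<omega> \<in> A i} =
      (\<Prod>i<n. emeasure M ((\<lambda>\<omega>. W (t (Suc i)) \<omega> - W (t i) \<omega>) -` A i \<inter> space M))"
    by (simp add: emeasure_eq_measure prod_ennreal)
  also have "\<dots> = (\<Prod>i<n. emeasure (distr M borel (W (t (Suc i) - t i))) (A i))"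
    by (intro prod.cong refl, subst W_stationary[symmetric])
       (auto simp: le A emeasure_distr)
  finally show ?thesis .
qed

definition concat :: "real \<Rightarrow> real \<Rightarrow> 'a \<times> 'a \<Rightarrow> real" where
  "concat u s z = (if s \<le> u then W s (fst z) else W u (fst z) + W (s - u) (snd z))"

lemma concat_measurable [measurable]: "concat u s \<in> borel_measurable (M \<Otimes>\<^sub>M M)"
  unfolding concat_def by measurable

abbreviation path :: "real set \<Rightarrow> (real \<Rightarrow> real) \<Rightarrow> real \<Rightarrow> real" where
  "path I w \<equiv> (\<lambda>s\<in>I. w s)"

text \<open>The Markov property at \<open>u\<close> as an equality of path laws: after
  \<open>u\<close> the path may be continued by an independent copy. As \<open>u\<close> is a grid
  point, each increment depends on one coordinate only, so the event is a product set.\<close>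

lemma Markov_law:
  assumes u: "0 \<le> u"
  shows "distr M (PiM {0..} (\<lambda>_. borel)) (\<lambda>\<omega>. \<lambda>s\<in>{0..}. W s \<omega>) =
    distr (M \<Otimes>\<^sub>M M) (PiM {0..} (\<lambda>_. borel)) (\<lambda>z. \<lambda>s\<in>{0..}. concat u s z)"
proof (rule process_law_eqI[where u = u])
  interpret P: pair_prob_space M M ..
  show "prob_space (M \<Otimes>\<^sub>M M)" by unfold_locales
  show "0 \<in> {0::real..}" "u \<in> {0..}" using u by auto
  show "W 0 \<omega> = 0" for \<omega> by (simp add: W_nonpos)
  show "concat u 0 z = 0" for z using u by (simp add: concat_def W_nonpos)
  fix n :: nat and t :: "nat \<Rightarrow> real" and A :: "nat \<Rightarrow> real set"
  assume t: "incseq t" "t 0 = 0" "u \<in> t ` {..n}" and A: "\<And>i. A i \<in> sets borel"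
  then obtain m where m: "m \<le> n" "t m = u" by auto
  have [measurable]: "A i \<in> sets borel" for i by (rule A)
  let ?\<nu> = "\<lambda>i. emeasure (distr M borel (W (t (Suc i) - t i))) (A i)"
  let ?P = "{\<omega> \<in> space M. \<forall>i\<in>{..<m}. W (t (Suc i)) \<omega> - W (t i) \<omega> \<in> A i}"
  let ?t = "\<lambda>i. t (m + i) - u"
  let ?F = "{\<omega> \<in> space M. \<forall>i\<in>{..<n - m}. W (?t (Suc i)) \<omega> - W (?t i) \<omega> \<in> A (m + i)}"
  have incr: "concat u (t (Suc i)) z - concat u (t i) z =
      (if i < m then W (t (Suc i)) (fst z) - W (t i) (fst z) else W (t (Suc i) - u) (snd z) - W (t i - u) (snd z))" for i z
  proof (cases "i < m")
    case True
    then have "t i \<le> u" "t (Suc i) \<le> u" using m t(1) by (auto simp: incseq_def)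
    then show ?thesis using True by (simp add: concat_def)
  next
    case False
    then have ge: "u \<le> t i" "u \<le> t (Suc i)" using m t(1) by (auto simp: incseq_def)
    \<comment> \<open>When the time equals \<open>u\<close> the definition uses its first branch,
      which agrees with the second one because \<open>W\<close> vanishes at time 0.\<close>
    then have "concat u (t i) z = W u (fst z) + W (t i - u) (snd z)"
      "concat u (t (Suc i)) z = W u (fst z) + W (t (Suc i) - u) (snd z)"
      by (auto simp: concat_def W_nonpos)
    then show ?thesis using False by simp
  qed
  have split: "(\<forall>i<n. Q i) \<longleftrightarrow> (\<forall>i\<in>{..<m}. Q i) \<and> (\<forall>i\<in>{..<n - m}. Q (m + i))" for Q :: "nat \<Rightarrow> bool"
  proof safe
    fix i assume *: "\<forall>i\<in>{..<m}. Q i" "\<forall>i\<in>{..<n - m}. Q (m + i)" and i: "i < n"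
    show "Q i"
    proof (cases "i < m")
      case False
      then have "i - m < n - m" "m + (i - m) = i" using i by auto
      then show ?thesis using *(2) by (metis lessThan_iff)
    qed (use * in auto)
  qed (use m in auto)
  have set_eq: "{z \<in> space (M \<Otimes>\<^sub>M M). \<forall>i<n. concat u (t (Suc i)) z - concat u (t i) z \<in> A i} = ?P \<times> ?F"
    unfolding split incr by (auto simp: space_pair_measure)
  have "emeasure (M \<Otimes>\<^sub>M M) {z \<in> space (M \<Otimes>\<^sub>M M). \<forall>i<n. concat u (t (Suc i)) z - concat u (t i) z \<in> A i}
      = emeasure M ?P * emeasure M ?F"
    unfolding set_eq by (rule emeasure_pair_measure_Times) measurable
  also have "emeasure M ?P = (\<Prod>i<m. ?\<nu> i)"
    using t by (intro increments_rectangle A) auto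
  also have "emeasure M ?F = (\<Prod>i<n - m. ?\<nu> (m + i))"
    using increments_rectangle[of ?t "\<lambda>i. A (m + i)" "n - m"] t m A by (simp add: incseq_def)
  also have "(\<Prod>i<m. ?\<nu> i) * (\<Prod>i<n - m. ?\<nu> (m + i)) = (\<Prod>i<n. ?\<nu> i)"
    using m(1) prod.atLeastLessThan_concat[of 0 m n ?\<nu>] prod.shift_bounds_nat_ivl[of ?\<nu> 0 m "n - m"]
    by (simp add: lessThan_atLeast0 add.commute)
  also have "\<dots> = emeasure M {\<omega> \<in> space M. \<forall>i<n. W (t (Suc i)) \<omega> - W (t i) \<omega> \<in> A i}"
    using increments_rectangle[of t A n] t A by (simp add: Ball_def)
  finally show "emeasure M {\<omega> \<in> space M. \<forall>i<n. W (t (Suc i)) \<omega> - W (t i) \<omega> \<in> A i} =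
    emeasure (M \<Otimes>\<^sub>M M) {z \<in> space (M \<Otimes>\<^sub>M M). \<forall>i<n. concat u (t (Suc i)) z - concat u (t i) z \<in> A i}" ..
qed (auto intro: prob_space_axioms)

lemma Markov:
  assumes u: "0 \<le> u" and H [measurable]: "H \<in> borel_measurable (PiM {0..} (\<lambda>_. borel))"
  shows "(\<integral>\<^sup>+\<omega>. H (\<lambda>s\<in>{0..}. W s \<omega>) \<partial>M) = (\<integral>\<^sup>+\<omega>. \<integral>\<^sup>+\<omega>'. H (\<lambda>s\<in>{0..}. concat u s (\<omega>, \<omega>')) \<partial>M \<partial>M)"
proof -
  have [measurable]: "(\<lambda>\<omega>. \<lambda>s\<in>{0..}. W s \<omega>) \<in> measurable M (PiM {0..} (\<lambda>_. borel))"
    "(\<lambda>z. \<lambda>s\<in>{0..}. concat u s z) \<in> measurable (M \<Otimes>\<^sub>M M) (PiM {0..} (\<lambda>_. borel))"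
    by (auto intro!: measurable_restrict)
  have "(\<integral>\<^sup>+\<omega>. H (\<lambda>s\<in>{0..}. W s \<omega>) \<partial>M) = (\<integral>\<^sup>+z. H (\<lambda>s\<in>{0..}. concat u s z) \<partial>(M \<Otimes>\<^sub>M M))"
    by (simp add: Markov_law[OF u] nn_integral_distr
        flip: nn_integral_distr[of "\<lambda>\<omega>. \<lambda>s\<in>{0..}. W s \<omega>" M "PiM {0..} (\<lambda>_. borel)" H])
  also have "\<dots> = (\<integral>\<^sup>+\<omega>. \<integral>\<^sup>+\<omega>'. H (\<lambda>s\<in>{0..}. concat u s (\<omega>, \<omega>')) \<partial>M \<partial>M)"
    by (subst nn_integral_fst[symmetric]) auto
  finally show ?thesis .
qed

lemma uminus_vimage_borel: "A \<in> sets borel \<Longrightarrow> (uminus :: real \<Rightarrow> real) -` A \<in> sets borel"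
  by (rule measurable_sets_borel[of uminus borel]) simp_all

text \<open>The increments of the reversed path are those of \<open>W\<close> taken in reverse order
  with opposite sign. Independence and stationarity absorb the order, symmetry of the increments
  absorbs the sign.\<close>

lemma reversal_law:
  assumes u: "0 \<le> u"
  shows "distr M (PiM {0..u} (\<lambda>_. borel)) (\<lambda>\<omega>. \<lambda>s\<in>{0..u}. W s \<omega>) =
    distr M (PiM {0..u} (\<lambda>_. borel)) (\<lambda>\<omega>. \<lambda>s\<in>{0..u}. W (u - s) \<omega> - W u \<omega>)"
proof (rule process_law_eqI[where u = u])
  show "0 \<in> {0::real..u}" "u \<in> {0..u}" using u by auto
  fix n :: nat and t :: "nat \<Rightarrow> real" and A :: "nat \<Rightarrow> real set"
  assume t: "incseq t" "t 0 = 0" "\<And>i. t i \<in> {0..u}" "u \<in> t ` {..n}" and A: "\<And>i. A i \<in> sets borel"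
  then obtain m where m: "m \<le> n" "t m = u" by auto
  have [measurable]: "A i \<in> sets borel" for i by (rule A)
  let ?\<nu> = "\<lambda>i. emeasure (distr M borel (W (t (Suc i) - t i))) (A i)"
  \<comment> \<open>The grid seen from \<open>u\<close> backwards; its j-th increment corresponds to
    increment \<open>n - Suc j\<close> of the original grid.\<close>
  define r where "r j = u - t (n - j)" for j
  have r: "incseq r" "0 \<le> r 0" using t(1,3) by (auto simp: r_def incseq_def)
  have "{\<omega> \<in> space M. \<forall>i<n. W (u - t (Suc i)) \<omega> - W u \<omega> - (W (u - t i) \<omega> - W u \<omega>) \<in> A i}
     = {\<omega> \<in> space M. \<forall>j\<in>{..<n}. W (r (Suc j)) \<omega> - W (r j) \<omega> \<in> uminus -` A (n - Suc j)}" (is "?L = ?R")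
  proof (intro Collect_cong conj_cong refl)
    fix \<omega>
    show "(\<forall>i<n. W (u - t (Suc i)) \<omega> - W u \<omega> - (W (u - t i) \<omega> - W u \<omega>) \<in> A i) =
      (\<forall>j\<in>{..<n}. W (r (Suc j)) \<omega> - W (r j) \<omega> \<in> uminus -` A (n - Suc j))"
      (is "(\<forall>i<n. ?X i) = (\<forall>j\<in>{..<n}. ?Y j)")
    proof -
      have XY: "?Y j = ?X (n - Suc j)" if "j < n" for j
        using that by (simp add: r_def Suc_diff_Suc)
      show ?thesis
      proof (intro iffI ballI allI impI)
        fix i assume Y: "\<forall>j\<in>{..<n}. ?Y j" and i: "i < n"
        have "?Y (n - Suc i)" by (rule bspec[OF Y]) (use i in simp)
        moreover have "n - Suc i < n" "n - Suc (n - Suc i) = i" using i by auto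
        ultimately show "?X i" using XY[of "n - Suc i"] by metis
      next
        fix j assume X: "\<forall>i<n. ?X i" and j: "j \<in> {..<n}"
        have "?X (n - Suc j)" by (rule X[rule_format]) (use j in simp)
        then show "?Y j" using XY[of j] j by simp
      qed
    qed
  qed
  then have "emeasure M ?L = (\<Prod>j<n. emeasure (distr M borel (W (r (Suc j) - r j))) (uminus -` A (n - Suc j)))"
    using increments_rectangle[of r "\<lambda>j. uminus -` A (n - Suc j)" n] r
    by (simp add: uminus_vimage_borel)
  also have "\<dots> = (\<Prod>j<n. ?\<nu> (n - Suc j))"
  proof (intro prod.cong refl)
    fix j assume j: "j \<in> {..<n}"
    have "r (Suc j) - r j = t (Suc (n - Suc j)) - t (n - Suc j)" using j by (simp add: r_def Suc_diff_Suc)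
    moreover have "emeasure (distr M borel (W d)) (uminus -` B) = emeasure (distr M borel (W d)) B" if "B \<in> sets borel" for d B
    proof -
      have "emeasure (distr M borel (W d)) (uminus -` B) = emeasure (distr M borel (\<lambda>\<omega>. - W d \<omega>)) B"
        using that by (simp add: emeasure_distr uminus_vimage_borel vimage_def)
      then show ?thesis by (simp add: W_symmetric)
    qed
    ultimately show "emeasure (distr M borel (W (r (Suc j) - r j))) (uminus -` A (n - Suc j)) = ?\<nu> (n - Suc j)"
      by (simp add: A)
  qed
  also have "\<dots> = (\<Prod>i<n. ?\<nu> i)" by (rule prod.nat_diff_reindex)
  also have "\<dots> = emeasure M {\<omega> \<in> space M. \<forall>i<n. W (t (Suc i)) \<omega> - W (t i) \<omega> \<in> A i}"
    using increments_rectangle[of t A n] t A by (simp add: Ball_def)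
  finally show "emeasure M {\<omega> \<in> space M. \<forall>i<n. W (t (Suc i)) \<omega> - W (t i) \<omega> \<in> A i} = emeasure M ?L" ..
qed (auto intro: prob_space_axioms simp: W_nonpos)

end

section \<open>Cadlag paths and joint measurability\<close>

definition skorokhod :: "(real \<Rightarrow> real) \<Rightarrow> bool" where
  "skorokhod w \<longleftrightarrow> (\<forall>t. continuous (at_right t) w) \<and> (\<forall>t. \<exists>l. (w \<longlongrightarrow> l) (at_left t))"

lemma skorokhod_add_const: "skorokhod w \<Longrightarrow> skorokhod (\<lambda>s. x + w s)"
  unfolding skorokhod_def using tendsto_add[OF tendsto_const, of w _ _ x]
  by (fast intro!: continuous_intros)

lemma skorokhod_shift:
  assumes "skorokhod w" shows "skorokhod (\<lambda>s. w (u + s))"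
  unfolding skorokhod_def continuous_within
proof (intro conjI allI)
  fix t
  have "filterlim (\<lambda>s. u + s) (at_right (u + t)) (at_right t)"
    by (intro filterlim_at_withinI tendsto_intros) (auto simp: eventually_at_filter)
  then show "((\<lambda>s. w (u + s)) \<longlongrightarrow> w (u + t)) (at_right t)"
    using assms by (auto simp: skorokhod_def continuous_within intro: filterlim_compose)
  obtain l where l: "(w \<longlongrightarrow> l) (at_left (u + t))" using assms by (auto simp: skorokhod_def)
  have "filterlim (\<lambda>s. u + s) (at_left (u + t)) (at_left t)"
    by (intro filterlim_at_withinI tendsto_intros) (auto simp: eventually_at_filter)
  then show "\<exists>l. ((\<lambda>s. w (u + s)) \<longlongrightarrow> l) (at_left t)"
    using filterlim_compose[OF l] by blast
qed

lemma skorokhod_right: "skorokhod w \<Longrightarrow> (w \<longlongrightarrow> w t) (at_right t)"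
  unfolding skorokhod_def continuous_within by auto

text \<open>The first multiple of 1 / (n + 1) strictly after \<open>s\<close>. Strictness matters:
  the approximation must stay to the right of \<open>s\<close>, where a cadlag path is
  continuous.\<close>

definition grid_above :: "nat \<Rightarrow> real \<Rightarrow> real" where
  "grid_above n s = (of_int \<lfloor>real (Suc n) * s\<rfloor> + 1) / real (Suc n)"

lemma grid_above: "s < grid_above n s" "grid_above n s \<le> s + 1 / real (Suc n)"
proof -
  have "real (Suc n) * s < of_int \<lfloor>real (Suc n) * s\<rfloor> + 1" by linarith
  then show "s < grid_above n s" by (simp add: grid_above_def field_simps)
  have "of_int \<lfloor>real (Suc n) * s\<rfloor> + 1 \<le> real (Suc n) * s + 1" by linarith
  then have "grid_above n s \<le> (real (Suc n) * s + 1) / real (Suc n)"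
    unfolding grid_above_def by (intro divide_right_mono) auto
  then show "grid_above n s \<le> s + 1 / real (Suc n)" by (simp add: add_divide_distrib)
qed

lemma filterlim_grid_above: "filterlim (\<lambda>n. grid_above n s) (at_right s) sequentially"
proof -
  have "(\<lambda>n. grid_above n s) \<longlonglongrightarrow> s"
  proof (rule tendsto_sandwich[of "\<lambda>_. s" _ _ "\<lambda>n. s + 1 / real (Suc n)"])
    show "(\<lambda>n. s + 1 / real (Suc n)) \<longlonglongrightarrow> s"
      using tendsto_add[OF tendsto_const LIMSEQ_inverse_real_of_nat, of s] by (simp add: inverse_eq_divide)
    show "\<forall>\<^sub>F n in sequentially. s \<le> grid_above n s"
      using grid_above(1) by (intro always_eventually allI less_imp_le)
    show "\<forall>\<^sub>F n in sequentially. grid_above n s \<le> s + 1 / real (Suc n)"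
      using grid_above(2) by (intro always_eventually allI)
  qed simp
  then show ?thesis
    by (intro filterlim_at_withinI) (use grid_above(1) in \<open>auto intro!: always_eventually simp: less_le\<close>)
qed

text \<open>Evaluated at \<open>grid_above\<close>, the process is used at countably many times
  only, hence is jointly measurable; right continuity passes this to the limit.\<close>

lemma right_continuous_joint_measurable:
  fixes F :: "real \<Rightarrow> 'a \<Rightarrow> real"
  assumes [measurable]: "\<And>t. F t \<in> borel_measurable N"
    and rc: "\<And>t \<omega>. continuous (at_right t) (\<lambda>s. F s \<omega>)"
  shows "(\<lambda>(s, \<omega>). F s \<omega>) \<in> borel_measurable (borel \<Otimes>\<^sub>M N)"
proof (rule borel_measurable_LIMSEQ_metric)
  fix n
  have "(\<lambda>p. F ((of_int k + 1) / real (Suc n)) (snd p)) \<in> borel_measurable (borel \<Otimes>\<^sub>M N)" for k :: int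
    by measurable
  moreover have "(\<lambda>p. \<lfloor>real (Suc n) * fst p\<rfloor>) \<in> measurable (borel \<Otimes>\<^sub>M N) (count_space UNIV)"
    by measurable
  ultimately have "(\<lambda>p. F ((of_int \<lfloor>real (Suc n) * fst p\<rfloor> + 1) / real (Suc n)) (snd p)) \<in> borel_measurable (borel \<Otimes>\<^sub>M N)"
    by (rule measurable_compose_countable)
  then show "(\<lambda>(s, \<omega>). F (grid_above n s) \<omega>) \<in> borel_measurable (borel \<Otimes>\<^sub>M N)"
    by (simp add: grid_above_def case_prod_beta)
next
  fix p :: "real \<times> 'a"
  have "(\<lambda>n. F (grid_above n (fst p)) (snd p)) \<longlonglongrightarrow> F (fst p) (snd p)"
    using rc[of "fst p" "snd p"] unfolding continuous_within
    by (rule filterlim_compose[OF _ filterlim_grid_above])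
  then show "(\<lambda>n. (case p of (s, \<omega>) \<Rightarrow> F (grid_above n s) \<omega>)) \<longlonglongrightarrow> (case p of (s, \<omega>) \<Rightarrow> F s \<omega>)"
    by (simp add: case_prod_beta)
qed

lemma skorokhod_measurable:
  assumes "skorokhod w" shows "w \<in> borel_measurable borel"
proof -
  have "(\<lambda>(s, \<omega>). w s) \<in> borel_measurable (borel \<Otimes>\<^sub>M count_space (UNIV :: unit set))"
    using assms by (intro right_continuous_joint_measurable) (auto simp: skorokhod_def)
  from measurable_compose[OF _ this, of "\<lambda>s. (s, ())" borel] show ?thesis by simp
qed

lemma skorokhod_bounded:
  assumes "skorokhod w" shows "\<exists>B. \<forall>s\<in>{a..b}. \<bar>w s\<bar> \<le> B"
proof -
  have loc: "\<exists>U B. open U \<and> t \<in> U \<and> (\<forall>s\<in>U. \<bar>w s\<bar> \<le> B)" for t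
  proof -
    obtain l where l: "(w \<longlongrightarrow> l) (at_left t)" using assms by (auto simp: skorokhod_def)
    have "\<forall>\<^sub>F s in at_left t. dist (w s) l < 1" using tendstoD[OF l, of 1] by simp
    moreover have "\<forall>\<^sub>F s in at_right t. dist (w s) (w t) < 1"
      using tendstoD[OF skorokhod_right[OF assms], of 1] by simp
    ultimately have "\<forall>\<^sub>F s in at t. \<bar>w s\<bar> \<le> \<bar>l\<bar> + \<bar>w t\<bar> + 1"
      unfolding eventually_at_split by (auto elim!: eventually_mono simp: dist_real_def)
    then have "\<forall>\<^sub>F s in nhds t. \<bar>w s\<bar> \<le> \<bar>l\<bar> + \<bar>w t\<bar> + 1"
      unfolding eventually_nhds_conv_at by simp
    then show ?thesis unfolding eventually_nhds by blast
  qed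
  then obtain U B where UB: "\<And>t. open (U t)" "\<And>t. t \<in> U t" "\<And>t s. s \<in> U t \<Longrightarrow> \<bar>w s\<bar> \<le> B t"
    by metis
  obtain T where T: "T \<subseteq> {a..b}" "finite T" "{a..b} \<subseteq> (\<Union>t\<in>T. U t)"
    by (rule compactE_image[of "{a..b}" "{a..b}" U]) (use UB in auto)
  have "\<bar>w s\<bar> \<le> (\<Sum>t\<in>T. \<bar>B t\<bar>)" if s: "s \<in> {a..b}" for s
  proof -
    obtain t where t: "t \<in> T" "s \<in> U t" using T(3) s by blast
    have "\<bar>w s\<bar> \<le> \<bar>B t\<bar>" using UB(3)[OF t(2)] by linarith
    also have "\<dots> \<le> (\<Sum>t\<in>T. \<bar>B t\<bar>)" using t T by (intro member_le_sum) auto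
    finally show ?thesis .
  qed
  then show ?thesis by blast
qed

subsection \<open>Killing at zero\<close>

text \<open>For a cadlag path this says that the path stays away from 0 on \<open>[0, u]\<close> (including its left limits).
  Rational multiples of \<open>u\<close> keep the event measurable and stable under time reversal on \<open>[0, u]\<close>.\<close>

definition alive :: "(real \<Rightarrow> real) \<Rightarrow> real \<Rightarrow> bool" where
  "alive w u \<longleftrightarrow> (\<exists>m::nat. \<forall>q\<in>\<rat> \<inter> {0..1}. 1 / real (Suc m) \<le> \<bar>w (u * q)\<bar>)"

lemma alive_cong:
  assumes "0 \<le> u" "\<And>s. 0 \<le> s \<Longrightarrow> s \<le> u \<Longrightarrow> w s = w' s"
  shows "alive w u \<longleftrightarrow> alive w' u"
proof -
  have "w (u * q) = w' (u * q)" if "q \<in> \<rat> \<inter> {0..1}" for q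
    using that assms(1) mult_left_mono[of q 1 u] by (intro assms(2)) auto
  then show ?thesis unfolding alive_def by simp
qed

lemma alive_reverse: "alive (\<lambda>s. w (u - s)) u \<longleftrightarrow> alive w u"
proof -
  have sym: "1 - q \<in> \<rat> \<inter> {0..1}" if "q \<in> \<rat> \<inter> {0..1}" for q :: real
    using that by auto
  have "(\<forall>q\<in>\<rat> \<inter> {0..1}. P (u - u * q)) \<longleftrightarrow> (\<forall>q\<in>\<rat> \<inter> {0..1}. P (u * q))" for P :: "real \<Rightarrow> bool"
  proof (intro iffI ballI)
    fix q :: real assume *: "\<forall>q\<in>\<rat> \<inter> {0..1}. P (u - u * q)" and q: "q \<in> \<rat> \<inter> {0..1}"
    have "P (u - u * (1 - q))" by (rule bspec[OF * sym[OF q]])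
    then show "P (u * q)" by (simp add: algebra_simps)
  next
    fix q :: real assume *: "\<forall>q\<in>\<rat> \<inter> {0..1}. P (u * q)" and q: "q \<in> \<rat> \<inter> {0..1}"
    have "P (u * (1 - q))" by (rule bspec[OF * sym[OF q]])
    then show "P (u - u * q)" by (simp add: algebra_simps)
  qed
  note this[of "\<lambda>z. 1 / real (Suc m) \<le> \<bar>w z\<bar>" for m]
  then show ?thesis unfolding alive_def by (intro ex_cong1)
qed

text \<open>Right continuity carries the lower bound from the rational multiples of \<open>u\<close>
  to every earlier time. A uniform bound also controls left limits, which is how
  \<open>alive\<close> notices a path that creeps up to 0 and jumps away.\<close>

lemma alive_iff:
  assumes "skorokhod w" "0 \<le> u"
  shows "alive w u \<longleftrightarrow> (\<exists>e>0. \<forall>s\<in>{0..u}. e \<le> \<bar>w s\<bar>)"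
proof
  assume "alive w u"
  then obtain m :: nat where "\<forall>q\<in>\<rat> \<inter> {0..1}. 1 / real (Suc m) \<le> \<bar>w (u * q)\<bar>"
    unfolding alive_def ..
  note m = bspec[OF this]
  let ?e = "1 / real (Suc m)"
  have "?e \<le> \<bar>w s\<bar>" if s: "s \<in> {0..u}" for s
  \<comment> \<open>At the endpoint there is nothing to the right inside [0, u], but
    \<open>u\<close> is itself the multiple with factor 1.\<close>
  proof (cases "s = u")
    case True then show ?thesis using m[of 1] by simp
  next
    case False
    then have su: "0 \<le> s" "s < u" using s by auto
    show ?thesis
    proof (rule ccontr)
      assume "\<not> ?thesis"
      then have "\<bar>w s\<bar> < ?e" by simp
      moreover have "((\<lambda>r. \<bar>w r\<bar>) \<longlongrightarrow> \<bar>w s\<bar>) (at_right s)"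
        using skorokhod_right[OF assms(1)] by (rule tendsto_rabs)
      ultimately have "\<forall>\<^sub>F r in at_right s. \<bar>w r\<bar> < ?e" by (rule order_tendstoD(2)[rotated])
      then obtain b where b: "b > s" "\<And>r. s < r \<Longrightarrow> r < b \<Longrightarrow> \<bar>w r\<bar> < ?e"
        unfolding eventually_at_right_field by auto
      have "s / u < min b u / u" using b(1) su by (intro divide_strict_right_mono) auto
      then obtain q where q: "q \<in> \<rat>" "s / u < q" "q < min b u / u"
        using Rats_dense_in_real by blast
      have "u * q < min b u" using q(3) su by (simp add: pos_less_divide_eq mult.commute)
      moreover have "s < u * q" using q(2) su by (simp add: pos_divide_less_eq mult.commute)
      ultimately have "s < u * q" "u * q < b" by auto
      moreover have "0 \<le> q"
      proof -
        have "0 \<le> s / u" using su by simp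
        then show ?thesis using q(2) by linarith
      qed
      moreover have "q \<le> 1"
      proof -
        have "min b u / u \<le> 1" using su by (simp add: divide_le_eq)
        then show ?thesis using q(3) by linarith
      qed
      ultimately have "\<bar>w (u * q)\<bar> < ?e" "?e \<le> \<bar>w (u * q)\<bar>"
        using b(2)[of "u * q"] m[of q] q(1) by simp_all
      then show False by (meson not_le)
    qed
  qed
  moreover have "?e > 0" by simp
  ultimately show "\<exists>e>0. \<forall>s\<in>{0..u}. e \<le> \<bar>w s\<bar>" by blast
next
  assume "\<exists>e>0. \<forall>s\<in>{0..u}. e \<le> \<bar>w s\<bar>"
  then obtain e where e0: "e > 0" "\<forall>s\<in>{0..u}. e \<le> \<bar>w s\<bar>" by (elim exE conjE)
  note e = e0(1) bspec[OF e0(2)]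
  obtain m :: nat where "inverse (real (Suc m)) < e"
    using reals_Archimedean[OF e(1)] by blast
  then have m: "1 / real (Suc m) < e" by (simp add: inverse_eq_divide)
  have "1 / real (Suc m) \<le> \<bar>w (u * q)\<bar>" if "q \<in> \<rat> \<inter> {0..1}" for q
  proof -
    have "0 \<le> q" "q \<le> 1" using that by simp_all
    then have "0 \<le> u * q" "u * q \<le> u"
      using assms(2) mult_left_mono[of q 1 u] by (simp_all only: mult_nonneg_nonneg mult_1_right)
    then have "e \<le> \<bar>w (u * q)\<bar>" by (intro e(2)) simp
    with less_imp_le[OF m] show ?thesis by (rule order_trans)
  qed
  then show "alive w u" unfolding alive_def by (intro exI[of _ m] ballI)
qed

lemma alive_mono:
  assumes "skorokhod w" "alive w v" "0 \<le> u" "u \<le> v" shows "alive w u"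
proof -
  obtain e where "e > 0" "\<forall>s\<in>{0..v}. e \<le> \<bar>w s\<bar>"
    using assms alive_iff[of w v] by auto
  then show ?thesis using assms alive_iff[of w u] by auto
qed

lemma alive_nonzero:
  assumes "skorokhod w" "alive w u" "0 \<le> s" "s \<le> u" shows "w s \<noteq> 0"
proof -
  obtain e where "e > 0" "\<forall>s\<in>{0..u}. e \<le> \<bar>w s\<bar>"
    using assms alive_iff[of w u] by auto
  then have "e > 0" "e \<le> \<bar>w s\<bar>" using assms by auto
  then show ?thesis by auto
qed

text \<open>Right continuity at \<open>u\<close> keeps the path away from 0 a little longer. Hence
  survival cannot end at a time at which the path still survives.\<close>

lemma alive_right_open:
  assumes "skorokhod w" "0 \<le> u" "alive w u"
  shows "\<exists>v>u. alive w v"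
proof -
  obtain e where e: "e > 0" "\<And>s. s \<in> {0..u} \<Longrightarrow> e \<le> \<bar>w s\<bar>"
    using assms by (auto simp: alive_iff)
  have "((\<lambda>r. \<bar>w r\<bar>) \<longlongrightarrow> \<bar>w u\<bar>) (at_right u)"
    using skorokhod_right[OF assms(1)] by (rule tendsto_rabs)
  moreover have "e / 2 < \<bar>w u\<bar>" using e(2)[of u] e(1) assms(2) by auto
  ultimately have "\<forall>\<^sub>F r in at_right u. e / 2 < \<bar>w r\<bar>" by (rule order_tendstoD(1))
  then obtain b where b: "b > u" "\<And>r. u < r \<Longrightarrow> r < b \<Longrightarrow> e / 2 < \<bar>w r\<bar>"
    unfolding eventually_at_right_field by auto
  have "e / 2 \<le> \<bar>w s\<bar>" if "s \<in> {0..(u + b) / 2}" for s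
  proof (cases "s \<le> u")
    case True
    then have "e \<le> \<bar>w s\<bar>" using e(2)[of s] that by auto
    then show ?thesis using e(1) by linarith
  next
    case False
    then show ?thesis using b(2)[of s] that b(1) by auto
  qed
  then have "alive w ((u + b) / 2)"
    using e(1) b(1) assms by (subst alive_iff) (auto intro!: exI[of _ "e / 2"])
  then show ?thesis using b(1) by (intro exI[of _ "(u + b) / 2"]) auto
qed

lemma alive_concat:
  assumes "skorokhod w" "0 \<le> u" "0 \<le> v"
  shows "alive w (u + v) \<longleftrightarrow> alive w u \<and> alive (\<lambda>s. w (u + s)) v"
proof -
  have sk: "skorokhod (\<lambda>s. w (u + s))"
    using assms(1) by (rule skorokhod_shift)
  note iffs = alive_iff[OF assms(1,2)] alive_iff[OF sk assms(3)] alive_iff[OF assms(1) add_nonneg_nonneg[OF assms(2,3)]]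
  show ?thesis
  proof (intro iffI conjI)
    assume "alive w u \<and> alive (\<lambda>s. w (u + s)) v"
    then obtain e d where e: "e > 0" "\<And>s. s \<in> {0..u} \<Longrightarrow> e \<le> \<bar>w s\<bar>" and d: "d > 0" "\<And>s. s \<in> {0..v} \<Longrightarrow> d \<le> \<bar>w (u + s)\<bar>"
      unfolding iffs by blast
    have "min e d \<le> \<bar>w s\<bar>" if "s \<in> {0..u + v}" for s
    proof (cases "s \<le> u")
      case True
      then have "e \<le> \<bar>w s\<bar>" using that by (intro e(2)) auto
      then show ?thesis by linarith
    next
      case False
      then have "d \<le> \<bar>w (u + (s - u))\<bar>" using that by (intro d(2)) auto
      then show ?thesis by simp
    qed
    moreover have "min e d > 0" using e(1) d(1) by simp
    ultimately show "alive w (u + v)" unfolding iffs by blast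
  next
    assume "alive w (u + v)"
    then obtain e where e: "e > 0" "\<And>s. s \<in> {0..u + v} \<Longrightarrow> e \<le> \<bar>w s\<bar>"
      unfolding iffs by blast
    have "\<forall>s\<in>{0..u}. e \<le> \<bar>w s\<bar>" "\<forall>s\<in>{0..v}. e \<le> \<bar>w (u + s)\<bar>"
      using e(2) assms by auto
    then show "alive w u" "alive (\<lambda>s. w (u + s)) v"
      unfolding iffs using e(1) by blast+
  qed
qed

subsection \<open>The clock\<close>

lemma inverse_clock_eq: "inverse_clock \<sigma> \<alpha> w t = Inf {s. 0 < s \<and> t < clock \<sigma> \<alpha> w s}"
  by (simp add: inverse_clock_def)

locale time_change =
  fixes \<sigma> :: "real \<Rightarrow> real" and \<alpha> :: real
  assumes sigma_cont: "continuous_on UNIV \<sigma>" and sigma_pos: "\<And>x. \<sigma> x > 0"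
begin

text \<open>At once the density of the speed measure and the rate at which the clock runs.\<close>

definition rho :: "real \<Rightarrow> real" where "rho x = \<sigma> x powr (- \<alpha>)"

lemma rho_pos: "rho x > 0" using sigma_pos[of x] by (simp add: rho_def)

lemma rho_cont: "continuous_on UNIV rho"
  unfolding rho_def using sigma_pos by (intro continuous_intros sigma_cont) (simp add: less_imp_neq[symmetric])

lemma rho_measurable [measurable]: "rho \<in> borel_measurable borel"
  using rho_cont by (rule borel_measurable_continuous_onI)

abbreviation "clk \<equiv> clock \<sigma> \<alpha>"
abbreviation "icl \<equiv> inverse_clock \<sigma> \<alpha>"

lemma clk_eq: "clk w u = (LBINT s:{0..u}. rho (w s))"
  by (simp add: clock_def rho_def)

text \<open>On a bounded time interval a cadlag path stays in a compact set, where a positive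
  continuous function has positive lower and finite upper bounds. So the clock is Lipschitz with
  Lipschitz inverse on bounded intervals.\<close>

lemma rho_path_bounds:
  assumes "skorokhod w"
  obtains m K where "0 < m" "m \<le> K" "\<And>s. s \<in> {a..b} \<Longrightarrow> m \<le> rho (w s)" "\<And>s. s \<in> {a..b} \<Longrightarrow> rho (w s) \<le> K"
proof -
  obtain B where B: "\<And>s. s \<in> {a..b} \<Longrightarrow> \<bar>w s\<bar> \<le> B"
    using skorokhod_bounded[OF assms, of a b] by blast
  define B' where "B' = \<bar>B\<bar>"
  have ne: "{-B'..B'} \<noteq> {}" by (simp add: B'_def)
  have c: "continuous_on {-B'..B'} rho" using rho_cont by (rule continuous_on_subset) simp
  obtain x where x: "x \<in> {-B'..B'}" "\<And>y. y \<in> {-B'..B'} \<Longrightarrow> rho x \<le> rho y"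
    using continuous_attains_inf[OF compact_Icc ne c] by blast
  obtain z where z: "z \<in> {-B'..B'}" "\<And>y. y \<in> {-B'..B'} \<Longrightarrow> rho y \<le> rho z"
    using continuous_attains_sup[OF compact_Icc ne c] by blast
  have "w s \<in> {-B'..B'}" if "s \<in> {a..b}" for s
    using B[OF that] by (auto simp: B'_def)
  then show thesis
    using x z rho_pos[of x] by (intro that[of "rho x" "rho z"]) auto
qed

lemma rho_path_measurable: "skorokhod w \<Longrightarrow> (\<lambda>s. rho (w s)) \<in> borel_measurable borel"
  using measurable_compose[OF skorokhod_measurable rho_measurable] by simp

lemma rho_path_integrable:
  assumes "skorokhod w" shows "set_integrable lborel {a..b} (\<lambda>s. rho (w s))"
proof -
  obtain m K where mK: "0 < m" "m \<le> K" "\<And>s. s \<in> {a..b} \<Longrightarrow> m \<le> rho (w s)" "\<And>s. s \<in> {a..b} \<Longrightarrow> rho (w s) \<le> K"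
    using rho_path_bounds[OF assms] by blast
  show ?thesis
    unfolding set_integrable_def
  proof (rule integrableI_bounded_set_indicator[where B = K])
    show "AE x in lborel. x \<in> {a..b} \<longrightarrow> norm (rho (w x)) \<le> K"
      using mK(4) by (auto simp: abs_of_pos[OF rho_pos])
  qed (use rho_path_measurable[OF assms] in \<open>auto simp: emeasure_lborel_Icc_eq\<close>)
qed

lemma clk_0: "clk w 0 = 0"
proof -
  have "AE s in lborel. indicator {0..0::real} s *\<^sub>R rho (w s) = 0"
    using AE_lborel_singleton[of 0] by eventually_elim (simp split: split_indicator)
  then show ?thesis
    unfolding clk_eq set_lebesgue_integral_def by (rule integral_eq_zero_AE)
qed

lemma clk_diff:
  assumes "skorokhod w" "0 \<le> u" "u \<le> v"
  shows "clk w v - clk w u = (LBINT s:{u..v}. rho (w s))"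
proof -
  have "clk w v = (LBINT s:{0..u} \<union> {u..v}. rho (w s))"
    unfolding clk_eq using assms by (simp add: ivl_disj_un_two_touch)
  also have "\<dots> = clk w u + (LBINT s:{u..v}. rho (w s))"
    unfolding clk_eq
  proof (rule set_integral_Un_AE)
    show "AE x in lborel. \<not> (x \<in> {0..u} \<and> x \<in> {u..v})"
      using AE_lborel_singleton[of u] by (auto elim!: eventually_mono)
  qed (use rho_path_integrable[OF assms(1)] in auto)
  finally show ?thesis by simp
qed

lemma clk_diff_bounds:
  assumes "0 \<le> u" "u \<le> v" "v \<le> b" "skorokhod w"
    and "\<And>s. s \<in> {0..b} \<Longrightarrow> m \<le> rho (w s)" "\<And>s. s \<in> {0..b} \<Longrightarrow> rho (w s) \<le> K"
  shows "m * (v - u) \<le> clk w v - clk w u" "clk w v - clk w u \<le> K * (v - u)"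
proof -
  have i: "set_integrable lborel {u..v} (\<lambda>s. rho (w s))" by (rule rho_path_integrable[OF assms(4)])
  have c: "set_integrable lborel {u..v} (\<lambda>s. k)" for k :: real
    by (auto simp: set_integrable_def emeasure_lborel_Icc_eq)
  have "(LBINT s:{u..v}. m) \<le> (LBINT s:{u..v}. rho (w s))"
    using assms by (intro set_integral_mono i c) auto
  then show "m * (v - u) \<le> clk w v - clk w u"
    using assms by (simp add: clk_diff[OF assms(4,1,2)] set_lebesgue_integral_def mult.commute)
  have "(LBINT s:{u..v}. rho (w s)) \<le> (LBINT s:{u..v}. K)"
    using assms by (intro set_integral_mono i c) auto
  then show "clk w v - clk w u \<le> K * (v - u)"
    using assms by (simp add: clk_diff[OF assms(4,1,2)] set_lebesgue_integral_def mult.commute)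
qed

lemma clk_strict_mono:
  assumes "skorokhod w" "0 \<le> u" "u < v" shows "clk w u < clk w v"
proof -
  obtain m K where mK: "0 < m" "m \<le> K" "\<And>s. s \<in> {0..v} \<Longrightarrow> m \<le> rho (w s)" "\<And>s. s \<in> {0..v} \<Longrightarrow> rho (w s) \<le> K"
    using rho_path_bounds[OF assms(1)] by blast
  have "m * (v - u) \<le> clk w v - clk w u"
    by (rule clk_diff_bounds(1)[of u v v w m K]) (use assms mK in auto)
  moreover have "m * (v - u) > 0" using mK(1) assms by simp
  ultimately show ?thesis by linarith
qed

lemma clk_mono: "skorokhod w \<Longrightarrow> 0 \<le> u \<Longrightarrow> u \<le> v \<Longrightarrow> clk w u \<le> clk w v"
  using clk_strict_mono[of w u v] by (cases "u = v") auto

lemma clk_less_iff: "skorokhod w \<Longrightarrow> 0 \<le> u \<Longrightarrow> 0 \<le> v \<Longrightarrow> clk w u < clk w v \<longleftrightarrow> u < v"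
  using clk_strict_mono[of w u v] clk_mono[of w v u] by (cases "u < v") auto

lemma clk_nonneg: "skorokhod w \<Longrightarrow> 0 \<le> u \<Longrightarrow> 0 \<le> clk w u"
  using clk_mono[of w 0 u] by (simp add: clk_0)

lemma clk_cont:
  assumes "skorokhod w" shows "continuous_on {0..b} (clk w)"
proof -
  obtain m K where mK: "0 < m" "m \<le> K" "\<And>s. s \<in> {0..b} \<Longrightarrow> m \<le> rho (w s)" "\<And>s. s \<in> {0..b} \<Longrightarrow> rho (w s) \<le> K"
    using rho_path_bounds[OF assms] by blast
  have le: "\<bar>clk w v - clk w u\<bar> \<le> K * (v - u)" if "0 \<le> u" "u \<le> v" "v \<le> b" for u v
    using clk_diff_bounds(2)[OF that assms mK(3,4)] clk_mono[OF assms that(1,2)] by simp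
  have "K-lipschitz_on {0..b} (clk w)"
  proof (rule lipschitz_onI)
    fix u v assume "u \<in> {0..b}" "v \<in> {0..b}"
    then show "dist (clk w u) (clk w v) \<le> K * dist u v"
      using le[of u v] le[of v u] by (cases "u \<le> v") (auto simp: dist_real_def abs_minus_commute)
  qed (use mK in auto)
  then show ?thesis by (rule lipschitz_on_continuous_on)
qed

lemma icl_clk:
  assumes "skorokhod w" "0 \<le> u" shows "icl w (clk w u) = u"
proof -
  have "{s. 0 < s \<and> clk w u < clk w s} = {u<..}"
    using clk_less_iff[OF assms(1,2)] assms(2) by (auto simp: less_le_trans)
  then show ?thesis by (simp add: inverse_clock_eq)
qed

lemma clk_surj:
  assumes "skorokhod w" "0 \<le> t" "t < clk w b" "0 \<le> b"
  obtains u where "0 \<le> u" "u < b" "clk w u = t"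
proof -
  obtain u where u: "0 \<le> u" "u \<le> b" "clk w u = t"
    using IVT'[of "clk w" 0 t b] assms clk_cont[OF assms(1), of b] by (auto simp: clk_0)
  then show thesis using that[of u] assms(3) by (cases "u = b") auto
qed

text \<open>On an individual path the clock may stay bounded, and then \<open>Inf {}\<close>
  appears; times are therefore inverted only below a clock value that is attained.\<close>

lemma clk_icl:
  assumes "skorokhod w" "0 \<le> t" "t < clk w b" "0 \<le> b"
  shows "clk w (icl w t) = t" "0 \<le> icl w t" "icl w t < b"
proof -
  obtain u where "0 \<le> u" "u < b" "clk w u = t" by (rule clk_surj[OF assms])
  then show "clk w (icl w t) = t" "0 \<le> icl w t" "icl w t < b"
    using icl_clk[OF assms(1), of u] by auto
qed

lemma clk_measurable: "skorokhod w \<Longrightarrow> clk w \<in> borel_measurable borel"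
proof (rule borel_measurable_mono, rule monoI)
  fix u v :: real assume w: "skorokhod w" and uv: "u \<le> v"
  have "clk w u = 0" if "u < 0" for u using that by (simp add: clk_eq set_lebesgue_integral_def)
  then show "clk w u \<le> clk w v"
    using clk_mono[OF w, of u v] clk_nonneg[OF w, of v] uv by (cases "u < 0"; cases "v < 0") auto
qed

lemma nn_integral_rho:
  assumes "skorokhod w" "0 \<le> u" "u \<le> v"
  shows "(\<integral>\<^sup>+s. indicator {u..v} s * ennreal (rho (w s)) \<partial>lborel) = ennreal (clk w v - clk w u)"
proof -
  have "(\<integral>\<^sup>+s. indicator {u..v} s * ennreal (rho (w s)) \<partial>lborel) = (\<integral>\<^sup>+s. ennreal (indicator {u..v} s *\<^sub>R rho (w s)) \<partial>lborel)"
    by (intro nn_integral_cong) (auto split: split_indicator)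
  also have "\<dots> = ennreal (LBINT s:{u..v}. rho (w s))"
    unfolding set_lebesgue_integral_def
    using rho_path_integrable[OF assms(1), of u v]
    by (intro nn_integral_eq_integral) (auto simp: set_integrable_def less_imp_le[OF rho_pos] split: split_indicator)
  finally show ?thesis by (simp add: clk_diff[OF assms])
qed

text \<open>The change of variables t = clk u. The path may jump, so instead of differentiating the
  clock the two measures are compared on half-lines, where both give an increment of the
  clock.\<close>

lemma clk_image_measure:
  assumes w: "skorokhod w" and n: "0 \<le> n"
  shows "distr (density lborel (\<lambda>u. indicator {0..n} u * ennreal (rho (w u)))) borel (clk w)
    = density lborel (indicator {0..clk w n})" (is "?P = ?Q")
proof (rule measure_eqI_lessThan)
  have [measurable]: "clk w \<in> borel_measurable borel" "(\<lambda>s. rho (w s)) \<in> borel_measurable borel"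
    using w by (simp_all add: clk_measurable rho_path_measurable)
  have P: "emeasure ?P {x<..} = (\<integral>\<^sup>+u. indicator {u. 0 \<le> u \<and> u \<le> n \<and> x < clk w u} u * ennreal (rho (w u)) \<partial>lborel)" for x
  proof -
    have "clk w -` {x<..} \<in> sets borel" using measurable_sets[OF clk_measurable[OF w], of "{x<..}"] by simp
    then have "emeasure ?P {x<..} = (\<integral>\<^sup>+u. indicator {0..n} u * ennreal (rho (w u)) * indicator (clk w -` {x<..}) u \<partial>lborel)"
      by (simp add: emeasure_distr emeasure_density)
    then show ?thesis by (auto intro!: nn_integral_cong split: split_indicator)
  qed
  have Q: "emeasure ?Q {x<..} = emeasure lborel ({0..clk w n} \<inter> {x<..})" for x
    by (subst emeasure_density)
      (auto simp flip: nn_integral_indicator intro!: nn_integral_cong split: split_indicator)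
  have "emeasure ?P {x<..} = ennreal (clk w n - max 0 (min x (clk w n)))" for x
  proof -
    consider "x < 0" | "0 \<le> x" "x < clk w n" | "clk w n \<le> x" by linarith
    then show ?thesis
    proof cases
      case 1
      have "{u. 0 \<le> u \<and> u \<le> n \<and> x < clk w u} = {0..n}"
        using less_le_trans[OF 1 clk_nonneg[OF w]] by (intro set_eqI) (simp, blast)
      then show ?thesis using 1 nn_integral_rho[OF w order_refl n] clk_nonneg[OF w n] by (simp add: P clk_0)
    next
      case 2
      obtain a where a: "0 \<le> a" "a < n" "clk w a = x" by (rule clk_surj[OF w 2 n])
      have "{u. 0 \<le> u \<and> u \<le> n \<and> x < clk w u} = {a<..n}"
        using clk_less_iff[OF w a(1)] a by auto
      then have "emeasure ?P {x<..} = (\<integral>\<^sup>+u. indicator {a<..n} u * ennreal (rho (w u)) \<partial>lborel)"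
        by (simp add: P)
      also have "\<dots> = (\<integral>\<^sup>+u. indicator {a..n} u * ennreal (rho (w u)) \<partial>lborel)"
        using AE_lborel_singleton[of a]
        by (intro nn_integral_cong_AE) (auto elim!: eventually_mono split: split_indicator)
      also have "\<dots> = ennreal (clk w n - x)" using nn_integral_rho[OF w a(1)] a by simp
      finally show ?thesis using 2 by simp
    next
      case 3
      then have "{u. 0 \<le> u \<and> u \<le> n \<and> x < clk w u} = {}"
        using clk_mono[OF w] by (auto simp: not_less intro: order_trans)
      then show ?thesis using 3 clk_nonneg[OF w n] by (simp add: P)
    qed
  qed
  moreover have "emeasure ?Q {x<..} = ennreal (clk w n - max 0 (min x (clk w n)))" for x
  proof -
    have "{0..clk w n} \<inter> {x<..} = (if x < 0 then {0..clk w n} else {x<..clk w n})" by auto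
    then show ?thesis using clk_nonneg[OF w n] unfolding Q by (auto simp: max_def min_def)
  qed
  ultimately show "emeasure ?P {x<..} < \<infinity>" "emeasure ?P {x<..} = emeasure ?Q {x<..}" for x by auto
qed auto

text \<open>The measure identity on [0, n] passes to the half-line by monotone convergence. The
  indicator on the right cuts down to the range of the clock.\<close>

lemma clk_substitution:
  assumes w: "skorokhod w" and [measurable]: "h \<in> borel_measurable borel"
  shows "(\<integral>\<^sup>+u. indicator {0..} u * (h (clk w u) * ennreal (rho (w u))) \<partial>lborel)
    = (\<integral>\<^sup>+t. indicator {t. 0 \<le> t \<and> (\<exists>n::nat. t < clk w n)} t * h t \<partial>lborel)"
proof -
  have [measurable]: "clk w \<in> borel_measurable borel" "(\<lambda>s. rho (w s)) \<in> borel_measurable borel"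
    using w by (simp_all add: clk_measurable rho_path_measurable)
  have eq: "(\<integral>\<^sup>+u. indicator {0..real n} u * (h (clk w u) * ennreal (rho (w u))) \<partial>lborel)
      = (\<integral>\<^sup>+t. indicator {0..clk w n} t * h t \<partial>lborel)" for n :: nat
  proof -
    have "(\<integral>\<^sup>+t. indicator {0..clk w n} t * h t \<partial>lborel) = (\<integral>\<^sup>+t. h t \<partial>density lborel (indicator {0..clk w n}))"
      by (simp add: nn_integral_density)
    also have "\<dots> = (\<integral>\<^sup>+t. h t \<partial>distr (density lborel (\<lambda>u. indicator {0..real n} u * ennreal (rho (w u)))) borel (clk w))"
      by (simp add: clk_image_measure[OF w])
    also have "\<dots> = (\<integral>\<^sup>+u. indicator {0..real n} u * (h (clk w u) * ennreal (rho (w u))) \<partial>lborel)"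
      by (simp add: nn_integral_distr nn_integral_density ac_simps)
    finally show ?thesis by simp
  qed
  have "(\<integral>\<^sup>+u. indicator {0..} u * (h (clk w u) * ennreal (rho (w u))) \<partial>lborel)
      = (\<integral>\<^sup>+u. (SUP n::nat. indicator {0..real n} u * (h (clk w u) * ennreal (rho (w u)))) \<partial>lborel)"
  proof (intro nn_integral_cong)
    fix u :: real
    obtain m :: nat where m: "u \<le> m" using real_arch_simple by blast
    have "(SUP n::nat. indicator {0..real n} u * c) = indicator {0..} u * c" for c :: ennreal
    proof (rule antisym)
      show "indicator {0..} u * c \<le> (SUP n::nat. indicator {0..real n} u * c)"
        using m by (intro SUP_upper2[of m]) (auto split: split_indicator)
    qed (auto intro!: SUP_least split: split_indicator)
    then show "indicator {0..} u * (h (clk w u) * ennreal (rho (w u)))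
        = (SUP n::nat. indicator {0..real n} u * (h (clk w u) * ennreal (rho (w u))))" by simp
  qed
  also have "\<dots> = (SUP n::nat. (\<integral>\<^sup>+u. indicator {0..real n} u * (h (clk w u) * ennreal (rho (w u))) \<partial>lborel))"
    by (rule nn_integral_monotone_convergence_SUP) (auto simp: incseq_def le_fun_def split: split_indicator)
  also have "\<dots> = (SUP n::nat. (\<integral>\<^sup>+t. indicator {0..clk w n} t * h t \<partial>lborel))"
    by (simp only: eq)
  also have "\<dots> = (\<integral>\<^sup>+t. (SUP n::nat. indicator {0..clk w n} t * h t) \<partial>lborel)"
  proof (rule nn_integral_monotone_convergence_SUP[symmetric])
    show "incseq (\<lambda>(n::nat) t. indicator {0..clk w n} t * h t)"
      using clk_mono[OF w] by (auto simp: incseq_def le_fun_def split: split_indicator intro: order_trans)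
  qed measurable
  also have "\<dots> = (\<integral>\<^sup>+t. indicator {t. 0 \<le> t \<and> (\<exists>n::nat. t < clk w n)} t * h t \<partial>lborel)"
  proof (intro nn_integral_cong antisym)
    fix t :: real
    show "(SUP n::nat. indicator {0..clk w n} t * h t) \<le> indicator {t. 0 \<le> t \<and> (\<exists>n::nat. t < clk w n)} t * h t"
    proof (intro SUP_least)
      fix n :: nat
      have "clk w n < clk w (Suc n)" using clk_strict_mono[OF w, of n "Suc n"] by simp
      then have "t \<le> clk w n \<Longrightarrow> \<exists>n::nat. t < clk w n" by (intro exI[of _ "Suc n"]) simp
      then show "indicator {0..clk w n} t * h t \<le> indicator {t. 0 \<le> t \<and> (\<exists>n::nat. t < clk w n)} t * h t"
        by (auto split: split_indicator)
    qed
    show "indicator {t. 0 \<le> t \<and> (\<exists>n::nat. t < clk w n)} t * h t \<le> (SUP n::nat. indicator {0..clk w n} t * h t)"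
    proof (cases "0 \<le> t \<and> (\<exists>n::nat. t < clk w n)")
      case True
      then obtain n :: nat where "t < clk w n" by blast
      then show ?thesis using True by (intro SUP_upper2[of n]) auto
    qed simp
  qed
  finally show ?thesis .
qed

section \<open>Riemann sums for the clock; reversal and shift\<close>

text \<open>Laws of paths are compared on a product space, where only finitely many coordinates are
  read at a time. These sums present the clock as a limit of such functionals; right endpoints are
  sampled to fit right continuity.\<close>

definition riemann :: "(real \<Rightarrow> real) \<Rightarrow> real \<Rightarrow> nat \<Rightarrow> real" where
  "riemann w u N = (\<Sum>k<N. u / real N * rho (w (u * (real (Suc k) / real N))))"

lemma riemann_cong:
  assumes "0 \<le> u" "\<And>s. 0 \<le> s \<Longrightarrow> s \<le> u \<Longrightarrow> w s = w' s"
  shows "riemann w u N = riemann w' u N"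
  unfolding riemann_def
proof (intro sum.cong refl)
  fix k assume "k \<in> {..<N}"
  then have "real (Suc k) / real N \<le> 1" by (simp add: divide_le_eq)
  then have "u * (real (Suc k) / real N) \<le> u" using mult_left_mono[OF _ assms(1)] by fastforce
  then have "w (u * (real (Suc k) / real N)) = w' (u * (real (Suc k) / real N))"
    using assms by (intro assms(2)) auto
  then show "u / real N * rho (w (u * (real (Suc k) / real N))) = u / real N * rho (w' (u * (real (Suc k) / real N)))"
    by simp
qed

text \<open>The sum is the integral of a step function whose value at \<open>s\<close> samples the
  path strictly to the right of \<open>s\<close> and within u / N of it. Right continuity gives
  pointwise convergence, and the bound on \<open>rho\<close> along the path dominates.\<close>

lemma riemann_tendsto:
  assumes w: "skorokhod w" and u: "0 \<le> u"
  shows "riemann w u \<longlonglongrightarrow> clk w u"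
proof (cases "u = 0")
  case True
  have "riemann w u = (\<lambda>_. 0)" using True by (simp add: riemann_def fun_eq_iff)
  then show ?thesis using True by (simp add: clk_0)
next
  case False
  then have u: "u > 0" using u by simp
  obtain m K where mK: "0 < m" "m \<le> K" "\<And>s. s \<in> {0..u} \<Longrightarrow> m \<le> rho (w s)" "\<And>s. s \<in> {0..u} \<Longrightarrow> rho (w s) \<le> K"
    using rho_path_bounds[OF w] by blast
  define I where "I N k = {u * (real k / real N)..<u * (real (Suc k) / real N)}" for N k :: nat
  define c where "c N k = u * (real (Suc k) / real N)" for N k :: nat
  define F where "F N s = (\<Sum>k<N. indicator (I N k) s * rho (w (c N k)))" for N s
  have idx: "s \<in> I N k \<longleftrightarrow> k = nat \<lfloor>real N * s / u\<rfloor>" if "0 \<le> s" "N > 0" for s N k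
  proof -
    have "s \<in> I N k \<longleftrightarrow> real k \<le> real N * s / u \<and> real N * s / u < real k + 1"
      using u that by (auto simp: I_def field_simps)
    also have "\<dots> \<longleftrightarrow> \<lfloor>real N * s / u\<rfloor> = int k" by (simp add: floor_eq_iff)
    also have "\<dots> \<longleftrightarrow> k = nat \<lfloor>real N * s / u\<rfloor>" using that u by auto
    finally show ?thesis .
  qed
  have Fval: "F N s = rho (w (c N (nat \<lfloor>real N * s / u\<rfloor>)))" if "0 \<le> s" "s < u" "N > 0" for N s
  proof -
    have "real N * s / u < real N" using that u by (simp add: divide_less_eq)
    then have "nat \<lfloor>real N * s / u\<rfloor> < N" using that u by (simp add: nat_less_iff floor_less_iff)
    then have "F N s = (\<Sum>k\<in>{nat \<lfloor>real N * s / u\<rfloor>}. indicator (I N k) s * rho (w (c N k)))"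
      unfolding F_def using idx[OF that(1,3)] by (intro sum.mono_neutral_right) (auto simp: indicator_def)
    then show ?thesis using idx[OF that(1,3)] by simp
  qed
  have F0: "F N s = 0" if "s < 0 \<or> u \<le> s" for N s
  proof -
    have "s \<notin> I N k" if k: "k < N" for k
    proof -
      have "real (Suc k) / real N \<le> 1" using k by (simp add: divide_le_eq)
      then have "u * (real (Suc k) / real N) \<le> u" using mult_left_mono[of _ 1 u] u by fastforce
      moreover have "0 \<le> u * (real k / real N)" using u by simp
      ultimately show ?thesis using \<open>s < 0 \<or> u \<le> s\<close> unfolding I_def by (metis atLeastLessThan_iff not_le order_trans)
    qed
    then show ?thesis by (simp add: F_def)
  qed
  have cle: "c N k \<in> {0..u}" if "k < N" for N k
  proof -
    have "real (Suc k) / real N \<le> 1" using that by (simp add: divide_le_eq)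
    then have "u * (real (Suc k) / real N) \<le> u" using mult_left_mono[of _ 1 u] u by fastforce
    then show ?thesis using u by (simp add: c_def)
  qed
  have int: "(\<integral>s. F N s \<partial>lborel) = riemann w u N" for N
  proof -
    have "emeasure lborel (I N k) < \<infinity>" "measure lborel (I N k) = u / real N" for k
      using u by (auto simp: I_def divide_right_mono mult_left_mono add_divide_distrib algebra_simps)
    then show ?thesis
      unfolding F_def riemann_def c_def by (subst Bochner_Integration.integral_sum) (auto simp: I_def)
  qed
  have "(\<lambda>N. (\<integral>s. F N s \<partial>lborel)) \<longlonglongrightarrow> (\<integral>s. indicator {0..u} s *\<^sub>R rho (w s) \<partial>lborel)"
  proof (rule integral_dominated_convergence[where w = "\<lambda>s. indicator {0..u} s * K"])
    show "(\<lambda>s. indicator {0..u} s *\<^sub>R rho (w s)) \<in> borel_measurable lborel"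
      using rho_path_measurable[OF w] by measurable
    show "F N \<in> borel_measurable lborel" for N unfolding F_def I_def by measurable
    show "integrable lborel (\<lambda>s. indicator {0..u} s * K)"
      by (intro integrable_mult_left integrable_real_indicator) (auto simp: emeasure_lborel_Icc_eq)
    show "AE s in lborel. norm (F N s) \<le> indicator {0..u} s * K" for N
    proof (intro AE_I2)
      fix s
      show "norm (F N s) \<le> indicator {0..u} s * K"
      proof (cases "0 \<le> s \<and> s < u \<and> N > 0")
        case True
        then have "real N * s / u < real N" using u by (simp add: divide_less_eq)
        then have "nat \<lfloor>real N * s / u\<rfloor> < N" using True u by (simp add: nat_less_iff floor_less_iff)
        then show ?thesis using True mK(4)[OF cle] by (simp add: Fval abs_of_pos[OF rho_pos])
      next
        case False
        then have "F N s = 0" using F0[of s N] by (cases "N = 0") (auto simp: F_def)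
        then show ?thesis using mK(1,2) by (simp split: split_indicator)
      qed
    qed
    show "AE s in lborel. (\<lambda>N. F N s) \<longlonglongrightarrow> indicator {0..u} s *\<^sub>R rho (w s)"
      using AE_lborel_singleton[of u]
    proof eventually_elim
      case (elim s)
      show ?case
      proof (cases "0 \<le> s \<and> s < u")
        case True
        define d where "d N = c N (nat \<lfloor>real N * s / u\<rfloor>)" for N
        have d: "s < d N" "d N \<le> s + u / real N" if "N > 0" for N
        proof -
          have k: "real (nat \<lfloor>real N * s / u\<rfloor>) = of_int \<lfloor>real N * s / u\<rfloor>" using True u by simp
          have "real N * s / u < of_int \<lfloor>real N * s / u\<rfloor> + 1" by linarith
          then have "s < u * ((of_int \<lfloor>real N * s / u\<rfloor> + 1) / real N)"
            using u that by (simp add: field_simps)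
          then show "s < d N" by (simp add: d_def c_def k add.commute)
          have "of_int \<lfloor>real N * s / u\<rfloor> \<le> real N * s / u" by linarith
          then have "u * ((of_int \<lfloor>real N * s / u\<rfloor> + 1) / real N) \<le> u * ((real N * s / u + 1) / real N)"
            using u by (intro mult_left_mono divide_right_mono) auto
          also have "\<dots> = s + u / real N" using u that by (simp add: field_simps)
          finally show "d N \<le> s + u / real N" by (simp add: d_def c_def k add.commute)
        qed
        have "d \<longlonglongrightarrow> s"
        proof (rule tendsto_sandwich[of "\<lambda>_. s" _ _ "\<lambda>N. s + u / real N"])
          have "(\<lambda>N. s + u / real N) \<longlonglongrightarrow> s + 0"
            by (intro tendsto_intros lim_const_over_n)
          then show "(\<lambda>N. s + u / real N) \<longlonglongrightarrow> s" by simp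
          show "\<forall>\<^sub>F N in sequentially. s \<le> d N" "\<forall>\<^sub>F N in sequentially. d N \<le> s + u / real N"
            by (rule eventually_mono[OF eventually_gt_at_top[of "0::nat"]], use d in \<open>auto intro: less_imp_le\<close>)+
        qed simp
        moreover have "\<forall>\<^sub>F N in sequentially. d N \<in> {s<..} - {s}"
          using eventually_gt_at_top[of "0::nat"]
        proof eventually_elim
          case (elim N) then show ?case using d(1)[of N] by auto
        qed
        ultimately have "filterlim d (at_right s) sequentially" by (rule filterlim_at_withinI)
        then have "(\<lambda>N. w (d N)) \<longlonglongrightarrow> w s"
          using skorokhod_right[OF w] by (rule filterlim_compose[rotated])
        then have "(\<lambda>N. rho (w (d N))) \<longlonglongrightarrow> rho (w s)"
          using rho_cont by (intro isCont_tendsto_compose[of _ rho]) (auto simp: continuous_on_eq_continuous_at)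
        moreover have "\<forall>\<^sub>F N in sequentially. rho (w (d N)) = F N s"
          using eventually_gt_at_top[of "0::nat"] by eventually_elim (use True in \<open>simp add: Fval d_def\<close>)
        ultimately have "(\<lambda>N. F N s) \<longlonglongrightarrow> rho (w s)" by (rule Lim_transform_eventually)
        then show ?thesis using True by simp
      next
        case False
        then show ?thesis using F0[of s] elim by (auto split: split_indicator)
      qed
    qed
  qed
  then show ?thesis unfolding int by (simp add: clk_eq set_lebesgue_integral_def)
qed

text \<open>The reversed path is left continuous, so \<open>riemann_tendsto\<close> does not cover
  it. But reversal only turns right endpoints into left endpoints, and the two sums differ by
  boundary terms of size u / N.\<close>

lemma riemann_reverse_tendsto:
  assumes w: "skorokhod w" and u: "0 \<le> u"
  shows "riemann (\<lambda>s. w (u - s)) u \<longlonglongrightarrow> clk w u"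
proof -
  have eq: "riemann (\<lambda>s. w (u - s)) u N = riemann w u N + u / real N * (rho (w 0) - rho (w u))" for N
  proof (cases "N = 0")
    case False
    let ?f = "\<lambda>k. u / real N * rho (w (u * (real k / real N)))"
    have "riemann (\<lambda>s. w (u - s)) u N = (\<Sum>k<N. ?f (N - Suc k))"
      unfolding riemann_def
    proof (intro sum.cong refl)
      fix k assume "k \<in> {..<N}"
      then have "u - u * (real (Suc k) / real N) = u * (real (N - Suc k) / real N)"
        by (simp add: of_nat_diff field_simps)
      then show "u / real N * rho (w (u - u * (real (Suc k) / real N))) = ?f (N - Suc k)" by simp
    qed
    also have "\<dots> = (\<Sum>k<N. ?f k)" by (rule sum.nat_diff_reindex)
    also have "\<dots> = (\<Sum>k<N. ?f (Suc k)) + ?f 0 - ?f N"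
      using sum_lessThan_telescope[of ?f N] by (simp add: sum_subtractf)
    finally show ?thesis using False by (simp add: riemann_def algebra_simps)
  qed (simp add: riemann_def)
  have "(\<lambda>N. riemann w u N + u / real N * (rho (w 0) - rho (w u))) \<longlonglongrightarrow> clk w u + 0 * (rho (w 0) - rho (w u))"
    by (intro tendsto_intros riemann_tendsto[OF assms] lim_const_over_n)
  then have "(\<lambda>N. riemann (\<lambda>s. w (u - s)) u N) \<longlonglongrightarrow> clk w u" unfolding eq by simp
  then show ?thesis .
qed

lemma clk_shift:
  assumes w: "skorokhod w" and u: "0 \<le> u" "0 \<le> v"
  shows "clk (\<lambda>s. w (u + s)) v = clk w (u + v) - clk w u"
proof -
  have "clk w (u + v) - clk w u = (\<integral>s. indicator {u..u + v} s *\<^sub>R rho (w s) \<partial>lborel)"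
    using clk_diff[OF w, of u "u + v"] u by (simp add: set_lebesgue_integral_def)
  also have "\<dots> = (\<integral>s. indicator {u..u + v} (u + 1 * s) *\<^sub>R rho (w (u + 1 * s)) \<partial>lborel)"
    by (subst lborel_integral_real_affine[of 1 _ u]) auto
  also have "\<dots> = clk (\<lambda>s. w (u + s)) v"
    by (simp add: clk_eq set_lebesgue_integral_def indicator_def)
  finally show ?thesis by simp
qed

subsection \<open>The time-changed path\<close>

abbreviation "tc \<equiv> time_changed \<sigma> \<alpha>"

text \<open>The first conjunct excludes times beyond the range of the clock, at which
  \<open>icl\<close> would be an arbitrary value.\<close>

definition alive_tc :: "(real \<Rightarrow> real) \<Rightarrow> real \<Rightarrow> bool" where
  "alive_tc w t \<longleftrightarrow> (\<exists>n::nat. t < clk w n) \<and> alive w (icl w t)"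

lemma alive_tc_clk:
  assumes w: "skorokhod w" and u: "0 \<le> u"
  shows "alive_tc w (clk w u) \<longleftrightarrow> alive w u" "tc w (clk w u) = w u"
proof -
  obtain n :: nat where "u < n" using reals_Archimedean2 by blast
  then have "\<exists>n::nat. clk w u < clk w n" using clk_strict_mono[OF w u] by blast
  then show "alive_tc w (clk w u) \<longleftrightarrow> alive w u" "tc w (clk w u) = w u"
    by (simp_all add: alive_tc_def time_changed_def icl_clk[OF assms])
qed

text \<open>Survival extends strictly beyond any survived time and the clock is strictly increasing,
  so being alive at \<open>t\<close> means that some survived time has a clock value above
  \<open>t\<close>. In this form monotonicity and openness in \<open>t\<close> are
  immediate.\<close>

lemma alive_tc_iff:
  assumes w: "skorokhod w" and t: "0 \<le> t"
  shows "alive_tc w t \<longleftrightarrow> (\<exists>u\<ge>0. alive w u \<and> t < clk w u)"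
proof
  assume a: "alive_tc w t"
  then obtain n :: nat where n: "t < clk w n" by (auto simp: alive_tc_def)
  note i = clk_icl[OF w t n of_nat_0_le_iff]
  obtain v where v: "v > icl w t" "alive w v"
    using alive_right_open[OF w i(2)] a by (auto simp: alive_tc_def)
  have "t < clk w v" using clk_strict_mono[OF w i(2) v(1)] i(1) by simp
  then show "\<exists>u\<ge>0. alive w u \<and> t < clk w u" using v i(2) by (intro exI[of _ v]) auto
next
  assume "\<exists>u\<ge>0. alive w u \<and> t < clk w u"
  then obtain u where u: "0 \<le> u" "alive w u" "t < clk w u" by blast
  obtain n :: nat where "u \<le> n" using real_arch_simple by blast
  then have "t < clk w n" using clk_mono[OF w u(1)] u(3) by (meson less_le_trans)
  moreover have "alive w (icl w t)"
    using clk_icl[OF w t u(3,1)] by (intro alive_mono[OF w u(2)]) auto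
  ultimately show "alive_tc w t" by (auto simp: alive_tc_def)
qed

lemma alive_tc_mono:
  "skorokhod w \<Longrightarrow> alive_tc w t \<Longrightarrow> 0 \<le> s \<Longrightarrow> s \<le> t \<Longrightarrow> alive_tc w s"
  unfolding alive_tc_iff by (meson alive_tc_iff le_less_trans order_trans)

lemma alive_tc_0:
  assumes "skorokhod w" shows "alive_tc w 0 \<longleftrightarrow> w 0 \<noteq> 0" "tc w 0 = w 0"
proof -
  have "alive w 0 \<longleftrightarrow> w 0 \<noteq> 0" by (auto simp: alive_iff[OF assms] intro!: exI[of _ "\<bar>w 0\<bar>"])
  then show "alive_tc w 0 \<longleftrightarrow> w 0 \<noteq> 0" "tc w 0 = w 0"
    using alive_tc_clk[OF assms, of 0] by (simp_all add: clk_0)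
qed

text \<open>While the path is alive the inverse clock is continuous and strictly increasing just
  after \<open>t\<close>, so right continuity of \<open>w\<close> transfers; once dead the function
  stays 0.\<close>

lemma killed_right_continuous:
  fixes k :: "real \<Rightarrow> real"
  assumes w: "skorokhod w" and t: "0 \<le> t" and k: "continuous_on UNIV k"
  shows "((\<lambda>s. if alive_tc w s then k (tc w s) else 0) \<longlongrightarrow> (if alive_tc w t then k (tc w t) else 0)) (at_right t)"
proof (cases "alive_tc w t")
  case False
  have "\<forall>\<^sub>F s in at_right t. (if alive_tc w s then k (tc w s) else 0) = 0"
    unfolding eventually_at_filter using alive_tc_mono[OF w _ t] False
    by (intro always_eventually) (auto dest: less_imp_le)
  then show ?thesis using False by (simp add: tendsto_eventually)
next
  case True
  then obtain u where u: "0 \<le> u" "alive w u" "t < clk w u" using alive_tc_iff[OF w t] by auto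
  note i = clk_icl[OF w t u(3,1)]
  have ev: "\<forall>\<^sub>F s in at_right t. t < s \<and> s < clk w u"
    using u(3) by (auto intro: eventually_conj simp: eventually_at_right_less eventually_at_right_field)
  have lim: "(icl w \<longlongrightarrow> icl w t) (at_right t)"
  proof (rule tendstoI)
    fix e :: real assume e: "e > 0"
    have "t < clk w (icl w t + e)" using clk_strict_mono[OF w i(2), of "icl w t + e"] e i(1) by simp
    then have "\<forall>\<^sub>F s in at_right t. t < s \<and> s < clk w (icl w t + e)"
      by (auto intro: eventually_conj simp: eventually_at_right_less eventually_at_right_field)
    then show "\<forall>\<^sub>F s in at_right t. dist (icl w s) (icl w t) < e"
    proof eventually_elim
      case (elim s)
      have s: "0 \<le> s" using elim t by simp
      note j = clk_icl[OF w s, of "icl w t + e"]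
      have "icl w s < icl w t + e" "0 \<le> icl w s" "clk w (icl w s) = s" using j elim i(2) e by auto
      moreover have "icl w t < icl w s"
        using clk_less_iff[OF w i(2), of "icl w s"] calculation elim i(1) by simp
      ultimately show ?case by (simp add: dist_real_def)
    qed
  qed
  \<comment> \<open>\<open>w\<close> is only right continuous, so the inverse clock has to approach
    its limit strictly from above.\<close>
  have gt: "\<forall>\<^sub>F s in at_right t. icl w s \<in> {icl w t<..} - {icl w t}"
    using ev
  proof eventually_elim
    case (elim s)
    have s: "0 \<le> s" using elim t by simp
    note j = clk_icl[OF w s, of u]
    show ?case using clk_less_iff[OF w i(2), of "icl w s"] elim i(1) j u(1) by simp
  qed
  have "filterlim (icl w) (at_right (icl w t)) (at_right t)"
    using lim gt by (rule filterlim_at_withinI)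
  then have "((\<lambda>s. w (icl w s)) \<longlongrightarrow> w (icl w t)) (at_right t)"
    using skorokhod_right[OF w] by (rule filterlim_compose[rotated])
  then have "((\<lambda>s. k (tc w s)) \<longlongrightarrow> k (tc w t)) (at_right t)"
    unfolding time_changed_def
    using k by (intro isCont_tendsto_compose[of _ k]) (auto simp: continuous_on_eq_continuous_at)
  moreover have "\<forall>\<^sub>F s in at_right t. k (tc w s) = (if alive_tc w s then k (tc w s) else 0)"
    using ev
  proof eventually_elim
    case (elim s)
    then have "alive_tc w s" using alive_tc_iff[OF w, of s] t u by auto
    then show ?case by simp
  qed
  ultimately show ?thesis using True by (simp add: Lim_transform_eventually)
qed

text \<open>Hitting 0 means taking the value 0, while \<open>alive\<close> also fails at a left
  limit 0. \<open>no_jump\<close> reconciles them: at the end of survival the path must actually be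
  at 0, so the first zero of \<open>y\<close> is the clock value of that time.\<close>

lemma hitting_time_iff:
  assumes w: "skorokhod w" and w0: "w 0 \<noteq> 0" and t: "0 < t"
    and killed: "\<exists>u\<ge>0. \<not> alive w u"
    and no_jump: "\<And>r. 0 < r \<Longrightarrow> (w \<longlongrightarrow> 0) (at_left r) \<Longrightarrow> w r = 0"
    and agree: "\<And>s b. 0 \<le> s \<Longrightarrow> 0 \<le> b \<Longrightarrow> s < clk w b \<Longrightarrow> y s = tc w s"
  shows "ereal t < hitting_time_zero y \<longleftrightarrow> alive_tc w t"
proof
  assume "alive_tc w t"
  then obtain u where u: "0 \<le> u" "alive w u" "t < clk w u" using alive_tc_iff[OF w, of t] t by auto
  have "ereal (clk w u) \<le> hitting_time_zero y"
    unfolding hitting_time_zero_def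
  proof (rule Inf_greatest)
    fix z assume "z \<in> ereal ` {t. 0 < t \<and> y t = 0}"
    then obtain s where s: "z = ereal s" "0 < s" "y s = 0" by auto
    have "\<not> s < clk w u"
    proof
      assume "s < clk w u"
      then have "0 \<le> icl w s" "icl w s < u" using clk_icl[OF w, of s u] s u by auto
      then have "w (icl w s) \<noteq> 0" using alive_nonzero[OF w u(2)] by auto
      then show False using s agree[of s u] u(1) \<open>s < clk w u\<close> by (simp add: time_changed_def)
    qed
    then show "ereal (clk w u) \<le> z" using s by simp
  qed
  then show "ereal t < hitting_time_zero y" using u(3) by (meson ereal_less_eq(3) less_le_trans ereal_less(1) less_ereal.simps(1))
next
  assume hit: "ereal t < hitting_time_zero y"
  define S where "S = {u. 0 \<le> u \<and> alive w u}"
  obtain u0 where u0: "u0 \<ge> 0" "\<not> alive w u0" using killed by blast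
  have bdd: "u \<le> u0" if "u \<in> S" for u
    using alive_mono[OF w, of u u0] that u0 by (auto simp: S_def) (meson linear)
  have "alive w 0" using w0 by (auto simp: alive_iff[OF w] intro!: exI[of _ "\<bar>w 0\<bar>"])
  then have S0: "0 \<in> S" by (simp add: S_def)
  \<comment> \<open>The lifetime of \<open>w\<close>; it is finite by \<open>killed\<close>. The
    path survives every time before \<open>T\<close>, but not \<open>T\<close> itself, by
    \<open>alive_right_open\<close>.\<close>
  define T where "T = Sup S"
  have bddS: "bdd_above S" using bdd by (auto intro!: bdd_aboveI)
  have T0: "0 \<le> T" unfolding T_def using S0 bddS by (rule cSup_upper)
  have below: "alive w u" if u: "0 \<le> u" "u < T" for u
  proof -
    obtain v where "v \<in> S" "u < v" using u less_cSup_iff[of S u] S0 bddS by (auto simp: T_def)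
    then show ?thesis using alive_mono[OF w, of v u] u by (auto simp: S_def)
  qed
  have notT: "\<not> alive w T"
  proof
    assume "alive w T"
    then obtain v where "v > T" "alive w v" using alive_right_open[OF w T0] by blast
    then have "v \<in> S" using T0 by (simp add: S_def)
    then have "v \<le> T" unfolding T_def using bddS by (rule cSup_upper)
    then show False using \<open>v > T\<close> by simp
  qed
  have Tpos: "T > 0" using T0 notT \<open>alive w 0\<close> by (cases "T = 0") auto
  have wT: "w T = 0"
  proof (rule ccontr)
    assume nz: "w T \<noteq> 0"
    obtain l where l: "(w \<longlongrightarrow> l) (at_left T)" using w by (auto simp: skorokhod_def)
    have "l \<noteq> 0" using no_jump[OF Tpos] l nz by auto
    then have "\<bar>l\<bar> / 2 < \<bar>l\<bar>" by simp
    then have "\<forall>\<^sub>F s in at_left T. \<bar>l\<bar> / 2 < \<bar>w s\<bar>" using tendsto_rabs[OF l] by (rule order_tendstoD(1)[rotated])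
    then obtain b where b: "b < T" "\<And>s. b < s \<Longrightarrow> s < T \<Longrightarrow> \<bar>l\<bar> / 2 < \<bar>w s\<bar>"
      unfolding eventually_at_left_field by auto
    \<comment> \<open>On [0, c] survival gives a lower bound, between \<open>c\<close> and
      \<open>T\<close> the nonzero left limit does, and at \<open>T\<close> the assumed nonzero
      value; so the path would survive \<open>T\<close>.\<close>
    define c where "c = max 0 ((b + T) / 2)"
    have c: "0 \<le> c" "c < T" "b < c" using b(1) Tpos by (auto simp: c_def less_max_iff_disj)
    obtain e where e: "e > 0" "\<And>s. s \<in> {0..c} \<Longrightarrow> e \<le> \<bar>w s\<bar>"
      using below[OF c(1,2)] alive_iff[OF w c(1)] by auto
    define d where "d = min e (min (\<bar>l\<bar> / 2) \<bar>w T\<bar>)"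
    have "d \<le> \<bar>w s\<bar>" if s: "s \<in> {0..T}" for s
    proof -
      consider "s \<in> {0..c}" | "c < s" "s < T" | "s = T" using s by force
      then show ?thesis
      proof cases
        case 1 then show ?thesis using e(2)[of s] by (simp add: d_def)
      next
        case 2 then show ?thesis using b(2)[of s] c by (simp add: d_def)
      next
        case 3 then show ?thesis by (simp add: d_def)
      qed
    qed
    moreover have "d > 0" using e(1) nz \<open>l \<noteq> 0\<close> by (simp add: d_def)
    ultimately have "alive w T" using alive_iff[OF w T0] by blast
    then show False using notT by simp
  qed
  have "tc w (clk w T) = 0" "0 < clk w T"
    using alive_tc_clk(2)[OF w T0] wT clk_strict_mono[OF w order_refl Tpos] by (simp_all add: clk_0)
  moreover have "y (clk w T) = tc w (clk w T)"
    using calculation(2) T0 clk_strict_mono[OF w T0, of "T + 1"] by (intro agree[of _ "T + 1"]) auto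
  ultimately have "hitting_time_zero y \<le> ereal (clk w T)"
    unfolding hitting_time_zero_def by (intro Inf_lower) auto
  then have tT: "t < clk w T" using hit by (metis ereal_less_eq(3) less_le_trans less_ereal.simps(1))
  then have i: "0 \<le> icl w t" "icl w t < T" using clk_icl[OF w, of t T] t T0 by auto
  obtain n :: nat where "T \<le> n" using real_arch_simple by blast
  then have "t < clk w n" using clk_mono[OF w T0] tT by (meson less_le_trans)
  then show "alive_tc w t" using below[OF i] by (auto simp: alive_tc_def)
qed

lemma alive_tc_nonzero:
  assumes w: "skorokhod w" and t: "0 \<le> t" and a: "alive_tc w t"
  shows "tc w t \<noteq> 0"
proof -
  obtain u where u: "0 \<le> u" "alive w u" "t < clk w u" using a alive_tc_iff[OF w t] by auto
  have "0 \<le> icl w t" "icl w t < u" using clk_icl[OF w t u(3,1)] by auto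
  then show ?thesis using alive_nonzero[OF w u(2)] by (auto simp: time_changed_def)
qed

lemma time_changed_cong:
  assumes w: "skorokhod w" and eq: "\<And>s. 0 \<le> s \<Longrightarrow> w' s = w s" and t: "0 \<le> t" "0 \<le> b" "t < clk w b"
  shows "tc w' t = tc w t"
proof -
  have "clk w' s = clk w s" for s
    unfolding clk_eq by (intro set_lebesgue_integral_cong) (auto simp: eq)
  then have "icl w' t = icl w t" by (simp add: inverse_clock_eq)
  then show ?thesis using eq clk_icl(2)[OF w t(1,3,2)] by (simp add: time_changed_def)
qed

end

subsection \<open>The stable process killed at zero, at an independent exponential time\<close>

locale stable_levy = cadlag_levy M W for M :: "'a measure" and W +
  fixes \<alpha> :: real
  assumes alpha: "1 < \<alpha>" "\<alpha> < 2"
    and W_char: "\<And>t \<xi>. 0 \<le> t \<Longrightarrow> char (distr M borel (W t)) \<xi> = of_real (exp (- t * \<bar>\<xi>\<bar> powr \<alpha>))"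
begin

lemma W_joint [measurable]: "(\<lambda>(s, \<omega>). W s \<omega>) \<in> borel_measurable (borel \<Otimes>\<^sub>M M)"
  by (rule right_continuous_joint_measurable) (auto intro: W_right)

lemma W_comp [measurable (raw)]:
  assumes "f \<in> borel_measurable N" "g \<in> measurable N M"
  shows "(\<lambda>z. W (f z) (g z)) \<in> borel_measurable N"
  using measurable_compose[OF measurable_Pair[OF assms] W_joint] by simp

lemma skorokhod_W: "skorokhod (\<lambda>s. x + W s \<omega>)"
  by (rule skorokhod_add_const) (simp add: skorokhod_def W_right W_left)

text \<open>Attaches an independent exponential time to the path; at this time the position has the
  explicit density given by \<open>pot_kernel\<close>.\<close>

definition S :: "real \<Rightarrow> (real \<times> 'a) measure" where
  "S l = density lborel (\<lambda>s. ennreal (exponential_density l s)) \<Otimes>\<^sub>M M"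

lemma sets_S [measurable_cong, simp]: "sets (S l) = sets (borel \<Otimes>\<^sub>M M)"
  unfolding S_def by (rule sets_pair_measure_cong) simp_all

lemma space_S [simp]: "space (S l) = UNIV \<times> space M"
  by (simp add: S_def space_pair_measure)

lemma W_joint_S [measurable]: "(\<lambda>z. W (fst z) (snd z)) \<in> borel_measurable (borel \<Otimes>\<^sub>M M)"
  using W_joint by (simp add: case_prod_beta)

text \<open>The first entrance into \<open>(-e, e)\<close> is discretised along dyadic grids; since all dyadic times are
  considered, no measurability of hitting times is needed.\<close>

definition hits :: "real \<Rightarrow> real \<Rightarrow> real \<Rightarrow> nat \<Rightarrow> (real \<Rightarrow> real) \<Rightarrow> bool" where
  "hits x e h k p \<longleftrightarrow> (\<forall>j<k. e \<le> \<bar>x + p (real j * h)\<bar>) \<and> \<bar>x + p (real k * h)\<bar> < e"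

definition avoids :: "real \<Rightarrow> real \<Rightarrow> nat \<Rightarrow> real \<times> 'a \<Rightarrow> bool" where
  "avoids x e n z \<longleftrightarrow> (\<forall>j::nat. real j * (1 / 2 ^ n) \<le> fst z \<longrightarrow> e \<le> \<bar>x + W (real j * (1 / 2 ^ n)) (snd z)\<bar>)"

definition avoids_dyadic :: "real \<Rightarrow> real \<Rightarrow> real \<times> 'a \<Rightarrow> bool" where
  "avoids_dyadic x e z \<longleftrightarrow> (\<forall>n. avoids x e n z)"

lemma avoids_measurable [measurable]: "Measurable.pred (borel \<Otimes>\<^sub>M M) (avoids x e n)"
  unfolding avoids_def[abs_def] by measurable

lemma avoids_dyadic_measurable [measurable]: "Measurable.pred (borel \<Otimes>\<^sub>M M) (avoids_dyadic x e)"
  unfolding avoids_dyadic_def[abs_def] by measurable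

text \<open>Splits the event according to the first grid index at which the path is in (-e, e). This
  index is unique, so at most one summand is nonzero.\<close>

lemma not_avoids_eq:
  "indicator {z. \<not> avoids x e n z} z =
    (\<Sum>k. indicator {z. hits x e (1 / 2 ^ n) k (\<lambda>s. W s (snd z)) \<and> real k * (1 / 2 ^ n) \<le> fst z} z :: ennreal)"
proof (cases "avoids x e n z")
  case True
  then have "\<not> (hits x e (1 / 2 ^ n) k (\<lambda>s. W s (snd z)) \<and> real k * (1 / 2 ^ n) \<le> fst z)" for k
    by (force simp: avoids_def hits_def)
  then show ?thesis using True by simp
next
  case False
  let ?P = "\<lambda>j::nat. \<bar>x + W (real j * (1 / 2 ^ n)) (snd z)\<bar> < e"
  obtain j :: nat where j: "real j * (1 / 2 ^ n) \<le> fst z" "?P j"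
    using False by (auto simp: avoids_def not_le)
  define k where "k = (LEAST j. ?P j)"
  have k: "?P k" "\<And>i. i < k \<Longrightarrow> \<not> ?P i" "k \<le> j"
    unfolding k_def using j(2) by (auto intro: LeastI Least_le dest: not_less_Least)
  have "real k * (1 / 2 ^ n) \<le> real j * (1 / 2 ^ n)" using k(3) by (intro mult_right_mono) auto
  then have kz: "real k * (1 / 2 ^ n) \<le> fst z" using j(1) by linarith
  have hits: "hits x e (1 / 2 ^ n) i (\<lambda>s. W s (snd z)) \<longleftrightarrow> i = k" for i
  proof
    assume h: "hits x e (1 / 2 ^ n) i (\<lambda>s. W s (snd z))"
    show "i = k"
    proof (rule ccontr)
      assume "i \<noteq> k"
      then consider "i < k" | "k < i" by linarith
      then show False
        using h k(1) k(2)[of i] by cases (auto simp: hits_def)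
    qed
  qed (use k in \<open>auto simp: hits_def not_less\<close>)
  have "(\<Sum>i. indicator {z. hits x e (1 / 2 ^ n) i (\<lambda>s. W s (snd z)) \<and> real i * (1 / 2 ^ n) \<le> fst z} z :: ennreal)
      = (\<Sum>i\<in>{k}. indicator {z. hits x e (1 / 2 ^ n) i (\<lambda>s. W s (snd z)) \<and> real i * (1 / 2 ^ n) \<le> fst z} z)"
    by (rule suminf_finite) (auto simp: hits)
  then show ?thesis using False kz by (simp add: hits)
qed

lemma avoids_Suc: "avoids x e (Suc n) z \<Longrightarrow> avoids x e n z"
  unfolding avoids_def
proof (intro allI impI)
  fix j :: nat assume *: "\<forall>j::nat. real j * (1 / 2 ^ Suc n) \<le> fst z \<longrightarrow> e \<le> \<bar>x + W (real j * (1 / 2 ^ Suc n)) (snd z)\<bar>"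
    and j: "real j * (1 / 2 ^ n) \<le> fst z"
  have "real (2 * j) * (1 / 2 ^ Suc n) = real j * (1 / 2 ^ n)" by simp
  then show "e \<le> \<bar>x + W (real j * (1 / 2 ^ n)) (snd z)\<bar>" using *[rule_format, of "2 * j"] j by simp
qed

lemma avoids_dyadic_mono:
  assumes "avoids_dyadic x e z" "d \<le> e" shows "avoids_dyadic x d z"
  using assms(1) order_trans[OF assms(2)] unfolding avoids_dyadic_def avoids_def by blast

lemma emeasure_S_Collect:
  assumes "Measurable.pred (borel \<Otimes>\<^sub>M M) P"
  shows "emeasure (S l) {z \<in> space (S l). P z} = (\<integral>\<^sup>+z. indicator {z. P z} z \<partial>S l)"
    "{z \<in> space (S l). P z} \<in> sets (S l)"
    "measure (S l) {z \<in> space (S l). P z} = (\<integral>z. indicator {z. P z} z \<partial>S l)"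
    "(indicator {z. P z} :: _ \<Rightarrow> real) \<in> borel_measurable (borel \<Otimes>\<^sub>M M)"
proof -
  show m: "{z \<in> space (S l). P z} \<in> sets (S l)"
    using assms measurable_cong_sets[OF sets_S[of l] refl, of "count_space UNIV"] by simp
  have "(\<integral>\<^sup>+z. indicator {z. P z} z \<partial>S l) = (\<integral>\<^sup>+z. indicator {z \<in> space (S l). P z} z \<partial>S l)"
    by (intro nn_integral_cong) (simp add: indicator_def)
  then show "emeasure (S l) {z \<in> space (S l). P z} = (\<integral>\<^sup>+z. indicator {z. P z} z \<partial>S l)"
    using m by (simp del: space_S)
  have "(\<integral>z. indicator {z. P z} z \<partial>S l) = (\<integral>z. indicator {z \<in> space (S l). P z} z \<partial>S l)"
    by (intro Bochner_Integration.integral_cong) (simp_all add: indicator_def)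
  also have "\<dots> = measure (S l) ({z \<in> space (S l). P z} \<inter> space (S l))"
    by (rule Bochner_Integration.integral_indicator)
  also have "{z \<in> space (S l). P z} \<inter> space (S l) = {z \<in> space (S l). P z}" by auto
  finally show "measure (S l) {z \<in> space (S l). P z} = (\<integral>z. indicator {z. P z} z \<partial>S l)" by simp
  show "(indicator {z. P z} :: _ \<Rightarrow> real) \<in> borel_measurable (borel \<Otimes>\<^sub>M M)"
    using assms by measurable
qed

context
  fixes l :: real assumes l: "l > 0"
begin

lemma pair_prob_S: "pair_prob_space (density lborel (\<lambda>s. ennreal (exponential_density l s))) M"
  using prob_space_exponential_density[OF l] prob_space_axioms
  by (simp add: pair_prob_space_def pair_sigma_finite_def prob_space_imp_sigma_finite)

lemma prob_space_S: "prob_space (S l)"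
proof -
  interpret P: pair_prob_space "density lborel (\<lambda>s. ennreal (exponential_density l s))" M by (rule pair_prob_S)
  show ?thesis unfolding S_def by unfold_locales
qed

lemma nn_integral_S:
  assumes [measurable]: "g \<in> borel_measurable (borel \<Otimes>\<^sub>M M)"
  shows "(\<integral>\<^sup>+z. g z \<partial>S l) = (\<integral>\<^sup>+s. ennreal (exponential_density l s) * (\<integral>\<^sup>+\<omega>. g (s, \<omega>) \<partial>M) \<partial>lborel)"
proof -
  interpret P: pair_prob_space "density lborel (\<lambda>s. ennreal (exponential_density l s))" M by (rule pair_prob_S)
  have "(\<integral>\<^sup>+z. g z \<partial>S l) = (\<integral>\<^sup>+s. \<integral>\<^sup>+\<omega>. g (s, \<omega>) \<partial>M \<partial>density lborel (\<lambda>s. ennreal (exponential_density l s)))"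
    unfolding S_def by (subst nn_integral_fst[symmetric]) simp_all
  then show ?thesis by (simp add: nn_integral_density)
qed

text \<open>Averaging exp(- s c) over the exponential law of rate \<open>l\<close> leaves l / (l +
  c) times the exponential density of rate l + c, whose integral is 1.\<close>

lemma char_S: "char (distr (S l) borel (\<lambda>z. W (fst z) (snd z))) \<xi> = of_real (l / (l + \<bar>\<xi>\<bar> powr \<alpha>))"
proof -
  interpret P: pair_prob_space "density lborel (\<lambda>s. ennreal (exponential_density l s))" M by (rule pair_prob_S)
  interpret prS: prob_space "S l" by (rule prob_space_S)
  let ?c = "\<bar>\<xi>\<bar> powr \<alpha>"
  have c: "?c \<ge> 0" "l + ?c > 0" using l by (auto intro: add_pos_nonneg)
  have "char (distr (S l) borel (\<lambda>z. W (fst z) (snd z))) \<xi> = (CLINT z|S l. iexp (\<xi> * W (fst z) (snd z)))"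
    by (simp add: char_def integral_distr)
  also have "\<dots> = (CLINT s|density lborel (\<lambda>s. ennreal (exponential_density l s)). CLINT \<omega>|M. iexp (\<xi> * W s \<omega>))"
    unfolding S_def
  proof (subst P.integral_fst'[symmetric])
    show "integrable (density lborel (\<lambda>s. ennreal (exponential_density l s)) \<Otimes>\<^sub>M M) (\<lambda>z. iexp (\<xi> * W (fst z) (snd z)))"
      by (rule P.integrable_const_bound[where B = 1]) (auto cong: measurable_cong_sets)
  qed simp
  also have "\<dots> = (CLINT s|lborel. exponential_density l s *\<^sub>R (CLINT \<omega>|M. iexp (\<xi> * W s \<omega>)))"
    by (subst integral_density) (auto simp: exponential_density_nonneg l)
  also have "\<dots> = (CLINT s|lborel. of_real (l / (l + ?c) * exponential_density (l + ?c) s))"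
  proof (rule Bochner_Integration.integral_cong[OF refl])
    fix s :: real
    show "exponential_density l s *\<^sub>R (CLINT \<omega>|M. iexp (\<xi> * W s \<omega>)) = of_real (l / (l + ?c) * exponential_density (l + ?c) s)"
    proof (cases "s < 0")
      case False
      have "(CLINT \<omega>|M. iexp (\<xi> * W s \<omega>)) = char (distr M borel (W s)) \<xi>"
        by (simp add: char_def integral_distr)
      then have "(CLINT \<omega>|M. iexp (\<xi> * W s \<omega>)) = of_real (exp (- s * ?c))"
        using W_char[of s \<xi>] False by simp
      moreover have "exponential_density l s * exp (- s * ?c) = l / (l + ?c) * exponential_density (l + ?c) s"
      proof -
        have "exp (- s * l) * exp (- s * ?c) = exp (- s * (l + ?c))" by (simp add: mult_exp_exp algebra_simps)
        then show ?thesis using False c by (simp add: exponential_density_def mult.assoc)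
      qed
      ultimately show ?thesis by (simp add: scaleR_conv_of_real flip: of_real_mult)
    qed (simp add: exponential_density_def)
  qed
  also have "\<dots> = of_real (l / (l + ?c))"
  proof -
    have "(\<integral>s. 1 \<partial>density lborel (\<lambda>s. ennreal (exponential_density (l + ?c) s))) = (\<integral>s. exponential_density (l + ?c) s \<partial>lborel)"
      by (subst integral_density) (auto simp: exponential_density_nonneg c(2))
    then have "(\<integral>s. exponential_density (l + ?c) s \<partial>lborel) = 1"
      using prob_space.prob_space[OF prob_space_exponential_density[OF c(2)]] by simp
    then show ?thesis by (subst integral_complex_of_real) simp
  qed
  finally show ?thesis .
qed

lemma real_distribution_S: "real_distribution (distr (S l) borel (\<lambda>z. W (fst z) (snd z)))"
  using prob_space.prob_space_distr[OF prob_space_S, of "\<lambda>z. W (fst z) (snd z)" borel]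
  by (simp add: real_distribution_def real_distribution_axioms_def cong: measurable_cong_sets)

lemma pot_kernel_nonneg: "0 \<le> pot_kernel \<alpha> l y"
  by (rule real_distribution.density_resolvent_char(1)[OF real_distribution_S alpha l char_S])

lemma resolvent_density:
  assumes [measurable]: "f \<in> borel_measurable borel"
  shows "(\<integral>\<^sup>+z. f (x + W (fst z) (snd z)) \<partial>S l) = (\<integral>\<^sup>+y. f y * ennreal (l * pot_kernel \<alpha> l (y - x)) \<partial>lborel)"
proof -
  have [measurable]: "pot_kernel \<alpha> l \<in> borel_measurable borel"
    using continuous_pot_kernel[OF alpha l] by (rule borel_measurable_continuous_onI)
  have "(\<integral>\<^sup>+z. f (x + W (fst z) (snd z)) \<partial>S l) = (\<integral>\<^sup>+y. f (x + y) \<partial>distr (S l) borel (\<lambda>z. W (fst z) (snd z)))"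
    by (subst nn_integral_distr) (auto cong: measurable_cong_sets)
  also have "\<dots> = (\<integral>\<^sup>+y. ennreal (l * pot_kernel \<alpha> l y) * f (x + y) \<partial>lborel)"
    by (subst real_distribution.density_resolvent_char(2)[OF real_distribution_S alpha l char_S])
      (simp add: nn_integral_density)
  also have "\<dots> = (\<integral>\<^sup>+y. f y * ennreal (l * pot_kernel \<alpha> l (y - x)) \<partial>lborel)"
    by (subst nn_integral_real_affine[where c = 1 and t = "-x"]) (auto simp: ac_simps)
  finally show ?thesis .
qed

section \<open>Resolvents decomposed at the entrance into a neighbourhood of 0\<close>

text \<open>For a fixed grid index the entrance event depends only on the path up to k h, so the
  Markov property at that time applies. The exponential time is memoryless: it exceeds k h with
  probability exp(- l k h), and its remainder is again exponential.\<close>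

lemma strong_Markov_grid:
  assumes [measurable]: "f \<in> borel_measurable borel" and h: "h > 0"
  shows "(\<integral>\<^sup>+z. f (x + W (fst z) (snd z)) * indicator {z. hits x e h k (\<lambda>s. W s (snd z)) \<and> real k * h \<le> fst z} z \<partial>S l)
    = ennreal (exp (- l * (real k * h))) *
      (\<integral>\<^sup>+\<omega>. indicator {\<omega>. hits x e h k (\<lambda>s. W s \<omega>)} \<omega> *
        (\<integral>\<^sup>+z. f (x + W (real k * h) \<omega> + W (fst z) (snd z)) \<partial>S l) \<partial>M)"
    (is "?L = ?R")
proof -
  let ?a = "real k * h"
  have a: "?a \<ge> 0" using h by simp
  have [measurable]: "Measurable.pred M (\<lambda>\<omega>. hits x e h k (\<lambda>s. W s \<omega>))"
    unfolding hits_def by measurable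
  have [measurable]: "Measurable.pred (PiM {0..} (\<lambda>_. borel)) (\<lambda>p. hits x e h k p)"
  proof -
    have [measurable]: "(\<lambda>p. p (real j * h)) \<in> borel_measurable (PiM {0..} (\<lambda>_. borel))" for j
      using h by (intro measurable_component_singleton) auto
    show ?thesis unfolding hits_def by measurable
  qed
  have hits_concat: "hits x e h k (\<lambda>s\<in>{0..}. concat ?a s (\<omega>, \<omega>')) = hits x e h k (\<lambda>s. W s \<omega>)" for \<omega> \<omega>'
  proof -
    have "(\<lambda>s\<in>{0..}. concat ?a s (\<omega>, \<omega>')) (real j * h) = W (real j * h) \<omega>" if "j \<le> k" for j
      using that h by (simp add: concat_def)
    then show ?thesis by (simp add: hits_def)
  qed
  have hits_restrict: "hits x e h k (\<lambda>s\<in>{0..}. W s \<omega>) = hits x e h k (\<lambda>s. W s \<omega>)" for \<omega>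
    using h by (simp add: hits_def)
  let ?I = "\<lambda>\<omega>. indicator {\<omega>. hits x e h k (\<lambda>s. W s \<omega>)} \<omega> :: ennreal"
  have Mk: "(\<integral>\<^sup>+\<omega>. f (x + W (?a + v) \<omega>) * ?I \<omega> \<partial>M) = (\<integral>\<^sup>+\<omega>. ?I \<omega> * (\<integral>\<^sup>+\<omega>'. f (x + W ?a \<omega> + W v \<omega>') \<partial>M) \<partial>M)" if v: "v \<ge> 0" for v
  proof -
    have [measurable]: "(\<lambda>p. p (?a + v)) \<in> borel_measurable (PiM {0..} (\<lambda>_. borel))"
      using a v by (intro measurable_component_singleton) auto
    define H where "H p = f (x + p (?a + v)) * indicator {p. hits x e h k p} p" for p
    have "H \<in> borel_measurable (PiM {0..} (\<lambda>_. borel))" unfolding H_def by measurable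
    from Markov[OF a this] have "(\<integral>\<^sup>+\<omega>. H (\<lambda>s\<in>{0..}. W s \<omega>) \<partial>M) = (\<integral>\<^sup>+\<omega>. \<integral>\<^sup>+\<omega>'. H (\<lambda>s\<in>{0..}. concat ?a s (\<omega>, \<omega>')) \<partial>M \<partial>M)" .
    moreover have "H (\<lambda>s\<in>{0..}. W s \<omega>) = f (x + W (?a + v) \<omega>) * ?I \<omega>" for \<omega>
      using a v hits_restrict[of \<omega>] by (simp add: H_def indicator_def)
    moreover have "H (\<lambda>s\<in>{0..}. concat ?a s (\<omega>, \<omega>')) = ?I \<omega> * f (x + W ?a \<omega> + W v \<omega>')" for \<omega> \<omega>'
    proof -
      have "(\<lambda>s\<in>{0..}. concat ?a s (\<omega>, \<omega>')) (?a + v) = W ?a \<omega> + W v \<omega>'"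
        using a v by (cases "v = 0") (auto simp: concat_def W_nonpos)
      then show ?thesis using hits_concat[of \<omega> \<omega>'] by (simp add: H_def indicator_def add.assoc)
    qed
    ultimately have "(\<integral>\<^sup>+\<omega>. f (x + W (?a + v) \<omega>) * ?I \<omega> \<partial>M) = (\<integral>\<^sup>+\<omega>. \<integral>\<^sup>+\<omega>'. ?I \<omega> * f (x + W ?a \<omega> + W v \<omega>') \<partial>M \<partial>M)" by simp
    then show ?thesis by (simp add: nn_integral_cmult)
  qed
  have "?L = (\<integral>\<^sup>+s. ennreal (exponential_density l s) * (\<integral>\<^sup>+\<omega>. f (x + W s \<omega>) * (?I \<omega> * indicator {?a..} s) \<partial>M) \<partial>lborel)"
    by (subst nn_integral_S) (auto intro!: nn_integral_cong arg_cong2[where f = "(*)"] simp: indicator_def)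
  also have "\<dots> = (\<integral>\<^sup>+v. ennreal (exponential_density l (?a + v)) * (\<integral>\<^sup>+\<omega>. f (x + W (?a + v) \<omega>) * (?I \<omega> * indicator {?a..} (?a + v)) \<partial>M) \<partial>lborel)"
    by (subst nn_integral_real_affine[where c = 1 and t = ?a]) auto
  also have "\<dots> = (\<integral>\<^sup>+v. ennreal (exp (- l * ?a)) * (ennreal (exponential_density l v) * (\<integral>\<^sup>+\<omega>. ?I \<omega> * (\<integral>\<^sup>+\<omega>'. f (x + W ?a \<omega> + W v \<omega>') \<partial>M) \<partial>M)) \<partial>lborel)"
  proof (intro nn_integral_cong)
    fix v :: real
    show "ennreal (exponential_density l (?a + v)) * (\<integral>\<^sup>+\<omega>. f (x + W (?a + v) \<omega>) * (?I \<omega> * indicator {?a..} (?a + v)) \<partial>M)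
      = ennreal (exp (- l * ?a)) * (ennreal (exponential_density l v) * (\<integral>\<^sup>+\<omega>. ?I \<omega> * (\<integral>\<^sup>+\<omega>'. f (x + W ?a \<omega> + W v \<omega>') \<partial>M) \<partial>M))"
    proof (cases "v < 0")
      case False
      then have "exponential_density l (?a + v) = exp (- l * ?a) * exponential_density l v"
        using a by (simp add: exponential_density_def exp_add[symmetric] algebra_simps)
      then show ?thesis using False Mk[of v] l
        by (simp add: ennreal_mult exponential_density_nonneg mult.assoc)
    qed (simp add: exponential_density_def)
  qed
  also have "\<dots> = ennreal (exp (- l * ?a)) * (\<integral>\<^sup>+v. (\<integral>\<^sup>+\<omega>. ?I \<omega> * (ennreal (exponential_density l v) * (\<integral>\<^sup>+\<omega>'. f (x + W ?a \<omega> + W v \<omega>') \<partial>M)) \<partial>M) \<partial>lborel)"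
    by (subst nn_integral_cmult) (auto simp: nn_integral_cmult[symmetric] ac_simps)
  also have "(\<integral>\<^sup>+v. (\<integral>\<^sup>+\<omega>. ?I \<omega> * (ennreal (exponential_density l v) * (\<integral>\<^sup>+\<omega>'. f (x + W ?a \<omega> + W v \<omega>') \<partial>M)) \<partial>M) \<partial>lborel)
     = (\<integral>\<^sup>+\<omega>. (\<integral>\<^sup>+v. ?I \<omega> * (ennreal (exponential_density l v) * (\<integral>\<^sup>+\<omega>'. f (x + W ?a \<omega> + W v \<omega>') \<partial>M)) \<partial>lborel) \<partial>M)"
    by (rule pair_sigma_finite.Fubini') (auto simp: pair_sigma_finite_def sigma_finite_lborel sigma_finite_measure_axioms)
  also have "\<dots> = (\<integral>\<^sup>+\<omega>. ?I \<omega> * (\<integral>\<^sup>+z. f (x + W ?a \<omega> + W (fst z) (snd z)) \<partial>S l) \<partial>M)"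
    by (intro nn_integral_cong) (simp add: nn_integral_S nn_integral_cmult)
  finally show ?thesis .
qed

text \<open>At the entrance the path is in (-e, e), where the resolvent of \<open>f\<close> lies
  between \<open>m\<close> and \<open>K\<close>. Summing over the entrance index compares the part
  after entrance with the probability of entering.\<close>

lemma hit_bounds_grid:
  assumes [measurable]: "f \<in> borel_measurable borel"
    and lo: "\<And>z. \<bar>z\<bar> < e \<Longrightarrow> m \<le> (\<integral>\<^sup>+\<zeta>. f (z + W (fst \<zeta>) (snd \<zeta>)) \<partial>S l)"
    and hi: "\<And>z. \<bar>z\<bar> < e \<Longrightarrow> (\<integral>\<^sup>+\<zeta>. f (z + W (fst \<zeta>) (snd \<zeta>)) \<partial>S l) \<le> K"
  shows "m * (\<integral>\<^sup>+z. indicator {z. \<not> avoids x e n z} z \<partial>S l) \<le> (\<integral>\<^sup>+z. f (x + W (fst z) (snd z)) * indicator {z. \<not> avoids x e n z} z \<partial>S l)"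
    and "(\<integral>\<^sup>+z. f (x + W (fst z) (snd z)) * indicator {z. \<not> avoids x e n z} z \<partial>S l) \<le> K * (\<integral>\<^sup>+z. indicator {z. \<not> avoids x e n z} z \<partial>S l)"
proof -
  define h :: real where "h = 1 / 2 ^ n"
  have h: "h > 0" by (simp add: h_def)
  let ?A = "\<lambda>k. {z. hits x e h k (\<lambda>s. W s (snd z)) \<and> real k * h \<le> fst z}"
  have [measurable]: "Measurable.pred (borel \<Otimes>\<^sub>M M) (\<lambda>z. hits x e h k (\<lambda>s. W s (snd z)))" for k
    unfolding hits_def by measurable
  have [measurable]: "Measurable.pred M (\<lambda>\<omega>. hits x e h k (\<lambda>s. W s \<omega>))" for k
    unfolding hits_def by measurable
  have ind_mult: "(\<integral>\<^sup>+\<omega>. indicator {\<omega>. hits x e h k (\<lambda>s. W s \<omega>)} \<omega> * c \<partial>M) =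
      c * (\<integral>\<^sup>+\<omega>. indicator {\<omega>. hits x e h k (\<lambda>s. W s \<omega>)} \<omega> \<partial>M)" for k c
    by (subst nn_integral_multc) (simp_all add: mult.commute)
  define T where "T k = ennreal (exp (- l * (real k * h))) * (\<integral>\<^sup>+\<omega>. indicator {\<omega>. hits x e h k (\<lambda>s. W s \<omega>)} \<omega> \<partial>M)" for k
  have sumf: "(\<integral>\<^sup>+z. f (x + W (fst z) (snd z)) * indicator {z. \<not> avoids x e n z} z \<partial>S l)
      = (\<Sum>k. \<integral>\<^sup>+z. f (x + W (fst z) (snd z)) * indicator (?A k) z \<partial>S l)"
    unfolding not_avoids_eq h_def[symmetric] ennreal_suminf_cmult[symmetric]
    by (rule nn_integral_suminf) (simp cong: measurable_cong_sets)
  have sum1: "(\<integral>\<^sup>+z. indicator {z. \<not> avoids x e n z} z \<partial>S l) = (\<Sum>k. T k)"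
  proof -
    have "(\<integral>\<^sup>+z. indicator {z. \<not> avoids x e n z} z \<partial>S l) = (\<Sum>k. \<integral>\<^sup>+z. indicator (?A k) z \<partial>S l)"
      unfolding not_avoids_eq h_def[symmetric]
      by (rule nn_integral_suminf) (simp cong: measurable_cong_sets)
    also have "\<dots> = (\<Sum>k. T k)"
      using strong_Markov_grid[of "\<lambda>_. 1" h x e] h prob_space.emeasure_space_1[OF prob_space_S]
      by (simp add: T_def)
    finally show ?thesis .
  qed
  have on: "\<bar>x + W (real k * h) \<omega>\<bar> < e" if "hits x e h k (\<lambda>s. W s \<omega>)" for k \<omega>
    using that by (simp add: hits_def)
  have eqk: "(\<integral>\<^sup>+z. f (x + W (fst z) (snd z)) * indicator (?A k) z \<partial>S l) = ennreal (exp (- l * (real k * h))) *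
      (\<integral>\<^sup>+\<omega>. indicator {\<omega>. hits x e h k (\<lambda>s. W s \<omega>)} \<omega> *
        (\<integral>\<^sup>+z. f (x + W (real k * h) \<omega> + W (fst z) (snd z)) \<partial>S l) \<partial>M)" for k
    by (rule strong_Markov_grid) (use h in auto)
  have "m * T k \<le> (\<integral>\<^sup>+z. f (x + W (fst z) (snd z)) * indicator (?A k) z \<partial>S l)" for k
  proof -
    have "m * T k = ennreal (exp (- l * (real k * h))) * (\<integral>\<^sup>+\<omega>. indicator {\<omega>. hits x e h k (\<lambda>s. W s \<omega>)} \<omega> * m \<partial>M)"
      unfolding T_def ind_mult by (simp add: ac_simps)
    also have "\<dots> \<le> (\<integral>\<^sup>+z. f (x + W (fst z) (snd z)) * indicator (?A k) z \<partial>S l)"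
      unfolding eqk by (rule mult_left_mono, rule nn_integral_mono) (auto simp: indicator_def intro: lo[OF on])
    finally show ?thesis .
  qed
  then show "m * (\<integral>\<^sup>+z. indicator {z. \<not> avoids x e n z} z \<partial>S l) \<le> (\<integral>\<^sup>+z. f (x + W (fst z) (snd z)) * indicator {z. \<not> avoids x e n z} z \<partial>S l)"
    unfolding sumf sum1 ennreal_suminf_cmult[symmetric] by (intro suminf_le) auto
  have "(\<integral>\<^sup>+z. f (x + W (fst z) (snd z)) * indicator (?A k) z \<partial>S l) \<le> K * T k" for k
  proof -
    have "(\<integral>\<^sup>+z. f (x + W (fst z) (snd z)) * indicator (?A k) z \<partial>S l)
       \<le> ennreal (exp (- l * (real k * h))) * (\<integral>\<^sup>+\<omega>. indicator {\<omega>. hits x e h k (\<lambda>s. W s \<omega>)} \<omega> * K \<partial>M)"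
      unfolding eqk by (rule mult_left_mono, rule nn_integral_mono) (auto simp: indicator_def intro: hi[OF on])
    also have "\<dots> = K * T k" unfolding T_def ind_mult by (simp add: ac_simps)
    finally show ?thesis .
  qed
  then show "(\<integral>\<^sup>+z. f (x + W (fst z) (snd z)) * indicator {z. \<not> avoids x e n z} z \<partial>S l) \<le> K * (\<integral>\<^sup>+z. indicator {z. \<not> avoids x e n z} z \<partial>S l)"
    unfolding sumf sum1 ennreal_suminf_cmult[symmetric] by (intro suminf_le) auto
qed

text \<open>The dyadic grids are nested, so the events of entering along them increase and the grid
  bounds pass to the supremum.\<close>

lemma hit_bounds:
  assumes [measurable]: "f \<in> borel_measurable borel"
    and lo: "\<And>z. \<bar>z\<bar> < e \<Longrightarrow> m \<le> (\<integral>\<^sup>+\<zeta>. f (z + W (fst \<zeta>) (snd \<zeta>)) \<partial>S l)"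
    and hi: "\<And>z. \<bar>z\<bar> < e \<Longrightarrow> (\<integral>\<^sup>+\<zeta>. f (z + W (fst \<zeta>) (snd \<zeta>)) \<partial>S l) \<le> K"
  shows "m * (\<integral>\<^sup>+z. indicator {z. \<not> avoids_dyadic x e z} z \<partial>S l) \<le> (\<integral>\<^sup>+z. f (x + W (fst z) (snd z)) * indicator {z. \<not> avoids_dyadic x e z} z \<partial>S l)" (is ?A)
    and "(\<integral>\<^sup>+z. f (x + W (fst z) (snd z)) * indicator {z. \<not> avoids_dyadic x e z} z \<partial>S l) \<le> K * (\<integral>\<^sup>+z. indicator {z. \<not> avoids_dyadic x e z} z \<partial>S l)" (is ?B)
proof -
  have avoids_mono: "avoids x e n z" if "n \<le> n'" "avoids x e n' z" for n n' z
    using that by (induction rule: dec_induct) (auto dest: avoids_Suc)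
  have lim: "(\<integral>\<^sup>+z. g z * indicator {z. \<not> avoids_dyadic x e z} z \<partial>S l) = (SUP n. \<integral>\<^sup>+z. g z * indicator {z. \<not> avoids x e n z} z \<partial>S l)"
    if g [measurable]: "g \<in> borel_measurable (borel \<Otimes>\<^sub>M M)" for g
  proof -
    have "g z * indicator {z. \<not> avoids_dyadic x e z} z = (SUP n. g z * indicator {z. \<not> avoids x e n z} z)" for z
    proof (cases "avoids_dyadic x e z")
      case True then show ?thesis by (simp add: avoids_dyadic_def)
    next
      case False
      then obtain n where n: "\<not> avoids x e n z" by (auto simp: avoids_dyadic_def)
      show ?thesis
      proof (rule antisym)
        show "g z * indicator {z. \<not> avoids_dyadic x e z} z \<le> (SUP n. g z * indicator {z. \<not> avoids x e n z} z)"
          by (rule SUP_upper2[of n]) (use n False in auto)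
      qed (use False in \<open>auto intro!: SUP_least split: split_indicator\<close>)
    qed
    then have "(\<integral>\<^sup>+z. g z * indicator {z. \<not> avoids_dyadic x e z} z \<partial>S l) = (\<integral>\<^sup>+z. (SUP n. g z * indicator {z. \<not> avoids x e n z} z) \<partial>S l)" by simp
    also have "\<dots> = (SUP n. \<integral>\<^sup>+z. g z * indicator {z. \<not> avoids x e n z} z \<partial>S l)"
      by (rule nn_integral_monotone_convergence_SUP)
        (auto simp: incseq_def le_fun_def split: split_indicator intro: avoids_mono cong: measurable_cong_sets)
    finally show ?thesis .
  qed
  have L1: "(\<integral>\<^sup>+z. indicator {z. \<not> avoids_dyadic x e z} z \<partial>S l) = (SUP n. \<integral>\<^sup>+z. indicator {z. \<not> avoids x e n z} z \<partial>S l)"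
    using lim[of "\<lambda>_. 1"] by simp
  have Lf: "(\<integral>\<^sup>+z. f (x + W (fst z) (snd z)) * indicator {z. \<not> avoids_dyadic x e z} z \<partial>S l) = (SUP n. \<integral>\<^sup>+z. f (x + W (fst z) (snd z)) * indicator {z. \<not> avoids x e n z} z \<partial>S l)"
    by (rule lim) measurable
  show ?A unfolding L1 Lf SUP_mult_left_ennreal
    by (intro SUP_mono) (use hit_bounds_grid(1)[OF assms] in blast)
  show ?B unfolding L1 Lf SUP_mult_left_ennreal
    by (intro SUP_mono) (use hit_bounds_grid(2)[OF assms] in blast)
qed

end

section \<open>Survival up to the exponential time and the hitting probability\<close>

lemma alive_W_measurable [measurable (raw)]:
  assumes [measurable]: "u \<in> borel_measurable N" "x \<in> borel_measurable N" "g \<in> measurable N M"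
  shows "Measurable.pred N (\<lambda>z. alive (\<lambda>s. x z + W s (g z)) (u z))"
proof -
  have "countable (\<rat> \<inter> {0..1::real})" using countable_rat by (rule countable_subset[rotated]) auto
  then show ?thesis unfolding alive_def by measurable
qed

text \<open>If the path were inside at \<open>r\<close>, it would still be inside at a dyadic time
  slightly later. That time must not exceed the exponential time, whence the strict
  inequality.\<close>

lemma avoids_dyadic_below:
  assumes "avoids_dyadic x e z" "0 \<le> r" "r < fst z"
  shows "e \<le> \<bar>x + W r (snd z)\<bar>"
proof (rule ccontr)
  let ?y = "\<lambda>s. x + W s (snd z)"
  assume "\<not> ?thesis"
  then have "\<bar>?y r\<bar> < e" by simp
  moreover have "((\<lambda>s. \<bar>?y s\<bar>) \<longlongrightarrow> \<bar>?y r\<bar>) (at_right r)"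
    by (intro tendsto_rabs skorokhod_right[OF skorokhod_W])
  ultimately have "\<forall>\<^sub>F s in at_right r. \<bar>?y s\<bar> < e" by (rule order_tendstoD(2)[rotated])
  then obtain b where b: "b > r" "\<And>s. r < s \<Longrightarrow> s < b \<Longrightarrow> \<bar>?y s\<bar> < e"
    unfolding eventually_at_right_field by auto
  define d where "d = min b (fst z) - r"
  have d: "d > 0" using b(1) assms(3) by (simp add: d_def)
  obtain n where n: "(1 / 2) ^ n < d" using real_arch_pow_inv[OF d, of "1 / 2"] by auto
  define j where "j = nat (\<lfloor>2 ^ n * r\<rfloor> + 1)"
  have j: "real j = of_int \<lfloor>2 ^ n * r\<rfloor> + 1" using assms(2) by (simp add: j_def)
  have "2 ^ n * r < of_int \<lfloor>2 ^ n * r\<rfloor> + 1" by linarith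
  then have 1: "r < real j * (1 / 2 ^ n)" unfolding j by (simp add: field_simps)
  have "of_int \<lfloor>2 ^ n * r\<rfloor> \<le> 2 ^ n * r" by linarith
  then have "real j * (1 / 2 ^ n) \<le> (2 ^ n * r + 1) * (1 / 2 ^ n)"
    unfolding j by (intro mult_right_mono) auto
  also have "\<dots> = r + (1 / 2) ^ n" by (simp add: field_simps)
  finally have 2: "real j * (1 / 2 ^ n) < r + d" using n by linarith
  have "e \<le> \<bar>?y (real j * (1 / 2 ^ n))\<bar>"
    using assms(1) 2 by (simp add: avoids_dyadic_def avoids_def d_def)
  moreover have "\<bar>?y (real j * (1 / 2 ^ n))\<bar> < e" using 1 2 by (intro b(2)) (simp_all add: d_def)
  ultimately show False by linarith
qed

lemma alive_imp_avoids:
  assumes "alive (\<lambda>s. x + W s (snd z)) (fst z)" "0 \<le> fst z"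
  shows "\<exists>m::nat. avoids_dyadic x (1 / real (Suc m)) z"
proof -
  obtain e where e: "e > 0" "\<And>s. s \<in> {0..fst z} \<Longrightarrow> e \<le> \<bar>x + W s (snd z)\<bar>"
    using assms alive_iff[OF skorokhod_W, of "fst z" x "snd z"] by auto
  obtain m :: nat where "inverse (real (Suc m)) < e" using reals_Archimedean[OF e(1)] by blast
  then have "1 / real (Suc m) < e" by (simp add: inverse_eq_divide)
  then have "avoids_dyadic x (1 / real (Suc m)) z"
    unfolding avoids_dyadic_def avoids_def using e(2) by (auto intro: order_trans less_imp_le)
  then show ?thesis by blast
qed

text \<open>Avoidance along dyadic times says nothing about the exponential time itself, so the
  position there is assumed nonzero; by \<open>AE_S_nonzero\<close> this holds almost
  surely.\<close>

lemma avoids_imp_alive: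
  assumes "avoids_dyadic x e z" "e > 0" "x + W (fst z) (snd z) \<noteq> 0" "0 \<le> fst z"
  shows "alive (\<lambda>s. x + W s (snd z)) (fst z)"
proof -
  let ?y = "\<lambda>s. x + W s (snd z)"
  have "min e \<bar>?y (fst z)\<bar> \<le> \<bar>?y s\<bar>" if s: "s \<in> {0..fst z}" for s
    using avoids_dyadic_below[OF assms(1), of s] s by (cases "s = fst z") auto
  moreover have "min e \<bar>?y (fst z)\<bar> > 0" using assms by simp
  ultimately show ?thesis using alive_iff[OF skorokhod_W assms(4)] by blast
qed

context
  fixes l :: real assumes l: "l > 0"
begin

lemma AE_S_time_nonneg: "AE z in S l. 0 \<le> fst z"
proof (rule AE_I)
  have "emeasure (S l) {z \<in> space (S l). \<not> 0 \<le> fst z} = (\<integral>\<^sup>+z. indicator {z. \<not> 0 \<le> fst z} z \<partial>S l)"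
    by (rule emeasure_S_Collect) measurable
  also have "\<dots> = (\<integral>\<^sup>+s. ennreal (exponential_density l s) * (\<integral>\<^sup>+\<omega>. indicator {z. \<not> 0 \<le> fst z} (s, \<omega>) \<partial>M) \<partial>lborel)"
    by (rule nn_integral_S[OF l]) measurable
  also have "\<dots> = (\<integral>\<^sup>+s. 0 \<partial>(lborel :: real measure))"
    by (intro nn_integral_cong) (auto simp: exponential_density_def indicator_def)
  finally show "emeasure (S l) {z \<in> space (S l). \<not> 0 \<le> fst z} = 0" by simp
qed auto

lemma AE_S_nonzero: "AE z in S l. x + W (fst z) (snd z) \<noteq> 0"
proof (rule AE_I)
  have "emeasure (S l) {z \<in> space (S l). \<not> x + W (fst z) (snd z) \<noteq> 0} = (\<integral>\<^sup>+z. indicator {0} (x + W (fst z) (snd z)) \<partial>S l)"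
    by (subst emeasure_S_Collect) (auto intro!: nn_integral_cong simp: indicator_def)
  also have "\<dots> = (\<integral>\<^sup>+y. indicator {0} y * ennreal (l * pot_kernel \<alpha> l (y - x)) \<partial>lborel)"
    by (rule resolvent_density[OF l]) measurable
  also have "\<dots> = (\<integral>\<^sup>+y. 0 \<partial>(lborel :: real measure))"
    using AE_lborel_singleton[of 0] by (intro nn_integral_cong_AE) (auto elim!: eventually_mono)
  finally show "emeasure (S l) {z \<in> space (S l). \<not> x + W (fst z) (snd z) \<noteq> 0} = 0" by simp
qed auto

text \<open>The Laplace transform at \<open>l\<close> of the killing time from \<open>x\<close>, as
  the probability that killing precedes the exponential time. \<open>kappa_eps\<close> is its
  analogue for entrance into (-e, e).\<close>

definition kappa :: "real \<Rightarrow> real" where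
  "kappa x = measure (S l) {z \<in> space (S l). \<not> alive (\<lambda>s. x + W s (snd z)) (fst z)}"

definition kappa_eps :: "real \<Rightarrow> real \<Rightarrow> real" where
  "kappa_eps x e = measure (S l) {z \<in> space (S l). \<not> avoids_dyadic x e z}"

lemma kappa_eps_nn: "(\<integral>\<^sup>+z. indicator {z. \<not> avoids_dyadic x e z} z \<partial>S l) = ennreal (kappa_eps x e)"
proof -
  interpret prS: prob_space "S l" by (rule prob_space_S[OF l])
  show ?thesis
    unfolding kappa_eps_def prS.emeasure_eq_measure[symmetric] by (rule emeasure_S_Collect(1)[symmetric]) measurable
qed

lemma AE_alive_lim:
  "AE z in S l. (\<lambda>m. indicator {z. \<not> avoids_dyadic x (1 / real (Suc m)) z} z :: real)
     \<longlonglongrightarrow> indicator {z. \<not> alive (\<lambda>s. x + W s (snd z)) (fst z)} z"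
  using AE_S_time_nonneg AE_S_nonzero[of x]
proof eventually_elim
  case (elim z)
  show ?case
  proof (cases "alive (\<lambda>s. x + W s (snd z)) (fst z)")
    case True
    then obtain m :: nat where m: "avoids_dyadic x (1 / real (Suc m)) z" using alive_imp_avoids elim(1) by blast
    have "\<forall>\<^sub>F n in sequentially. avoids_dyadic x (1 / real (Suc n)) z"
      unfolding eventually_sequentially
      by (intro exI[of _ m] allI impI avoids_dyadic_mono[OF m]) (simp add: field_simps)
    then have "\<forall>\<^sub>F n in sequentially. (indicator {z. \<not> avoids_dyadic x (1 / real (Suc n)) z} z :: real) = 0"
      by eventually_elim simp
    then show ?thesis using True by (simp add: tendsto_eventually)
  next
    case False
    then have "\<not> avoids_dyadic x (1 / real (Suc n)) z" for n
      using avoids_imp_alive[of x "1 / real (Suc n)" z] elim by auto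
    then show ?thesis using False by simp
  qed
qed

lemma kappa_eps_tendsto: "(\<lambda>m. kappa_eps x (1 / real (Suc m))) \<longlonglongrightarrow> kappa x"
proof -
  interpret prS: prob_space "S l" by (rule prob_space_S[OF l])
  have 1: "kappa_eps x e = (\<integral>z. indicator {z. \<not> avoids_dyadic x e z} z \<partial>S l)" for e
    unfolding kappa_eps_def by (rule emeasure_S_Collect(3)) measurable
  have 2: "kappa x = (\<integral>z. indicator {z. \<not> alive (\<lambda>s. x + W s (snd z)) (fst z)} z \<partial>S l)"
    unfolding kappa_def by (rule emeasure_S_Collect(3)) measurable
  show ?thesis
    unfolding 1 2
  proof (rule integral_dominated_convergence[where w = "\<lambda>_. 1"])
    show "(indicator {z. \<not> avoids_dyadic x (1 / real (Suc m)) z} :: _ \<Rightarrow> real) \<in> borel_measurable (S l)" for m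
      using emeasure_S_Collect(4)[of "\<lambda>z. \<not> avoids_dyadic x (1 / real (Suc m)) z"]
      by (simp cong: measurable_cong_sets)
    show "(indicator {z. \<not> alive (\<lambda>s. x + W s (snd z)) (fst z)} :: _ \<Rightarrow> real) \<in> borel_measurable (S l)"
      using emeasure_S_Collect(4)[of "\<lambda>z. \<not> alive (\<lambda>s. x + W s (snd z)) (fst z)"]
      by (simp cong: measurable_cong_sets)
    show "AE z in S l. (\<lambda>m. indicator {z. \<not> avoids_dyadic x (1 / real (Suc m)) z} z :: real)
        \<longlonglongrightarrow> indicator {z. \<not> alive (\<lambda>s. x + W s (snd z)) (fst z)} z"
      by (rule AE_alive_lim)
  qed (auto simp: indicator_def)
qed

text \<open>A path that avoids the interval can be inside only at the exponential time itself. For a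
  given path at most one value of that time is possible, because a later one would require avoidance
  at the earlier; and single points are null for the exponential law.\<close>

lemma resolvent_mass: "(\<integral>\<^sup>+z. f (x + W (fst z) (snd z)) * indicator {z. \<not> avoids_dyadic x e z} z \<partial>S l)
    = (\<integral>\<^sup>+z. f (x + W (fst z) (snd z)) \<partial>S l)"
  if f [measurable]: "f \<in> borel_measurable borel" and f0: "\<And>y. e \<le> \<bar>y\<bar> \<Longrightarrow> f y = 0"
proof (rule nn_integral_cong_AE)
  let ?B = "{z. avoids_dyadic x e z \<and> \<bar>x + W (fst z) (snd z)\<bar> < e \<and> 0 \<le> fst z}"
  have single: "s = s'" if "(s, \<omega>) \<in> ?B" "(s', \<omega>) \<in> ?B" for s s' \<omega>
    using avoids_dyadic_below[of x e "(s, \<omega>)" s'] avoids_dyadic_below[of x e "(s', \<omega>)" s] that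
    by (cases s s' rule: linorder_cases) auto
  have m: "Measurable.pred (borel \<Otimes>\<^sub>M M) (\<lambda>z. z \<in> ?B)" unfolding mem_Collect_eq by measurable
  interpret P: pair_prob_space "density lborel (\<lambda>s. ennreal (exponential_density l s))" M by (rule pair_prob_S[OF l])
  have "emeasure (S l) {z \<in> space (S l). \<not> z \<notin> ?B} = (\<integral>\<^sup>+z. indicator ?B z \<partial>S l)"
    using emeasure_S_Collect(1)[OF m] by (simp only: not_not mem_Collect_eq)
  also have "\<dots> = (\<integral>\<^sup>+\<omega>. (\<integral>\<^sup>+s. indicator ?B (s, \<omega>) \<partial>density lborel (\<lambda>s. ennreal (exponential_density l s))) \<partial>M)"
    unfolding S_def
    by (rule P.nn_integral_snd[symmetric]) (use m in \<open>simp cong: measurable_cong_sets\<close>)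
  also have "\<dots> = (\<integral>\<^sup>+\<omega>. 0 \<partial>M)"
  proof (intro nn_integral_cong)
    fix \<omega> assume "\<omega> \<in> space M"
    have "\<exists>a. \<forall>s. (s, \<omega>) \<in> ?B \<longrightarrow> s = a" using single[of _ \<omega>] by blast
    then obtain a where a: "\<And>s. (s, \<omega>) \<in> ?B \<Longrightarrow> s = a" by blast
    have "AE s in density lborel (\<lambda>s. ennreal (exponential_density l s)). indicator ?B (s, \<omega>) = (0::ennreal)"
      using AE_lborel_singleton[of a]
      by (subst AE_density) (use a in \<open>auto elim!: eventually_mono simp: indicator_def simp del: mem_Collect_eq\<close>)
    then show "(\<integral>\<^sup>+s. indicator ?B (s, \<omega>) \<partial>density lborel (\<lambda>s. ennreal (exponential_density l s))) = 0"
      by (subst nn_integral_cong_AE[of _ "\<lambda>_. 0"]) auto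
  qed
  finally have null: "emeasure (S l) {z \<in> space (S l). \<not> z \<notin> ?B} = 0" by simp
  have "AE z in S l. z \<notin> ?B"
    by (rule AE_I[OF order_refl null]) (use emeasure_S_Collect(2)[OF m] in simp)
  then show "AE z in S l. f (x + W (fst z) (snd z)) * indicator {z. \<not> avoids_dyadic x e z} z = f (x + W (fst z) (snd z))"
    using AE_S_time_nonneg
  proof eventually_elim
    case (elim z)
    then show ?case using f0[of "x + W (fst z) (snd z)"] by (cases "avoids_dyadic x e z") (auto simp: not_less[symmetric])
  qed
qed

lemma nn_integral_ball_bounds:
  assumes e: "e > 0" and g [measurable]: "g \<in> borel_measurable borel"
    and "\<And>y. \<bar>y\<bar> < e \<Longrightarrow> c1 \<le> g y" "\<And>y. \<bar>y\<bar> < e \<Longrightarrow> g y \<le> c2"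
  shows "ennreal (2 * e * (l * c1)) \<le> (\<integral>\<^sup>+y. indicator {-e<..<e} y * ennreal (l * g y) \<partial>lborel)"
    "(\<integral>\<^sup>+y. indicator {-e<..<e} y * ennreal (l * g y) \<partial>lborel) \<le> ennreal (2 * e * (l * c2))"
proof -
  have c: "(\<integral>\<^sup>+y. indicator {-e<..<e} y * ennreal (l * c) \<partial>lborel) = ennreal (2 * e * (l * c))" for c
    using e by (subst nn_integral_multc) (auto simp flip: ennreal_mult')
  show "ennreal (2 * e * (l * c1)) \<le> (\<integral>\<^sup>+y. indicator {-e<..<e} y * ennreal (l * g y) \<partial>lborel)"
    unfolding c[symmetric] using assms l
    by (intro nn_integral_mono) (auto split: split_indicator intro!: ennreal_leI mult_left_mono)
  show "(\<integral>\<^sup>+y. indicator {-e<..<e} y * ennreal (l * g y) \<partial>lborel) \<le> ennreal (2 * e * (l * c2))"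
    unfolding c[symmetric] using assms l
    by (intro nn_integral_mono) (auto split: split_indicator intro!: ennreal_leI mult_left_mono)
qed

lemma pot_kernel_measurable [measurable]: "pot_kernel \<alpha> l \<in> borel_measurable borel"
  using continuous_pot_kernel[OF alpha l] by (rule borel_measurable_continuous_onI)

text \<open>Both sides come from the expected time spent in \<open>(-e, e)\<close>, decomposed at the entrance into that
  interval; the potential is nearly constant there by the Hoelder bound.\<close>

lemma kappa_pot_kernel: "pot_kernel \<alpha> l x = kappa x * pot_kernel \<alpha> l 0"
proof -
  obtain C where C: "C \<ge> 0" "\<And>l x y. l > 0 \<Longrightarrow> \<bar>pot_kernel \<alpha> l x - pot_kernel \<alpha> l y\<bar> \<le> C * \<bar>x - y\<bar> powr (\<alpha> - 1)"
    using pot_kernel_Hoelder[OF alpha] by blast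
  let ?p = "pot_kernel \<alpha> l"
  interpret prS: prob_space "S l" by (rule prob_space_S[OF l])
  have est: "\<bar>?p x - kappa_eps x e * ?p 0\<bar> \<le> 2 * (C * (2 * e) powr (\<alpha> - 1))" if e: "e > 0" for e
  proof -
    \<comment> \<open>The largest change of the kernel over a displacement of 2 e, the diameter of
      (-e, e). It enters twice in the final estimate: for the start at \<open>x\<close> and for the
      start at the entrance position.\<close>
    define d where "d = C * (2 * e) powr (\<alpha> - 1)"
    define a where "a = kappa_eps x e"
    have a: "0 \<le> a" "a \<le> 1" by (auto simp: a_def kappa_eps_def)
    have d: "d \<ge> 0" using C by (simp add: d_def)
    have hold: "\<bar>?p (y - z) - ?p z'\<bar> \<le> d" if "\<bar>y - z - z'\<bar> \<le> 2 * e" for y z z'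
    proof -
      have "\<bar>?p (y - z) - ?p z'\<bar> \<le> C * \<bar>y - z - z'\<bar> powr (\<alpha> - 1)" by (rule C(2)[OF l])
      also have "\<dots> \<le> d" unfolding d_def using C(1) that alpha by (intro mult_left_mono powr_mono2) auto
      finally show ?thesis .
    qed
    let ?f = "\<lambda>y. indicator {-e<..<e} y :: ennreal"
    let ?V = "\<lambda>z. \<integral>\<^sup>+\<zeta>. ?f (z + W (fst \<zeta>) (snd \<zeta>)) \<partial>S l"
    have V: "?V z = (\<integral>\<^sup>+y. ?f y * ennreal (l * ?p (y - z)) \<partial>lborel)" for z
      by (rule resolvent_density[OF l]) measurable
    have bd: "ennreal (2 * e * (l * (?p z' - d))) \<le> ?V z" "?V z \<le> ennreal (2 * e * (l * (?p z' + d)))"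
      if zz: "\<And>y. \<bar>y\<bar> < e \<Longrightarrow> \<bar>y - z - z'\<bar> \<le> 2 * e" for z z'
    proof -
      have "?p z' - d \<le> ?p (y - z)" "?p (y - z) \<le> ?p z' + d" if "\<bar>y\<bar> < e" for y
        using hold[OF zz[OF that]] by (simp_all add: abs_le_iff)
      note b = nn_integral_ball_bounds[OF e _ this]
      show "ennreal (2 * e * (l * (?p z' - d))) \<le> ?V z" "?V z \<le> ennreal (2 * e * (l * (?p z' + d)))"
        unfolding V by (rule b; simp)+
    qed
    have V0: "ennreal (2 * e * (l * (?p 0 - d))) \<le> ?V z" "?V z \<le> ennreal (2 * e * (l * (?p 0 + d)))" if z: "\<bar>z\<bar> < e" for z
      by (rule bd, use z in linarith)+
    have Vx: "ennreal (2 * e * (l * (?p x - d))) \<le> ?V x" "?V x \<le> ennreal (2 * e * (l * (?p x + d)))"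
      using bd[of x "-x"] e by (simp_all add: pot_kernel_minus)
    have mass: "(\<integral>\<^sup>+z. ?f (x + W (fst z) (snd z)) * indicator {z. \<not> avoids_dyadic x e z} z \<partial>S l) = ?V x"
      by (rule resolvent_mass) (auto simp: indicator_def)
    have m: "?f \<in> borel_measurable borel" by measurable
    have pos: "?p 0 + d \<ge> 0" using pot_kernel_nonneg[OF l, of 0] d by simp
    have "ennreal (2 * e * (l * (?p 0 - d))) * (\<integral>\<^sup>+z. indicator {z. \<not> avoids_dyadic x e z} z \<partial>S l)
        \<le> (\<integral>\<^sup>+z. ?f (x + W (fst z) (snd z)) * indicator {z. \<not> avoids_dyadic x e z} z \<partial>S l)"
      by (rule hit_bounds(1)[OF l m V0])
    then have "ennreal (2 * e * (l * (?p 0 - d))) * ennreal a \<le> ?V x"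
      unfolding mass kappa_eps_nn a_def .
    also note Vx(2)
    finally have 1: "(2 * e * (l * (?p 0 - d))) * a \<le> 2 * e * (l * (?p x + d))"
      using a e l pot_kernel_nonneg[OF l, of x] d by (simp add: ennreal_mult''[symmetric] ennreal_le_iff)
    have "(\<integral>\<^sup>+z. ?f (x + W (fst z) (snd z)) * indicator {z. \<not> avoids_dyadic x e z} z \<partial>S l)
        \<le> ennreal (2 * e * (l * (?p 0 + d))) * (\<integral>\<^sup>+z. indicator {z. \<not> avoids_dyadic x e z} z \<partial>S l)"
      by (rule hit_bounds(2)[OF l m V0])
    note Vx(1)
    also have "?V x \<le> ennreal (2 * e * (l * (?p 0 + d))) * ennreal a"
      using \<open>_ \<le> ennreal (2 * e * (l * (?p 0 + d))) * _\<close> unfolding mass kappa_eps_nn a_def .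
    finally have 2: "2 * e * (l * (?p x - d)) \<le> (2 * e * (l * (?p 0 + d))) * a"
      using a e l pos by (simp add: ennreal_mult''[symmetric] ennreal_le_iff)
    have "(2 * e * l) * ((?p 0 - d) * a) \<le> (2 * e * l) * (?p x + d)" "(2 * e * l) * (?p x - d) \<le> (2 * e * l) * ((?p 0 + d) * a)"
      using 1 2 by (simp_all only: ac_simps)
    then have "(?p 0 - d) * a \<le> ?p x + d" "?p x - d \<le> (?p 0 + d) * a"
      using e l by (simp_all only: mult_le_cancel_left_pos mult_pos_pos zero_less_numeral)
    moreover have "d * a \<le> d" using a d by (simp add: mult_left_le)
    ultimately show ?thesis unfolding a_def[symmetric] d_def[symmetric] by (simp add: abs_le_iff algebra_simps)
  qed
  have "(\<lambda>m. \<bar>?p x - kappa_eps x (1 / real (Suc m)) * ?p 0\<bar>) \<longlonglongrightarrow> \<bar>?p x - kappa x * ?p 0\<bar>"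
    by (intro tendsto_intros kappa_eps_tendsto)
  moreover have "(\<lambda>m. 2 * (C * (2 * (1 / real (Suc m))) powr (\<alpha> - 1))) \<longlonglongrightarrow> 2 * (C * (2 * 0) powr (\<alpha> - 1))"
    using alpha LIMSEQ_inverse_real_of_nat
    by (intro tendsto_intros tendsto_powr2) (auto simp: inverse_eq_divide)
  moreover have "\<forall>m\<ge>0. \<bar>?p x - kappa_eps x (1 / real (Suc m)) * ?p 0\<bar> \<le> 2 * (C * (2 * (1 / real (Suc m))) powr (\<alpha> - 1))"
    by (intro allI impI est) simp
  ultimately have "\<bar>?p x - kappa x * ?p 0\<bar> \<le> 2 * (C * (2 * 0) powr (\<alpha> - 1))"
    using LIMSEQ_le by blast
  then show ?thesis by simp
qed

text \<open>First passage decomposition: the full resolvent \<open>v x\<close> is the part before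
  killing plus the part after it, and the latter restarts near 0, contributing
  \<open>kappa x * v 0\<close>. Continuity of \<open>v\<close> at 0 is what allows restarting in
  (-e, e) instead of at 0.\<close>

lemma killed_resolvent_ennreal:
  fixes v :: "real \<Rightarrow> real"
  assumes f [measurable]: "f \<in> borel_measurable borel"
    and V: "\<And>z. (\<integral>\<^sup>+\<zeta>. ennreal (f (z + W (fst \<zeta>) (snd \<zeta>))) \<partial>S l) = ennreal (v z)"
    and v: "\<And>z. 0 \<le> v z" "isCont v 0" and f0: "\<And>y. 0 \<le> f y"
  shows "(\<integral>z. f (x + W (fst z) (snd z)) * indicator {z. alive (\<lambda>s. x + W s (snd z)) (fst z)} z \<partial>S l) = v x - kappa x * v 0"
    (is "(\<integral>z. ?F z * indicator ?alive z \<partial>S l) = _")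
proof -
  interpret prS: prob_space "S l" by (rule prob_space_S[OF l])
  have [measurable]: "(\<lambda>z. f (x + W (fst z) (snd z))) \<in> borel_measurable (borel \<Otimes>\<^sub>M M)" by measurable
  have F: "integrable (S l) ?F" "(\<integral>z. ?F z \<partial>S l) = v x"
    using V[of x] f0 v(1)[of x]
    by (auto intro!: integrableI_nn_integral_finite integral_eq_nn_integral[THEN trans] cong: measurable_cong_sets)
  have ind [measurable]: "(indicator {z. \<not> avoids_dyadic x e z} :: _ \<Rightarrow> real) \<in> borel_measurable (S l)"
    "(indicator ?alive :: _ \<Rightarrow> real) \<in> borel_measurable (S l)"
    "(indicator (- ?alive) :: _ \<Rightarrow> real) \<in> borel_measurable (S l)" for e
    using emeasure_S_Collect(4)[of "\<lambda>z. \<not> avoids_dyadic x e z"]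
      emeasure_S_Collect(4)[of "\<lambda>z. alive (\<lambda>s. x + W s (snd z)) (fst z)"]
      emeasure_S_Collect(4)[of "\<lambda>z. \<not> alive (\<lambda>s. x + W s (snd z)) (fst z)"]
    by (simp_all add: Collect_neg_eq[symmetric] cong: measurable_cong_sets)
  have Fm: "?F \<in> borel_measurable (S l)" using F(1) by simp
  define I where "I e = (\<integral>z. ?F z * indicator {z. \<not> avoids_dyadic x e z} z \<partial>S l)" for e
  have Ie: "ennreal (I e) = (\<integral>\<^sup>+z. ennreal (?F z) * indicator {z. \<not> avoids_dyadic x e z} z \<partial>S l)" for e
  proof -
    have "(\<integral>\<^sup>+z. ennreal (?F z * indicator {z. \<not> avoids_dyadic x e z} z) \<partial>S l) = ennreal (I e)"
      unfolding I_def
      by (rule nn_integral_eq_integral)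
        (use f0 Fm in \<open>auto intro!: Bochner_Integration.integrable_bound[OF F(1)] simp: indicator_def\<close>)
    moreover have "ennreal (?F z * indicator {z. \<not> avoids_dyadic x e z} z) = ennreal (?F z) * indicator {z. \<not> avoids_dyadic x e z} z" for z
      by (simp split: split_indicator)
    ultimately show ?thesis by simp
  qed
  have I0: "0 \<le> I e" for e unfolding I_def using f0 by (intro Bochner_Integration.integral_nonneg) auto
  have limI: "(\<lambda>m. I (1 / real (Suc m))) \<longlonglongrightarrow> (\<integral>z. ?F z * indicator (- ?alive) z \<partial>S l)"
    unfolding I_def
  proof (rule integral_dominated_convergence[where w = ?F])
    show "AE z in S l. (\<lambda>m. ?F z * indicator {z. \<not> avoids_dyadic x (1 / real (Suc m)) z} z) \<longlonglongrightarrow> ?F z * indicator (- ?alive) z"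
      using AE_alive_lim[of x] by eventually_elim (auto intro!: tendsto_mult simp: Collect_neg_eq)
  qed (use F Fm f0 in \<open>auto simp: indicator_def\<close>)
  have "\<bar>(\<integral>z. ?F z * indicator (- ?alive) z \<partial>S l) - kappa x * v 0\<bar> \<le> 0"
  \<comment> \<open>Once (-e, e) is small, \<open>v\<close> at any entrance position is within
    \<delta> of \<open>v 0\<close>, so \<open>hit_bounds\<close> pins the dead part up to \<delta>;
    then e tends to 0.\<close>
  proof (rule field_le_epsilon)
    fix \<delta> :: real assume \<delta>: "\<delta> > 0"
    obtain r where r: "r > 0" "\<And>z. dist z 0 < r \<Longrightarrow> dist (v z) (v 0) < \<delta>"
      using v(2) \<delta> unfolding continuous_at_eps_delta by blast
    obtain m0 :: nat where "inverse (real (Suc m0)) < r" using reals_Archimedean[OF r(1)] by blast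
    then have m0: "1 / real (Suc m0) < r" by (simp add: inverse_eq_divide)
    have "\<bar>I (1 / real (Suc m)) - kappa_eps x (1 / real (Suc m)) * v 0\<bar> \<le> \<delta>" if m: "m \<ge> m0" for m
    proof -
      let ?e = "1 / real (Suc m)"
      have "?e \<le> 1 / real (Suc m0)" using m by (simp add: field_simps)
      then have er: "?e < r" using m0 by (rule le_less_trans)
      define a where "a = kappa_eps x ?e"
      have a: "0 \<le> a" "a \<le> 1" by (auto simp: a_def kappa_eps_def)
      have vz: "v 0 - \<delta> \<le> v z" "v z \<le> v 0 + \<delta>" if "\<bar>z\<bar> < ?e" for z
        using r(2)[of z] less_trans[OF that er] by (auto simp: dist_real_def)
      have lo: "ennreal (v 0 - \<delta>) \<le> (\<integral>\<^sup>+\<zeta>. ennreal (f (z + W (fst \<zeta>) (snd \<zeta>))) \<partial>S l)"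
        and hi: "(\<integral>\<^sup>+\<zeta>. ennreal (f (z + W (fst \<zeta>) (snd \<zeta>))) \<partial>S l) \<le> ennreal (v 0 + \<delta>)" if "\<bar>z\<bar> < ?e" for z
        unfolding V using vz[OF that] by (auto intro: ennreal_leI)
      have mf: "(\<lambda>y. ennreal (f y)) \<in> borel_measurable borel" by measurable
      have "ennreal (v 0 - \<delta>) * ennreal a \<le> ennreal (I ?e)" "ennreal (I ?e) \<le> ennreal (v 0 + \<delta>) * ennreal a"
        using hit_bounds[OF l mf lo hi, of ?e x] unfolding kappa_eps_nn Ie a_def by simp_all
      then have "(v 0 - \<delta>) * a \<le> I ?e" "I ?e \<le> (v 0 + \<delta>) * a"
        using a I0[of ?e] v(1)[of 0] \<delta> by (simp_all add: ennreal_mult''[symmetric] ennreal_le_iff del: ennreal_plus)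
      moreover have "\<delta> * a \<le> \<delta>" using a \<delta> by (simp add: mult_left_le)
      ultimately show ?thesis unfolding a_def[symmetric] by (simp add: abs_le_iff algebra_simps)
    qed
    moreover have "(\<lambda>m. \<bar>I (1 / real (Suc m)) - kappa_eps x (1 / real (Suc m)) * v 0\<bar>) \<longlonglongrightarrow>
        \<bar>(\<integral>z. ?F z * indicator (- ?alive) z \<partial>S l) - kappa x * v 0\<bar>"
      by (intro tendsto_intros limI kappa_eps_tendsto)
    ultimately have "\<bar>(\<integral>z. ?F z * indicator (- ?alive) z \<partial>S l) - kappa x * v 0\<bar> \<le> \<delta>"
      using LIMSEQ_le_const2 by blast
    then show "\<bar>(\<integral>z. ?F z * indicator (- ?alive) z \<partial>S l) - kappa x * v 0\<bar> \<le> 0 + \<delta>" by simp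
  qed
  then have dead: "(\<integral>z. ?F z * indicator (- ?alive) z \<partial>S l) = kappa x * v 0" by simp
  have i: "integrable (S l) (\<lambda>z. ?F z * indicator ?alive z)" "integrable (S l) (\<lambda>z. ?F z * indicator (- ?alive) z)"
    using f0 Fm by (auto intro!: Bochner_Integration.integrable_bound[OF F(1)] simp: indicator_def)
  have "v x = (\<integral>z. ?F z * indicator ?alive z + ?F z * indicator (- ?alive) z \<partial>S l)"
    unfolding F(2)[symmetric] by (intro Bochner_Integration.integral_cong) (auto simp: indicator_def)
  also have "\<dots> = (\<integral>z. ?F z * indicator ?alive z \<partial>S l) + kappa x * v 0"
    by (simp only: Bochner_Integration.integral_add[OF i] dead)
  finally show ?thesis by simp
qed

end

end

subsection \<open>Hitting zero\<close>

text \<open>Detects a jump of size more than \<open>\<delta>\<close> whose left limit is 0. For a fixed cadlag path this happens only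
  for finitely many starting points \<open>z\<close>, so it has probability 0 after a time at which the position has a
  density; hence a left limit 0 forces the path to visit 0.\<close>

definition jump_at_zero :: "real \<Rightarrow> real \<Rightarrow> real \<Rightarrow> (real \<Rightarrow> real) \<Rightarrow> bool" where
  "jump_at_zero \<delta> v z w \<longleftrightarrow> (\<forall>n::nat. \<exists>a\<in>\<rat> \<inter> {0..v}. \<exists>b\<in>\<rat> \<inter> {0..v}.
     a < b \<and> b - a < 1 / real (Suc n) \<and> \<bar>z + w a\<bar> < 1 / real (Suc n) \<and> \<delta> < \<bar>w b - w a\<bar>)"

lemma jump_at_zero_cong:
  assumes "z = z'" "\<And>t. 0 \<le> t \<Longrightarrow> w t = w' t"
  shows "jump_at_zero \<delta> v z w \<longleftrightarrow> jump_at_zero \<delta> v z' w'"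
proof -
  have "w a = w' a" if "a \<in> \<rat> \<inter> {0..v}" for a using that by (intro assms(2)) auto
  then show ?thesis unfolding jump_at_zero_def assms(1) by (intro all_cong1 bex_cong refl) auto
qed

text \<open>The pairs a < b shrink to an accumulation time r. An increment above \<delta> cannot
  occur on one side of r, where the path is nearly constant, so a lies before r and b does not;
  hence the left limit at r is -z and the jump there is at least \<delta>.\<close>

lemma jump_at_zeroD:
  assumes w: "skorokhod w" and d: "\<delta> > 0" and j: "jump_at_zero \<delta> v z w"
  shows "\<exists>r\<in>{0..v}. \<exists>L. (w \<longlongrightarrow> L) (at_left r) \<and> \<delta> \<le> \<bar>w r - L\<bar> \<and> z = - L"
proof -
  obtain a b where ab: "\<And>n. a n \<in> {0..v}" "\<And>n. b n \<in> {0..v}" "\<And>n. a n < b n"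
    "\<And>n. b n - a n < 1 / real (Suc n)" "\<And>n. \<bar>z + w (a n)\<bar> < 1 / real (Suc n)" "\<And>n. \<delta> < \<bar>w (b n) - w (a n)\<bar>"
    using j unfolding jump_at_zero_def by (metis IntD2)
  have "seq_compact {0..v}" by (simp add: compact_imp_seq_compact)
  then obtain r k where r: "r \<in> {0..v}" "strict_mono (k :: nat \<Rightarrow> nat)" "(a \<circ> k) \<longlonglongrightarrow> r"
    using ab(1) by (meson seq_compactE)
  have inv: "(\<lambda>n. 1 / real (Suc (k n))) \<longlonglongrightarrow> 0"
    using LIMSEQ_subseq_LIMSEQ[OF LIMSEQ_inverse_real_of_nat r(2)] by (simp add: o_def inverse_eq_divide)
  have "(\<lambda>n. b (k n) - a (k n)) \<longlonglongrightarrow> 0"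
    by (rule tendsto_sandwich[OF _ _ tendsto_const inv]) (use ab(3,4) in \<open>auto intro!: always_eventually less_imp_le\<close>)
  from tendsto_add[OF this r(3)] have b: "(\<lambda>n. b (k n)) \<longlonglongrightarrow> r" by (simp add: o_def)
  have a: "(\<lambda>n. a (k n)) \<longlonglongrightarrow> r" using r(3) by (simp add: o_def)
  obtain L where L: "(w \<longlongrightarrow> L) (at_left r)" using w by (auto simp: skorokhod_def)
  \<comment> \<open>The error e is incurred at both ends of the pair, hence 2 e. The condition 2 e <
    \<delta> is what excludes both ends lying on the same side of r.\<close>
  have key: "\<bar>z + L\<bar> \<le> 2 * e \<and> \<delta> - 2 * e \<le> \<bar>w r - L\<bar>" if e: "0 < e" "2 * e < \<delta>" for e
  proof -
    have "\<forall>\<^sub>F s in at_left r. dist (w s) L < e" using L e(1) by (rule tendstoD)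
    then obtain c where c: "c < r" "\<And>s. c < s \<Longrightarrow> s < r \<Longrightarrow> dist (w s) L < e"
      unfolding eventually_at_left_field by auto
    have "\<forall>\<^sub>F s in at_right r. dist (w s) (w r) < e" using skorokhod_right[OF w] e(1) by (rule tendstoD)
    then obtain d' where d': "r < d'" "\<And>s. r < s \<Longrightarrow> s < d' \<Longrightarrow> dist (w s) (w r) < e"
      unfolding eventually_at_right_field by auto
    have "\<forall>\<^sub>F n in sequentially. c < a (k n) \<and> a (k n) < d' \<and> c < b (k n) \<and> b (k n) < d' \<and> 1 / real (Suc (k n)) < e"
      using order_tendstoD(1)[OF a c(1)] order_tendstoD(2)[OF a d'(1)] order_tendstoD(1)[OF b c(1)]
        order_tendstoD(2)[OF b d'(1)] order_tendstoD(2)[OF inv e(1)] by eventually_elim auto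
    then obtain n where n: "c < a (k n)" "a (k n) < d'" "c < b (k n)" "b (k n) < d'" "1 / real (Suc (k n)) < e"
      unfolding eventually_sequentially by auto
    let ?a = "a (k n)" and ?b = "b (k n)"
    have left: "\<bar>w s - L\<bar> < e" if "c < s" "s < r" for s using c(2)[OF that] by (simp add: dist_real_def)
    have right: "\<bar>w s - w r\<bar> < e" if "r \<le> s" "s < d'" for s
      using d'(2)[of s] that e(1) by (cases "s = r") (auto simp: dist_real_def)
    have "?a < r"
    proof (rule ccontr)
      assume "\<not> ?a < r"
      then have "\<bar>w ?a - w r\<bar> < e" "\<bar>w ?b - w r\<bar> < e" using right n ab(3)[of "k n"] by auto
      then show False using ab(6)[of "k n"] e(2) by linarith
    qed
    moreover have "r \<le> ?b"
    proof (rule ccontr)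
      assume "\<not> r \<le> ?b"
      then have "\<bar>w ?a - L\<bar> < e" "\<bar>w ?b - L\<bar> < e" using left n ab(3)[of "k n"] by auto
      then show False using ab(6)[of "k n"] e(2) by linarith
    qed
    ultimately have "\<bar>w ?a - L\<bar> < e" "\<bar>w ?b - w r\<bar> < e" using left right n by auto
    moreover have "\<bar>z + w ?a\<bar> < e" using ab(5)[of "k n"] n(5) by (rule less_trans)
    ultimately show ?thesis using ab(6)[of "k n"] by linarith
  qed
  have "\<bar>z + L\<bar> \<le> 0"
  proof (rule field_le_epsilon)
    fix e :: real assume "e > 0"
    define m where "m = min (e / 2) (\<delta> / 4)"
    have "0 < m" "2 * m < \<delta>" "2 * m \<le> e" using \<open>e > 0\<close> d by (auto simp: m_def min_def)
    then show "\<bar>z + L\<bar> \<le> 0 + e" using key[of m] by linarith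
  qed
  moreover have "\<delta> \<le> \<bar>w r - L\<bar>"
  proof (rule field_le_epsilon)
    fix e :: real assume "e > 0"
    define m where "m = min (e / 2) (\<delta> / 4)"
    have "0 < m" "2 * m < \<delta>" "2 * m \<le> e" using \<open>e > 0\<close> d by (auto simp: m_def min_def)
    then show "\<delta> \<le> \<bar>w r - L\<bar> + e" using key[of m] by linarith
  qed
  ultimately show ?thesis using L r(1) by (intro bexI[of _ r] exI[of _ L]) auto
qed

text \<open>Infinitely many large jumps would accumulate at some r. Close to r and on one side of it
  the path is within \<delta> / 4 of a fixed value, which leaves jumps of at most \<delta> /
  2.\<close>

lemma finite_large_jumps:
  assumes w: "skorokhod w" and d: "\<delta> > 0"
  shows "finite {r \<in> {0..v}. \<exists>L. (w \<longlongrightarrow> L) (at_left r) \<and> \<delta> \<le> \<bar>w r - L\<bar>}" (is "finite ?D")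
proof (rule ccontr)
  assume "infinite ?D"
  moreover have "?D \<subseteq> {0..v}" by auto
  moreover have "\<forall>t. infinite t \<and> t \<subseteq> {0..v} \<longrightarrow> (\<exists>x\<in>{0..v}. x islimpt t)"
    by (subst compact_eq_Bolzano_Weierstrass[symmetric]) simp
  ultimately obtain r where r: "r islimpt ?D" by blast
  obtain l where l: "(w \<longlongrightarrow> l) (at_left r)" using w by (auto simp: skorokhod_def)
  have "\<delta> / 4 > 0" using d by simp
  have "\<forall>\<^sub>F s in at_left r. dist (w s) l < \<delta> / 4" using l \<open>\<delta> / 4 > 0\<close> by (rule tendstoD)
  then obtain c where c: "c < r" "\<And>s. c < s \<Longrightarrow> s < r \<Longrightarrow> dist (w s) l < \<delta> / 4"
    unfolding eventually_at_left_field by auto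
  have "\<forall>\<^sub>F s in at_right r. dist (w s) (w r) < \<delta> / 4" using skorokhod_right[OF w] \<open>\<delta> / 4 > 0\<close> by (rule tendstoD)
  then obtain d' where d': "r < d'" "\<And>s. r < s \<Longrightarrow> s < d' \<Longrightarrow> dist (w s) (w r) < \<delta> / 4"
    unfolding eventually_at_right_field by auto
  have "\<exists>s\<in>?D. s \<in> {c<..<d'} \<and> s \<noteq> r"
    by (rule r[unfolded islimpt_def, rule_format]) (use c(1) d'(1) in simp_all)
  then obtain s where s: "s \<in> ?D" "s \<in> {c<..<d'}" "s \<noteq> r" by blast
  obtain L where L: "(w \<longlongrightarrow> L) (at_left s)" "\<delta> \<le> \<bar>w s - L\<bar>" using s(1) by auto
  define m where "m = (if s < r then l else w r)"
  define c' where "c' = (if s < r then c else r)"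
  have cs: "c' < s" using s by (auto simp: c'_def)
  have near: "\<bar>w t - m\<bar> \<le> \<delta> / 4" if "c' < t" "t \<le> s" for t
    using c(2)[of t] d'(2)[of t] s that by (auto simp: m_def c'_def dist_real_def split: if_splits)
  have "\<bar>L - m\<bar> \<le> \<delta> / 4"
  proof (rule tendsto_upperbound)
    show "((\<lambda>t. \<bar>w t - m\<bar>) \<longlongrightarrow> \<bar>L - m\<bar>) (at_left s)" by (intro tendsto_intros L(1))
    show "\<forall>\<^sub>F t in at_left s. \<bar>w t - m\<bar> \<le> \<delta> / 4"
      unfolding eventually_at_left_field using near cs by (intro exI[of _ c']) auto
  qed simp
  moreover have "\<bar>w s - m\<bar> \<le> \<delta> / 4" using near cs by simp
  ultimately show False using L(2) d by linarith
qed

lemma jump_at_zero_null: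
  assumes w: "skorokhod w" and d: "\<delta> > 0"
  shows "finite {z. jump_at_zero \<delta> v z w}"
proof -
  let ?D = "{r \<in> {0..v}. \<exists>L. (w \<longlongrightarrow> L) (at_left r) \<and> \<delta> \<le> \<bar>w r - L\<bar>}"
  have "{z. jump_at_zero \<delta> v z w} \<subseteq> (\<lambda>r. - Lim (at_left r) w) ` ?D"
  proof
    fix z assume "z \<in> {z. jump_at_zero \<delta> v z w}"
    then obtain r L where r: "r \<in> {0..v}" "(w \<longlongrightarrow> L) (at_left r)" "\<delta> \<le> \<bar>w r - L\<bar>" "z = - L"
      using jump_at_zeroD[OF w d] by blast
    moreover have "Lim (at_left r) w = L" using r(2) by (intro tendsto_Lim) simp_all
    ultimately show "z \<in> (\<lambda>r. - Lim (at_left r) w) ` ?D" by (intro image_eqI[of _ _ r]) auto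
  qed
  then show ?thesis using finite_large_jumps[OF w d] by (meson finite_imageI finite_subset)
qed

lemma jump_at_zeroI:
  assumes w: "skorokhod w" and r: "0 < r" "r < v" and lim: "((\<lambda>s. z + w s) \<longlongrightarrow> 0) (at_left r)"
    and d: "\<delta> < \<bar>z + w r\<bar>"
  shows "jump_at_zero \<delta> v z w"
  unfolding jump_at_zero_def
proof
  fix n :: nat
  let ?h = "1 / real (Suc n)"
  have h: "?h > 0" by simp
  \<comment> \<open>Half of the excess of the jump over \<delta>: one half is spent on the deviation
    at a, the other on the deviation at b.\<close>
  define \<eta> where "\<eta> = (\<bar>z + w r\<bar> - \<delta>) / 2"
  have \<eta>: "\<eta> > 0" using d by (simp add: \<eta>_def)
  have "\<forall>\<^sub>F s in at_left r. dist (z + w s) 0 < min ?h \<eta>" using lim by (rule tendstoD) (use \<eta> h in simp)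
  then obtain c where c: "c < r" "\<And>s. c < s \<Longrightarrow> s < r \<Longrightarrow> dist (z + w s) 0 < min ?h \<eta>"
    unfolding eventually_at_left_field by auto
  have "\<forall>\<^sub>F s in at_right r. dist (w s) (w r) < \<eta>" using skorokhod_right[OF w] \<eta> by (rule tendstoD)
  then obtain d' where d': "r < d'" "\<And>s. r < s \<Longrightarrow> s < d' \<Longrightarrow> dist (w s) (w r) < \<eta>"
    unfolding eventually_at_right_field by auto
  have "max (max 0 c) (r - ?h / 2) < r" using r c(1) h by simp
  then obtain a where a: "a \<in> \<rat>" "max (max 0 c) (r - ?h / 2) < a" "a < r" using Rats_dense_in_real by blast
  have "r < min (min v d') (r + ?h / 2)" using r d'(1) h by simp
  then obtain b where b: "b \<in> \<rat>" "r < b" "b < min (min v d') (r + ?h / 2)" using Rats_dense_in_real by blast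
  have "\<bar>z + w a\<bar> < min ?h \<eta>" using c(2)[of a] a by (simp add: dist_real_def)
  then have wa: "\<bar>z + w a\<bar> < ?h" "\<bar>z + w a\<bar> < \<eta>" by (simp_all only: min_less_iff_conj)
  have wb: "\<bar>w b - w r\<bar> < \<eta>" using d'(2)[of b] b by (simp add: dist_real_def)
  have "\<delta> < \<bar>w b - w a\<bar>" using wa(2) wb unfolding \<eta>_def by (simp add: abs_if split: if_splits)
  moreover have "b - a < ?h"
  proof -
    have "b < r + ?h / 2" "r - ?h / 2 < a" using a(2) b(3) by (simp_all only: max_less_iff_conj min_less_iff_conj)
    then have "b - a < (r + ?h / 2) - (r - ?h / 2)" by (rule diff_strict_mono)
    moreover have "(r + h / 2) - (r - h / 2) = h" for h by simp
    ultimately show ?thesis by metis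
  qed
  moreover have "a \<in> \<rat> \<inter> {0..v}" "b \<in> \<rat> \<inter> {0..v}" "a < b" using a b r by auto
  ultimately show "\<exists>a\<in>\<rat> \<inter> {0..v}. \<exists>b\<in>\<rat> \<inter> {0..v}. a < b \<and> b - a < ?h \<and> \<bar>z + w a\<bar> < ?h \<and> \<delta> < \<bar>w b - w a\<bar>"
    using wa(1) by blast
qed

context stable_levy
begin

lemma jump_measurable:
  assumes Z [measurable]: "Z \<in> borel_measurable N" and F: "\<And>t. 0 \<le> t \<Longrightarrow> F t \<in> borel_measurable N"
  shows "Measurable.pred N (\<lambda>p. jump_at_zero \<delta> v (Z p) (\<lambda>t. F t p))"
proof -
  have c: "countable (\<rat> \<inter> {0..v::real})" using countable_rat by (rule countable_subset[rotated]) auto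
  have [measurable]: "F a \<in> borel_measurable N" if "a \<in> \<rat> \<inter> {0..v}" for a using that by (intro F) auto
  show ?thesis
    unfolding jump_at_zero_def pred_def
    by (intro sets.sets_Collect_countable_All sets.sets_Collect_countable_Ex' c) measurable
qed

text \<open>By the Markov property at s the later increments are independent of the position, so
  they can be fixed first. Only finitely many positions are then bad, and averaging s exponentially
  makes the position absolutely continuous.\<close>

lemma jump_null_AE:
  assumes d: "\<delta> > 0"
  shows "AE s in density lborel (\<lambda>s. ennreal (exponential_density 1 s)). AE \<omega> in M. \<not> jump_at_zero \<delta> v (x + W s \<omega>) (\<lambda>t. W (s + t) \<omega> - W s \<omega>)"
proof -
  let ?E = "density lborel (\<lambda>s. ennreal (exponential_density 1 s))"
  let ?J = "\<lambda>s \<omega>. jump_at_zero \<delta> v (x + W s \<omega>) (\<lambda>t. W (s + t) \<omega> - W s \<omega>)"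
  have [measurable]: "Measurable.pred (borel \<Otimes>\<^sub>M M) (\<lambda>z. ?J (fst z) (snd z))"
    by (rule jump_measurable) measurable
  have [measurable]: "Measurable.pred ((borel \<Otimes>\<^sub>M M) \<Otimes>\<^sub>M M) (\<lambda>z. jump_at_zero \<delta> v (x + W (fst (fst z)) (snd (fst z))) (\<lambda>t. W t (snd z)))"
    by (rule jump_measurable) measurable
  have step: "(\<integral>\<^sup>+\<omega>. indicator {\<omega>. ?J s \<omega>} \<omega> \<partial>M) =
      (\<integral>\<^sup>+\<omega>. \<integral>\<^sup>+\<omega>'. indicator {z. jump_at_zero \<delta> v z (\<lambda>t. W t \<omega>')} (x + W s \<omega>) \<partial>M \<partial>M)" if s: "s \<ge> 0" for s
  proof -
    define H where "H p = (indicator {p. jump_at_zero \<delta> v (x + p s) (\<lambda>t. p (s + t) - p s)} p :: ennreal)" for p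
    have comp: "(\<lambda>p. p t) \<in> borel_measurable (PiM {0..} (\<lambda>_. borel))" if "t \<ge> 0" for t :: real
      using that by (intro measurable_component_singleton) auto
    have "Measurable.pred (PiM {0..} (\<lambda>_. borel)) (\<lambda>p. jump_at_zero \<delta> v (x + p s) (\<lambda>t. p (s + t) - p s))"
      by (rule jump_measurable) (use s in \<open>auto intro!: borel_measurable_diff borel_measurable_add comp\<close>)
    then have "H \<in> borel_measurable (PiM {0..} (\<lambda>_. borel))" unfolding H_def by measurable
    from Markov[OF s this] have "(\<integral>\<^sup>+\<omega>. H (\<lambda>s\<in>{0..}. W s \<omega>) \<partial>M) = (\<integral>\<^sup>+\<omega>. \<integral>\<^sup>+\<omega>'. H (\<lambda>t\<in>{0..}. concat s t (\<omega>, \<omega>')) \<partial>M \<partial>M)" .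
    moreover have "H (\<lambda>s\<in>{0..}. W s \<omega>) = indicator {\<omega>. ?J s \<omega>} \<omega>" for \<omega>
      unfolding H_def indicator_def mem_Collect_eq
      by (intro arg_cong[where f = of_bool] jump_at_zero_cong) (use s in simp_all)
    moreover have "H (\<lambda>t\<in>{0..}. concat s t (\<omega>, \<omega>')) = indicator {z. jump_at_zero \<delta> v z (\<lambda>t. W t \<omega>')} (x + W s \<omega>)" for \<omega> \<omega>'
    proof -
      have "concat s (s + t) (\<omega>, \<omega>') - concat s s (\<omega>, \<omega>') = W t \<omega>'" if "t \<ge> 0" for t
        using that by (cases "t = 0") (auto simp: concat_def W_nonpos)
      moreover have "concat s s (\<omega>, \<omega>') = W s \<omega>" by (simp add: concat_def)
      ultimately show ?thesis
        unfolding H_def indicator_def mem_Collect_eq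
        by (intro arg_cong[where f = of_bool] jump_at_zero_cong) (use s in simp_all)
    qed
    ultimately show ?thesis by simp
  qed
  have zero: "(\<integral>\<^sup>+\<zeta>. indicator {z. jump_at_zero \<delta> v z (\<lambda>t. W t \<omega>')} (x + W (fst \<zeta>) (snd \<zeta>)) \<partial>S 1) = 0" for \<omega>'
  proof -
    have fin: "finite {z. jump_at_zero \<delta> v z (\<lambda>t. W t \<omega>')}"
      using jump_at_zero_null[OF _ d] skorokhod_W[of 0 \<omega>'] by simp
    then have "{z. jump_at_zero \<delta> v z (\<lambda>t. W t \<omega>')} \<in> sets borel" by (simp add: sets.countable countable_finite)
    then have "(\<integral>\<^sup>+\<zeta>. indicator {z. jump_at_zero \<delta> v z (\<lambda>t. W t \<omega>')} (x + W (fst \<zeta>) (snd \<zeta>)) \<partial>S 1)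
      = (\<integral>\<^sup>+y. indicator {z. jump_at_zero \<delta> v z (\<lambda>t. W t \<omega>')} y * ennreal (1 * pot_kernel \<alpha> 1 (y - x)) \<partial>lborel)"
      by (intro resolvent_density) simp_all
    also have "\<dots> = (\<integral>\<^sup>+y. 0 \<partial>(lborel :: real measure))"
    proof (rule nn_integral_cong_AE)
      have "AE y in lborel. y \<notin> {z. jump_at_zero \<delta> v z (\<lambda>t. W t \<omega>')}"
        using fin by (intro AE_not_in countable_imp_null_set_lborel countable_finite)
      then show "AE y in lborel. indicator {z. jump_at_zero \<delta> v z (\<lambda>t. W t \<omega>')} y * ennreal (1 * pot_kernel \<alpha> 1 (y - x)) = 0"
        by eventually_elim simp
    qed
    finally show ?thesis by simp
  qed
  have "(\<integral>\<^sup>+s. (\<integral>\<^sup>+\<omega>. indicator {\<omega>. ?J s \<omega>} \<omega> \<partial>M) \<partial>?E)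
     = (\<integral>\<^sup>+s. ennreal (exponential_density 1 s) * (\<integral>\<^sup>+\<omega>. indicator {z. ?J (fst z) (snd z)} (s, \<omega>) \<partial>M) \<partial>lborel)"
  proof (subst nn_integral_density)
    have "indicator {\<omega>. ?J s \<omega>} \<omega> = (indicator {z. ?J (fst z) (snd z)} (s, \<omega>) :: ennreal)" for s \<omega>
      by (simp add: indicator_def)
    then show "(\<lambda>s. \<integral>\<^sup>+\<omega>. indicator {\<omega>. ?J s \<omega>} \<omega> \<partial>M) \<in> borel_measurable lborel"
      "(\<integral>\<^sup>+s. ennreal (exponential_density 1 s) * (\<integral>\<^sup>+\<omega>. indicator {\<omega>. ?J s \<omega>} \<omega> \<partial>M) \<partial>lborel)
       = (\<integral>\<^sup>+s. ennreal (exponential_density 1 s) * (\<integral>\<^sup>+\<omega>. indicator {z. ?J (fst z) (snd z)} (s, \<omega>) \<partial>M) \<partial>lborel)"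
      by simp_all
  qed simp
  also have "\<dots> = (\<integral>\<^sup>+s. ennreal (exponential_density 1 s) * (\<integral>\<^sup>+\<omega>. (\<integral>\<^sup>+\<omega>'. indicator {z. jump_at_zero \<delta> v z (\<lambda>t. W t \<omega>')} (x + W s \<omega>) \<partial>M) \<partial>M) \<partial>lborel)"
  proof (intro nn_integral_cong)
    fix s :: real
    show "ennreal (exponential_density 1 s) * (\<integral>\<^sup>+\<omega>. indicator {z. ?J (fst z) (snd z)} (s, \<omega>) \<partial>M)
      = ennreal (exponential_density 1 s) * (\<integral>\<^sup>+\<omega>. (\<integral>\<^sup>+\<omega>'. indicator {z. jump_at_zero \<delta> v z (\<lambda>t. W t \<omega>')} (x + W s \<omega>) \<partial>M) \<partial>M)"
      using step[of s] by (cases "s < 0") (simp_all add: exponential_density_def indicator_def)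
  qed
  also have "\<dots> = (\<integral>\<^sup>+\<zeta>. (\<integral>\<^sup>+\<omega>'. indicator {z. jump_at_zero \<delta> v (x + W (fst (fst z)) (snd (fst z))) (\<lambda>t. W t (snd z))} (\<zeta>, \<omega>') \<partial>M) \<partial>S 1)"
    by (subst nn_integral_S) (auto simp: indicator_def)
  also have "\<dots> = (\<integral>\<^sup>+\<omega>'. (\<integral>\<^sup>+\<zeta>. indicator {z. jump_at_zero \<delta> v (x + W (fst (fst z)) (snd (fst z))) (\<lambda>t. W t (snd z))} (\<zeta>, \<omega>') \<partial>S 1) \<partial>M)"
  proof (rule pair_sigma_finite.Fubini')
    show "pair_sigma_finite M (S 1)"
      using prob_space_S[of 1] prob_space_axioms by (simp add: pair_sigma_finite_def prob_space_imp_sigma_finite)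
  qed (simp cong: measurable_cong_sets sets_pair_measure_cong)
  also have "\<dots> = (\<integral>\<^sup>+\<omega>'. 0 \<partial>M)"
    using zero by (intro nn_integral_cong) (simp add: indicator_def)
  finally have "(\<integral>\<^sup>+s. (\<integral>\<^sup>+\<omega>. indicator {\<omega>. ?J s \<omega>} \<omega> \<partial>M) \<partial>?E) = 0" by simp
  then have "AE s in ?E. (\<integral>\<^sup>+\<omega>. indicator {\<omega>. ?J s \<omega>} \<omega> \<partial>M) = 0"
    by (subst (asm) nn_integral_0_iff_AE) auto
  then show ?thesis
  proof eventually_elim
    case (elim s)
    have "Measurable.pred M (?J s)" by (rule jump_measurable) measurable
    then have "AE \<omega> in M. indicator {\<omega>. ?J s \<omega>} \<omega> = (0::ennreal)"
      using elim by (subst (asm) nn_integral_0_iff_AE) auto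
    then show ?case by eventually_elim (auto simp: indicator_def split: if_splits)
  qed
qed

text \<open>Almost every s is good for Lebesgue measure on the half-line, as the exponential density
  is positive there, so good times exist arbitrarily close to 0. Each r > 0 lies after one of a
  sequence of such times, and countably many null sets are discarded.\<close>

lemma no_jump_AE:
  "AE \<omega> in M. \<forall>r>0. ((\<lambda>s. x + W s \<omega>) \<longlongrightarrow> 0) (at_left r) \<longrightarrow> x + W r \<omega> = 0"
proof -
  let ?E = "density lborel (\<lambda>s. ennreal (exponential_density 1 s))"
  let ?Good = "\<lambda>s. AE \<omega> in M. \<forall>k m :: nat. \<not> jump_at_zero (1 / real (Suc k)) (real m) (x + W s \<omega>) (\<lambda>t. W (s + t) \<omega> - W s \<omega>)"
  have "AE s in ?E. \<forall>k m :: nat. AE \<omega> in M. \<not> jump_at_zero (1 / real (Suc k)) (real m) (x + W s \<omega>) (\<lambda>t. W (s + t) \<omega> - W s \<omega>)"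
    by (subst AE_all_countable, intro allI, subst AE_all_countable, intro allI jump_null_AE) simp
  then have good: "AE s in ?E. ?Good s" by (simp add: AE_all_countable)
  have "\<exists>s. 0 < s \<and> s < 1 / real (Suc i) \<and> ?Good s" for i :: nat
  proof (rule ccontr)
    let ?h = "1 / real (Suc i)"
    assume "\<not> ?thesis"
    then have "AE s in ?E. s \<notin> {0<..<?h}" using good by (auto elim: eventually_mono)
    then have "AE s in lborel. s \<notin> {0<..<?h}"
      by (subst (asm) AE_density) (auto simp: exponential_density_def elim!: eventually_mono)
    then have "{0<..<?h} \<in> null_sets lborel" by (subst AE_iff_null_sets) auto
    then have "emeasure lborel {0<..<?h} = 0" by auto
    then show False by simp
  qed
  then have "\<forall>i. \<exists>s. 0 < s \<and> s < 1 / real (Suc i) \<and> ?Good s" by (rule allI)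
  from choice[OF this] obtain s where "\<forall>i. 0 < s i \<and> s i < 1 / real (Suc i) \<and> ?Good (s i)" by (elim exE)
  then have s: "\<And>i. 0 < s i" "\<And>i. s i < 1 / real (Suc i)" "\<And>i. ?Good (s i)" by (simp_all only: simp_thms)
  have "AE \<omega> in M. \<forall>i k m :: nat. \<not> jump_at_zero (1 / real (Suc k)) (real m) (x + W (s i) \<omega>) (\<lambda>t. W (s i + t) \<omega> - W (s i) \<omega>)"
    using s(3) by (simp add: AE_all_countable)
  then show ?thesis
  proof eventually_elim
    case (elim \<omega>)
    show ?case
    proof (intro allI impI, rule ccontr)
      fix r :: real assume r: "r > 0" and lim: "((\<lambda>s. x + W s \<omega>) \<longlongrightarrow> 0) (at_left r)" and nz: "x + W r \<omega> \<noteq> 0"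
      obtain i :: nat where "inverse (real (Suc i)) < r" using reals_Archimedean[OF r] by blast
      then have "1 / real (Suc i) < r" by (simp add: inverse_eq_divide)
      then have sr: "s i < r" using s(2)[of i] by (rule less_trans[rotated])
      have "0 < \<bar>x + W r \<omega>\<bar>" using nz by simp
      then obtain k :: nat where "inverse (real (Suc k)) < \<bar>x + W r \<omega>\<bar>" using reals_Archimedean by blast
      then have k: "1 / real (Suc k) < \<bar>x + W r \<omega>\<bar>" by (simp add: inverse_eq_divide)
      obtain m :: nat where m: "r - s i < m" using reals_Archimedean2 by blast
      have sk: "skorokhod (\<lambda>t. W (s i + t) \<omega> - W (s i) \<omega>)"
        using skorokhod_shift[OF skorokhod_W[of "- W (s i) \<omega>" \<omega>], of "s i"] by simp
      have f: "filterlim (\<lambda>t. s i + t) (at_left r) (at_left (r - s i))"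
        by (rule filterlim_at_withinI) (auto intro!: tendsto_eq_intros simp: eventually_at_filter)
      have "((\<lambda>t. x + W (s i + t) \<omega>) \<longlongrightarrow> 0) (at_left (r - s i))"
        using filterlim_compose[OF lim f] .
      then have "jump_at_zero (1 / real (Suc k)) (real m) (x + W (s i) \<omega>) (\<lambda>t. W (s i + t) \<omega> - W (s i) \<omega>)"
        by (intro jump_at_zeroI[OF sk, of "r - s i"]) (use sr m k in simp_all)
      then show False using elim by blast
    qed
  qed
qed

text \<open>Surviving forever has probability at most 1 - kappa for every l, and this equals (u_l(0)
  - u_l(x)) / u_l(0). The numerator is bounded uniformly in l by the Hoelder estimate while the
  denominator becomes arbitrarily large.\<close>

lemma killed_AE: "AE \<omega> in M. \<exists>u\<ge>0. \<not> alive (\<lambda>s. x + W s \<omega>) u"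
proof -
  obtain C where C: "C \<ge> 0" "\<And>l x y. l > 0 \<Longrightarrow> \<bar>pot_kernel \<alpha> l x - pot_kernel \<alpha> l y\<bar> \<le> C * \<bar>x - y\<bar> powr (\<alpha> - 1)"
    using pot_kernel_Hoelder[OF alpha] by blast
  let ?N = "{\<omega> \<in> space M. \<forall>n::nat. alive (\<lambda>s. x + W s \<omega>) (real n)}"
  have N [measurable]: "?N \<in> sets M" by measurable
  have "measure M ?N \<le> \<epsilon>" if \<epsilon>: "\<epsilon> > 0" for \<epsilon>
  proof -
    define D where "D = C * \<bar>x\<bar> powr (\<alpha> - 1)"
    have D: "D \<ge> 0" using C by (simp add: D_def)
    have "\<forall>\<^sub>F l in at_right 0. pot_kernel \<alpha> l 0 \<ge> (D + 1) / \<epsilon> \<and> l > 0"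
      by (intro eventually_conj pot_kernel_0_large alpha eventually_at_right_less)
    from eventually_happens'[OF trivial_limit_at_right_real this]
    obtain l where l: "pot_kernel \<alpha> l 0 \<ge> (D + 1) / \<epsilon>" "l > 0" by blast
    interpret prS: prob_space "S l" by (rule prob_space_S[OF l(2)])
    let ?p = "pot_kernel \<alpha> l"
    have "(D + 1) / \<epsilon> > 0" using D \<epsilon> by simp
    then have p0: "?p 0 > 0" using l(1) by (rule less_le_trans)
    have "kappa l x * ?p 0 = ?p x" by (rule kappa_pot_kernel[OF l(2), symmetric])
    then have "(1 - kappa l x) * ?p 0 = ?p 0 - ?p x" by (simp add: algebra_simps)
    also have "\<dots> \<le> D" using C(2)[OF l(2), of 0 x] by (simp add: D_def abs_le_iff)
    also have "\<dots> \<le> \<epsilon> * ?p 0" using l(1) \<epsilon> by (simp add: divide_le_eq mult.commute)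
    finally have 1: "1 - kappa l x \<le> \<epsilon>" using p0 by simp
    have "emeasure M ?N = (\<integral>\<^sup>+s. ennreal (exponential_density l s) * emeasure M ?N \<partial>lborel)"
    proof -
      have "(\<integral>\<^sup>+s. ennreal (exponential_density l s) \<partial>lborel) = 1"
        using prob_space.emeasure_space_1[OF prob_space_exponential_density[OF l(2)]] by (simp add: emeasure_density)
      then show ?thesis by (simp add: nn_integral_multc)
    qed
    also have "\<dots> \<le> (\<integral>\<^sup>+s. ennreal (exponential_density l s) * (\<integral>\<^sup>+\<omega>. indicator {z. alive (\<lambda>s. x + W s (snd z)) (fst z)} (s, \<omega>) \<partial>M) \<partial>lborel)"
    proof (intro nn_integral_mono)
      fix s :: real
      show "ennreal (exponential_density l s) * emeasure M ?N \<le> ennreal (exponential_density l s) * (\<integral>\<^sup>+\<omega>. indicator {z. alive (\<lambda>s. x + W s (snd z)) (fst z)} (s, \<omega>) \<partial>M)"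
      proof (cases "s < 0")
        case False
        have "alive (\<lambda>s. x + W s \<omega>) s" if \<omega>: "\<omega> \<in> ?N" for \<omega>
        proof -
          obtain n :: nat where n: "s \<le> n" using real_arch_simple by blast
          have "alive (\<lambda>s. x + W s \<omega>) (real n)" using \<omega> by blast
          from alive_mono[OF skorokhod_W this] show ?thesis using n False by simp
        qed
        then have "(\<integral>\<^sup>+\<omega>. indicator ?N \<omega> \<partial>M) \<le> (\<integral>\<^sup>+\<omega>. indicator {z. alive (\<lambda>s. x + W s (snd z)) (fst z)} (s, \<omega>) \<partial>M)"
          by (intro nn_integral_mono) (auto simp: indicator_def)
        then show ?thesis by (intro mult_left_mono) auto
      qed (simp add: exponential_density_def)
    qed
    also have "\<dots> = (\<integral>\<^sup>+z. indicator {z. alive (\<lambda>s. x + W s (snd z)) (fst z)} z \<partial>S l)"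
      by (rule nn_integral_S[OF l(2), symmetric]) measurable
    also have "\<dots> = emeasure (S l) {z \<in> space (S l). alive (\<lambda>s. x + W s (snd z)) (fst z)}"
      by (rule emeasure_S_Collect(1)[symmetric]) measurable
    also have "\<dots> = 1 - kappa l x"
    proof -
      have m: "{z \<in> space (S l). alive (\<lambda>s. x + W s (snd z)) (fst z)} \<in> sets (S l)"
        by (rule emeasure_S_Collect(2)) measurable
      show ?thesis
        using prS.prob_neg[OF m] by (simp add: kappa_def[OF l(2)] prS.emeasure_eq_measure del: space_S)
    qed
    finally have "ennreal (measure M ?N) \<le> ennreal (1 - kappa l x)" by (simp add: emeasure_eq_measure)
    moreover have "0 \<le> 1 - kappa l x" by (simp add: kappa_def[OF l(2)] del: space_S)
    ultimately show ?thesis using 1 by (simp add: ennreal_le_iff)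
  qed
  then have "measure M ?N \<le> 0 + \<epsilon>" if "\<epsilon> > 0" for \<epsilon> using that by simp
  then have "measure M ?N \<le> 0" by (rule field_le_epsilon)
  then have "prob ?N = 0" by (rule antisym) simp
  then have "AE \<omega> in M. \<omega> \<notin> ?N" using N by (simp add: prob_eq_0)
  then show ?thesis using AE_space by eventually_elim (auto intro: of_nat_0_le_iff)
qed

subsection \<open>The Green operator of the process killed at zero\<close>

text \<open>The potential of the stable process killed at 0, in its own time; the time change enters
  later by inserting \<open>rho\<close> into the argument.\<close>

definition green :: "(real \<Rightarrow> ennreal) \<Rightarrow> real \<Rightarrow> ennreal" where
  "green f x = (\<integral>\<^sup>+u. indicator {0..} u *
     (\<integral>\<^sup>+\<omega>. indicator {\<omega>. alive (\<lambda>s. x + W s \<omega>) u} \<omega> * f (x + W u \<omega>) \<partial>M) \<partial>lborel)"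

definition green_kernel :: "real \<Rightarrow> real \<Rightarrow> real \<Rightarrow> real" where
  "green_kernel l x y = pot_kernel \<alpha> l (y - x) - pot_kernel \<alpha> l x * pot_kernel \<alpha> l y / pot_kernel \<alpha> l 0"

lemma pot_kernel_le_0:
  assumes l: "l > 0" shows "pot_kernel \<alpha> l x \<le> pot_kernel \<alpha> l 0"
proof -
  interpret prS: prob_space "S l" by (rule prob_space_S[OF l])
  have "kappa l x \<le> 1" by (simp add: kappa_def[OF l] del: space_S)
  then have "kappa l x * pot_kernel \<alpha> l 0 \<le> 1 * pot_kernel \<alpha> l 0"
    using pot_kernel_nonneg[OF l] by (intro mult_right_mono) auto
  then show ?thesis using kappa_pot_kernel[OF l, of x] by simp
qed

lemma pot_kernel_0_pos:
  assumes l: "l > 0" shows "pot_kernel \<alpha> l 0 > 0"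
proof (rule ccontr)
  assume "\<not> ?thesis"
  then have "pot_kernel \<alpha> l x = 0" for x
    using pot_kernel_nonneg[OF l, of x] pot_kernel_le_0[OF l, of x] by linarith
  then have "(\<integral>\<^sup>+z. 1 \<partial>S l) = 0"
    using resolvent_density[OF l, of "\<lambda>_. 1" 0] by simp
  then show False using prob_space.emeasure_space_1[OF prob_space_S[OF l]] by (simp del: space_S)
qed

text \<open>Single values of u_l may diverge as l tends to 0, so the kernel is regrouped as (u(y -
  x) - u(y)) + (u(0) - u(x)) u(y) / u(0), where the last quotient is at most 1. This gives |x| powr
  (\<alpha> - 1) up to a constant; symmetry gives the same for y, and the smaller bound is at most
  the geometric mean.\<close>

lemma green_kernel_bounds:
  obtains C where "C \<ge> 0"
    "\<And>l x y. l > 0 \<Longrightarrow> green_kernel l x y \<le> C * (\<bar>x\<bar> powr ((\<alpha> - 1) / 2) * \<bar>y\<bar> powr ((\<alpha> - 1) / 2))"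
    "\<And>l x x' y. l > 0 \<Longrightarrow> \<bar>green_kernel l x y - green_kernel l x' y\<bar> \<le> C * \<bar>x - x'\<bar> powr (\<alpha> - 1)"
proof -
  obtain C where C: "C \<ge> 0" "\<And>l x y. l > 0 \<Longrightarrow> \<bar>pot_kernel \<alpha> l x - pot_kernel \<alpha> l y\<bar> \<le> C * \<bar>x - y\<bar> powr (\<alpha> - 1)"
    using pot_kernel_Hoelder[OF alpha] by blast
  show thesis
  proof (rule that[of "2 * C"])
    show "2 * C \<ge> 0" using C by simp
    fix l x y :: real assume l: "l > 0"
    let ?p = "pot_kernel \<alpha> l"
    note p0 = pot_kernel_0_pos[OF l]
    have le: "green_kernel l x y \<le> 2 * (C * \<bar>x\<bar> powr (\<alpha> - 1))" for x y
    proof -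
      have "?p y - ?p x * ?p y / ?p 0 = (?p 0 - ?p x) * (?p y / ?p 0)"
        using p0 by (simp add: field_simps)
      also have "\<dots> \<le> (?p 0 - ?p x) * 1"
        using p0 pot_kernel_le_0[OF l] by (intro mult_left_mono) (auto simp: divide_le_eq)
      also have "\<dots> \<le> C * \<bar>x\<bar> powr (\<alpha> - 1)" using C(2)[OF l, of 0 x] by (simp add: abs_le_iff)
      finally have "?p y - ?p x * ?p y / ?p 0 \<le> C * \<bar>x\<bar> powr (\<alpha> - 1)" .
      moreover have "?p (y - x) - ?p y \<le> C * \<bar>x\<bar> powr (\<alpha> - 1)" using C(2)[OF l, of "y - x" y] by (simp add: abs_le_iff)
      ultimately show ?thesis by (simp add: green_kernel_def)
    qed
    have sym: "green_kernel l x y = green_kernel l y x"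
      using pot_kernel_minus[of \<alpha> l "x - y"] by (simp add: green_kernel_def mult.commute)
    have sq: "(\<bar>z\<bar> powr ((\<alpha> - 1) / 2)) * (\<bar>z\<bar> powr ((\<alpha> - 1) / 2)) = \<bar>z\<bar> powr (\<alpha> - 1)" for z :: real
      by (simp flip: powr_add)
    show "green_kernel l x y \<le> 2 * C * (\<bar>x\<bar> powr ((\<alpha> - 1) / 2) * \<bar>y\<bar> powr ((\<alpha> - 1) / 2))"
    proof (cases "\<bar>x\<bar> \<le> \<bar>y\<bar>")
      case True
      have "green_kernel l x y \<le> 2 * C * (\<bar>x\<bar> powr ((\<alpha> - 1) / 2) * \<bar>x\<bar> powr ((\<alpha> - 1) / 2))"
        using le[of x y] by (simp add: sq)
      also have "\<dots> \<le> 2 * C * (\<bar>x\<bar> powr ((\<alpha> - 1) / 2) * \<bar>y\<bar> powr ((\<alpha> - 1) / 2))"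
        using C(1) True alpha by (intro mult_left_mono powr_mono2) auto
      finally show ?thesis .
    next
      case False
      have "green_kernel l x y \<le> 2 * C * (\<bar>y\<bar> powr ((\<alpha> - 1) / 2) * \<bar>y\<bar> powr ((\<alpha> - 1) / 2))"
        using le[of y x] by (simp add: sq sym)
      also have "\<dots> \<le> 2 * C * (\<bar>x\<bar> powr ((\<alpha> - 1) / 2) * \<bar>y\<bar> powr ((\<alpha> - 1) / 2))"
        using C(1) False alpha by (intro mult_left_mono mult_right_mono powr_mono2) auto
      finally show ?thesis .
    qed
  next
    fix l x x' y :: real assume l: "l > 0"
    let ?p = "pot_kernel \<alpha> l"
    note p0 = pot_kernel_0_pos[OF l]
    have "green_kernel l x y - green_kernel l x' y = (?p (y - x) - ?p (y - x')) - (?p x - ?p x') * (?p y / ?p 0)"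
      using p0 by (simp add: green_kernel_def field_simps)
    also have "\<bar>\<dots>\<bar> \<le> \<bar>?p (y - x) - ?p (y - x')\<bar> + \<bar>?p x - ?p x'\<bar> * \<bar>?p y / ?p 0\<bar>"
      unfolding abs_mult[symmetric] by (rule abs_triangle_ineq4)
    also have "\<dots> \<le> C * \<bar>x - x'\<bar> powr (\<alpha> - 1) + C * \<bar>x - x'\<bar> powr (\<alpha> - 1) * 1"
    proof (intro add_mono mult_mono)
      show "\<bar>?p (y - x) - ?p (y - x')\<bar> \<le> C * \<bar>x - x'\<bar> powr (\<alpha> - 1)"
        using C(2)[OF l, of "y - x" "y - x'"] by (simp add: abs_minus_commute)
      show "\<bar>?p y / ?p 0\<bar> \<le> 1"
        using p0 pot_kernel_le_0[OF l, of y] pot_kernel_nonneg[OF l, of y] by simp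
    qed (use C l in auto)
    finally show "\<bar>green_kernel l x y - green_kernel l x' y\<bar> \<le> 2 * C * \<bar>x - x'\<bar> powr (\<alpha> - 1)" by simp
  qed
qed

text \<open>First passage decomposition with \<open>kappa l x\<close> replaced by u_l(x) / u_l(0).
  The sign of the kernel integral is read off the probabilistic side.\<close>

lemma killed_resolvent_nonneg:
  assumes l: "l > 0" and f: "integrable lborel f" and f0: "\<And>y. 0 \<le> f y"
  shows "(\<integral>\<^sup>+z. ennreal (f (x + W (fst z) (snd z))) * indicator {z. alive (\<lambda>s. x + W s (snd z)) (fst z)} z \<partial>S l)
      = ennreal (l * (\<integral>y. f y * green_kernel l x y \<partial>lborel))"
    and "integrable lborel (\<lambda>y. f y * green_kernel l x y)"
    and "0 \<le> (\<integral>y. f y * green_kernel l x y \<partial>lborel)"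
proof -
  have [measurable]: "f \<in> borel_measurable borel" using f by simp
  note [measurable] = pot_kernel_measurable[OF l]
  let ?p = "pot_kernel \<alpha> l"
  note p0 = pot_kernel_0_pos[OF l]
  have int: "integrable lborel (\<lambda>y. f y * ?p (y - z))" for z
  proof (rule Bochner_Integration.integrable_bound)
    show "integrable lborel (\<lambda>y. f y * ?p 0)" using f by simp
    show "AE y in lborel. norm (f y * ?p (y - z)) \<le> norm (f y * ?p 0)"
      using f0 pot_kernel_nonneg[OF l] pot_kernel_le_0[OF l] by (intro AE_I2) (auto simp: abs_mult intro!: mult_left_mono)
  qed simp
  note int0 = int[of 0, simplified]
  define v where "v z = l * (\<integral>y. f y * ?p (y - z) \<partial>lborel)" for z
  have v0: "0 \<le> v z" for z
    unfolding v_def using l f0 pot_kernel_nonneg[OF l] by (intro mult_nonneg_nonneg Bochner_Integration.integral_nonneg) auto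
  have V: "(\<integral>\<^sup>+\<zeta>. ennreal (f (z + W (fst \<zeta>) (snd \<zeta>))) \<partial>S l) = ennreal (v z)" for z
  proof -
    have "(\<integral>\<^sup>+\<zeta>. ennreal (f (z + W (fst \<zeta>) (snd \<zeta>))) \<partial>S l) = (\<integral>\<^sup>+y. ennreal (f y) * ennreal (l * ?p (y - z)) \<partial>lborel)"
      by (rule resolvent_density[OF l]) measurable
    also have "\<dots> = (\<integral>\<^sup>+y. ennreal (l * (f y * ?p (y - z))) \<partial>lborel)"
      using f0 by (intro nn_integral_cong) (simp add: ennreal_mult'[symmetric] ac_simps)
    also have "\<dots> = ennreal (\<integral>y. l * (f y * ?p (y - z)) \<partial>lborel)"
      using int l f0 pot_kernel_nonneg[OF l] by (intro nn_integral_eq_integral) auto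
    finally show ?thesis by (simp add: v_def)
  qed
  have cont: "isCont v 0"
  proof -
    obtain C where C: "C \<ge> 0" "\<And>l x y. l > 0 \<Longrightarrow> \<bar>pot_kernel \<alpha> l x - pot_kernel \<alpha> l y\<bar> \<le> C * \<bar>x - y\<bar> powr (\<alpha> - 1)"
      using pot_kernel_Hoelder[OF alpha] by blast
    define F where "F = (\<integral>y. f y \<partial>lborel)"
    have est: "\<bar>v z - v 0\<bar> \<le> l * (F * (C * \<bar>z\<bar> powr (\<alpha> - 1)))" for z
    proof -
      have "\<bar>v z - v 0\<bar> = \<bar>l * (\<integral>y. f y * (?p (y - z) - ?p y) \<partial>lborel)\<bar>"
        using int[of z] int0 by (simp add: v_def right_diff_distrib)
      also have "\<dots> \<le> l * (\<integral>y. \<bar>f y * (?p (y - z) - ?p y)\<bar> \<partial>lborel)"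
        using l mult_left_mono[OF integral_abs_bound, of l lborel "\<lambda>y. f y * (?p (y - z) - ?p y)"] by (simp add: abs_mult[of l])
      also have "\<dots> \<le> l * (\<integral>y. f y * (C * \<bar>z\<bar> powr (\<alpha> - 1)) \<partial>lborel)"
      proof (rule mult_left_mono, rule integral_mono_AE', goal_cases)
        case 2
        show ?case
        proof (rule AE_I2)
        fix y
        have "\<bar>?p (y - z) - ?p y\<bar> \<le> C * \<bar>z\<bar> powr (\<alpha> - 1)" using C(2)[OF l, of "y - z" y] by simp
        then show "\<bar>f y * (?p (y - z) - ?p y)\<bar> \<le> f y * (C * \<bar>z\<bar> powr (\<alpha> - 1))"
          using f0[of y] by (simp add: abs_mult mult_left_mono)
        qed
      qed (use f l C f0 in auto)
      finally show ?thesis by (simp add: F_def)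
    qed
    have "((\<lambda>z. l * (F * (C * \<bar>z\<bar> powr (\<alpha> - 1)))) \<longlongrightarrow> l * (F * (C * \<bar>0\<bar> powr (\<alpha> - 1)))) (at 0)"
    proof (intro tendsto_mult tendsto_const)
      show "((\<lambda>z::real. \<bar>z\<bar> powr (\<alpha> - 1)) \<longlongrightarrow> \<bar>0\<bar> powr (\<alpha> - 1)) (at 0)"
        by (rule tendsto_powr2) (use alpha tendsto_rabs[OF tendsto_ident_at, of "0::real"] in auto)
    qed
    then have "((\<lambda>z. l * (F * (C * \<bar>z\<bar> powr (\<alpha> - 1)))) \<longlongrightarrow> 0) (at 0)" by simp
    then have "((\<lambda>z. v z - v 0) \<longlongrightarrow> 0) (at 0)"
      by (rule Lim_null_comparison[rotated]) (use est in \<open>auto intro!: always_eventually\<close>)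
    then show ?thesis by (simp add: isCont_def LIM_zero_iff)
  qed
  show i: "integrable lborel (\<lambda>y. f y * green_kernel l x y)"
  proof -
    have "(\<lambda>y. f y * green_kernel l x y) = (\<lambda>y. f y * ?p (y - x) - f y * ?p y * (?p x / ?p 0))"
      by (simp add: green_kernel_def algebra_simps)
    then show ?thesis using int[of x] int0 by simp
  qed
  have "v x - kappa l x * v 0 = l * (\<integral>y. f y * green_kernel l x y \<partial>lborel)"
  proof -
    have k: "kappa l x = ?p x / ?p 0" using kappa_pot_kernel[OF l, of x] p0 by (simp add: field_simps)
    have "(\<integral>y. f y * green_kernel l x y \<partial>lborel) = (\<integral>y. f y * ?p (y - x) - f y * ?p y * (?p x / ?p 0) \<partial>lborel)"
      by (simp add: green_kernel_def algebra_simps)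
    also have "\<dots> = (\<integral>y. f y * ?p (y - x) \<partial>lborel) - (\<integral>y. f y * ?p y \<partial>lborel) * (?p x / ?p 0)"
      using int[of x] int0 by simp
    finally have J: "(\<integral>y. f y * green_kernel l x y \<partial>lborel) = (\<integral>y. f y * ?p (y - x) \<partial>lborel) - (\<integral>y. f y * ?p y \<partial>lborel) * (?p x / ?p 0)" .
    show ?thesis unfolding v_def k J by (simp add: right_diff_distrib)
  qed
  then have main: "(\<integral>z. f (x + W (fst z) (snd z)) * indicator {z. alive (\<lambda>s. x + W s (snd z)) (fst z)} z \<partial>S l) = l * (\<integral>y. f y * green_kernel l x y \<partial>lborel)"
    (is "(\<integral>z. ?F z \<partial>S l) = _")
    using killed_resolvent_ennreal[OF l _ V v0 cont f0, of x] by simp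
  then have "0 \<le> l * (\<integral>y. f y * green_kernel l x y \<partial>lborel)"
    using f0 by (metis (no_types, lifting) Bochner_Integration.integral_nonneg mult_nonneg_nonneg indicator_pos_le)
  then show "0 \<le> (\<integral>y. f y * green_kernel l x y \<partial>lborel)" using l by (simp add: zero_le_mult_iff)
  have Fm: "?F \<in> borel_measurable (S l)"
    using emeasure_S_Collect(4)[of "\<lambda>z. alive (\<lambda>s. x + W s (snd z)) (fst z)"]
    by (simp cong: measurable_cong_sets)
  have "(\<integral>\<^sup>+z. ennreal (f (x + W (fst z) (snd z))) * indicator {z. alive (\<lambda>s. x + W s (snd z)) (fst z)} z \<partial>S l) = (\<integral>\<^sup>+z. ennreal (?F z) \<partial>S l)"
    by (intro nn_integral_cong) (auto split: split_indicator)
  also have "\<dots> = ennreal (\<integral>z. ?F z \<partial>S l)"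
  proof (rule nn_integral_eq_integral)
    have "(\<integral>\<^sup>+z. ennreal (?F z) \<partial>S l) \<le> (\<integral>\<^sup>+z. ennreal (f (x + W (fst z) (snd z))) \<partial>S l)"
      using f0 by (intro nn_integral_mono) (auto split: split_indicator)
    then have "(\<integral>\<^sup>+z. ennreal (?F z) \<partial>S l) < \<infinity>" using V[of x] by (auto simp: top_unique less_top[symmetric])
    then show "integrable (S l) ?F" using f0 Fm by (intro integrableI_nonneg) auto
  qed (use f0 in auto)
  finally show "(\<integral>\<^sup>+z. ennreal (f (x + W (fst z) (snd z))) * indicator {z. alive (\<lambda>s. x + W s (snd z)) (fst z)} z \<partial>S l)
      = ennreal (l * (\<integral>y. f y * green_kernel l x y \<partial>lborel))"
    by (simp add: main)
qed

text \<open>The factor \<open>l\<close> of the exponential density cancels, leaving the weight exp(-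
  l u), which increases to 1 as l decreases: monotone convergence.\<close>

lemma green_limit:
  assumes f: "integrable lborel f" and f0: "\<And>y. 0 \<le> f y"
  shows "(\<lambda>n. ennreal (\<integral>y. f y * green_kernel (1 / real (Suc n)) x y \<partial>lborel)) \<longlonglongrightarrow> green (\<lambda>y. ennreal (f y)) x"
proof -
  have [measurable]: "f \<in> borel_measurable borel" using f by simp
  let ?E = "\<lambda>u. (\<integral>\<^sup>+\<omega>. indicator {\<omega>. alive (\<lambda>s. x + W s \<omega>) u} \<omega> * ennreal (f (x + W u \<omega>)) \<partial>M)"
  have Em [measurable]: "?E \<in> borel_measurable borel"
  proof -
    have "(\<lambda>(u, \<omega>). indicator {z. alive (\<lambda>s. x + W s (snd z)) (fst z)} (u, \<omega>) * ennreal (f (x + W u \<omega>))) \<in> borel_measurable (borel \<Otimes>\<^sub>M M)"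
      by measurable
    then have "(\<lambda>u. \<integral>\<^sup>+\<omega>. indicator {z. alive (\<lambda>s. x + W s (snd z)) (fst z)} (u, \<omega>) * ennreal (f (x + W u \<omega>)) \<partial>M) \<in> borel_measurable borel"
      by (rule borel_measurable_nn_integral)
    then show ?thesis by (simp add: indicator_def)
  qed
  define l where "l n = 1 / real (Suc n)" for n
  have l: "l n > 0" for n by (simp add: l_def)
  have eq: "ennreal (\<integral>y. f y * green_kernel (l n) x y \<partial>lborel) = (\<integral>\<^sup>+u. ennreal (exp (- l n * u)) * (indicator {0..} u * ?E u) \<partial>lborel)" for n
  proof -
    have "ennreal (l n) * ennreal (\<integral>y. f y * green_kernel (l n) x y \<partial>lborel) =
      (\<integral>\<^sup>+z. ennreal (f (x + W (fst z) (snd z))) * indicator {z. alive (\<lambda>s. x + W s (snd z)) (fst z)} z \<partial>S (l n))"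
      using killed_resolvent_nonneg[OF l f f0] l[of n] by (simp add: ennreal_mult)
    also have "\<dots> = (\<integral>\<^sup>+s. ennreal (exponential_density (l n) s) * ?E s \<partial>lborel)"
    proof -
      have "(\<integral>\<^sup>+\<omega>. ennreal (f (x + W s \<omega>)) * indicator {z. alive (\<lambda>s. x + W s (snd z)) (fst z)} (s, \<omega>) \<partial>M) = ?E s" for s
        by (intro nn_integral_cong) (simp add: indicator_def)
      then show ?thesis by (subst nn_integral_S[OF l]) simp_all
    qed
    also have "\<dots> = (\<integral>\<^sup>+u. ennreal (l n) * (ennreal (exp (- l n * u)) * (indicator {0..} u * ?E u)) \<partial>lborel)"
    proof (intro nn_integral_cong)
      fix u :: real
      show "ennreal (exponential_density (l n) u) * ?E u = ennreal (l n) * (ennreal (exp (- l n * u)) * (indicator {0..} u * ?E u))"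
        using l[of n] by (cases "u < 0") (auto simp: exponential_density_def ennreal_mult mult.assoc mult.commute[of u])
    qed
    also have "\<dots> = ennreal (l n) * (\<integral>\<^sup>+u. ennreal (exp (- l n * u)) * (indicator {0..} u * ?E u) \<partial>lborel)"
      by (rule nn_integral_cmult) measurable
    finally show ?thesis using l[of n] by (simp add: ennreal_mult_cancel_left)
  qed
  have "(\<lambda>n. \<integral>\<^sup>+u. ennreal (exp (- l n * u)) * (indicator {0..} u * ?E u) \<partial>lborel) \<longlonglongrightarrow> (\<integral>\<^sup>+u. indicator {0..} u * ?E u \<partial>lborel)"
  proof (rule nn_integral_LIMSEQ)
    show "incseq (\<lambda>n u. ennreal (exp (- l n * u)) * (indicator {0..} u * ?E u))"
    proof (intro incseq_SucI le_funI)
      fix n u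
      show "ennreal (exp (- l n * u)) * (indicator {0..} u * ?E u) \<le> ennreal (exp (- l (Suc n) * u)) * (indicator {0..} u * ?E u)"
      proof (cases "u \<ge> 0")
        case True
        have "l (Suc n) \<le> l n" by (simp add: l_def field_simps)
        then show ?thesis using True by (intro mult_right_mono ennreal_leI) (auto intro: mult_right_mono)
      qed simp
    qed
    fix u :: real
    have "l \<longlonglongrightarrow> 0" unfolding l_def using LIMSEQ_inverse_real_of_nat by (simp add: inverse_eq_divide)
    then have "(\<lambda>n. ennreal (exp (- l n * u))) \<longlonglongrightarrow> ennreal (exp (- 0 * u))"
      by (intro tendsto_ennrealI tendsto_intros)
    then show "(\<lambda>n. ennreal (exp (- l n * u)) * (indicator {0..} u * ?E u)) \<longlonglongrightarrow> indicator {0..} u * ?E u"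
      using tendsto_mult_ennreal[of _ 1 _ "\<lambda>_. indicator {0..} u * ?E u" "indicator {0..} u * ?E u"] by (force intro: tendsto_const)
  qed measurable
  then have "(\<lambda>n. ennreal (\<integral>y. f y * green_kernel (l n) x y \<partial>lborel)) \<longlonglongrightarrow> (\<integral>\<^sup>+u. indicator {0..} u * ?E u \<partial>lborel)"
    unfolding eq .
  then show ?thesis unfolding green_def l_def .
qed

text \<open>Kernel bounds uniform in l survive the limit. The first shows finiteness, which gives
  \<open>enn2real\<close> its meaning; the second is stated for a pair f, g because
  \<open>green\<close> takes nonnegative functions and a signed one has to be written as a
  difference.\<close>

lemma green_bounds:
  obtains C where "C \<ge> 0"
    "\<And>f x. integrable lborel f \<Longrightarrow> (\<And>y. 0 \<le> f y) \<Longrightarrow> integrable lborel (\<lambda>y. f y * \<bar>y\<bar> powr ((\<alpha> - 1) / 2)) \<Longrightarrow>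
       green (\<lambda>y. ennreal (f y)) x \<le> ennreal (C * \<bar>x\<bar> powr ((\<alpha> - 1) / 2) * (\<integral>y. f y * \<bar>y\<bar> powr ((\<alpha> - 1) / 2) \<partial>lborel))"
    "\<And>f g x x'. integrable lborel f \<Longrightarrow> (\<And>y. 0 \<le> f y) \<Longrightarrow> integrable lborel (\<lambda>y. f y * \<bar>y\<bar> powr ((\<alpha> - 1) / 2)) \<Longrightarrow>
       integrable lborel g \<Longrightarrow> (\<And>y. 0 \<le> g y) \<Longrightarrow> integrable lborel (\<lambda>y. g y * \<bar>y\<bar> powr ((\<alpha> - 1) / 2)) \<Longrightarrow>
       \<bar>(enn2real (green (\<lambda>y. ennreal (f y)) x) - enn2real (green (\<lambda>y. ennreal (g y)) x)) -
         (enn2real (green (\<lambda>y. ennreal (f y)) x') - enn2real (green (\<lambda>y. ennreal (g y)) x'))\<bar>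
       \<le> C * \<bar>x - x'\<bar> powr (\<alpha> - 1) * (\<integral>y. \<bar>f y - g y\<bar> \<partial>lborel)"
proof -
  obtain C where C: "C \<ge> 0"
    "\<And>l x y. l > 0 \<Longrightarrow> green_kernel l x y \<le> C * (\<bar>x\<bar> powr ((\<alpha> - 1) / 2) * \<bar>y\<bar> powr ((\<alpha> - 1) / 2))"
    "\<And>l x x' y. l > 0 \<Longrightarrow> \<bar>green_kernel l x y - green_kernel l x' y\<bar> \<le> C * \<bar>x - x'\<bar> powr (\<alpha> - 1)"
    using green_kernel_bounds by blast
  have l: "1 / real (Suc n) > 0" for n by simp
  have 1: "green (\<lambda>y. ennreal (f y)) x \<le> ennreal (C * \<bar>x\<bar> powr ((\<alpha> - 1) / 2) * (\<integral>y. f y * \<bar>y\<bar> powr ((\<alpha> - 1) / 2) \<partial>lborel))"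
    if f: "integrable lborel f" "\<And>y. 0 \<le> f y" "integrable lborel (\<lambda>y. f y * \<bar>y\<bar> powr ((\<alpha> - 1) / 2))" for f x
  proof (rule LIMSEQ_le_const2[OF green_limit[OF f(1,2)]])
    have "(\<integral>y. f y * green_kernel (1 / real (Suc n)) x y \<partial>lborel) \<le> (\<integral>y. C * \<bar>x\<bar> powr ((\<alpha> - 1) / 2) * (f y * \<bar>y\<bar> powr ((\<alpha> - 1) / 2)) \<partial>lborel)" for n
    proof (rule integral_mono)
      fix y
      show "f y * green_kernel (1 / real (Suc n)) x y \<le> C * \<bar>x\<bar> powr ((\<alpha> - 1) / 2) * (f y * \<bar>y\<bar> powr ((\<alpha> - 1) / 2))"
        using mult_left_mono[OF C(2)[OF l[of n], of x y] f(2)[of y]] by (simp add: ac_simps)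
    qed (use killed_resolvent_nonneg(2)[OF l[of n] f(1,2)] f(3) in auto)
    then show "\<exists>N. \<forall>n\<ge>N. ennreal (\<integral>y. f y * green_kernel (1 / real (Suc n)) x y \<partial>lborel) \<le> ennreal (C * \<bar>x\<bar> powr ((\<alpha> - 1) / 2) * (\<integral>y. f y * \<bar>y\<bar> powr ((\<alpha> - 1) / 2) \<partial>lborel))"
      by (auto intro: ennreal_leI)
  qed
  have lim: "(\<lambda>n. \<integral>y. f y * green_kernel (1 / real (Suc n)) x y \<partial>lborel) \<longlonglongrightarrow> enn2real (green (\<lambda>y. ennreal (f y)) x)"
    if f: "integrable lborel f" "\<And>y. 0 \<le> f y" "integrable lborel (\<lambda>y. f y * \<bar>y\<bar> powr ((\<alpha> - 1) / 2))" for f x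
  proof -
    have "green (\<lambda>y. ennreal (f y)) x \<noteq> \<top>" using 1[OF f, of x] by (auto simp: top_unique)
    then have "green (\<lambda>y. ennreal (f y)) x = ennreal (enn2real (green (\<lambda>y. ennreal (f y)) x))"
      by (simp add: less_top)
    then have "(\<lambda>n. ennreal (\<integral>y. f y * green_kernel (1 / real (Suc n)) x y \<partial>lborel)) \<longlonglongrightarrow> ennreal (enn2real (green (\<lambda>y. ennreal (f y)) x))"
      using green_limit[OF f(1,2), of x] by metis
    then show ?thesis
      by (rule tendsto_ennrealD) (use killed_resolvent_nonneg(3)[OF l f(1,2)] in \<open>auto intro!: always_eventually\<close>)
  qed
  show thesis
  proof (rule that[OF C(1) 1])
    fix f g x x'
    assume f: "integrable lborel f" "\<And>y. 0 \<le> f y" "integrable lborel (\<lambda>y. f y * \<bar>y\<bar> powr ((\<alpha> - 1) / 2))"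
      and g: "integrable lborel g" "\<And>y. 0 \<le> g y" "integrable lborel (\<lambda>y. g y * \<bar>y\<bar> powr ((\<alpha> - 1) / 2))"
    let ?I = "\<lambda>h x n. \<integral>y. h y * green_kernel (1 / real (Suc n)) x y \<partial>lborel"
    have "\<bar>(?I f x n - ?I g x n) - (?I f x' n - ?I g x' n)\<bar> \<le> C * \<bar>x - x'\<bar> powr (\<alpha> - 1) * (\<integral>y. \<bar>f y - g y\<bar> \<partial>lborel)" for n
    proof -
      let ?k = "green_kernel (1 / real (Suc n))"
      note i = killed_resolvent_nonneg(2)[OF l[of n] f(1,2)] killed_resolvent_nonneg(2)[OF l[of n] g(1,2)]
      have "(?I f x n - ?I g x n) - (?I f x' n - ?I g x' n) = (\<integral>y. (f y * ?k x y - g y * ?k x y) - (f y * ?k x' y - g y * ?k x' y) \<partial>lborel)"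
        using i by simp
      also have "\<dots> = (\<integral>y. (f y - g y) * (?k x y - ?k x' y) \<partial>lborel)"
        by (intro Bochner_Integration.integral_cong) (auto simp: algebra_simps)
      finally have "\<bar>(?I f x n - ?I g x n) - (?I f x' n - ?I g x' n)\<bar> = \<bar>\<integral>y. (f y - g y) * (?k x y - ?k x' y) \<partial>lborel\<bar>"
        by (rule arg_cong)
      also have "\<dots> \<le> (\<integral>y. \<bar>(f y - g y) * (?k x y - ?k x' y)\<bar> \<partial>lborel)" by (rule integral_abs_bound)
      also have "\<dots> \<le> (\<integral>y. (C * \<bar>x - x'\<bar> powr (\<alpha> - 1)) * \<bar>f y - g y\<bar> \<partial>lborel)"
      proof (rule integral_mono_AE')
        show "AE y in lborel. \<bar>(f y - g y) * (?k x y - ?k x' y)\<bar> \<le> (C * \<bar>x - x'\<bar> powr (\<alpha> - 1)) * \<bar>f y - g y\<bar>"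
        proof (rule AE_I2)
          fix y
          show "\<bar>(f y - g y) * (?k x y - ?k x' y)\<bar> \<le> (C * \<bar>x - x'\<bar> powr (\<alpha> - 1)) * \<bar>f y - g y\<bar>"
            using mult_right_mono[OF C(3)[OF l[of n], of x y x'] abs_ge_zero[of "f y - g y"]] by (simp add: abs_mult mult.commute)
        qed
      qed (use f g C in auto)
      finally show ?thesis by simp
    qed
    moreover have "(\<lambda>n. \<bar>(?I f x n - ?I g x n) - (?I f x' n - ?I g x' n)\<bar>) \<longlonglongrightarrow>
      \<bar>(enn2real (green (\<lambda>y. ennreal (f y)) x) - enn2real (green (\<lambda>y. ennreal (g y)) x)) -
         (enn2real (green (\<lambda>y. ennreal (f y)) x') - enn2real (green (\<lambda>y. ennreal (g y)) x'))\<bar>"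
      by (intro tendsto_intros lim f g)
    ultimately show "\<bar>(enn2real (green (\<lambda>y. ennreal (f y)) x) - enn2real (green (\<lambda>y. ennreal (g y)) x)) -
         (enn2real (green (\<lambda>y. ennreal (f y)) x') - enn2real (green (\<lambda>y. ennreal (g y)) x'))\<bar>
       \<le> C * \<bar>x - x'\<bar> powr (\<alpha> - 1) * (\<integral>y. \<bar>f y - g y\<bar> \<partial>lborel)"
      using LIMSEQ_le_const2 by blast
  qed
qed

end

subsection \<open>Occupation times and symmetry of the killed semigroup\<close>

locale stable_clock = stable_levy M W \<alpha> + time_change \<sigma> \<alpha>
  for M :: "'a measure" and W :: "real \<Rightarrow> 'a \<Rightarrow> real" and \<alpha> :: real and \<sigma> :: "real \<Rightarrow> real"
begin

abbreviation pth :: "real \<Rightarrow> 'a \<Rightarrow> real \<Rightarrow> real" where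
  "pth x \<omega> \<equiv> (\<lambda>s. x + W s \<omega>)"

lemma clk_joint_measurable [measurable (raw)]:
  assumes [measurable]: "u \<in> borel_measurable N" "x \<in> borel_measurable N" "g \<in> measurable N M"
  shows "(\<lambda>z. clk (pth (x z) (g z)) (u z)) \<in> borel_measurable N"
proof -
  have "clk (pth (x z) (g z)) (u z) = (\<integral>s. of_bool (0 \<le> s \<and> s \<le> u z) * rho (x z + W s (g z)) \<partial>lborel)" for z
    unfolding clk_eq set_lebesgue_integral_def by (intro Bochner_Integration.integral_cong) (auto simp: indicator_def)
  then show ?thesis by simp
qed

text \<open>The clock is strictly increasing, so its inverse is below a exactly if the clock exceeds
  t at some rational time below a. On the event that the clock never exceeds t the value is the
  constant \<open>Inf {}\<close>.\<close>

lemma icl_joint_measurable [measurable (raw)]: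
  assumes [measurable]: "t \<in> borel_measurable N" "x \<in> borel_measurable N" "g \<in> measurable N M"
  shows "(\<lambda>z. icl (pth (x z) (g z)) (t z)) \<in> borel_measurable N"
proof (rule borel_measurableI_less)
  fix a :: real
  have c: "countable (\<rat> \<inter> {0<..<a})" using countable_rat by (rule countable_subset[rotated]) auto
  have eq: "icl (pth (x z) (g z)) (t z) < a \<longleftrightarrow>
     (if \<exists>n::nat. t z < clk (pth (x z) (g z)) (real n) then \<exists>q\<in>\<rat> \<inter> {0<..<a}. t z < clk (pth (x z) (g z)) q else Inf {} < a)" for z
  proof -
    let ?w = "pth (x z) (g z)"
    let ?S = "{s. 0 < s \<and> t z < clk ?w s}"
    have nth: "\<exists>n::nat. t z < clk ?w (real n)" if s: "s \<in> ?S" for s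
    proof -
      obtain n :: nat where "s \<le> n" using real_arch_simple by blast
      then have "clk ?w s \<le> clk ?w n" using s by (intro clk_mono[OF skorokhod_W]) auto
      then show ?thesis using s by (intro exI[of _ n]) simp
    qed
    show ?thesis
    proof (cases "\<exists>n::nat. t z < clk ?w (real n)")
      case True
      then obtain n :: nat where n: "t z < clk ?w (real n)" by blast
      have "clk ?w (real n) < clk ?w (real (Suc n))" by (intro clk_strict_mono[OF skorokhod_W]) auto
      then have "real (Suc n) \<in> ?S" using n by simp
      then have ne: "?S \<noteq> {}" by blast
      have bdd: "bdd_below ?S" by (intro bdd_belowI[of _ 0]) auto
      have "Inf ?S < a \<longleftrightarrow> (\<exists>s\<in>?S. s < a)" using ne bdd by (rule cInf_less_iff)
      also have "\<dots> \<longleftrightarrow> (\<exists>q\<in>\<rat> \<inter> {0<..<a}. t z < clk ?w q)"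
      proof
        assume "\<exists>s\<in>?S. s < a"
        then obtain s where s: "0 < s" "t z < clk ?w s" "s < a" by blast
        obtain q where q: "q \<in> \<rat>" "s < q" "q < a" using Rats_dense_in_real[OF s(3)] by blast
        have "clk ?w s < clk ?w q" using s q by (intro clk_strict_mono[OF skorokhod_W]) auto
        then have "t z < clk ?w q" using s(2) by simp
        then show "\<exists>q\<in>\<rat> \<inter> {0<..<a}. t z < clk ?w q" using q s(1) by (intro bexI[of _ q]) auto
      qed auto
      finally show ?thesis using True by (simp add: inverse_clock_eq)
    next
      case False
      then have S: "?S = {}" using nth by blast
      show ?thesis unfolding inverse_clock_eq S using False by simp
    qed
  qed
  have p: "Measurable.pred N (\<lambda>z. \<exists>q\<in>\<rat> \<inter> {0<..<a}. t z < clk (pth (x z) (g z)) q)"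
    unfolding pred_def by (intro sets.sets_Collect_countable_Ex' c) measurable
  show "{z \<in> space N. icl (pth (x z) (g z)) (t z) < a} \<in> sets N"
    unfolding eq using p by measurable
qed

lemma alive_tc_joint_measurable [measurable (raw)]:
  assumes [measurable]: "t \<in> borel_measurable N" "x \<in> borel_measurable N" "g \<in> measurable N M"
  shows "Measurable.pred N (\<lambda>z. alive_tc (pth (x z) (g z)) (t z))"
  unfolding alive_tc_def by measurable

lemma tc_joint_measurable [measurable (raw)]:
  assumes [measurable]: "t \<in> borel_measurable N" "x \<in> borel_measurable N" "g \<in> measurable N M"
  shows "(\<lambda>z. tc (pth (x z) (g z)) (t z)) \<in> borel_measurable N"
  unfolding time_changed_def by measurable

text \<open>The killed semigroup of the time-changed process on nonnegative functions, in the form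
  suited to Fubini; \<open>PT\<close> is the real-valued version.\<close>

definition Pn :: "real \<Rightarrow> (real \<Rightarrow> ennreal) \<Rightarrow> real \<Rightarrow> ennreal" where
  "Pn t k x = (\<integral>\<^sup>+\<omega>. indicator {\<omega>. alive_tc (pth x \<omega>) t} \<omega> * k (tc (pth x \<omega>) t) \<partial>M)"

lemma indicator_Collect_measurable [measurable (raw)]:
  assumes "Measurable.pred N (\<lambda>z. P z (g z))"
  shows "(\<lambda>z. indicator {\<omega>. P z \<omega>} (g z) :: ennreal) \<in> borel_measurable N"
proof -
  have "(\<lambda>z. indicator {\<omega>. P z \<omega>} (g z) :: ennreal) = indicator {z. P z (g z)}" by (auto simp: indicator_def)
  then show ?thesis using assms by (simp add: borel_measurable_indicator')
qed

lemma Pn_measurable [measurable (raw)]: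
  assumes [measurable]: "k \<in> borel_measurable borel" "t \<in> borel_measurable N" "x \<in> borel_measurable N"
  shows "(\<lambda>z. Pn (t z) k (x z)) \<in> borel_measurable N"
  unfolding Pn_def by measurable

text \<open>Substituting the clock turns an integral over the time of the time-changed process into one
  over the original time.\<close>

lemma occupation:
  assumes [measurable]: "h \<in> borel_measurable borel" "k \<in> borel_measurable borel"
  shows "(\<integral>\<^sup>+t. indicator {0..} t * (h t * Pn t k x) \<partial>lborel) =
    (\<integral>\<^sup>+u. indicator {0..} u * (\<integral>\<^sup>+\<omega>. indicator {\<omega>. alive (pth x \<omega>) u} \<omega> * h (clk (pth x \<omega>) u) *
        (k (x + W u \<omega>) * ennreal (rho (x + W u \<omega>))) \<partial>M) \<partial>lborel)"
proof -
  interpret P: pair_sigma_finite lborel M by unfold_locales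
  let ?h = "\<lambda>\<omega> t. h t * (indicator {\<omega>. alive_tc (pth x \<omega>) t} \<omega> * k (tc (pth x \<omega>) t))"
  have "(\<integral>\<^sup>+t. indicator {0..} t * (h t * Pn t k x) \<partial>lborel) = (\<integral>\<^sup>+t. \<integral>\<^sup>+\<omega>. indicator {0..} t * ?h \<omega> t \<partial>M \<partial>lborel)"
    unfolding Pn_def by (simp add: nn_integral_cmult)
  also have "\<dots> = (\<integral>\<^sup>+\<omega>. \<integral>\<^sup>+t. indicator {0..} t * ?h \<omega> t \<partial>lborel \<partial>M)"
    by (rule P.Fubini'[symmetric]) measurable
  also have "\<dots> = (\<integral>\<^sup>+\<omega>. \<integral>\<^sup>+u. indicator {0..} u * (?h \<omega> (clk (pth x \<omega>) u) * ennreal (rho (x + W u \<omega>))) \<partial>lborel \<partial>M)"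
  proof (rule nn_integral_cong)
    fix \<omega> assume [measurable]: "\<omega> \<in> space M"
    have "(\<integral>\<^sup>+t. indicator {0..} t * ?h \<omega> t \<partial>lborel) =
        (\<integral>\<^sup>+t. indicator {t. 0 \<le> t \<and> (\<exists>n::nat. t < clk (pth x \<omega>) n)} t * ?h \<omega> t \<partial>lborel)"
      by (intro nn_integral_cong) (auto simp: indicator_def alive_tc_def)
    also have "\<dots> = (\<integral>\<^sup>+u. indicator {0..} u * (?h \<omega> (clk (pth x \<omega>) u) * ennreal (rho (x + W u \<omega>))) \<partial>lborel)"
      by (rule clk_substitution[OF skorokhod_W, symmetric]) measurable
    finally show "(\<integral>\<^sup>+t. indicator {0..} t * ?h \<omega> t \<partial>lborel) = (\<integral>\<^sup>+u. indicator {0..} u * (?h \<omega> (clk (pth x \<omega>) u) * ennreal (rho (x + W u \<omega>))) \<partial>lborel)" .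
  qed
  also have "\<dots> = (\<integral>\<^sup>+u. \<integral>\<^sup>+\<omega>. indicator {0..} u * (?h \<omega> (clk (pth x \<omega>) u) * ennreal (rho (x + W u \<omega>))) \<partial>M \<partial>lborel)"
    by (rule P.Fubini') measurable
  also have "\<dots> = (\<integral>\<^sup>+u. indicator {0..} u * (\<integral>\<^sup>+\<omega>. indicator {\<omega>. alive (pth x \<omega>) u} \<omega> * h (clk (pth x \<omega>) u) *
        (k (x + W u \<omega>) * ennreal (rho (x + W u \<omega>))) \<partial>M) \<partial>lborel)"
  proof (rule nn_integral_cong)
    fix u :: real
    show "(\<integral>\<^sup>+\<omega>. indicator {0..} u * (?h \<omega> (clk (pth x \<omega>) u) * ennreal (rho (x + W u \<omega>))) \<partial>M) =
      indicator {0..} u * (\<integral>\<^sup>+\<omega>. indicator {\<omega>. alive (pth x \<omega>) u} \<omega> * h (clk (pth x \<omega>) u) * (k (x + W u \<omega>) * ennreal (rho (x + W u \<omega>))) \<partial>M)"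
    proof (cases "u \<ge> 0")
      case True
      then show ?thesis
        by (auto intro!: nn_integral_cong simp: alive_tc_clk[OF skorokhod_W] indicator_def mult.assoc)
    qed simp
  qed
  finally show ?thesis .
qed

section \<open>Time reversal and Markov property for survival and clock jointly\<close>

lemma riemann_PiM_measurable:
  assumes F: "\<And>s. 0 \<le> s \<Longrightarrow> s \<le> u \<Longrightarrow> F s \<in> borel_measurable N" and u: "0 \<le> u"
  shows "(\<lambda>p. lim (riemann (\<lambda>s. F s p) u)) \<in> borel_measurable N"
proof -
  have "(\<lambda>p. riemann (\<lambda>s. F s p) u n) \<in> borel_measurable N" for n
    unfolding riemann_def
  proof (intro borel_measurable_sum borel_measurable_times borel_measurable_const)
    fix k assume "k \<in> {..<n}"
    then have "real (Suc k) / real n \<le> 1" by (simp add: divide_le_eq)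
    then have "u * (real (Suc k) / real n) \<le> u" using mult_left_mono[OF _ u] by fastforce
    then have "F (u * (real (Suc k) / real n)) \<in> borel_measurable N" using u by (intro F) auto
    then show "(\<lambda>p. rho (F (u * (real (Suc k) / real n)) p)) \<in> borel_measurable N" by measurable
  qed
  then show ?thesis by measurable
qed

lemma alive_PiM_measurable:
  assumes F: "\<And>s. 0 \<le> s \<Longrightarrow> s \<le> u \<Longrightarrow> F s \<in> borel_measurable N" and u: "0 \<le> u"
  shows "Measurable.pred N (\<lambda>p. alive (\<lambda>s. F s p) u)"
proof -
  have c: "countable (\<rat> \<inter> {0..1::real})" using countable_rat by (rule countable_subset[rotated]) auto
  have [measurable]: "F (u * q) \<in> borel_measurable N" if q: "q \<in> \<rat> \<inter> {0..1}" for q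
    using q u mult_left_mono[of q 1 u] by (intro F) auto
  show ?thesis
    unfolding alive_def pred_def
    by (intro sets.sets_Collect_countable_Ex sets.sets_Collect_countable_All' c) measurable
qed

lemma lim_riemann: "skorokhod w \<Longrightarrow> 0 \<le> u \<Longrightarrow> lim (riemann w u) = clk w u"
  using riemann_tendsto by (intro limI) auto

text \<open>Time reversal: started from Lebesgue measure the stable process is symmetric, while killing
  and the clock do not see the direction of time.\<close>

lemma reversal:
  assumes [measurable]: "\<phi> \<in> borel_measurable borel" "a \<in> borel_measurable borel" "b \<in> borel_measurable borel"
    and u: "0 \<le> u"
  shows "(\<integral>\<^sup>+x. a x * (\<integral>\<^sup>+\<omega>. indicator {\<omega>. alive (pth x \<omega>) u} \<omega> * \<phi> (clk (pth x \<omega>) u) * b (x + W u \<omega>) \<partial>M) \<partial>lborel) =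
    (\<integral>\<^sup>+x. b x * (\<integral>\<^sup>+\<omega>. indicator {\<omega>. alive (pth x \<omega>) u} \<omega> * \<phi> (clk (pth x \<omega>) u) * a (x + W u \<omega>) \<partial>M) \<partial>lborel)"
proof -
  interpret P: pair_sigma_finite lborel M by unfold_locales
  \<comment> \<open>A functional on the product space, so that equality of path laws applies to it;
    hence the clock appears as a limit of Riemann sums.\<close>
  define H :: "real \<Rightarrow> (real \<Rightarrow> real) \<Rightarrow> ennreal" where
    "H z p = indicator {p. alive (\<lambda>s. z + p s) u} p * \<phi> (lim (riemann (\<lambda>s. z + p s) u)) * a (z + p u)" for z p
  have comp [measurable]: "(\<lambda>p. p s) \<in> borel_measurable (PiM {0..u} (\<lambda>_. borel))" if "0 \<le> s" "s \<le> u" for s :: real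
    using that by (intro measurable_component_singleton) auto
  have H: "H z \<in> borel_measurable (PiM {0..u} (\<lambda>_. borel))" for z
  proof -
    have "Measurable.pred (PiM {0..u} (\<lambda>_. borel)) (\<lambda>p. alive (\<lambda>s. z + p s) u)"
      "(\<lambda>p. lim (riemann (\<lambda>s. z + p s) u)) \<in> borel_measurable (PiM {0..u} (\<lambda>_. borel))"
      using u by (auto intro!: alive_PiM_measurable riemann_PiM_measurable borel_measurable_add comp)
    moreover have "(\<lambda>p. p u) \<in> borel_measurable (PiM {0..u} (\<lambda>_. borel))" using u by (intro comp) auto
    ultimately show ?thesis unfolding H_def by measurable
  qed
  have H_cong: "H z (\<lambda>s\<in>{0..u}. p s) = H z p" for z p
  proof -
    have "alive (\<lambda>s. z + (\<lambda>s\<in>{0..u}. p s) s) u = alive (\<lambda>s. z + p s) u"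
      using u by (intro alive_cong) auto
    moreover have "riemann (\<lambda>s. z + (\<lambda>s\<in>{0..u}. p s) s) u = riemann (\<lambda>s. z + p s) u"
      using u by (intro ext riemann_cong) auto
    ultimately show ?thesis using u by (simp add: H_def indicator_def)
  qed
  have HW: "H z (\<lambda>s. W s \<omega>) = indicator {\<omega>. alive (pth z \<omega>) u} \<omega> * \<phi> (clk (pth z \<omega>) u) * a (z + W u \<omega>)" for z \<omega>
    by (simp add: H_def lim_riemann[OF skorokhod_W u] indicator_def)
  have Hrev: "H z (\<lambda>s. W (u - s) \<omega> - W u \<omega>) =
      indicator {\<omega>. alive (pth (z - W u \<omega>) \<omega>) u} \<omega> * \<phi> (clk (pth (z - W u \<omega>) \<omega>) u) * a (z - W u \<omega>)" for z \<omega>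
  proof -
    let ?w = "pth (z - W u \<omega>) \<omega>"
    have "(\<lambda>s. z + (W (u - s) \<omega> - W u \<omega>)) = (\<lambda>s. ?w (u - s))" by auto
    moreover have "lim (riemann (\<lambda>s. ?w (u - s)) u) = clk ?w u"
      using riemann_reverse_tendsto[OF skorokhod_W u] by (intro limI)
    moreover have "alive (\<lambda>s. ?w (u - s)) u = alive ?w u" by (rule alive_reverse)
    ultimately show ?thesis by (simp add: H_def W_nonpos indicator_def)
  qed
  have "(\<integral>\<^sup>+x. a x * (\<integral>\<^sup>+\<omega>. indicator {\<omega>. alive (pth x \<omega>) u} \<omega> * \<phi> (clk (pth x \<omega>) u) * b (x + W u \<omega>) \<partial>M) \<partial>lborel)
     = (\<integral>\<^sup>+x. \<integral>\<^sup>+\<omega>. a x * (indicator {\<omega>. alive (pth x \<omega>) u} \<omega> * \<phi> (clk (pth x \<omega>) u) * b (x + W u \<omega>)) \<partial>M \<partial>lborel)"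
    by (simp add: nn_integral_cmult)
  also have "\<dots> = (\<integral>\<^sup>+\<omega>. \<integral>\<^sup>+x. a x * (indicator {\<omega>. alive (pth x \<omega>) u} \<omega> * \<phi> (clk (pth x \<omega>) u) * b (x + W u \<omega>)) \<partial>lborel \<partial>M)"
    by (rule P.Fubini'[symmetric]) measurable
  \<comment> \<open>For a fixed sample, translation by \<open>W u\<close> makes the terminal
    position z the variable of integration. Seen from z, the path is the reversed one.\<close>
  also have "\<dots> = (\<integral>\<^sup>+\<omega>. \<integral>\<^sup>+z. b z * H z (\<lambda>s. W (u - s) \<omega> - W u \<omega>) \<partial>lborel \<partial>M)"
  proof (rule nn_integral_cong)
    fix \<omega> assume [measurable]: "\<omega> \<in> space M"
    show "(\<integral>\<^sup>+x. a x * (indicator {\<omega>. alive (pth x \<omega>) u} \<omega> * \<phi> (clk (pth x \<omega>) u) * b (x + W u \<omega>)) \<partial>lborel)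
       = (\<integral>\<^sup>+z. b z * H z (\<lambda>s. W (u - s) \<omega> - W u \<omega>) \<partial>lborel)"
    proof -
      let ?F = "\<lambda>x. a x * (indicator {\<omega>. alive (pth x \<omega>) u} \<omega> * \<phi> (clk (pth x \<omega>) u) * b (x + W u \<omega>))"
      have "?F \<in> borel_measurable borel" by measurable
      then have "(\<integral>\<^sup>+x. ?F x \<partial>lborel) = (\<integral>\<^sup>+z. ?F (- W u \<omega> + 1 * z) \<partial>lborel)"
        by (subst nn_integral_real_affine[where c = 1 and t = "- W u \<omega>"]) simp_all
      also have "\<dots> = (\<integral>\<^sup>+z. b z * H z (\<lambda>s. W (u - s) \<omega> - W u \<omega>) \<partial>lborel)"
      proof (rule nn_integral_cong)
        fix z
        have e: "- W u \<omega> + 1 * z = z - W u \<omega>" "z - W u \<omega> + W u \<omega> = z" by simp_all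
        show "?F (- W u \<omega> + 1 * z) = b z * H z (\<lambda>s. W (u - s) \<omega> - W u \<omega>)"
          unfolding e(1) Hrev e(2) indicator_def mem_Collect_eq by (simp only: ac_simps)
      qed
      finally show ?thesis .
    qed
  qed
  also have "\<dots> = (\<integral>\<^sup>+z. \<integral>\<^sup>+\<omega>. b z * H z (\<lambda>s. W (u - s) \<omega> - W u \<omega>) \<partial>M \<partial>lborel)"
    unfolding Hrev by (rule P.Fubini') measurable
  also have "\<dots> = (\<integral>\<^sup>+z. b z * (\<integral>\<^sup>+\<omega>. H z (\<lambda>s. W s \<omega>) \<partial>M) \<partial>lborel)"
  proof (rule nn_integral_cong)
    fix z :: real
    have m1: "(\<lambda>\<omega>. \<lambda>s\<in>{0..u}. W s \<omega>) \<in> measurable M (PiM {0..u} (\<lambda>_. borel))"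
      and m2: "(\<lambda>\<omega>. \<lambda>s\<in>{0..u}. W (u - s) \<omega> - W u \<omega>) \<in> measurable M (PiM {0..u} (\<lambda>_. borel))"
      by (auto intro!: measurable_restrict)
    have "(\<integral>\<^sup>+\<omega>. H z (\<lambda>s\<in>{0..u}. W (u - s) \<omega> - W u \<omega>) \<partial>M) = (\<integral>\<^sup>+\<omega>. H z (\<lambda>s\<in>{0..u}. W s \<omega>) \<partial>M)"
    proof -
      have "(\<integral>\<^sup>+\<omega>. H z (\<lambda>s\<in>{0..u}. W (u - s) \<omega> - W u \<omega>) \<partial>M) =
          (\<integral>\<^sup>+p. H z p \<partial>distr M (PiM {0..u} (\<lambda>_. borel)) (\<lambda>\<omega>. \<lambda>s\<in>{0..u}. W (u - s) \<omega> - W u \<omega>))"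
        by (rule nn_integral_distr[symmetric, OF m2]) (use H in simp)
      also have "\<dots> = (\<integral>\<^sup>+p. H z p \<partial>distr M (PiM {0..u} (\<lambda>_. borel)) (\<lambda>\<omega>. \<lambda>s\<in>{0..u}. W s \<omega>))"
        by (simp add: reversal_law[OF u])
      also have "\<dots> = (\<integral>\<^sup>+\<omega>. H z (\<lambda>s\<in>{0..u}. W s \<omega>) \<partial>M)"
        by (rule nn_integral_distr[OF m1]) (use H in simp)
      finally show ?thesis .
    qed
    then have "(\<integral>\<^sup>+\<omega>. H z (\<lambda>s. W (u - s) \<omega> - W u \<omega>) \<partial>M) = (\<integral>\<^sup>+\<omega>. H z (\<lambda>s. W s \<omega>) \<partial>M)"
      unfolding H_cong .
    moreover have "(\<integral>\<^sup>+\<omega>. b z * H z (\<lambda>s. W (u - s) \<omega> - W u \<omega>) \<partial>M) = b z * (\<integral>\<^sup>+\<omega>. H z (\<lambda>s. W (u - s) \<omega> - W u \<omega>) \<partial>M)"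
      unfolding Hrev by (rule nn_integral_cmult) measurable
    ultimately show "(\<integral>\<^sup>+\<omega>. b z * H z (\<lambda>s. W (u - s) \<omega> - W u \<omega>) \<partial>M) = b z * (\<integral>\<^sup>+\<omega>. H z (\<lambda>s. W s \<omega>) \<partial>M)" by simp
  qed
  finally show ?thesis unfolding HW .
qed

text \<open>Survival and clock over [0, u + v] split at \<open>u\<close> by
  \<open>alive_concat\<close> and \<open>clk_shift\<close>, so the functional is one of the
  concatenated path and \<open>Markov\<close> applies.\<close>

lemma Markov_killed:
  assumes [measurable]: "\<phi> \<in> borel_measurable borel" "\<psi> \<in> borel_measurable borel" "m \<in> borel_measurable borel" "k \<in> borel_measurable borel"
    and u: "0 \<le> u" and v: "0 \<le> v"
  shows "(\<integral>\<^sup>+\<omega>. indicator {\<omega>. alive (pth x \<omega>) u} \<omega> * \<phi> (clk (pth x \<omega>) u) * (m (x + W u \<omega>) *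
      (\<integral>\<^sup>+\<omega>'. indicator {\<omega>'. alive (pth (x + W u \<omega>) \<omega>') v} \<omega>' * \<psi> (clk (pth (x + W u \<omega>) \<omega>') v) * k (x + W u \<omega> + W v \<omega>') \<partial>M)) \<partial>M)
    = (\<integral>\<^sup>+\<omega>. indicator {\<omega>. alive (pth x \<omega>) (u + v)} \<omega> * \<phi> (clk (pth x \<omega>) u) * m (x + W u \<omega>) *
        (\<psi> (clk (pth x \<omega>) (u + v) - clk (pth x \<omega>) u) * k (x + W (u + v) \<omega>)) \<partial>M)"
proof -
  define H :: "(real \<Rightarrow> real) \<Rightarrow> ennreal" where
    "H p = indicator {p. alive (\<lambda>s. x + p s) u} p * \<phi> (lim (riemann (\<lambda>s. x + p s) u)) * m (x + p u) *
       (indicator {p. alive (\<lambda>s. x + p (u + s)) v} p * \<psi> (lim (riemann (\<lambda>s. x + p (u + s)) v)) * k (x + p (u + v)))" for p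
  have comp: "(\<lambda>p. p s) \<in> borel_measurable (PiM {0..} (\<lambda>_. borel))" if "0 \<le> s" for s :: real
    using that by (intro measurable_component_singleton) auto
  have H: "H \<in> borel_measurable (PiM {0..} (\<lambda>_. borel))"
  proof -
    have "Measurable.pred (PiM {0..} (\<lambda>_. borel)) (\<lambda>p. alive (\<lambda>s. x + p s) u)"
      "Measurable.pred (PiM {0..} (\<lambda>_. borel)) (\<lambda>p. alive (\<lambda>s. x + p (u + s)) v)"
      "(\<lambda>p. lim (riemann (\<lambda>s. x + p s) u)) \<in> borel_measurable (PiM {0..} (\<lambda>_. borel))"
      "(\<lambda>p. lim (riemann (\<lambda>s. x + p (u + s)) v)) \<in> borel_measurable (PiM {0..} (\<lambda>_. borel))"
      using u v by (auto intro!: alive_PiM_measurable riemann_PiM_measurable borel_measurable_add comp)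
    moreover have "(\<lambda>p. p u) \<in> borel_measurable (PiM {0..} (\<lambda>_. borel))" "(\<lambda>p. p (u + v)) \<in> borel_measurable (PiM {0..} (\<lambda>_. borel))"
      using u v by (auto intro!: comp)
    ultimately show ?thesis unfolding H_def by measurable
  qed
  have H_cong: "H p = H p'" if pp: "\<And>s. 0 \<le> s \<Longrightarrow> p s = p' s" for p p'
  proof -
    have "alive (\<lambda>s. x + p s) u = alive (\<lambda>s. x + p' s) u" "alive (\<lambda>s. x + p (u + s)) v = alive (\<lambda>s. x + p' (u + s)) v"
      using u v pp by (auto intro!: alive_cong)
    moreover have "riemann (\<lambda>s. x + p s) u = riemann (\<lambda>s. x + p' s) u" "riemann (\<lambda>s. x + p (u + s)) v = riemann (\<lambda>s. x + p' (u + s)) v"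
      using u v pp by (auto intro!: ext riemann_cong)
    ultimately show ?thesis using u v pp by (simp add: H_def indicator_def)
  qed
  have HW: "H (\<lambda>s\<in>{0..}. W s \<omega>) = indicator {\<omega>. alive (pth x \<omega>) (u + v)} \<omega> * \<phi> (clk (pth x \<omega>) u) * m (x + W u \<omega>) *
        (\<psi> (clk (pth x \<omega>) (u + v) - clk (pth x \<omega>) u) * k (x + W (u + v) \<omega>))" for \<omega>
  proof -
    have "H (\<lambda>s\<in>{0..}. W s \<omega>) = H (\<lambda>s. W s \<omega>)" by (rule H_cong) simp
    moreover have "skorokhod (\<lambda>s. x + W (u + s) \<omega>)" by (rule skorokhod_shift[OF skorokhod_W])
    moreover have "clk (\<lambda>s. x + W (u + s) \<omega>) v = clk (pth x \<omega>) (u + v) - clk (pth x \<omega>) u"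
      by (rule clk_shift[OF skorokhod_W u v])
    ultimately show ?thesis
      using alive_concat[OF skorokhod_W u v, of x \<omega>]
      by (auto simp: H_def lim_riemann skorokhod_W u v indicator_def mult.assoc)
  qed
  have Hc: "H (\<lambda>s\<in>{0..}. concat u s (\<omega>, \<omega>')) = indicator {\<omega>. alive (pth x \<omega>) u} \<omega> * \<phi> (clk (pth x \<omega>) u) * (m (x + W u \<omega>) *
      (indicator {\<omega>'. alive (pth (x + W u \<omega>) \<omega>') v} \<omega>' * \<psi> (clk (pth (x + W u \<omega>) \<omega>') v) * k (x + W u \<omega> + W v \<omega>')))" for \<omega> \<omega>'
  proof -
    have c: "concat u s (\<omega>, \<omega>') = W s \<omega>" if "s \<le> u" for s using that by (simp add: concat_def)
    have c': "x + concat u (u + s) (\<omega>, \<omega>') = x + W u \<omega> + W s \<omega>'" if "0 \<le> s" for s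
      using that by (cases "s = 0") (auto simp: concat_def W_nonpos)
    have e1: "H (\<lambda>s\<in>{0..}. concat u s (\<omega>, \<omega>')) = H (\<lambda>s. concat u s (\<omega>, \<omega>'))" by (rule H_cong) simp
    have e2: "alive (\<lambda>s. x + concat u s (\<omega>, \<omega>')) u = alive (pth x \<omega>) u" using u c by (intro alive_cong) auto
    have e3: "riemann (\<lambda>s. x + concat u s (\<omega>, \<omega>')) u = riemann (pth x \<omega>) u" using u c by (intro ext riemann_cong) auto
    have e4: "alive (\<lambda>s. x + concat u (u + s) (\<omega>, \<omega>')) v = alive (pth (x + W u \<omega>) \<omega>') v"
      using v c' by (intro alive_cong)
    have e5: "riemann (\<lambda>s. x + concat u (u + s) (\<omega>, \<omega>')) v = riemann (pth (x + W u \<omega>) \<omega>') v"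
      using v c' by (intro ext riemann_cong)
    show ?thesis
      unfolding e1
      unfolding H_def e3 e5 lim_riemann[OF skorokhod_W u] lim_riemann[OF skorokhod_W v] c'[OF v] c[OF order_refl]
      by (simp only: indicator_def mem_Collect_eq e2 e4 mult.assoc)
  qed
  have "(\<integral>\<^sup>+\<omega>. H (\<lambda>s\<in>{0..}. W s \<omega>) \<partial>M) = (\<integral>\<^sup>+\<omega>. \<integral>\<^sup>+\<omega>'. H (\<lambda>s\<in>{0..}. concat u s (\<omega>, \<omega>')) \<partial>M \<partial>M)"
    by (rule Markov[OF u H])
  then show ?thesis unfolding HW Hc by (simp add: nn_integral_cmult)
qed

text \<open>For one sample, the substitutions t = clk u and s = clk (u + v) - clk u. The inner one
  is the clock of the path shifted by u, so \<open>clk_substitution\<close> is used twice.\<close>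

lemma two_time_substitution:
  assumes [measurable]: "\<phi> \<in> borel_measurable borel" "\<psi> \<in> borel_measurable borel" "k \<in> borel_measurable borel"
    and [measurable]: "\<omega> \<in> space M"
  shows "(\<integral>\<^sup>+u. indicator {0..} u * (\<integral>\<^sup>+v. indicator {0..} v *
      (indicator {\<omega>. alive (pth x \<omega>) (u + v)} \<omega> * \<phi> (clk (pth x \<omega>) u) * ennreal (rho (x + W u \<omega>)) *
        (\<psi> (clk (pth x \<omega>) (u + v) - clk (pth x \<omega>) u) * (k (x + W (u + v) \<omega>) * ennreal (rho (x + W (u + v) \<omega>))))) \<partial>lborel) \<partial>lborel)
    = (\<integral>\<^sup>+t. indicator {0..} t * (\<phi> t * (\<integral>\<^sup>+s. indicator {0..} s * (\<psi> s *
        (indicator {\<omega>. alive_tc (pth x \<omega>) (t + s)} \<omega> * k (tc (pth x \<omega>) (t + s)))) \<partial>lborel)) \<partial>lborel)"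
proof -
  let ?w = "pth x \<omega>"
  let ?h = "\<lambda>r. indicator {\<omega>. alive_tc (pth x \<omega>) r} \<omega> * k (tc ?w r)"
  define \<Theta> where "\<Theta> t = (\<integral>\<^sup>+s. indicator {0..} s * (\<psi> s * ?h (t + s)) \<partial>lborel)" for t
  have [measurable]: "\<Theta> \<in> borel_measurable borel" unfolding \<Theta>_def by measurable
  have sk: "skorokhod ?w" by (rule skorokhod_W)
  have inner: "(\<integral>\<^sup>+v. indicator {0..} v * (indicator {\<omega>. alive (pth x \<omega>) (u + v)} \<omega> * \<phi> (clk ?w u) * ennreal (rho (x + W u \<omega>)) *
        (\<psi> (clk ?w (u + v) - clk ?w u) * (k (x + W (u + v) \<omega>) * ennreal (rho (x + W (u + v) \<omega>))))) \<partial>lborel)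
     = \<phi> (clk ?w u) * ennreal (rho (?w u)) * \<Theta> (clk ?w u)" if u: "u \<ge> 0" for u
  proof -
    let ?w' = "\<lambda>s. ?w (u + s)"
    have sk': "skorokhod ?w'" using sk by (rule skorokhod_shift)
    have cl: "clk ?w' v = clk ?w (u + v) - clk ?w u" if "v \<ge> 0" for v by (rule clk_shift[OF sk u that])
    define h' where "h' s = \<psi> s * ?h (clk ?w u + s)" for s
    have [measurable]: "h' \<in> borel_measurable borel" unfolding h'_def by measurable
    have "(\<integral>\<^sup>+v. indicator {0..} v * (indicator {\<omega>. alive (pth x \<omega>) (u + v)} \<omega> * \<phi> (clk ?w u) * ennreal (rho (x + W u \<omega>)) *
        (\<psi> (clk ?w (u + v) - clk ?w u) * (k (x + W (u + v) \<omega>) * ennreal (rho (x + W (u + v) \<omega>))))) \<partial>lborel)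
      = (\<integral>\<^sup>+v. (\<phi> (clk ?w u) * ennreal (rho (?w u))) * (indicator {0..} v * (h' (clk ?w' v) * ennreal (rho (?w' v)))) \<partial>lborel)"
    proof (rule nn_integral_cong)
      fix v :: real
      show "indicator {0..} v * (indicator {\<omega>. alive (pth x \<omega>) (u + v)} \<omega> * \<phi> (clk ?w u) * ennreal (rho (x + W u \<omega>)) *
        (\<psi> (clk ?w (u + v) - clk ?w u) * (k (x + W (u + v) \<omega>) * ennreal (rho (x + W (u + v) \<omega>)))))
        = (\<phi> (clk ?w u) * ennreal (rho (?w u))) * (indicator {0..} v * (h' (clk ?w' v) * ennreal (rho (?w' v))))"
      proof (cases "v \<ge> 0")
        case True
        then have e: "clk ?w u + clk ?w' v = clk ?w (u + v)" "0 \<le> u + v" using cl[OF True] u by auto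
        show ?thesis
          unfolding h'_def e(1) cl[OF True]
          using alive_tc_clk[OF sk e(2)] True by (auto simp: indicator_def mult.assoc mult.left_commute)
      qed simp
    qed
    also have "\<dots> = (\<phi> (clk ?w u) * ennreal (rho (?w u))) * (\<integral>\<^sup>+v. indicator {0..} v * (h' (clk ?w' v) * ennreal (rho (?w' v))) \<partial>lborel)"
    proof (rule nn_integral_cmult)
      have "clk ?w' \<in> borel_measurable borel" "(\<lambda>v. rho (?w' v)) \<in> borel_measurable borel"
        using clk_measurable[OF sk'] rho_path_measurable[OF sk'] by simp_all
      then show "(\<lambda>v. indicator {0..} v * (h' (clk ?w' v) * ennreal (rho (?w' v)))) \<in> borel_measurable lborel" by measurable
    qed
    also have "(\<integral>\<^sup>+v. indicator {0..} v * (h' (clk ?w' v) * ennreal (rho (?w' v))) \<partial>lborel)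
      = (\<integral>\<^sup>+s. indicator {s. 0 \<le> s \<and> (\<exists>n::nat. s < clk ?w' n)} s * h' s \<partial>lborel)"
      by (rule clk_substitution[OF sk']) measurable
    also have "\<dots> = \<Theta> (clk ?w u)"
      unfolding \<Theta>_def
    proof (rule nn_integral_cong)
      fix s :: real
      have "\<exists>n::nat. s < clk ?w' n" if a: "alive_tc ?w (clk ?w u + s)"
      proof -
        obtain n :: nat where n: "clk ?w u + s < clk ?w n" using a by (auto simp: alive_tc_def)
        have "clk ?w n \<le> clk ?w (u + n)" using u by (intro clk_mono[OF sk]) auto
        then show ?thesis using n cl[of n] by (intro exI[of _ n]) simp
      qed
      then show "indicator {s. 0 \<le> s \<and> (\<exists>n::nat. s < clk ?w' n)} s * h' s = indicator {0..} s * (\<psi> s * ?h (clk ?w u + s))"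
        by (auto simp: h'_def indicator_def)
    qed
    finally show ?thesis .
  qed
  have "(\<integral>\<^sup>+u. indicator {0..} u * (\<integral>\<^sup>+v. indicator {0..} v *
      (indicator {\<omega>. alive (pth x \<omega>) (u + v)} \<omega> * \<phi> (clk ?w u) * ennreal (rho (x + W u \<omega>)) *
        (\<psi> (clk ?w (u + v) - clk ?w u) * (k (x + W (u + v) \<omega>) * ennreal (rho (x + W (u + v) \<omega>))))) \<partial>lborel) \<partial>lborel)
    = (\<integral>\<^sup>+u. indicator {0..} u * ((\<phi> (clk ?w u) * \<Theta> (clk ?w u)) * ennreal (rho (?w u))) \<partial>lborel)"
  proof (rule nn_integral_cong)
    fix u :: real
    show "indicator {0..} u * (\<integral>\<^sup>+v. indicator {0..} v *
      (indicator {\<omega>. alive (pth x \<omega>) (u + v)} \<omega> * \<phi> (clk ?w u) * ennreal (rho (x + W u \<omega>)) *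
        (\<psi> (clk ?w (u + v) - clk ?w u) * (k (x + W (u + v) \<omega>) * ennreal (rho (x + W (u + v) \<omega>))))) \<partial>lborel)
      = indicator {0..} u * ((\<phi> (clk ?w u) * \<Theta> (clk ?w u)) * ennreal (rho (?w u)))"
    proof (cases "u \<ge> 0")
      case True
      show ?thesis unfolding inner[OF True] by (simp only: ac_simps)
    qed simp
  qed
  also have "\<dots> = (\<integral>\<^sup>+t. indicator {t. 0 \<le> t \<and> (\<exists>n::nat. t < clk ?w n)} t * (\<phi> t * \<Theta> t) \<partial>lborel)"
    by (rule clk_substitution[OF sk, where h = "\<lambda>t. \<phi> t * \<Theta> t"]) measurable
  also have "\<dots> = (\<integral>\<^sup>+t. indicator {0..} t * (\<phi> t * \<Theta> t) \<partial>lborel)"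
  proof (rule nn_integral_cong)
    fix t :: real
    have "\<Theta> t = 0" if none: "\<not> (\<exists>n::nat. t < clk ?w n)"
    proof -
      have z: "indicator {0..} s * (\<psi> s * ?h (t + s)) = 0" for s
      proof (cases "s \<ge> 0")
        case True
        then have "\<not> alive_tc ?w (t + s)" using none by (auto simp: alive_tc_def not_less intro: order_trans[of _ t])
        then show ?thesis by simp
      qed simp
      show ?thesis unfolding \<Theta>_def z by simp
    qed
    then show "indicator {t. 0 \<le> t \<and> (\<exists>n::nat. t < clk ?w n)} t * (\<phi> t * \<Theta> t) = indicator {0..} t * (\<phi> t * \<Theta> t)"
      by (auto simp: indicator_def)
  qed
  finally show ?thesis unfolding \<Theta>_def .
qed

text \<open>Tested against functions of both times, the two sides become occupation integrals over the original
  times, to which time reversal and the Markov property of the stable process apply.\<close>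

lemma semigroup_symmetry_tested:
  assumes [measurable]: "\<phi> \<in> borel_measurable borel" "\<psi> \<in> borel_measurable borel" "g \<in> borel_measurable borel" "k \<in> borel_measurable borel"
  shows "(\<integral>\<^sup>+x. ennreal (rho x) * ((\<integral>\<^sup>+t. indicator {0..} t * (\<phi> t * Pn t g x) \<partial>lborel) * (\<integral>\<^sup>+s. indicator {0..} s * (\<psi> s * Pn s k x) \<partial>lborel)) \<partial>lborel)
    = (\<integral>\<^sup>+x. ennreal (rho x) * (g x * (\<integral>\<^sup>+t. indicator {0..} t * (\<phi> t * (\<integral>\<^sup>+s. indicator {0..} s * (\<psi> s * Pn (t + s) k x) \<partial>lborel)) \<partial>lborel)) \<partial>lborel)"
proof -
  interpret P: pair_sigma_finite lborel M by unfold_locales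
  define \<Sigma> where "\<Sigma> x = (\<integral>\<^sup>+s. indicator {0..} s * (\<psi> s * Pn s k x) \<partial>lborel)" for x
  have [measurable]: "\<Sigma> \<in> borel_measurable borel" unfolding \<Sigma>_def by measurable
  let ?E = "\<lambda>a b u x. \<integral>\<^sup>+\<omega>. indicator {\<omega>. alive (pth x \<omega>) u} \<omega> * \<phi> (clk (pth x \<omega>) u) * b (x + W u \<omega>) \<partial>M"
  let ?g = "\<lambda>x. g x * ennreal (rho x)" and ?S = "\<lambda>x. ennreal (rho x) * \<Sigma> x"
  have "(\<integral>\<^sup>+x. ennreal (rho x) * ((\<integral>\<^sup>+t. indicator {0..} t * (\<phi> t * Pn t g x) \<partial>lborel) * \<Sigma> x) \<partial>lborel)
     = (\<integral>\<^sup>+x. \<integral>\<^sup>+u. indicator {0..} u * (?S x * ?E \<phi> ?g u x) \<partial>lborel \<partial>lborel)"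
  proof (rule nn_integral_cong)
    fix x :: real
    have "(\<integral>\<^sup>+t. indicator {0..} t * (\<phi> t * Pn t g x) \<partial>lborel) = (\<integral>\<^sup>+u. indicator {0..} u * ?E \<phi> ?g u x \<partial>lborel)"
      by (rule occupation) measurable
    then have "ennreal (rho x) * ((\<integral>\<^sup>+t. indicator {0..} t * (\<phi> t * Pn t g x) \<partial>lborel) * \<Sigma> x)
        = ?S x * (\<integral>\<^sup>+u. indicator {0..} u * ?E \<phi> ?g u x \<partial>lborel)" by (simp only: ac_simps)
    also have "\<dots> = (\<integral>\<^sup>+u. ?S x * (indicator {0..} u * ?E \<phi> ?g u x) \<partial>lborel)"
      by (rule nn_integral_cmult[symmetric]) measurable
    finally show "ennreal (rho x) * ((\<integral>\<^sup>+t. indicator {0..} t * (\<phi> t * Pn t g x) \<partial>lborel) * \<Sigma> x)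
      = (\<integral>\<^sup>+u. indicator {0..} u * (?S x * ?E \<phi> ?g u x) \<partial>lborel)" by (simp only: mult.left_commute)
  qed
  also have "\<dots> = (\<integral>\<^sup>+u. \<integral>\<^sup>+x. indicator {0..} u * (?S x * ?E \<phi> ?g u x) \<partial>lborel \<partial>lborel)"
    by (rule lborel_pair.Fubini') measurable
  \<comment> \<open>Reversal moves the factor with \<open>\<Sigma>\<close>, which carries the second
    time, from the starting point to the end of the path, where the Markov property can append
    it.\<close>
  also have "\<dots> = (\<integral>\<^sup>+u. \<integral>\<^sup>+x. indicator {0..} u * (?g x * ?E \<phi> ?S u x) \<partial>lborel \<partial>lborel)"
  proof (rule nn_integral_cong)
    fix u :: real
    show "(\<integral>\<^sup>+x. indicator {0..} u * (?S x * ?E \<phi> ?g u x) \<partial>lborel) = (\<integral>\<^sup>+x. indicator {0..} u * (?g x * ?E \<phi> ?S u x) \<partial>lborel)"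
    proof (cases "u \<ge> 0")
      case True
      have "(\<integral>\<^sup>+x. ?S x * ?E \<phi> ?g u x \<partial>lborel) = (\<integral>\<^sup>+x. ?g x * ?E \<phi> ?S u x \<partial>lborel)"
        by (rule reversal[OF _ _ _ True]) measurable
      then show ?thesis using True by simp
    qed simp
  qed
  also have "\<dots> = (\<integral>\<^sup>+x. \<integral>\<^sup>+u. indicator {0..} u * (?g x * ?E \<phi> ?S u x) \<partial>lborel \<partial>lborel)"
    by (rule lborel_pair.Fubini'[symmetric]) measurable
  also have "\<dots> = (\<integral>\<^sup>+x. ennreal (rho x) * (g x * (\<integral>\<^sup>+t. indicator {0..} t * (\<phi> t * (\<integral>\<^sup>+s. indicator {0..} s * (\<psi> s * Pn (t + s) k x) \<partial>lborel)) \<partial>lborel)) \<partial>lborel)"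
  proof (rule nn_integral_cong)
    fix x :: real
    let ?T = "\<lambda>u v \<omega>. indicator {\<omega>. alive (pth x \<omega>) (u + v)} \<omega> * \<phi> (clk (pth x \<omega>) u) * ennreal (rho (x + W u \<omega>)) *
        (\<psi> (clk (pth x \<omega>) (u + v) - clk (pth x \<omega>) u) * (k (x + W (u + v) \<omega>) * ennreal (rho (x + W (u + v) \<omega>))))"
    \<comment> \<open>Writing \<open>\<Sigma>\<close> at the endpoint as an occupation integral over
      v, the Markov property merges the pieces of lengths u and v into one path of length u +
      v.\<close>
    have ES: "?E \<phi> ?S u x = (\<integral>\<^sup>+v. indicator {0..} v * (\<integral>\<^sup>+\<omega>. ?T u v \<omega> \<partial>M) \<partial>lborel)" if u: "u \<ge> 0" for u
    proof -
      let ?K = "\<lambda>y v. \<integral>\<^sup>+\<omega>'. indicator {\<omega>'. alive (pth y \<omega>') v} \<omega>' * \<psi> (clk (pth y \<omega>') v) * (k (y + W v \<omega>') * ennreal (rho (y + W v \<omega>'))) \<partial>M"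
      have Sig: "\<Sigma> y = (\<integral>\<^sup>+v. indicator {0..} v * ?K y v \<partial>lborel)" for y
        unfolding \<Sigma>_def by (rule occupation) measurable
      have "?E \<phi> ?S u x = (\<integral>\<^sup>+\<omega>. \<integral>\<^sup>+v. indicator {0..} v * (indicator {\<omega>. alive (pth x \<omega>) u} \<omega> * \<phi> (clk (pth x \<omega>) u) * (ennreal (rho (x + W u \<omega>)) * ?K (x + W u \<omega>) v)) \<partial>lborel \<partial>M)"
      proof (rule nn_integral_cong)
        fix \<omega> assume [measurable]: "\<omega> \<in> space M"
        have "indicator {\<omega>. alive (pth x \<omega>) u} \<omega> * \<phi> (clk (pth x \<omega>) u) * ?S (x + W u \<omega>)
          = (indicator {\<omega>. alive (pth x \<omega>) u} \<omega> * \<phi> (clk (pth x \<omega>) u) * ennreal (rho (x + W u \<omega>))) * (\<integral>\<^sup>+v. indicator {0..} v * ?K (x + W u \<omega>) v \<partial>lborel)"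
          unfolding Sig by (simp only: mult.assoc)
        also have "\<dots> = (\<integral>\<^sup>+v. (indicator {\<omega>. alive (pth x \<omega>) u} \<omega> * \<phi> (clk (pth x \<omega>) u) * ennreal (rho (x + W u \<omega>))) * (indicator {0..} v * ?K (x + W u \<omega>) v) \<partial>lborel)"
          by (rule nn_integral_cmult[symmetric]) measurable
        finally show "indicator {\<omega>. alive (pth x \<omega>) u} \<omega> * \<phi> (clk (pth x \<omega>) u) * ?S (x + W u \<omega>)
          = (\<integral>\<^sup>+v. indicator {0..} v * (indicator {\<omega>. alive (pth x \<omega>) u} \<omega> * \<phi> (clk (pth x \<omega>) u) * (ennreal (rho (x + W u \<omega>)) * ?K (x + W u \<omega>) v)) \<partial>lborel)"
          by (simp only: mult.assoc mult.left_commute)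
      qed
      also have "\<dots> = (\<integral>\<^sup>+v. \<integral>\<^sup>+\<omega>. indicator {0..} v * (indicator {\<omega>. alive (pth x \<omega>) u} \<omega> * \<phi> (clk (pth x \<omega>) u) * (ennreal (rho (x + W u \<omega>)) * ?K (x + W u \<omega>) v)) \<partial>M \<partial>lborel)"
        by (rule P.Fubini') measurable
      also have "\<dots> = (\<integral>\<^sup>+v. indicator {0..} v * (\<integral>\<^sup>+\<omega>. ?T u v \<omega> \<partial>M) \<partial>lborel)"
      proof (rule nn_integral_cong)
        fix v :: real
        show "(\<integral>\<^sup>+\<omega>. indicator {0..} v * (indicator {\<omega>. alive (pth x \<omega>) u} \<omega> * \<phi> (clk (pth x \<omega>) u) * (ennreal (rho (x + W u \<omega>)) * ?K (x + W u \<omega>) v)) \<partial>M)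
           = indicator {0..} v * (\<integral>\<^sup>+\<omega>. ?T u v \<omega> \<partial>M)"
        proof (cases "v \<ge> 0")
          case True
          have "(\<integral>\<^sup>+\<omega>. indicator {\<omega>. alive (pth x \<omega>) u} \<omega> * \<phi> (clk (pth x \<omega>) u) * (ennreal (rho (x + W u \<omega>)) * ?K (x + W u \<omega>) v) \<partial>M) = (\<integral>\<^sup>+\<omega>. ?T u v \<omega> \<partial>M)"
            by (rule Markov_killed[OF _ _ _ _ u True, where m = "\<lambda>y. ennreal (rho y)" and k = "\<lambda>y. k y * ennreal (rho y)"]) measurable
          then show ?thesis using True by simp
        qed simp
      qed
      finally show ?thesis .
    qed
    have "(\<integral>\<^sup>+u. indicator {0..} u * (?g x * ?E \<phi> ?S u x) \<partial>lborel) = (\<integral>\<^sup>+u. ?g x * (indicator {0..} u * (\<integral>\<^sup>+v. indicator {0..} v * (\<integral>\<^sup>+\<omega>. ?T u v \<omega> \<partial>M) \<partial>lborel)) \<partial>lborel)"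
    proof (rule nn_integral_cong)
      fix u :: real
      show "indicator {0..} u * (?g x * ?E \<phi> ?S u x) = ?g x * (indicator {0..} u * (\<integral>\<^sup>+v. indicator {0..} v * (\<integral>\<^sup>+\<omega>. ?T u v \<omega> \<partial>M) \<partial>lborel))"
      proof (cases "u \<ge> 0")
        case True
        show ?thesis unfolding ES[OF True] by (simp only: mult.left_commute)
      qed simp
    qed
    also have "\<dots> = ?g x * (\<integral>\<^sup>+u. indicator {0..} u * (\<integral>\<^sup>+v. indicator {0..} v * (\<integral>\<^sup>+\<omega>. ?T u v \<omega> \<partial>M) \<partial>lborel) \<partial>lborel)"
      by (rule nn_integral_cmult) measurable
    also have "(\<integral>\<^sup>+u. indicator {0..} u * (\<integral>\<^sup>+v. indicator {0..} v * (\<integral>\<^sup>+\<omega>. ?T u v \<omega> \<partial>M) \<partial>lborel) \<partial>lborel)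
       = (\<integral>\<^sup>+u. \<integral>\<^sup>+\<omega>. indicator {0..} u * (\<integral>\<^sup>+v. indicator {0..} v * ?T u v \<omega> \<partial>lborel) \<partial>M \<partial>lborel)"
    proof (rule nn_integral_cong)
      fix u :: real
      have "(\<integral>\<^sup>+v. indicator {0..} v * (\<integral>\<^sup>+\<omega>. ?T u v \<omega> \<partial>M) \<partial>lborel) = (\<integral>\<^sup>+v. \<integral>\<^sup>+\<omega>. indicator {0..} v * ?T u v \<omega> \<partial>M \<partial>lborel)"
        by (rule nn_integral_cong, rule nn_integral_cmult[symmetric]) measurable
      also have "\<dots> = (\<integral>\<^sup>+\<omega>. \<integral>\<^sup>+v. indicator {0..} v * ?T u v \<omega> \<partial>lborel \<partial>M)"
        by (rule P.Fubini'[symmetric]) measurable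
      finally have "indicator {0..} u * (\<integral>\<^sup>+v. indicator {0..} v * (\<integral>\<^sup>+\<omega>. ?T u v \<omega> \<partial>M) \<partial>lborel) = indicator {0..} u * (\<integral>\<^sup>+\<omega>. \<integral>\<^sup>+v. indicator {0..} v * ?T u v \<omega> \<partial>lborel \<partial>M)"
        by (rule arg_cong)
      also have "\<dots> = (\<integral>\<^sup>+\<omega>. indicator {0..} u * (\<integral>\<^sup>+v. indicator {0..} v * ?T u v \<omega> \<partial>lborel) \<partial>M)"
        by (rule nn_integral_cmult[symmetric]) measurable
      finally show "indicator {0..} u * (\<integral>\<^sup>+v. indicator {0..} v * (\<integral>\<^sup>+\<omega>. ?T u v \<omega> \<partial>M) \<partial>lborel) = (\<integral>\<^sup>+\<omega>. indicator {0..} u * (\<integral>\<^sup>+v. indicator {0..} v * ?T u v \<omega> \<partial>lborel) \<partial>M)" .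
    qed
    also have "\<dots> = (\<integral>\<^sup>+\<omega>. \<integral>\<^sup>+u. indicator {0..} u * (\<integral>\<^sup>+v. indicator {0..} v * ?T u v \<omega> \<partial>lborel) \<partial>lborel \<partial>M)"
      by (rule P.Fubini'[symmetric]) measurable
    also have "\<dots> = (\<integral>\<^sup>+\<omega>. \<integral>\<^sup>+t. indicator {0..} t * (\<phi> t * (\<integral>\<^sup>+s. indicator {0..} s * (\<psi> s *
        (indicator {\<omega>. alive_tc (pth x \<omega>) (t + s)} \<omega> * k (tc (pth x \<omega>) (t + s)))) \<partial>lborel)) \<partial>lborel \<partial>M)"
      by (rule nn_integral_cong, rule two_time_substitution) measurable
    also have "\<dots> = (\<integral>\<^sup>+t. \<integral>\<^sup>+\<omega>. indicator {0..} t * (\<phi> t * (\<integral>\<^sup>+s. indicator {0..} s * (\<psi> s *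
        (indicator {\<omega>. alive_tc (pth x \<omega>) (t + s)} \<omega> * k (tc (pth x \<omega>) (t + s)))) \<partial>lborel)) \<partial>M \<partial>lborel)"
      by (rule P.Fubini') measurable
    also have "\<dots> = (\<integral>\<^sup>+t. indicator {0..} t * (\<phi> t * (\<integral>\<^sup>+s. indicator {0..} s * (\<psi> s * Pn (t + s) k x) \<partial>lborel)) \<partial>lborel)"
    proof (rule nn_integral_cong)
      fix t :: real
      let ?p = "\<lambda>s \<omega>. indicator {\<omega>. alive_tc (pth x \<omega>) (t + s)} \<omega> * k (tc (pth x \<omega>) (t + s))"
      have "(\<integral>\<^sup>+\<omega>. \<integral>\<^sup>+s. indicator {0..} s * (\<psi> s * ?p s \<omega>) \<partial>lborel \<partial>M) = (\<integral>\<^sup>+s. \<integral>\<^sup>+\<omega>. indicator {0..} s * (\<psi> s * ?p s \<omega>) \<partial>M \<partial>lborel)"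
        by (rule P.Fubini') measurable
      also have "\<dots> = (\<integral>\<^sup>+s. indicator {0..} s * (\<psi> s * Pn (t + s) k x) \<partial>lborel)"
        unfolding Pn_def by (simp add: nn_integral_cmult)
      finally have *: "(\<integral>\<^sup>+\<omega>. \<integral>\<^sup>+s. indicator {0..} s * (\<psi> s * ?p s \<omega>) \<partial>lborel \<partial>M) = (\<integral>\<^sup>+s. indicator {0..} s * (\<psi> s * Pn (t + s) k x) \<partial>lborel)" .
      show "(\<integral>\<^sup>+\<omega>. indicator {0..} t * (\<phi> t * (\<integral>\<^sup>+s. indicator {0..} s * (\<psi> s * ?p s \<omega>) \<partial>lborel)) \<partial>M) = indicator {0..} t * (\<phi> t * (\<integral>\<^sup>+s. indicator {0..} s * (\<psi> s * Pn (t + s) k x) \<partial>lborel))"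
        unfolding *[symmetric] by (simp add: nn_integral_cmult)
    qed
    finally show "(\<integral>\<^sup>+u. indicator {0..} u * (?g x * ?E \<phi> ?S u x) \<partial>lborel) =
      ennreal (rho x) * (g x * (\<integral>\<^sup>+t. indicator {0..} t * (\<phi> t * (\<integral>\<^sup>+s. indicator {0..} s * (\<psi> s * Pn (t + s) k x) \<partial>lborel)) \<partial>lborel))"
      by (simp only: ac_simps)
  qed
  finally show ?thesis unfolding \<Sigma>_def .
qed

end

subsection \<open>Completeness of \<open>L\<^sup>2\<close> and a compactness criterion\<close>

lemma L2_norm_sq: "f \<in> square_integrable N \<Longrightarrow> (\<integral>\<^sup>+x. ennreal ((f x)\<^sup>2) \<partial>N) = ennreal ((L2_norm N f)\<^sup>2)"
  unfolding square_integrable_def L2_norm_def by (simp add: nn_integral_eq_integral)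

lemma square_integrableI:
  assumes "f \<in> borel_measurable N" "(\<integral>\<^sup>+x. ennreal ((f x)\<^sup>2) \<partial>N) < \<infinity>"
  shows "f \<in> square_integrable N"
  unfolding square_integrable_def using assms by (auto intro!: integrableI_nonneg)

lemma L2_norm_le:
  assumes "f \<in> square_integrable N" "(\<integral>\<^sup>+x. ennreal ((f x)\<^sup>2) \<partial>N) \<le> ennreal (c\<^sup>2)" "0 \<le> c"
  shows "L2_norm N f \<le> c"
proof -
  have "(L2_norm N f)\<^sup>2 \<le> c\<^sup>2" using assms by (simp add: L2_norm_sq)
  then show ?thesis using assms(3) by (simp add: power2_le_iff_abs_le)
qed

lemma L2_norm_nonneg: "0 \<le> L2_norm N f" by (simp add: L2_norm_def)

lemma L2_norm_cong_AE:
  assumes "f \<in> borel_measurable N" "g \<in> borel_measurable N" "AE x in N. f x = g x"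
  shows "L2_norm N f = L2_norm N g"
  unfolding L2_norm_def by (rule arg_cong[of _ _ sqrt], rule integral_cong_AE) (use assms in auto)

lemma L2_norm_minus_commute: "L2_norm N (\<lambda>x. f x - g x) = L2_norm N (\<lambda>x. g x - f x)"
  by (simp add: L2_norm_def power2_commute)

lemma L2_norm_diff_triangle:
  assumes "f \<in> square_integrable N" "g \<in> square_integrable N" "h \<in> square_integrable N"
  shows "L2_norm N (\<lambda>x. f x - h x) \<le> L2_norm N (\<lambda>x. f x - g x) + L2_norm N (\<lambda>x. g x - h x)"
  using L2_norm_triangle[OF square_integrable_diff[OF assms(1,2)] square_integrable_diff[OF assms(2,3)]] by simp

text \<open>Partial sums of the thresholds dominate each threshold; adding the index makes them
  strictly increasing.\<close>

lemma rapid_subsequence: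
  fixes P :: "nat \<Rightarrow> nat \<Rightarrow> nat \<Rightarrow> bool"
  assumes "\<And>k. \<exists>n0. \<forall>m\<ge>n0. \<forall>n\<ge>n0. P k m n"
  obtains r where "strict_mono r" "\<And>k m n. r k \<le> m \<Longrightarrow> r k \<le> n \<Longrightarrow> P k m n"
proof -
  obtain N where N: "\<And>k m n. N k \<le> m \<Longrightarrow> N k \<le> n \<Longrightarrow> P k m n"
    using choice[of "\<lambda>k n0. \<forall>m\<ge>n0. \<forall>n\<ge>n0. P k m n"] assms by blast
  define r where "r n = (\<Sum>i\<le>n. N i) + n" for n
  have "strict_mono r" by (rule strict_mono_Suc_iff[THEN iffD2]) (simp add: r_def)
  moreover have "N k \<le> r k" for k unfolding r_def by (cases k) auto
  ultimately show thesis using N le_trans by (intro that[of r]) blast+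
qed

text \<open>The squared increments have integrals at most 4^(-n), so even with weights 2^n their
  series is integrable and hence finite almost everywhere. This works on any measure space, without
  passing through L^1.\<close>

lemma AE_convergent_of_L2_summable:
  assumes f: "\<And>n. f n \<in> square_integrable N"
    and d: "\<And>n. L2_norm N (\<lambda>x. f (Suc n) x - f n x) \<le> (1/2) ^ n"
  shows "AE x in N. convergent (\<lambda>n. f n x)"
proof -
  have [measurable]: "f n \<in> borel_measurable N" for n using f by (rule square_integrable_measurable)
  let ?d = "\<lambda>n x. f (Suc n) x - f n x"
  have "(\<integral>\<^sup>+x. (\<Sum>n. ennreal (2 ^ n * (?d n x)\<^sup>2)) \<partial>N) = (\<Sum>n. \<integral>\<^sup>+x. ennreal (2 ^ n * (?d n x)\<^sup>2) \<partial>N)"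
    by (rule nn_integral_suminf) measurable
  also have "\<dots> \<le> (\<Sum>n. ennreal ((1/2) ^ n))"
  proof (rule suminf_le)
    fix n
    have "(\<integral>\<^sup>+x. ennreal (2 ^ n * (?d n x)\<^sup>2) \<partial>N) = ennreal (2 ^ n) * ennreal ((L2_norm N (?d n))\<^sup>2)"
      using L2_norm_sq[OF square_integrable_diff[OF f f]] by (simp add: ennreal_mult nn_integral_cmult)
    also have "\<dots> \<le> ennreal (2 ^ n) * ennreal (((1/2) ^ n)\<^sup>2)"
      using d[of n] L2_norm_nonneg by (intro mult_left_mono ennreal_leI power_mono) auto
    also have "\<dots> = ennreal ((1/2) ^ n)"
      by (simp add: ennreal_mult[symmetric] power2_eq_square power_one_over)
    finally show "(\<integral>\<^sup>+x. ennreal (2 ^ n * (?d n x)\<^sup>2) \<partial>N) \<le> ennreal ((1/2) ^ n)" .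
  qed auto
  also have "\<dots> < \<infinity>" by (subst suminf_ennreal2) (auto simp: summable_geometric)
  finally have "AE x in N. (\<Sum>n. ennreal (2 ^ n * (?d n x)\<^sup>2)) \<noteq> \<infinity>"
    by (intro nn_integral_PInf_AE) auto
  then show ?thesis
  proof eventually_elim
    case (elim x)
    have "summable (\<lambda>n. 2 ^ n * (?d n x)\<^sup>2)"
      using elim by (intro summable_suminf_not_top) auto
    then have "summable (\<lambda>n. (1/2) ^ n + 2 ^ n * (?d n x)\<^sup>2)"
      by (intro summable_add summable_geometric) auto
    moreover have "norm (?d n x) \<le> (1/2) ^ n + 2 ^ n * (?d n x)\<^sup>2" for n
    proof -
      \<comment> \<open>Arithmetic-geometric mean inequality: with the weight 2^n the increment is
        dominated by a sum of two summable terms.\<close>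
      have "0 \<le> (1/2) ^ n * (1 - 2 ^ n * \<bar>?d n x\<bar>)\<^sup>2" by simp
      also have "\<dots> = (1/2) ^ n + 2 ^ n * (?d n x)\<^sup>2 - 2 * \<bar>?d n x\<bar>"
        by (simp add: power2_eq_square field_simps power_one_over)
      finally show ?thesis by (simp add: abs_if split: if_splits)
    qed
    ultimately have "summable (\<lambda>n. ?d n x)" by (rule summable_comparison_test'[where N = 0])
    then have "convergent (\<lambda>n. \<Sum>i<n. ?d i x)" by (simp add: summable_iff_convergent)
    then have "convergent (\<lambda>n. (\<Sum>i<n. ?d i x) + f 0 x)" by (intro convergent_add convergent_const)
    moreover have "(\<Sum>i<n. ?d i x) + f 0 x = f n x" for n by (induction n) auto
    ultimately show ?case by simp
  qed
qed

text \<open>Riesz-Fischer: a rapidly Cauchy subsequence of representatives converges almost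
  everywhere, and Fatou passes its Cauchy estimate to the limit. Completeness is what turns total
  boundedness of the image into compact closure.\<close>

lemma L2_mcomplete: "Metric_space.mcomplete (L2_space N) (L2_dist N)"
proof -
  interpret L: Metric_space "L2_space N" "L2_dist N" by (rule Metric_space_L2)
  show ?thesis unfolding L.mcomplete_def
  proof (intro allI impI)
    fix F :: "nat \<Rightarrow> ('a \<Rightarrow> real) set" assume F: "L.MCauchy F"
    have "\<exists>f. f \<in> square_integrable N \<and> F n = L2_class N f" for n
    proof -
      have "F n \<in> L2_space N" using F unfolding L.MCauchy_def by auto
      then show ?thesis by (rule L2_space_cases) auto
    qed
    then obtain f where f: "\<And>n. f n \<in> square_integrable N" "\<And>n. F n = L2_class N (f n)"
      using choice[of "\<lambda>n f. f \<in> square_integrable N \<and> F n = L2_class N f"] by blast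
    have cauchy: "\<exists>n0. \<forall>m\<ge>n0. \<forall>n\<ge>n0. L2_norm N (\<lambda>x. f m x - f n x) < (1/2) ^ k" for k :: nat
    proof -
      have "0 < (1/2::real) ^ k" by simp
      then obtain n0 where "\<And>m n. n0 \<le> m \<Longrightarrow> n0 \<le> n \<Longrightarrow> L2_dist N (F m) (F n) < (1/2) ^ k"
        using F unfolding L.MCauchy_def by blast
      then show ?thesis unfolding f(2) L2_dist_class[OF f(1) f(1)] by blast
    qed
    obtain r where r: "strict_mono r" "\<And>k m n. r k \<le> m \<Longrightarrow> r k \<le> n \<Longrightarrow> L2_norm N (\<lambda>x. f m x - f n x) < (1/2) ^ k"
      using rapid_subsequence[of "\<lambda>k m n. L2_norm N (\<lambda>x. f m x - f n x) < (1/2) ^ k"] cauchy by blast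
    have r_le: "r k \<le> r n" if "k \<le> n" for k n using r(1) that by (simp add: strict_mono_less_eq)
    have ae: "AE x in N. convergent (\<lambda>n. f (r n) x)"
      using r(2) r_le by (intro AE_convergent_of_L2_summable f less_imp_le) auto
    define g where "g x = lim (\<lambda>n. f (r n) x)" for x
    have [measurable]: "f n \<in> borel_measurable N" for n using f(1) by (rule square_integrable_measurable)
    have [measurable]: "g \<in> borel_measurable N" unfolding g_def by measurable
    have lim: "AE x in N. (\<lambda>n. f (r n) x) \<longlonglongrightarrow> g x"
      using ae by eventually_elim (simp add: g_def convergent_LIMSEQ_iff)
    have bound: "(\<integral>\<^sup>+x. ennreal ((f (r k) x - g x)\<^sup>2) \<partial>N) \<le> ennreal (((1/2) ^ k)\<^sup>2)" for k
    proof -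
      have "(\<integral>\<^sup>+x. ennreal ((f (r k) x - g x)\<^sup>2) \<partial>N) = (\<integral>\<^sup>+x. liminf (\<lambda>n. ennreal ((f (r k) x - f (r n) x)\<^sup>2)) \<partial>N)"
      proof (rule nn_integral_cong_AE, use lim in eventually_elim)
        fix x assume "(\<lambda>n. f (r n) x) \<longlonglongrightarrow> g x"
        then have "(\<lambda>n. ennreal ((f (r k) x - f (r n) x)\<^sup>2)) \<longlonglongrightarrow> ennreal ((f (r k) x - g x)\<^sup>2)"
          by (intro tendsto_ennrealI tendsto_power tendsto_diff tendsto_const)
        then show "ennreal ((f (r k) x - g x)\<^sup>2) = liminf (\<lambda>n. ennreal ((f (r k) x - f (r n) x)\<^sup>2))"
          by (rule lim_imp_Liminf[OF trivial_limit_sequentially, symmetric])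
      qed
      also have "\<dots> \<le> liminf (\<lambda>n. \<integral>\<^sup>+x. ennreal ((f (r k) x - f (r n) x)\<^sup>2) \<partial>N)"
        by (rule nn_integral_liminf) measurable
      also have "\<dots> \<le> limsup (\<lambda>n. \<integral>\<^sup>+x. ennreal ((f (r k) x - f (r n) x)\<^sup>2) \<partial>N)"
        by (rule Liminf_le_Limsup) simp
      also have "\<dots> \<le> ennreal (((1/2) ^ k)\<^sup>2)"
      proof (rule Limsup_bounded)
        show "\<forall>\<^sub>F n in sequentially. (\<integral>\<^sup>+x. ennreal ((f (r k) x - f (r n) x)\<^sup>2) \<partial>N) \<le> ennreal (((1/2) ^ k)\<^sup>2)"
          using eventually_ge_at_top[of k]
        proof eventually_elim
          case (elim n)
          show ?case
            unfolding L2_norm_sq[OF square_integrable_diff[OF f(1) f(1)]]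
            using r(2)[of k "r k" "r n"] r_le[OF elim] L2_norm_nonneg by (intro ennreal_leI power_mono) (auto intro: less_imp_le)
        qed
      qed
      finally show ?thesis .
    qed
    have D: "(\<lambda>x. f (r k) x - g x) \<in> square_integrable N" for k
      using bound[of k] by (intro square_integrableI) (auto intro: le_less_trans)
    have g: "g \<in> square_integrable N"
      using square_integrable_diff[OF f(1) D, of "r 0" 0] by simp
    have "limitin L.mtopology (F \<circ> r) (L2_class N g) sequentially"
      unfolding L.limit_metric_sequentially
    proof (intro conjI allI impI)
      have cl: "L2_class N h \<in> L2_space N" if "h \<in> square_integrable N" for h
        using that unfolding L2_class_def L2_space_def by (rule quotientI)
      show "L2_class N g \<in> L2_space N" by (rule cl[OF g])
      fix e :: real assume "0 < e"
      then obtain k where k: "(1/2) ^ k < e" using real_arch_pow_inv[of e "1/2"] by auto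
      show "\<exists>n0. \<forall>n\<ge>n0. (F \<circ> r) n \<in> L2_space N \<and> L2_dist N ((F \<circ> r) n) (L2_class N g) < e"
      proof (intro exI[of _ k] allI impI conjI)
        fix n assume n: "k \<le> n"
        show "(F \<circ> r) n \<in> L2_space N" using cl[OF f(1)] by (simp add: f(2))
        have "L2_norm N (\<lambda>x. f (r n) x - g x) \<le> (1/2) ^ n" by (rule L2_norm_le[OF D bound]) simp
        also have "\<dots> \<le> (1/2) ^ k" using n by (intro power_decreasing) auto
        finally show "L2_dist N ((F \<circ> r) n) (L2_class N g) < e"
          using k by (simp add: f(2) L2_dist_class[OF f(1) g])
      qed
    qed
    then show "\<exists>G. limitin L.mtopology F G sequentially"
      using L.MCauchy_convergent_subsequence[OF F r(1)] by blast
  qed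
qed

text \<open>Contractivity allows inputs to be replaced by elements of the dense set \<open>D\<close>
  at small cost. The radius 2 instead of 1 makes room for the approximation error, which is at most
  1.\<close>

lemma compact_operator_on_L2I:
  assumes lin: "acts_linearly_on_L2 N T"
    and contr: "\<And>f. f \<in> square_integrable N \<Longrightarrow> L2_norm N (T f) \<le> L2_norm N f"
    and D: "D \<subseteq> square_integrable N"
    and dense: "\<And>f e. f \<in> square_integrable N \<Longrightarrow> 0 < e \<Longrightarrow> \<exists>g\<in>D. L2_norm N (\<lambda>x. f x - g x) < e"
    and sub: "\<And>g. (\<And>n::nat. g n \<in> D) \<Longrightarrow> (\<And>n. L2_norm N (g n) \<le> 2) \<Longrightarrow>
      \<exists>r::nat \<Rightarrow> nat. strict_mono r \<and> (\<forall>e>0. \<exists>n0. \<forall>m\<ge>n0. \<forall>n\<ge>n0. L2_norm N (\<lambda>x. T (g (r m)) x - T (g (r n)) x) < e)"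
  shows "compact_operator_on_L2 N T"
proof -
  interpret L: Metric_space "L2_space N" "L2_dist N" by (rule Metric_space_L2)
  let ?S = "(\<lambda>f. L2_class N (T f)) ` {f \<in> square_integrable N. L2_norm N f \<le> 1}"
  have T: "T f \<in> square_integrable N" if "f \<in> square_integrable N" for f
    using lin that by (simp add: acts_linearly_on_L2_def)
  have Tdiff: "L2_norm N (\<lambda>x. T f x - T g x) \<le> L2_norm N (\<lambda>x. f x - g x)"
    if fg: "f \<in> square_integrable N" "g \<in> square_integrable N" for f g
  proof -
    have "AE x in N. T (\<lambda>y. 1 * f y + (- 1) * g y) x = 1 * T f x + (- 1) * T g x"
      using lin fg unfolding acts_linearly_on_L2_def by blast
    then have "L2_norm N (\<lambda>x. T f x - T g x) = L2_norm N (T (\<lambda>y. f y - g y))"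
      by (intro L2_norm_cong_AE square_integrable_measurable square_integrable_diff T fg) auto
    also have "\<dots> \<le> L2_norm N (\<lambda>x. f x - g x)" by (intro contr square_integrable_diff fg)
    finally show ?thesis .
  qed
  have "L.mtotally_bounded ?S"
    unfolding L.mtotally_bounded_sequentially
  proof (intro conjI allI impI)
    have cl: "L2_class N h \<in> L2_space N" if "h \<in> square_integrable N" for h
      using that unfolding L2_class_def L2_space_def by (rule quotientI)
    then show S: "?S \<subseteq> L2_space N" using T by auto
    fix F :: "nat \<Rightarrow> ('a \<Rightarrow> real) set" assume F: "range F \<subseteq> ?S"
    then have "\<exists>f. f \<in> square_integrable N \<and> L2_norm N f \<le> 1 \<and> F n = L2_class N (T f)" for n by auto
    then obtain f where f: "\<And>n. f n \<in> square_integrable N" "\<And>n. L2_norm N (f n) \<le> 1" "\<And>n. F n = L2_class N (T (f n))"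
      using choice[of "\<lambda>n f. f \<in> square_integrable N \<and> L2_norm N f \<le> 1 \<and> F n = L2_class N (T f)"] by blast
    have "\<exists>g. g \<in> D \<and> L2_norm N (\<lambda>x. f n x - g x) < inverse (real (Suc n))" for n
      using dense[OF f(1)[of n], of "inverse (real (Suc n))"] by auto
    then obtain g where g: "\<And>n. g n \<in> D" "\<And>n. L2_norm N (\<lambda>x. f n x - g n x) < inverse (real (Suc n))"
      using choice[of "\<lambda>n g. g \<in> D \<and> L2_norm N (\<lambda>x. f n x - g x) < inverse (real (Suc n))"] by blast
    have gsq: "g n \<in> square_integrable N" for n using g(1) D by blast
    have g2: "L2_norm N (g n) \<le> 2" for n
    proof -
      have "L2_norm N (g n) \<le> L2_norm N (\<lambda>x. g n x - f n x) + L2_norm N (f n)"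
        using L2_norm_triangle[OF square_integrable_diff[OF gsq f(1)] f(1), of n n n] by simp
      moreover have "inverse (real (Suc n)) \<le> 1" by (simp add: inverse_eq_divide)
      ultimately show ?thesis using g(2)[of n] f(2)[of n] by (simp add: L2_norm_minus_commute[of N "g n"])
    qed
    from sub[where g = g, OF g(1) g2] obtain r :: "nat \<Rightarrow> nat" where r: "strict_mono r"
      "\<forall>e>0. \<exists>n0. \<forall>m\<ge>n0. \<forall>n\<ge>n0. L2_norm N (\<lambda>x. T (g (r m)) x - T (g (r n)) x) < e"
      by (elim exE conjE)
    have "L.MCauchy (F \<circ> r)"
      unfolding L.MCauchy_def
    proof (intro conjI allI impI)
      show "range (F \<circ> r) \<subseteq> L2_space N" using F S by auto
      fix e :: real assume e: "0 < e"
      then obtain n0 where n0: "\<And>m n. n0 \<le> m \<Longrightarrow> n0 \<le> n \<Longrightarrow> L2_norm N (\<lambda>x. T (g (r m)) x - T (g (r n)) x) < e / 3"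
        using r(2)[rule_format, of "e / 3"] by auto
      obtain k where k: "inverse (real (Suc k)) < e / 3" using reals_Archimedean[of "e / 3"] e by auto
      have near: "L2_norm N (\<lambda>x. T (f (r n)) x - T (g (r n)) x) < e / 3" if "k \<le> n" for n
      proof -
        have "k \<le> r n" using that seq_suble[OF r(1), of n] by simp
        then have "inverse (real (Suc (r n))) \<le> inverse (real (Suc k))" by (intro le_imp_inverse_le) auto
        then show ?thesis using Tdiff[OF f(1) gsq, of "r n" "r n"] g(2)[of "r n"] k by linarith
      qed
      show "\<exists>N'. \<forall>n n'. N' \<le> n \<longrightarrow> N' \<le> n' \<longrightarrow> L2_dist N ((F \<circ> r) n) ((F \<circ> r) n') < e"
      proof (intro exI[of _ "max n0 k"] allI impI)
        fix m n assume mn: "max n0 k \<le> m" "max n0 k \<le> n"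
        have "L2_norm N (\<lambda>x. T (f (r m)) x - T (f (r n)) x)
            \<le> L2_norm N (\<lambda>x. T (f (r m)) x - T (g (r m)) x) + L2_norm N (\<lambda>x. T (g (r m)) x - T (f (r n)) x)"
          by (intro L2_norm_diff_triangle T f gsq)
        also have "L2_norm N (\<lambda>x. T (g (r m)) x - T (f (r n)) x)
            \<le> L2_norm N (\<lambda>x. T (g (r m)) x - T (g (r n)) x) + L2_norm N (\<lambda>x. T (g (r n)) x - T (f (r n)) x)"
          by (intro L2_norm_diff_triangle T f gsq)
        finally show "L2_dist N ((F \<circ> r) m) ((F \<circ> r) n) < e"
          using near[of m] near[of n] n0[of m n] mn
          by (simp add: f(3) L2_dist_class T f(1) L2_norm_minus_commute[of N "T (g (r n))"])
      qed
    qed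
    then show "\<exists>r. strict_mono r \<and> L.MCauchy (F \<circ> r)" using r(1) by blast
  qed
  then have "compactin (L2_topology N) (L2_topology N closure_of ?S)"
    using L.mtotally_bounded_eq_compact_closure_of[OF L2_mcomplete] by blast
  then show ?thesis using lin by (simp add: compact_operator_on_L2_def)
qed

subsection \<open>The killed semigroup on \<open>L\<^sup>2\<close>\<close>

text \<open>The test function is the normalised indicator of a short interval after t. Rescaling it
  to (0, 1) puts the shrinking into the argument of \<open>G\<close>, which is approached strictly
  from the right, as right continuity in time demands.\<close>

lemma nn_integral_average:
  fixes G :: "real \<Rightarrow> ennreal"
  assumes [measurable]: "G \<in> borel_measurable borel" and t: "0 \<le> t"
  shows "(\<integral>\<^sup>+r. indicator {0..} r * (ennreal (real (Suc n)) * indicator {t<..<t + 1 / real (Suc n)} r * G r) \<partial>lborel) =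
    (\<integral>\<^sup>+a. indicator {0<..<1} a * G (t + a / real (Suc n)) \<partial>lborel)"
proof -
  let ?c = "1 / real (Suc n)"
  let ?F = "\<lambda>r. indicator {0..} r * (ennreal (real (Suc n)) * indicator {t<..<t + ?c} r * G r)"
  have eq: "?F (t + ?c * a) = ennreal (real (Suc n)) * (indicator {0<..<1} a * G (t + a / real (Suc n)))" for a
  proof -
    have "(t < t + ?c * a \<and> t + ?c * a < t + ?c) \<longleftrightarrow> 0 < a \<and> a < 1"
      by (auto simp: zero_less_divide_iff divide_less_cancel)
    moreover have "0 < a \<Longrightarrow> 0 \<le> t + ?c * a" using t by simp
    ultimately show ?thesis by (auto simp: indicator_def)
  qed
  have "(\<integral>\<^sup>+r. ?F r \<partial>lborel) = ennreal \<bar>?c\<bar> * (\<integral>\<^sup>+a. ?F (t + ?c * a) \<partial>lborel)"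
    by (rule nn_integral_real_affine) (auto simp del: of_nat_Suc)
  also have "\<dots> = ennreal ?c * (ennreal (real (Suc n)) * (\<integral>\<^sup>+a. indicator {0<..<1} a * G (t + a / real (Suc n)) \<partial>lborel))"
    unfolding eq by (subst nn_integral_cmult) (auto simp del: of_nat_Suc)
  also have "\<dots> = (\<integral>\<^sup>+a. indicator {0<..<1} a * G (t + a / real (Suc n)) \<partial>lborel)"
    by (simp add: mult.assoc[symmetric] ennreal_mult[symmetric] del: of_nat_Suc)
  finally show ?thesis .
qed

locale stable_speed = stable_clock M W \<alpha> \<sigma>
  for M :: "'a measure" and W :: "real \<Rightarrow> 'a \<Rightarrow> real" and \<alpha> :: real and \<sigma> :: "real \<Rightarrow> real" +
  assumes mu_prob: "prob_space (speed_measure \<sigma> \<alpha>)"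
    and I_finite: "(\<integral>\<^sup>+x. ennreal (\<sigma> x powr (- \<alpha>) * \<bar>x\<bar> powr (\<alpha> - 1)) \<partial>lborel) < \<infinity>"
begin

abbreviation mu :: "real measure" where "mu \<equiv> speed_measure \<sigma> \<alpha>"

lemma mu_eq: "mu = density lborel (\<lambda>x. ennreal (rho x))"
  by (simp add: speed_measure_def rho_def)

sublocale mu: prob_space mu by (rule mu_prob)

lemma sets_mu [simp, measurable_cong]: "sets mu = sets borel" by (simp add: mu_eq)

lemma space_mu [simp]: "space mu = UNIV" by (simp add: mu_eq)

lemma nn_integral_mu:
  "f \<in> borel_measurable borel \<Longrightarrow> (\<integral>\<^sup>+x. f x \<partial>mu) = (\<integral>\<^sup>+x. ennreal (rho x) * f x \<partial>lborel)"
  unfolding mu_eq by (intro nn_integral_density) auto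

text \<open>Where the expectation does not exist this is 0 by convention; for square integrable
  \<open>f\<close> such starting points are null by \<open>PT_integrable_AE\<close>.\<close>

definition PT :: "real \<Rightarrow> (real \<Rightarrow> real) \<Rightarrow> real \<Rightarrow> real" where
  "PT t f x = (\<integral>\<omega>. (if alive_tc (pth x \<omega>) t then f (tc (pth x \<omega>) t) else 0) \<partial>M)"

lemma PT_measurable [measurable (raw)]:
  assumes [measurable]: "f \<in> borel_measurable borel" "t \<in> borel_measurable N" "x \<in> borel_measurable N"
  shows "(\<lambda>z. PT (t z) f (x z)) \<in> borel_measurable N"
  unfolding PT_def by measurable

lemma PT_integrable:
  fixes f :: "real \<Rightarrow> real"
  assumes [measurable]: "f \<in> borel_measurable borel" and B: "\<And>y. \<bar>f y\<bar> \<le> B"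
  shows "integrable M (\<lambda>\<omega>. if alive_tc (pth x \<omega>) t then f (tc (pth x \<omega>) t) else 0)"
proof (rule Bochner_Integration.integrable_bound[where f = "\<lambda>_. B"])
  have "0 \<le> B" using B[of 0] by simp
  then show "AE \<omega> in M. norm (if alive_tc (pth x \<omega>) t then f (tc (pth x \<omega>) t) else 0) \<le> norm B"
    using B by (intro AE_I2) auto
qed auto

lemma PT_bound:
  assumes [measurable]: "f \<in> borel_measurable borel" and B: "\<And>y. \<bar>f y\<bar> \<le> B"
  shows "\<bar>PT t f x\<bar> \<le> B"
proof -
  have B0: "0 \<le> B" using B[of 0] by simp
  have "\<bar>PT t f x\<bar> \<le> (\<integral>\<omega>. \<bar>if alive_tc (pth x \<omega>) t then f (tc (pth x \<omega>) t) else 0\<bar> \<partial>M)"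
    unfolding PT_def by (rule integral_abs_bound)
  also have "\<dots> \<le> (\<integral>\<omega>. B \<partial>M)"
    using PT_integrable[of f B x t] B B0 by (intro integral_mono) auto
  finally show ?thesis by (simp add: prob_space)
qed

lemma PT_diff:
  assumes [measurable]: "f \<in> borel_measurable borel" "g \<in> borel_measurable borel"
    and B: "\<And>y. \<bar>f y\<bar> \<le> B" "\<And>y. \<bar>g y\<bar> \<le> B"
  shows "PT t (\<lambda>y. f y - g y) x = PT t f x - PT t g x"
proof -
  have "PT t (\<lambda>y. f y - g y) x = (\<integral>\<omega>. (if alive_tc (pth x \<omega>) t then f (tc (pth x \<omega>) t) else 0) - (if alive_tc (pth x \<omega>) t then g (tc (pth x \<omega>) t) else 0) \<partial>M)"
    unfolding PT_def by (intro Bochner_Integration.integral_cong) auto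
  then show ?thesis unfolding PT_def
    using PT_integrable[OF assms(1) B(1)] PT_integrable[OF assms(2) B(2)] by simp
qed

lemma Pn_eq_PT:
  assumes [measurable]: "f \<in> borel_measurable borel" and B: "\<And>y. 0 \<le> f y" "\<And>y. f y \<le> B"
  shows "Pn t (\<lambda>y. ennreal (f y)) x = ennreal (PT t f x)"
proof -
  have "Pn t (\<lambda>y. ennreal (f y)) x = (\<integral>\<^sup>+\<omega>. ennreal (if alive_tc (pth x \<omega>) t then f (tc (pth x \<omega>) t) else 0) \<partial>M)"
    unfolding Pn_def by (intro nn_integral_cong) (auto simp: indicator_def)
  also have "\<dots> = ennreal (PT t f x)"
    unfolding PT_def using B PT_integrable[OF assms(1), of B] by (intro nn_integral_eq_integral) auto
  finally show ?thesis .
qed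

lemma PT_nonneg: "(\<And>y. 0 \<le> f y) \<Longrightarrow> 0 \<le> PT t f x"
  unfolding PT_def by (intro integral_nonneg_AE AE_I2) auto

lemma PT_right_continuous:
  assumes f: "continuous_on UNIV f" and B: "\<And>y. \<bar>f y\<bar> \<le> B" and t: "0 \<le> t"
    and r: "r \<longlonglongrightarrow> t" "\<And>n. t < r n"
  shows "(\<lambda>n. PT (r n) f x) \<longlonglongrightarrow> PT t f x"
proof -
  have [measurable]: "f \<in> borel_measurable borel" using f by (rule borel_measurable_continuous_onI)
  have r': "filterlim r (at_right t) sequentially"
    unfolding filterlim_at using r by (auto intro!: always_eventually)
  have B0: "0 \<le> B" using B[of 0] by simp
  show ?thesis unfolding PT_def
  proof (rule integral_dominated_convergence[where w = "\<lambda>_. B"])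
    show "AE \<omega> in M. (\<lambda>n. if alive_tc (pth x \<omega>) (r n) then f (tc (pth x \<omega>) (r n)) else 0)
        \<longlonglongrightarrow> (if alive_tc (pth x \<omega>) t then f (tc (pth x \<omega>) t) else 0)"
      using filterlim_compose[OF killed_right_continuous[OF skorokhod_W t f] r'] by (intro AE_I2)
    show "AE \<omega> in M. norm (if alive_tc (pth x \<omega>) (r n) then f (tc (pth x \<omega>) (r n)) else 0) \<le> B" for n
      using B B0 by (intro AE_I2) auto
  qed auto
qed

lemma Pn_right_continuous:
  assumes f: "continuous_on UNIV f" and B: "\<And>y. 0 \<le> f y" "\<And>y. f y \<le> B" and t: "0 \<le> t"
    and r: "r \<longlonglongrightarrow> t" "\<And>n. t < r n"
  shows "(\<lambda>n. Pn (r n) (\<lambda>y. ennreal (f y)) x) \<longlonglongrightarrow> Pn t (\<lambda>y. ennreal (f y)) x"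
proof -
  have m: "f \<in> borel_measurable borel" using f by (rule borel_measurable_continuous_onI)
  show ?thesis unfolding Pn_eq_PT[OF m B]
    using B by (intro tendsto_ennrealI PT_right_continuous[OF f _ t r, of B]) simp
qed

lemma Pn_le:
  assumes [measurable]: "f \<in> borel_measurable borel" and B: "\<And>y. 0 \<le> f y" "\<And>y. f y \<le> B"
  shows "Pn t (\<lambda>y. ennreal (f y)) x \<le> ennreal B"
  unfolding Pn_eq_PT[OF assms] using PT_bound[OF assms(1), of B t x] B by (intro ennreal_leI) simp

text \<open>The tested identity is localised at given times by averaging over short time intervals.\<close>

lemma semigroup_symmetry_nonneg:
  assumes f: "continuous_on UNIV f" "\<And>y. 0 \<le> f y" "\<And>y. f y \<le> B"
    and h: "continuous_on UNIV h" "\<And>y. 0 \<le> h y" "\<And>y. h y \<le> B"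
    and t: "0 \<le> t" and s: "0 \<le> s"
  shows "(\<integral>\<^sup>+x. Pn t (\<lambda>y. ennreal (f y)) x * Pn s (\<lambda>y. ennreal (h y)) x \<partial>mu) =
    (\<integral>\<^sup>+x. ennreal (f x) * Pn (t + s) (\<lambda>y. ennreal (h y)) x \<partial>mu)"
proof -
  have fm [measurable]: "f \<in> borel_measurable borel" using f(1) by (rule borel_measurable_continuous_onI)
  have hm [measurable]: "h \<in> borel_measurable borel" using h(1) by (rule borel_measurable_continuous_onI)
  let ?f = "\<lambda>y. ennreal (f y)" and ?h = "\<lambda>y. ennreal (h y)"
  let ?I = "\<lambda>a::real. indicator {0<..<1} a :: ennreal"
  let ?d = "\<lambda>n a. a / real (Suc n)"
  have B0: "0 \<le> B" using f(2,3)[of 0] by simp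
  have I1: "(\<integral>\<^sup>+a. ?I a \<partial>lborel) = 1" by simp
  have d0: "(\<lambda>n. c + ?d n a) \<longlonglongrightarrow> c" for c a
    using tendsto_add[OF tendsto_const LIMSEQ_Suc[OF lim_const_over_n[of a]], of c] by simp
  have avg_lim: "(\<lambda>n. \<integral>\<^sup>+a. ?I a * Pn (c + ?d n a) (\<lambda>y. ennreal (g y)) x \<partial>lborel) \<longlonglongrightarrow> Pn c (\<lambda>y. ennreal (g y)) x"
    if g: "continuous_on UNIV g" "\<And>y. 0 \<le> g y" "\<And>y. g y \<le> B" and c: "0 \<le> c" for g c x
  proof -
    have gm [measurable]: "g \<in> borel_measurable borel" using g(1) by (rule borel_measurable_continuous_onI)
    have "(\<lambda>n. \<integral>\<^sup>+a. ?I a * Pn (c + ?d n a) (\<lambda>y. ennreal (g y)) x \<partial>lborel) \<longlonglongrightarrow>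
        (\<integral>\<^sup>+a. ?I a * Pn c (\<lambda>y. ennreal (g y)) x \<partial>lborel)"
    proof (rule nn_integral_dominated_convergence[where w = "\<lambda>a. ?I a * ennreal B"])
      show "AE a in lborel. ?I a * Pn (c + ?d n a) (\<lambda>y. ennreal (g y)) x \<le> ?I a * ennreal B" for n
        using Pn_le[OF gm g(2,3)] by (intro AE_I2 mult_left_mono) auto
      show "(\<integral>\<^sup>+a. ?I a * ennreal B \<partial>lborel) < \<infinity>"
        by (simp add: nn_integral_multc)
      show "AE a in lborel. (\<lambda>n. ?I a * Pn (c + ?d n a) (\<lambda>y. ennreal (g y)) x) \<longlonglongrightarrow> ?I a * Pn c (\<lambda>y. ennreal (g y)) x"
      proof (intro AE_I2)
        fix a :: real
        show "(\<lambda>n. ?I a * Pn (c + ?d n a) (\<lambda>y. ennreal (g y)) x) \<longlonglongrightarrow> ?I a * Pn c (\<lambda>y. ennreal (g y)) x"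
        proof (cases "0 < a")
          case True
          have "(\<lambda>n. Pn (c + ?d n a) (\<lambda>y. ennreal (g y)) x) \<longlonglongrightarrow> Pn c (\<lambda>y. ennreal (g y)) x"
            using True by (intro Pn_right_continuous[OF g c d0]) (simp del: of_nat_Suc)
          then show ?thesis using True by (cases "a < 1") (simp_all add: indicator_def del: of_nat_Suc)
        qed simp
      qed
    qed measurable
    then show ?thesis by (simp add: nn_integral_multc)
  qed
  let ?A = "\<lambda>n x. \<integral>\<^sup>+a. ?I a * Pn (t + ?d n a) ?f x \<partial>lborel"
  let ?B = "\<lambda>n x. \<integral>\<^sup>+b. ?I b * Pn (s + ?d n b) ?h x \<partial>lborel"
  let ?C = "\<lambda>n x. \<integral>\<^sup>+a. ?I a * (\<integral>\<^sup>+b. ?I b * Pn (t + ?d n a + (s + ?d n b)) ?h x \<partial>lborel) \<partial>lborel"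
  have fin: "Pn r (\<lambda>y. ennreal (g y)) x \<noteq> \<top>" if "g \<in> borel_measurable borel" "\<And>y. 0 \<le> g y" "\<And>y. g y \<le> B" for g r x
    using Pn_le[OF that, of r x] by (auto simp: top_unique)
  have avg_le: "(\<integral>\<^sup>+a. ?I a * H a \<partial>lborel) \<le> c" if "\<And>a. H a \<le> c" for H c
  proof -
    have "(\<integral>\<^sup>+a. ?I a * H a \<partial>lborel) \<le> (\<integral>\<^sup>+a. ?I a * c \<partial>lborel)" using that by (intro nn_integral_mono mult_left_mono) auto
    then show ?thesis by (simp add: nn_integral_multc)
  qed
  have eq: "(\<integral>\<^sup>+x. ?A n x * ?B n x \<partial>mu) = (\<integral>\<^sup>+x. ?f x * ?C n x \<partial>mu)" for n
  proof -
    let ?\<phi> = "\<lambda>c r. ennreal (real (Suc n)) * indicator {c<..<c + 1 / real (Suc n)} r"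
    have "(\<integral>\<^sup>+x. ?A n x * ?B n x \<partial>mu) = (\<integral>\<^sup>+x. ennreal (rho x) * ((\<integral>\<^sup>+r. indicator {0..} r * (?\<phi> t r * Pn r ?f x) \<partial>lborel) * (\<integral>\<^sup>+q. indicator {0..} q * (?\<phi> s q * Pn q ?h x) \<partial>lborel)) \<partial>lborel)"
      by (subst nn_integral_mu) (auto simp del: of_nat_Suc simp: nn_integral_average[OF _ t] nn_integral_average[OF _ s])
    also have "\<dots> = (\<integral>\<^sup>+x. ennreal (rho x) * (?f x * (\<integral>\<^sup>+r. indicator {0..} r * (?\<phi> t r * (\<integral>\<^sup>+q. indicator {0..} q * (?\<phi> s q * Pn (r + q) ?h x) \<partial>lborel)) \<partial>lborel)) \<partial>lborel)"
      by (rule semigroup_symmetry_tested) measurable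
    also have "\<dots> = (\<integral>\<^sup>+x. ?f x * ?C n x \<partial>mu)"
      by (subst nn_integral_mu) (auto simp del: of_nat_Suc simp: nn_integral_average[OF _ t] nn_integral_average[OF _ s])
    finally show ?thesis .
  qed
  have "(\<lambda>n. \<integral>\<^sup>+x. ?A n x * ?B n x \<partial>mu) \<longlonglongrightarrow> (\<integral>\<^sup>+x. Pn t ?f x * Pn s ?h x \<partial>mu)"
  proof (rule nn_integral_dominated_convergence[where w = "\<lambda>_. ennreal B * ennreal B"])
    show "AE x in mu. ?A n x * ?B n x \<le> ennreal B * ennreal B" for n
      by (intro AE_I2 mult_mono avg_le Pn_le fm f hm h) auto
    show "(\<integral>\<^sup>+x. ennreal B * ennreal B \<partial>mu) < \<infinity>" using mu.emeasure_space_1 by (simp add: ennreal_mult_less_top)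
    show "AE x in mu. (\<lambda>n. ?A n x * ?B n x) \<longlonglongrightarrow> Pn t ?f x * Pn s ?h x"
      using fin[OF fm f(2,3)] fin[OF hm h(2,3)] by (intro AE_I2 tendsto_mult_ennreal avg_lim f h t s) auto
  qed measurable
  moreover have "(\<lambda>n. \<integral>\<^sup>+x. ?f x * ?C n x \<partial>mu) \<longlonglongrightarrow> (\<integral>\<^sup>+x. ?f x * Pn (t + s) ?h x \<partial>mu)"
  proof (rule nn_integral_dominated_convergence[where w = "\<lambda>_. ennreal B * ennreal B"])
    show "AE x in mu. ?f x * ?C n x \<le> ennreal B * ennreal B" for n
      by (intro AE_I2 mult_mono avg_le Pn_le ennreal_leI f hm h) auto
    show "(\<integral>\<^sup>+x. ennreal B * ennreal B \<partial>mu) < \<infinity>" using mu.emeasure_space_1 by (simp add: ennreal_mult_less_top)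
    have C: "(\<lambda>n. ?C n x) \<longlonglongrightarrow> Pn (t + s) ?h x" for x
    proof -
      have "(\<lambda>n. ?C n x) \<longlonglongrightarrow> (\<integral>\<^sup>+a. ?I a * Pn (t + s) ?h x \<partial>lborel)"
      proof (rule nn_integral_dominated_convergence[where w = "\<lambda>a. ?I a * ennreal B"])
        show "AE a in lborel. ?I a * (\<integral>\<^sup>+b. ?I b * Pn (t + ?d n a + (s + ?d n b)) ?h x \<partial>lborel) \<le> ?I a * ennreal B" for n
          by (intro AE_I2 mult_left_mono avg_le Pn_le hm h) auto
        show "(\<integral>\<^sup>+a. ?I a * ennreal B \<partial>lborel) < \<infinity>" by (simp add: nn_integral_multc)
        show "AE a in lborel. (\<lambda>n. ?I a * (\<integral>\<^sup>+b. ?I b * Pn (t + ?d n a + (s + ?d n b)) ?h x \<partial>lborel)) \<longlonglongrightarrow> ?I a * Pn (t + s) ?h x"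
        proof (intro AE_I2)
          fix a :: real
          show "(\<lambda>n. ?I a * (\<integral>\<^sup>+b. ?I b * Pn (t + ?d n a + (s + ?d n b)) ?h x \<partial>lborel)) \<longlonglongrightarrow> ?I a * Pn (t + s) ?h x"
          proof (cases "0 < a \<and> a < 1")
            case True
            have "(\<lambda>n. \<integral>\<^sup>+b. ?I b * Pn (t + ?d n a + (s + ?d n b)) ?h x \<partial>lborel) \<longlonglongrightarrow> (\<integral>\<^sup>+b. ?I b * Pn (t + s) ?h x \<partial>lborel)"
            proof (rule nn_integral_dominated_convergence[where w = "\<lambda>b. ?I b * ennreal B"])
              show "AE b in lborel. ?I b * Pn (t + ?d n a + (s + ?d n b)) ?h x \<le> ?I b * ennreal B" for n
                by (intro AE_I2 mult_left_mono Pn_le hm h) auto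
              show "(\<integral>\<^sup>+b. ?I b * ennreal B \<partial>lborel) < \<infinity>" by (simp add: nn_integral_multc)
              show "AE b in lborel. (\<lambda>n. ?I b * Pn (t + ?d n a + (s + ?d n b)) ?h x) \<longlonglongrightarrow> ?I b * Pn (t + s) ?h x"
              proof (intro AE_I2)
                fix b :: real
                show "(\<lambda>n. ?I b * Pn (t + ?d n a + (s + ?d n b)) ?h x) \<longlonglongrightarrow> ?I b * Pn (t + s) ?h x"
                proof (cases "0 < b \<and> b < 1")
                  case b: True
                  have pos: "0 < ?d n a" "0 < ?d n b" for n using True b by (simp_all del: of_nat_Suc)
                  have "(\<lambda>n. Pn (t + ?d n a + (s + ?d n b)) ?h x) \<longlonglongrightarrow> Pn (t + s) ?h x"
                  proof (rule Pn_right_continuous[OF h])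
                    show "(\<lambda>n. t + ?d n a + (s + ?d n b)) \<longlonglongrightarrow> t + s" by (rule tendsto_add[OF d0 d0])
                    show "t + s < t + ?d n a + (s + ?d n b)" for n using pos[of n] by linarith
                  qed (use t s in auto)
                  then show ?thesis using b by simp
                qed auto
              qed
            qed measurable
            then show ?thesis using True by (simp add: nn_integral_multc)
          qed auto
        qed
      qed measurable
      then show ?thesis by (simp add: nn_integral_multc)
    qed
    show "AE x in mu. (\<lambda>n. ?f x * ?C n x) \<longlonglongrightarrow> ?f x * Pn (t + s) ?h x"
      using fin[OF hm h(2,3)] by (intro AE_I2 tendsto_mult_ennreal C tendsto_const) auto
  qed measurable
  ultimately show ?thesis unfolding eq by (rule LIMSEQ_unique)
qed

end

section \<open>From continuous to measurable functions: contraction\<close>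

text \<open>Indicators of open sets are limits of continuous functions of the distance to the
  complement; outer regularity of the finite measure passes the inequality to Borel sets, and then
  to integrals.\<close>

lemma nn_integral_le_of_continuous:
  fixes \<nu> \<mu> :: "real measure"
  assumes [measurable_cong]: "sets \<nu> = sets borel" "sets \<mu> = sets borel"
    and fin: "emeasure \<nu> UNIV \<noteq> \<infinity>" "emeasure \<mu> UNIV \<noteq> \<infinity>"
    and le: "\<And>k. continuous_on UNIV k \<Longrightarrow> (\<And>x. 0 \<le> k x) \<Longrightarrow> (\<And>x. k x \<le> 1) \<Longrightarrow>
      (\<integral>\<^sup>+x. ennreal (k x) \<partial>\<nu>) \<le> (\<integral>\<^sup>+x. ennreal (k x) \<partial>\<mu>)"
  shows "(\<integral>\<^sup>+x. f x \<partial>\<nu>) \<le> (\<integral>\<^sup>+x. f x \<partial>\<mu>)"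
proof -
  have sp [simp]: "space \<nu> = UNIV" "space \<mu> = UNIV" using assms(1,2) by (auto dest: sets_eq_imp_space_eq)
  have open_le: "emeasure \<nu> U \<le> emeasure \<mu> U" if U: "open U" for U
  \<comment> \<open>The complement is empty here and its \<open>infdist\<close> is 0 by convention,
    so the approximating functions would vanish.\<close>
  proof (cases "U = UNIV")
    case True
    then show ?thesis using le[of "\<lambda>_. 1"] by simp
  next
    case False
    have [measurable]: "U \<in> sets borel" using U by simp
    define k where "k n x = min 1 (real n * infdist x (- U))" for n x
    have k: "continuous_on UNIV (k n)" "0 \<le> k n x" "k n x \<le> 1" for n x
      unfolding k_def by (auto intro!: continuous_intros simp: infdist_nonneg)
    have k_le: "k n x \<le> indicator U x" for n x
      by (cases "x \<in> U") (auto simp: k_def)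
    have [measurable]: "k n \<in> borel_measurable borel" for n using k(1) by (rule borel_measurable_continuous_onI)
    have lim: "(\<lambda>n. k n x) \<longlonglongrightarrow> indicator U x" for x
    proof (cases "x \<in> U")
      case True
      have pos: "0 < infdist x (- U)" using False True U by (intro infdist_pos_not_in_closed) auto
      obtain N :: nat where N: "1 / infdist x (- U) < real N" using reals_Archimedean2 by blast
      have "k n x = 1" if n: "n \<ge> N" for n
      proof -
        have "1 \<le> real N * infdist x (- U)" using N pos by (simp add: field_simps)
        also have "\<dots> \<le> real n * infdist x (- U)" using n pos by (intro mult_right_mono) auto
        finally show ?thesis by (simp add: k_def)
      qed
      then have "\<forall>\<^sub>F n in sequentially. k n x = 1" by (auto simp: eventually_sequentially)
      then show ?thesis using True by (simp add: tendsto_eventually)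
    qed (simp add: k_def)
    have "(\<lambda>n. \<integral>\<^sup>+x. ennreal (k n x) \<partial>\<nu>) \<longlonglongrightarrow> (\<integral>\<^sup>+x. indicator U x \<partial>\<nu>)"
    proof (rule nn_integral_dominated_convergence[where w = "\<lambda>_. 1"])
      show "AE x in \<nu>. ennreal (k n x) \<le> 1" for n using ennreal_leI[OF k(3)[of n]] by simp
      show "AE x in \<nu>. (\<lambda>n. ennreal (k n x)) \<longlonglongrightarrow> indicator U x"
        using tendsto_ennrealI[OF lim] by (simp add: ennreal_indicator)
    qed (use fin in \<open>auto simp: less_top\<close>)
    then have "(\<lambda>n. \<integral>\<^sup>+x. ennreal (k n x) \<partial>\<nu>) \<longlonglongrightarrow> emeasure \<nu> U" by simp
    moreover have "(\<integral>\<^sup>+x. ennreal (k n x) \<partial>\<nu>) \<le> emeasure \<mu> U" for n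
    proof -
      have "(\<integral>\<^sup>+x. ennreal (k n x) \<partial>\<nu>) \<le> (\<integral>\<^sup>+x. ennreal (k n x) \<partial>\<mu>)" by (rule le[OF k])
      also have "\<dots> \<le> (\<integral>\<^sup>+x. indicator U x \<partial>\<mu>)"
        using ennreal_leI[OF k_le[of n]] by (intro nn_integral_mono) (simp add: ennreal_indicator)
      finally show ?thesis by simp
    qed
    ultimately show ?thesis by (intro LIMSEQ_le_const2) auto
  qed
  have "emeasure \<nu> B \<le> emeasure \<mu> B" if B: "B \<in> sets borel" for B
  proof -
    have sB: "B \<in> sets \<nu>" using B assms(1) by simp
    have "emeasure \<mu> B = (INF U \<in> {U. B \<subseteq> U \<and> open U}. emeasure \<mu> U)"
      using B fin assms(2) by (intro outer_regular) auto
    moreover have "emeasure \<nu> B \<le> emeasure \<mu> U" if U: "B \<subseteq> U" "open U" for U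
      using emeasure_mono[OF U(1), of \<nu>] open_le[OF U(2)] U(2) assms(1) by (auto intro: order_trans)
    ultimately show ?thesis by (auto intro: INF_greatest)
  qed
  then have "\<nu> \<le> \<mu>" using assms(1,2) by (simp add: le_measure)
  then show ?thesis using assms(1,2) by (intro nn_integral_mono_measure) auto
qed

context stable_speed
begin

lemma Pn_0_le: "Pn 0 k x \<le> k x"
proof -
  have "Pn 0 k x \<le> (\<integral>\<^sup>+\<omega>. k x \<partial>M)"
    unfolding Pn_def using W_nonpos
    by (intro nn_integral_mono) (simp add: alive_tc_0[OF skorokhod_W] indicator_def)
  then show ?thesis by (simp add: emeasure_space_1)
qed

text \<open>For continuous f the symmetry identity with the constant 1 at times t and 0 gives that
  the integral of P_t f equals that of (P_t 1)(P_0 f), which is at most that of f. The left side is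
  integration of f against a fixed image measure, so the inequality extends to all Borel
  functions.\<close>

lemma contraction:
  assumes [measurable]: "k \<in> borel_measurable borel" and t: "0 \<le> t"
  shows "(\<integral>\<^sup>+x. Pn t k x \<partial>mu) \<le> (\<integral>\<^sup>+x. k x \<partial>mu)"
proof -
  interpret P: pair_sigma_finite mu M by unfold_locales
  define D where "D = density (mu \<Otimes>\<^sub>M M) (\<lambda>z. indicator {\<omega>. alive_tc (pth (fst z) \<omega>) t} (snd z))"
  define \<nu> where "\<nu> = distr D borel (\<lambda>z. tc (pth (fst z) (snd z)) t)"
  have sets_D [measurable_cong]: "sets D = sets (mu \<Otimes>\<^sub>M M)" by (simp add: D_def)
  have [simp]: "sets \<nu> = sets borel" by (simp add: \<nu>_def)
  have int: "(\<integral>\<^sup>+y. f y \<partial>\<nu>) = (\<integral>\<^sup>+x. Pn t f x \<partial>mu)" if [measurable]: "f \<in> borel_measurable borel" for f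
  proof -
    have "(\<integral>\<^sup>+y. f y \<partial>\<nu>) = (\<integral>\<^sup>+z. f (tc (pth (fst z) (snd z)) t) \<partial>D)"
      unfolding \<nu>_def by (rule nn_integral_distr) measurable
    also have "\<dots> = (\<integral>\<^sup>+z. indicator {\<omega>. alive_tc (pth (fst z) \<omega>) t} (snd z) * f (tc (pth (fst z) (snd z)) t) \<partial>(mu \<Otimes>\<^sub>M M))"
      unfolding D_def by (rule nn_integral_density) measurable
    also have "\<dots> = (\<integral>\<^sup>+x. Pn t f x \<partial>mu)"
      unfolding Pn_def by (subst nn_integral_fst[symmetric]) simp_all
    finally show ?thesis .
  qed
  have cont_le: "(\<integral>\<^sup>+x. Pn t (\<lambda>y. ennreal (f y)) x \<partial>mu) \<le> (\<integral>\<^sup>+x. ennreal (f x) \<partial>mu)"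
    if f: "continuous_on UNIV f" "\<And>x. 0 \<le> f x" "\<And>x. f x \<le> 1" for f
  proof -
    have "(\<integral>\<^sup>+x. Pn t (\<lambda>y. ennreal (f y)) x \<partial>mu) = (\<integral>\<^sup>+x. ennreal ((\<lambda>_. 1) x) * Pn (t + 0) (\<lambda>y. ennreal (f y)) x \<partial>mu)" by simp
    also have "\<dots> = (\<integral>\<^sup>+x. Pn t (\<lambda>y. ennreal ((\<lambda>_. 1) y)) x * Pn 0 (\<lambda>y. ennreal (f y)) x \<partial>mu)"
      using f t by (intro semigroup_symmetry_nonneg[symmetric, where B = 1]) auto
    also have "\<dots> \<le> (\<integral>\<^sup>+x. 1 * ennreal (f x) \<partial>mu)"
      using Pn_le[of "\<lambda>_. 1" 1 t] Pn_0_le[of "\<lambda>y. ennreal (f y)"] by (intro nn_integral_mono mult_mono) auto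
    finally show ?thesis by simp
  qed
  have "(\<integral>\<^sup>+y. k y \<partial>\<nu>) \<le> (\<integral>\<^sup>+y. k y \<partial>mu)"
  proof (rule nn_integral_le_of_continuous)
    show "emeasure mu UNIV \<noteq> \<infinity>" using mu.emeasure_space_1 by simp
    have "emeasure \<nu> UNIV = (\<integral>\<^sup>+x. Pn t (\<lambda>y. ennreal 1) x \<partial>mu)"
      using int[of "\<lambda>_. 1"] sets_eq_imp_space_eq[of \<nu> borel] by simp
    also have "\<dots> \<le> (\<integral>\<^sup>+x. ennreal 1 \<partial>mu)" by (rule cont_le) auto
    finally show "emeasure \<nu> UNIV \<noteq> \<infinity>" using mu.emeasure_space_1 by (auto simp: top_unique)
    fix f :: "real \<Rightarrow> real" assume f: "continuous_on UNIV f" "\<And>x. 0 \<le> f x" "\<And>x. f x \<le> 1"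
    have [measurable]: "f \<in> borel_measurable borel" using f(1) by (rule borel_measurable_continuous_onI)
    show "(\<integral>\<^sup>+x. ennreal (f x) \<partial>\<nu>) \<le> (\<integral>\<^sup>+x. ennreal (f x) \<partial>mu)"
      using cont_le[OF f] by (simp add: int)
  qed auto
  then show ?thesis by (simp add: int)
qed

text \<open>The class on which right continuity in time, and with it the symmetry identity at fixed
  times, is available; it is dense in L^2.\<close>

definition bcont :: "(real \<Rightarrow> real) \<Rightarrow> bool" where
  "bcont f \<longleftrightarrow> continuous_on UNIV f \<and> (\<exists>B. \<forall>x. \<bar>f x\<bar> \<le> B)"

lemma bcont_measurable: "bcont f \<Longrightarrow> f \<in> borel_measurable borel"
  unfolding bcont_def by (auto intro: borel_measurable_continuous_onI)

lemma bcont_pos_neg: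
  assumes "bcont f" shows "bcont (\<lambda>x. max 0 (f x))" "bcont (\<lambda>x. max 0 (- f x))"
proof -
  obtain B where B: "\<And>x. \<bar>f x\<bar> \<le> B" using assms by (auto simp: bcont_def)
  have "\<bar>max 0 (f x)\<bar> \<le> B" "\<bar>max 0 (- f x)\<bar> \<le> B" for x using B[of x] by auto
  then show "bcont (\<lambda>x. max 0 (f x))" "bcont (\<lambda>x. max 0 (- f x))"
    using assms by (auto simp: bcont_def intro!: continuous_intros)
qed

lemma bcont_diff:
  assumes "bcont f" "bcont g" shows "bcont (\<lambda>x. f x - g x)"
proof -
  obtain B C where B: "\<And>x. \<bar>f x\<bar> \<le> B" "\<And>x. \<bar>g x\<bar> \<le> C" using assms unfolding bcont_def by blast
  have "\<bar>f x - g x\<bar> \<le> B + C" for x using B[of x] by linarith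
  then show ?thesis using assms by (auto simp: bcont_def intro!: continuous_intros)
qed

lemma PT_bcont_bound:
  assumes "bcont f"
  obtains B where "\<And>t x. \<bar>PT t f x\<bar> \<le> B" "\<And>x. \<bar>f x\<bar> \<le> B"
  using assms PT_bound[OF bcont_measurable[OF assms]] unfolding bcont_def by blast

lemma PT_bcont_diff:
  assumes f: "bcont f" and g: "bcont g"
  shows "PT t (\<lambda>y. f y - g y) x = PT t f x - PT t g x"
proof -
  obtain B C where B: "\<And>x. \<bar>f x\<bar> \<le> B" "\<And>x. \<bar>g x\<bar> \<le> C" using assms unfolding bcont_def by blast
  show ?thesis
    using B by (intro PT_diff[OF bcont_measurable[OF f] bcont_measurable[OF g], where B = "max B C"]) (auto intro: le_max_iff_disj[THEN iffD2])
qed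

lemma integrable_mult_bounded:
  fixes f g :: "real \<Rightarrow> real"
  assumes [measurable]: "f \<in> borel_measurable borel" "g \<in> borel_measurable borel"
    and B: "\<And>x. \<bar>f x\<bar> \<le> B" "\<And>x. \<bar>g x\<bar> \<le> C"
  shows "integrable mu (\<lambda>x. f x * g x)"
proof (rule mu.integrable_const_bound[where B = "B * C"])
  have "0 \<le> B" using B(1)[of 0] by simp
  then show "AE x in mu. norm (f x * g x) \<le> B * C"
    using B by (auto simp: abs_mult intro!: mult_mono)
qed auto

lemma PT_mult_integrable:
  assumes f: "bcont f" and h: "bcont h"
  shows "integrable mu (\<lambda>x. PT t f x * PT s h x)" "integrable mu (\<lambda>x. f x * PT s h x)"
proof -
  note [measurable] = bcont_measurable[OF f] bcont_measurable[OF h]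
  obtain B where B: "\<And>t x. \<bar>PT t f x\<bar> \<le> B" "\<And>x. \<bar>f x\<bar> \<le> B" using PT_bcont_bound[OF f] by blast
  obtain C where C: "\<And>t x. \<bar>PT t h x\<bar> \<le> C" "\<And>x. \<bar>h x\<bar> \<le> C" using PT_bcont_bound[OF h] by blast
  show "integrable mu (\<lambda>x. PT t f x * PT s h x)" "integrable mu (\<lambda>x. f x * PT s h x)"
    using B C by (auto intro!: integrable_mult_bounded)
qed

lemma semigroup_symmetry:
  assumes f: "bcont f" and h: "bcont h" and t: "0 \<le> t" and s: "0 \<le> s"
  shows "(\<integral>x. PT t f x * PT s h x \<partial>mu) = (\<integral>x. f x * PT (t + s) h x \<partial>mu)"
proof -
  have nonneg: "(\<integral>x. PT t f x * PT s h x \<partial>mu) = (\<integral>x. f x * PT (t + s) h x \<partial>mu)"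
    if f: "bcont f" "\<And>x. 0 \<le> f x" and h: "bcont h" "\<And>x. 0 \<le> h x" for f h
  proof -
    note [measurable] = bcont_measurable[OF f(1)] bcont_measurable[OF h(1)]
    obtain B where B: "\<And>t x. \<bar>PT t f x\<bar> \<le> B" "\<And>x. \<bar>f x\<bar> \<le> B" using PT_bcont_bound[OF f(1)] by blast
    obtain C where C: "\<And>t x. \<bar>PT t h x\<bar> \<le> C" "\<And>x. \<bar>h x\<bar> \<le> C" using PT_bcont_bound[OF h(1)] by blast
    have le: "f x \<le> max B C" "h x \<le> max B C" for x using B(2)[of x] C(2)[of x] by auto
    have "(\<integral>\<^sup>+x. ennreal (PT t f x) * ennreal (PT s h x) \<partial>mu) = (\<integral>\<^sup>+x. ennreal (f x) * ennreal (PT (t + s) h x) \<partial>mu)"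
      using semigroup_symmetry_nonneg[where f = f and h = h and B = "max B C", OF _ f(2) le(1) _ h(2) le(2) t s] f(1) h(1)
      by (simp add: Pn_eq_PT[OF _ f(2) le(1)] Pn_eq_PT[OF _ h(2) le(2)] bcont_def)
    then have "(\<integral>\<^sup>+x. ennreal (PT t f x * PT s h x) \<partial>mu) = (\<integral>\<^sup>+x. ennreal (f x * PT (t + s) h x) \<partial>mu)"
      using f(2) h(2) by (simp add: ennreal_mult PT_nonneg)
    then show ?thesis
      using f h by (simp add: integral_eq_nn_integral PT_nonneg)
  qed
  have half: "(\<integral>x. PT t f x * PT s h x \<partial>mu) = (\<integral>x. f x * PT (t + s) h x \<partial>mu)"
    if f: "bcont f" "\<And>x. 0 \<le> f x" and h: "bcont h" for f h
  proof -
    let ?p = "\<lambda>x. max 0 (h x)" and ?n = "\<lambda>x. max 0 (- h x)"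
    note pn = bcont_pos_neg[OF h]
    have h': "h = (\<lambda>x. ?p x - ?n x)" by auto
    have D: "PT r h x = PT r ?p x - PT r ?n x" for r x
      using PT_bcont_diff[OF pn, of r x] h' by simp
    have "(\<integral>x. PT t f x * PT s h x \<partial>mu) = (\<integral>x. PT t f x * PT s ?p x \<partial>mu) - (\<integral>x. PT t f x * PT s ?n x \<partial>mu)"
      unfolding D right_diff_distrib by (intro Bochner_Integration.integral_diff PT_mult_integrable f pn)
    also have "\<dots> = (\<integral>x. f x * PT (t + s) ?p x \<partial>mu) - (\<integral>x. f x * PT (t + s) ?n x \<partial>mu)"
      using nonneg[OF f pn(1)] nonneg[OF f pn(2)] by simp
    also have "\<dots> = (\<integral>x. f x * PT (t + s) h x \<partial>mu)"
      unfolding D right_diff_distrib by (intro Bochner_Integration.integral_diff[symmetric] PT_mult_integrable f pn)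
    finally show ?thesis .
  qed
  let ?p = "\<lambda>x. max 0 (f x)" and ?n = "\<lambda>x. max 0 (- f x)"
  note pn = bcont_pos_neg[OF f]
  have f': "f x = ?p x - ?n x" for x by auto
  have D: "PT r f x = PT r ?p x - PT r ?n x" for r x
    using PT_bcont_diff[OF pn, of r x] f' by simp
  have "(\<integral>x. PT t f x * PT s h x \<partial>mu) = (\<integral>x. PT t ?p x * PT s h x \<partial>mu) - (\<integral>x. PT t ?n x * PT s h x \<partial>mu)"
    unfolding D left_diff_distrib by (intro Bochner_Integration.integral_diff PT_mult_integrable h pn)
  also have "\<dots> = (\<integral>x. ?p x * PT (t + s) h x \<partial>mu) - (\<integral>x. ?n x * PT (t + s) h x \<partial>mu)"
    using half[OF pn(1) _ h] half[OF pn(2) _ h] by simp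
  also have "\<dots> = (\<integral>x. ?p x * PT (t + s) h x - ?n x * PT (t + s) h x \<partial>mu)"
    by (intro Bochner_Integration.integral_diff[symmetric] PT_mult_integrable h pn)
  also have "\<dots> = (\<integral>x. f x * PT (t + s) h x \<partial>mu)"
    unfolding left_diff_distrib[symmetric] f'[symmetric] ..
  finally show ?thesis .
qed

section \<open>Moments and the potential operator\<close>

text \<open>Half the exponent of the moment condition, so that |x| powr \<open>hp\<close> is square
  integrable for the speed measure.\<close>

abbreviation hp :: real where "hp \<equiv> (\<alpha> - 1) / 2"

lemma moment: "integrable lborel (\<lambda>x. rho x * \<bar>x\<bar> powr (\<alpha> - 1))"
proof (rule integrableI_nonneg)
  show "(\<lambda>x. rho x * \<bar>x\<bar> powr (\<alpha> - 1)) \<in> borel_measurable lborel" by measurable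
  show "(\<integral>\<^sup>+x. ennreal (rho x * \<bar>x\<bar> powr (\<alpha> - 1)) \<partial>lborel) < \<infinity>"
    using I_finite by (simp add: rho_def)
qed (use rho_pos in \<open>simp add: less_imp_le\<close>)

lemma rho_integrable: "integrable lborel rho"
proof (rule integrableI_nonneg)
  have "(\<integral>\<^sup>+x. ennreal (rho x) \<partial>lborel) = emeasure mu UNIV"
    by (simp add: mu_eq emeasure_density)
  then show "(\<integral>\<^sup>+x. ennreal (rho x) \<partial>lborel) < \<infinity>" using mu.emeasure_space_1 by simp
qed (use rho_pos in \<open>auto simp: less_imp_le\<close>)

lemma powr_half_le: "\<bar>x\<bar> powr hp \<le> 1 + \<bar>x\<bar> powr (\<alpha> - 1)"
proof (cases "\<bar>x\<bar> \<le> 1")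
  case True
  then have "\<bar>x\<bar> powr hp \<le> 1 powr hp" using alpha by (intro powr_mono2) auto
  then show ?thesis by (simp add: add_increasing2)
next
  case False
  then have "\<bar>x\<bar> powr hp \<le> \<bar>x\<bar> powr (\<alpha> - 1)" using alpha by (intro powr_mono) auto
  then show ?thesis by simp
qed

lemma half_moment: "integrable lborel (\<lambda>x. rho x * \<bar>x\<bar> powr hp)"
proof (rule Bochner_Integration.integrable_bound[OF Bochner_Integration.integrable_add[OF rho_integrable moment]])
  show "AE x in lborel. norm (rho x * \<bar>x\<bar> powr hp) \<le> norm (rho x + rho x * \<bar>x\<bar> powr (\<alpha> - 1))"
  proof (rule AE_I2)
    fix x
    have "rho x * \<bar>x\<bar> powr hp \<le> rho x * (1 + \<bar>x\<bar> powr (\<alpha> - 1))"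
      using rho_pos[of x] powr_half_le by (intro mult_left_mono) auto
    moreover have "0 \<le> rho x * \<bar>x\<bar> powr hp" "0 \<le> rho x * \<bar>x\<bar> powr (\<alpha> - 1)" "0 \<le> rho x"
      using rho_pos[of x] by auto
    ultimately show "norm (rho x * \<bar>x\<bar> powr hp) \<le> norm (rho x + rho x * \<bar>x\<bar> powr (\<alpha> - 1))"
      by (simp add: distrib_left)
  qed
qed simp

text \<open>The potential G f of the time-changed killed process for signed f: \<open>green\<close>
  integrates along the stable process, so the clock rate \<open>rho\<close> is inserted.\<close>

definition pot :: "(real \<Rightarrow> real) \<Rightarrow> real \<Rightarrow> real" where
  "pot f x = enn2real (green (\<lambda>y. ennreal (max 0 (f y) * rho y)) x)
     - enn2real (green (\<lambda>y. ennreal (max 0 (- f y) * rho y)) x)"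

lemma nn_integral_Pn_green:
  assumes [measurable]: "k \<in> borel_measurable borel"
  shows "(\<integral>\<^sup>+t. indicator {0..} t * Pn t k x \<partial>lborel) = green (\<lambda>y. k y * ennreal (rho y)) x"
  using occupation[of "\<lambda>_. 1" k x] unfolding green_def by simp

lemma weighted_integrable:
  fixes f :: "real \<Rightarrow> real"
  assumes [measurable]: "f \<in> borel_measurable borel" and B: "\<And>y. \<bar>f y\<bar> \<le> B"
  shows "integrable lborel (\<lambda>y. f y * rho y)" "integrable lborel (\<lambda>y. f y * rho y * \<bar>y\<bar> powr hp)"
proof -
  have B0: "0 \<le> B" using B[of 0] by simp
  show "integrable lborel (\<lambda>y. f y * rho y)"
    using B B0 rho_pos
    by (intro Bochner_Integration.integrable_bound[OF integrable_mult_right[OF rho_integrable, of B]] AE_I2)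
      (auto simp: abs_mult less_imp_le intro!: mult_right_mono)
  show "integrable lborel (\<lambda>y. f y * rho y * \<bar>y\<bar> powr hp)"
    using B B0 rho_pos
    by (intro Bochner_Integration.integrable_bound[OF integrable_mult_right[OF half_moment, of B]] AE_I2)
      (auto simp: abs_mult less_imp_le mult.assoc intro!: mult_right_mono)
qed

lemma green_finite:
  obtains C where "0 \<le> C"
    "\<And>f B x. f \<in> borel_measurable borel \<Longrightarrow> (\<And>y. 0 \<le> f y) \<Longrightarrow> (\<And>y. f y \<le> B) \<Longrightarrow>
      green (\<lambda>y. ennreal (f y * rho y)) x \<le> ennreal (C * B * \<bar>x\<bar> powr hp)"
proof (rule green_bounds)
  fix C assume C: "C \<ge> 0"
    "\<And>f x. integrable lborel f \<Longrightarrow> (\<And>y. 0 \<le> f y) \<Longrightarrow> integrable lborel (\<lambda>y. f y * \<bar>y\<bar> powr hp) \<Longrightarrow>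
       green (\<lambda>y. ennreal (f y)) x \<le> ennreal (C * \<bar>x\<bar> powr hp * (\<integral>y. f y * \<bar>y\<bar> powr hp \<partial>lborel))"
  let ?m = "\<integral>y. rho y * \<bar>y\<bar> powr hp \<partial>lborel"
  have m: "0 \<le> ?m" using rho_pos by (intro integral_nonneg_AE AE_I2) (simp add: less_imp_le)
  show thesis
  proof
    show "0 \<le> C * ?m" using C(1) m by simp
    fix f :: "real \<Rightarrow> real" and B x
    assume [measurable]: "f \<in> borel_measurable borel" and f: "\<And>y. 0 \<le> f y" "\<And>y. f y \<le> B"
    have abs: "\<bar>f y\<bar> \<le> B" for y using f by simp
    note int = weighted_integrable[OF \<open>f \<in> borel_measurable borel\<close> abs]
    have "(\<integral>y. f y * rho y * \<bar>y\<bar> powr hp \<partial>lborel) \<le> (\<integral>y. B * (rho y * \<bar>y\<bar> powr hp) \<partial>lborel)"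
    proof (rule integral_mono[OF int(2)])
      show "integrable lborel (\<lambda>y. B * (rho y * \<bar>y\<bar> powr hp))" using half_moment by simp
      show "f y * rho y * \<bar>y\<bar> powr hp \<le> B * (rho y * \<bar>y\<bar> powr hp)" for y
        unfolding mult.assoc using f(2) rho_pos[of y] by (intro mult_right_mono) auto
    qed
    then have "(\<integral>y. f y * rho y * \<bar>y\<bar> powr hp \<partial>lborel) \<le> B * ?m" by simp
    then have "C * \<bar>x\<bar> powr hp * (\<integral>y. f y * rho y * \<bar>y\<bar> powr hp \<partial>lborel) \<le> C * \<bar>x\<bar> powr hp * (B * ?m)"
      using C(1) by (intro mult_left_mono) auto
    then have "ennreal (C * \<bar>x\<bar> powr hp * (\<integral>y. f y * rho y * \<bar>y\<bar> powr hp \<partial>lborel)) \<le> ennreal (C * ?m * B * \<bar>x\<bar> powr hp)"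
      by (intro ennreal_leI) (simp add: ac_simps)
    then show "green (\<lambda>y. ennreal (f y * rho y)) x \<le> ennreal (C * ?m * B * \<bar>x\<bar> powr hp)"
      using C(2)[OF int(1) _ int(2), of x] f(1) rho_pos by (auto simp: less_imp_le intro: order_trans)
  qed
qed

text \<open>The time integral converges without any decay rate for P_t f, since for nonnegative f it
  is a Green potential, finite by \<open>green_finite\<close>; positive and negative parts are
  treated separately.\<close>

lemma PT_integral_pot:
  assumes f: "bcont f"
  shows "integrable lborel (\<lambda>t. indicator {0..} t * PT t f x)"
    "(\<integral>t. indicator {0..} t * PT t f x \<partial>lborel) = pot f x"
proof -
  obtain C where C: "0 \<le> C"
    "\<And>f B x. f \<in> borel_measurable borel \<Longrightarrow> (\<And>y. 0 \<le> f y) \<Longrightarrow> (\<And>y. f y \<le> B) \<Longrightarrow>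
      green (\<lambda>y. ennreal (f y * rho y)) x \<le> ennreal (C * B * \<bar>x\<bar> powr hp)"
    using green_finite by blast
  have pos: "integrable lborel (\<lambda>t. indicator {0..} t * PT t g x)
     \<and> (\<integral>t. indicator {0..} t * PT t g x \<partial>lborel) = enn2real (green (\<lambda>y. ennreal (g y * rho y)) x)"
    if g: "bcont g" "\<And>y. 0 \<le> g y" for g
  proof -
    note gm [measurable] = bcont_measurable[OF g(1)]
    obtain B where B: "\<And>x. \<bar>g x\<bar> \<le> B" using g(1) by (auto simp: bcont_def)
    have B': "g x \<le> B" for x using B[of x] by simp
    have eq: "(\<integral>\<^sup>+t. ennreal (indicator {0..} t * PT t g x) \<partial>lborel) = green (\<lambda>y. ennreal (g y * rho y)) x"
    proof -
      have "(\<integral>\<^sup>+t. ennreal (indicator {0..} t * PT t g x) \<partial>lborel) = (\<integral>\<^sup>+t. indicator {0..} t * Pn t (\<lambda>y. ennreal (g y)) x \<partial>lborel)"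
        by (intro nn_integral_cong) (simp add: Pn_eq_PT[OF gm g(2) B'] indicator_def)
      also have "\<dots> = green (\<lambda>y. ennreal (g y * rho y)) x"
        using g(2) rho_pos by (simp add: nn_integral_Pn_green ennreal_mult less_imp_le)
      finally show ?thesis .
    qed
    have nn: "0 \<le> indicator {0..} t * PT t g x" for t using g(2) by (simp add: PT_nonneg)
    show ?thesis
    proof
      show "integrable lborel (\<lambda>t. indicator {0..} t * PT t g x)"
        using C(2)[OF gm g(2) B', of x] nn by (intro integrableI_nonneg) (auto simp: eq intro: le_less_trans)
      show "(\<integral>t. indicator {0..} t * PT t g x \<partial>lborel) = enn2real (green (\<lambda>y. ennreal (g y * rho y)) x)"
        using nn by (subst integral_eq_nn_integral) (auto simp: eq)
    qed
  qed
  let ?p = "\<lambda>x. max 0 (f x)" and ?n = "\<lambda>x. max 0 (- f x)"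
  note pn = bcont_pos_neg[OF f]
  have p: "integrable lborel (\<lambda>t. indicator {0..} t * PT t ?p x)"
    "(\<integral>t. indicator {0..} t * PT t ?p x \<partial>lborel) = enn2real (green (\<lambda>y. ennreal (?p y * rho y)) x)"
    using pos[OF pn(1)] by auto
  have n: "integrable lborel (\<lambda>t. indicator {0..} t * PT t ?n x)"
    "(\<integral>t. indicator {0..} t * PT t ?n x \<partial>lborel) = enn2real (green (\<lambda>y. ennreal (?n y * rho y)) x)"
    using pos[OF pn(2)] by auto
  have f': "f = (\<lambda>x. ?p x - ?n x)" by auto
  have D: "indicator {0..} t * PT t f x = indicator {0..} t * PT t ?p x - indicator {0..} t * PT t ?n x" for t
    using PT_bcont_diff[OF pn, of t x] f' by (simp add: right_diff_distrib)
  show "integrable lborel (\<lambda>t. indicator {0..} t * PT t f x)"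
    "(\<integral>t. indicator {0..} t * PT t f x \<partial>lborel) = pot f x"
    unfolding D pot_def using p n by simp_all
qed

text \<open>The function \<open>b t = \<langle>f, P\<^sub>t f\<rangle>\<close> is midpoint convex because \<open>b ((s + t) / 2)\<close> is the inner
  product of \<open>P\<^bsub>s/2\<^esub> f\<close> and \<open>P\<^bsub>t/2\<^esub> f\<close>; hence \<open>T b T\<close> is at most half of its integral over \<open>[0, 2 T]\<close>.\<close>

lemma smoothing:
  assumes f: "bcont f" and t: "0 < t"
  shows "(\<integral>x. (PT t f x)\<^sup>2 \<partial>mu) \<le> (\<integral>x. f x * pot f x \<partial>mu) / (4 * t)"
proof -
  interpret P: pair_sigma_finite lborel mu by unfold_locales
  note fm [measurable] = bcont_measurable[OF f]
  obtain B where B: "\<And>t x. \<bar>PT t f x\<bar> \<le> B" "\<And>x. \<bar>f x\<bar> \<le> B" using PT_bcont_bound[OF f] by blast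
  have B0: "0 \<le> B" using B(2)[of 0] by simp
  obtain C where C: "0 \<le> C"
    "\<And>f B x. f \<in> borel_measurable borel \<Longrightarrow> (\<And>y. 0 \<le> f y) \<Longrightarrow> (\<And>y. f y \<le> B) \<Longrightarrow>
      green (\<lambda>y. ennreal (f y * rho y)) x \<le> ennreal (C * B * \<bar>x\<bar> powr hp)"
    using green_finite by blast
  define b where "b r = (\<integral>x. f x * PT r f x \<partial>mu)" for r
  have b_meas [measurable]: "b \<in> borel_measurable borel" unfolding b_def by measurable
  have b_sq: "b (r + r) = (\<integral>x. (PT r f x)\<^sup>2 \<partial>mu)" if "0 \<le> r" for r
    unfolding b_def using semigroup_symmetry[OF f f that that] by (simp add: power2_eq_square)
  have b_nonneg: "0 \<le> b r" if "0 \<le> r" for r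
  proof -
    have "b (r / 2 + r / 2) = (\<integral>x. (PT (r / 2) f x)\<^sup>2 \<partial>mu)" using that by (intro b_sq) simp
    then show ?thesis by simp
  qed
  have sq_int: "integrable mu (\<lambda>x. (PT r f x)\<^sup>2)" for r
    using PT_mult_integrable(1)[OF f f, of r r] by (simp add: power2_eq_square)
  have convex: "2 * b T \<le> b (T - s) + b (T + s)" if s: "0 \<le> s" "s \<le> T" for s T
  proof -
    let ?p = "(T - s) / 2" and ?q = "(T + s) / 2"
    have "2 * b (?p + ?q) = (\<integral>x. 2 * (PT ?p f x * PT ?q f x) \<partial>mu)"
      unfolding b_def using semigroup_symmetry[OF f f, of ?p ?q] s by simp
    also have "\<dots> \<le> (\<integral>x. (PT ?p f x)\<^sup>2 + (PT ?q f x)\<^sup>2 \<partial>mu)"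
    proof (rule integral_mono)
      show "2 * (PT ?p f x * PT ?q f x) \<le> (PT ?p f x)\<^sup>2 + (PT ?q f x)\<^sup>2" for x
        using sum_squares_bound[of "PT ?p f x" "PT ?q f x"] by (simp add: mult.assoc)
    qed (use PT_mult_integrable(1)[OF f f] sq_int in auto)
    also have "\<dots> = b (?p + ?p) + b (?q + ?q)"
    proof -
      have "b (?p + ?p) = (\<integral>x. (PT ?p f x)\<^sup>2 \<partial>mu)" "b (?q + ?q) = (\<integral>x. (PT ?q f x)\<^sup>2 \<partial>mu)"
        by (rule b_sq, use s in simp)+
      then show ?thesis by (simp only: Bochner_Integration.integral_add[OF sq_int sq_int])
    qed
    finally have "2 * b (?p + ?q) \<le> b (?p + ?p) + b (?q + ?q)" .
    moreover have "?p + ?q = T" "?p + ?p = T - s" "?q + ?q = T + s" by (simp_all add: field_simps)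
    ultimately show ?thesis by simp
  qed
  let ?h = "\<lambda>t x. indicator {0..} t * (f x * PT t f x)"
  \<comment> \<open>For fixed x the time integral of P_t |f| is a Green potential, at most a
    multiple of |x| powr \<open>hp\<close>; integrating this over x leaves the half moment.\<close>
  have int: "integrable (lborel \<Otimes>\<^sub>M mu) (case_prod ?h)"
  proof (rule integrableI_bounded)
    have "(\<integral>\<^sup>+z. ennreal (norm (case_prod ?h z)) \<partial>(lborel \<Otimes>\<^sub>M mu)) = (\<integral>\<^sup>+x. \<integral>\<^sup>+t. ennreal (norm (?h t x)) \<partial>lborel \<partial>mu)"
      by (subst P.nn_integral_snd[symmetric]) auto
    also have "\<dots> \<le> (\<integral>\<^sup>+x. ennreal (B * (C * B * \<bar>x\<bar> powr hp)) \<partial>mu)"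
    proof (rule nn_integral_mono)
      fix x
      have abs: "\<bar>PT t f x\<bar> \<le> PT t (\<lambda>y. \<bar>f y\<bar>) x" for t
        unfolding PT_def by (rule order_trans[OF integral_abs_bound]) (auto simp: if_distrib[of abs] cong: if_cong)
      have "(\<integral>\<^sup>+t. ennreal (norm (?h t x)) \<partial>lborel) \<le> (\<integral>\<^sup>+t. ennreal B * (indicator {0..} t * Pn t (\<lambda>y. ennreal \<bar>f y\<bar>) x) \<partial>lborel)"
      proof (rule nn_integral_mono)
        fix t
        have "\<bar>f x * PT t f x\<bar> \<le> B * PT t (\<lambda>y. \<bar>f y\<bar>) x"
          unfolding abs_mult using B(2)[of x] B0 abs[of t] by (intro mult_mono) auto
        then show "ennreal (norm (?h t x)) \<le> ennreal B * (indicator {0..} t * Pn t (\<lambda>y. ennreal \<bar>f y\<bar>) x)"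
          using B0 B(2) by (auto simp: indicator_def Pn_eq_PT[where B = B] ennreal_mult''[symmetric] PT_nonneg ennreal_leI)
      qed
      also have "\<dots> = ennreal B * green (\<lambda>y. ennreal (\<bar>f y\<bar> * rho y)) x"
        using rho_pos by (simp add: nn_integral_cmult nn_integral_Pn_green ennreal_mult less_imp_le)
      also have "\<dots> \<le> ennreal B * ennreal (C * B * \<bar>x\<bar> powr hp)"
        using B(2) by (intro mult_left_mono C) auto
      finally show "(\<integral>\<^sup>+t. ennreal (norm (?h t x)) \<partial>lborel) \<le> ennreal (B * (C * B * \<bar>x\<bar> powr hp))"
        using B0 C(1) by (simp add: ennreal_mult'')
    qed
    also have "\<dots> = (\<integral>\<^sup>+x. ennreal (B * (C * B)) * ennreal (rho x * \<bar>x\<bar> powr hp) \<partial>lborel)"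
      using B0 C(1) rho_pos by (subst nn_integral_mu) (auto simp: ennreal_mult''[symmetric] ennreal_mult'[symmetric] less_imp_le ac_simps intro!: nn_integral_cong)
    also have "\<dots> = ennreal (B * (C * B)) * ennreal (\<integral>x. rho x * \<bar>x\<bar> powr hp \<partial>lborel)"
      using rho_pos half_moment by (simp add: nn_integral_cmult nn_integral_eq_integral less_imp_le)
    also have "\<dots> < \<infinity>" by (simp add: ennreal_mult_less_top)
    finally show "(\<integral>\<^sup>+z. ennreal (norm (case_prod ?h z)) \<partial>(lborel \<Otimes>\<^sub>M mu)) < \<infinity>" .
  qed simp
  have total: "(\<integral>t. indicator {0..} t * b t \<partial>lborel) = (\<integral>x. f x * pot f x \<partial>mu)"
  proof -
    have "(\<integral>t. indicator {0..} t * b t \<partial>lborel) = (\<integral>t. \<integral>x. ?h t x \<partial>mu \<partial>lborel)"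
      unfolding b_def by simp
    also have "\<dots> = (\<integral>x. \<integral>t. ?h t x \<partial>lborel \<partial>mu)" by (rule P.Fubini_integral[OF int, symmetric])
    also have "\<dots> = (\<integral>x. f x * pot f x \<partial>mu)"
      unfolding mult.left_commute[of _ "f _"] by (simp add: PT_integral_pot[OF f])
    finally show ?thesis .
  qed
  have int_b: "integrable lborel (\<lambda>t. indicator {0..} t * b t)"
    using P.integrable_fst[OF int] unfolding b_def by simp
  \<comment> \<open>b(2 t) is the squared norm of P_t f, so convexity is used at
    \<open>T = 2 * t\<close>, and 2 T = 4 t is the factor in the claim.\<close>
  define T where "T = 2 * t"
  have T: "0 < T" using t by (simp add: T_def)
  have "ennreal (2 * T * b T) = (\<integral>\<^sup>+s. indicator {0<..T} s * ennreal (2 * b T) \<partial>lborel)"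
    using T b_nonneg[of T] by (simp add: nn_integral_multc ennreal_mult[symmetric] mult.commute mult.left_commute)
  also have "\<dots> \<le> (\<integral>\<^sup>+s. indicator {0<..T} s * ennreal (b (T - s)) + indicator {0<..T} s * ennreal (b (T + s)) \<partial>lborel)"
  proof (intro nn_integral_mono)
    fix s show "indicator {0<..T} s * ennreal (2 * b T) \<le> indicator {0<..T} s * ennreal (b (T - s)) + indicator {0<..T} s * ennreal (b (T + s))"
      using convex[of s T] b_nonneg[of "T - s"] b_nonneg[of "T + s"]
      by (auto simp: indicator_def ennreal_plus[symmetric] ennreal_leI simp del: ennreal_plus)
  qed
  also have "\<dots> = (\<integral>\<^sup>+s. indicator {0<..T} s * ennreal (b (T - s)) \<partial>lborel) + (\<integral>\<^sup>+s. indicator {0<..T} s * ennreal (b (T + s)) \<partial>lborel)"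
    by (rule nn_integral_add) auto
  \<comment> \<open>The values b(T - s) and b(T + s) for s in (0, T] sweep out [0, T) and (T, 2 T];
    the two parts together are at most the whole integral of b.\<close>
  also have "(\<integral>\<^sup>+s. indicator {0<..T} s * ennreal (b (T - s)) \<partial>lborel) = (\<integral>\<^sup>+r. indicator {0..<T} r * ennreal (b r) \<partial>lborel)"
    by (subst nn_integral_real_affine[where c = "- 1" and t = T]) (auto intro!: nn_integral_cong simp: indicator_def)
  also have "(\<integral>\<^sup>+s. indicator {0<..T} s * ennreal (b (T + s)) \<partial>lborel) = (\<integral>\<^sup>+r. indicator {T<..2 * T} r * ennreal (b r) \<partial>lborel)"
    by (subst (2) nn_integral_real_affine[where c = 1 and t = T]) (auto intro!: nn_integral_cong simp: indicator_def)
  also have "(\<integral>\<^sup>+r. indicator {0..<T} r * ennreal (b r) \<partial>lborel) + (\<integral>\<^sup>+r. indicator {T<..2 * T} r * ennreal (b r) \<partial>lborel)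
      = (\<integral>\<^sup>+r. indicator {0..<T} r * ennreal (b r) + indicator {T<..2 * T} r * ennreal (b r) \<partial>lborel)"
    by (rule nn_integral_add[symmetric]) auto
  also have "\<dots> \<le> (\<integral>\<^sup>+r. ennreal (indicator {0..} r * b r) \<partial>lborel)"
    using T by (intro nn_integral_mono) (auto simp: indicator_def)
  also have "\<dots> = ennreal (\<integral>r. indicator {0..} r * b r \<partial>lborel)"
    using b_nonneg by (intro nn_integral_eq_integral int_b AE_I2) (simp add: indicator_def)
  finally have "ennreal (2 * T * b T) \<le> ennreal (\<integral>x. f x * pot f x \<partial>mu)" unfolding total .
  moreover have "0 \<le> (\<integral>r. indicator {0..} r * b r \<partial>lborel)"
    using b_nonneg by (intro integral_nonneg_AE AE_I2) (simp add: indicator_def)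
  ultimately have "2 * T * b T \<le> (\<integral>x. f x * pot f x \<partial>mu)" by (simp add: total)
  then show ?thesis using b_sq[of t] t by (simp add: T_def field_simps)
qed

section \<open>Square integrable functions on the punctured line\<close>

lemma mu_not_zero: "AE x in mu. x \<noteq> 0"
  unfolding mu_eq using AE_lborel_singleton[of "0::real"] by (auto simp: AE_density elim: eventually_mono)

abbreviation N0 :: "real measure" where "N0 \<equiv> restrict_space mu R0"

text \<open>Represents a function on the punctured line by one on the whole line; the origin is null
  for the speed measure, so norms and almost everywhere statements are unchanged.\<close>

definition off0 :: "(real \<Rightarrow> real) \<Rightarrow> real \<Rightarrow> real" where
  "off0 f x = (if x = 0 then 0 else f x)"

lemma indicator_R0: "indicator R0 x *\<^sub>R f x = off0 f x"
  by (simp add: off0_def)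

lemma N0_measurable_iff: "f \<in> borel_measurable N0 \<longleftrightarrow> off0 f \<in> borel_measurable borel"
  by (subst borel_measurable_restrict_space_iff) (simp_all only: indicator_R0, simp_all cong: measurable_cong_sets)

lemma off0_sq: "(\<lambda>x. indicator R0 x *\<^sub>R (f x)\<^sup>2) = (\<lambda>x. (off0 f x)\<^sup>2)"
  by (auto simp: off0_def)

lemma N0_square_integrable_iff: "f \<in> square_integrable N0 \<longleftrightarrow> off0 f \<in> square_integrable mu"
proof -
  have "integrable N0 (\<lambda>x. (f x)\<^sup>2) \<longleftrightarrow> integrable mu (\<lambda>x. indicator R0 x *\<^sub>R (f x)\<^sup>2)"
    by (rule integrable_restrict_space) simp
  then have "integrable N0 (\<lambda>x. (f x)\<^sup>2) \<longleftrightarrow> integrable mu (\<lambda>x. (off0 f x)\<^sup>2)"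
    by (simp only: off0_sq)
  then show ?thesis unfolding square_integrable_def mem_Collect_eq N0_measurable_iff
    by (simp cong: measurable_cong_sets)
qed

lemma N0_L2_norm: "L2_norm N0 f = L2_norm mu (off0 f)"
proof -
  have "(\<integral>x. (f x)\<^sup>2 \<partial>N0) = (\<integral>x. indicator R0 x *\<^sub>R (f x)\<^sup>2 \<partial>mu)"
    by (rule integral_restrict_space) simp
  then show ?thesis unfolding L2_norm_def by (simp only: off0_sq)
qed

lemma off0_AE: "AE x in mu. off0 f x = f x"
  using mu_not_zero by eventually_elim (simp add: off0_def)

lemma off0_measurable [measurable]:
  "f \<in> borel_measurable borel \<Longrightarrow> off0 f \<in> borel_measurable borel"
proof -
  assume [measurable]: "f \<in> borel_measurable borel"
  have [measurable]: "Measurable.pred borel (\<lambda>x::real. x = 0)" unfolding pred_def by simp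
  show ?thesis unfolding off0_def[abs_def] by measurable
qed

lemma L2_norm_off0: "f \<in> borel_measurable borel \<Longrightarrow> L2_norm mu (off0 f) = L2_norm mu f"
  by (intro L2_norm_cong_AE off0_AE) (auto cong: measurable_cong_sets)

lemma square_integrable_off0:
  assumes [measurable]: "f \<in> borel_measurable borel"
  shows "off0 f \<in> square_integrable mu \<longleftrightarrow> f \<in> square_integrable mu"
proof -
  have "integrable mu (\<lambda>x. (off0 f x)\<^sup>2) \<longleftrightarrow> integrable mu (\<lambda>x. (f x)\<^sup>2)"
    by (rule integrable_cong_AE) (use off0_AE[of f] in auto)
  then show ?thesis by (simp add: square_integrable_def)
qed

lemma N0_AE_iff: "(AE x in N0. P x) \<longleftrightarrow> (AE x in mu. P x)"
proof -
  have "(AE x in N0. P x) \<longleftrightarrow> (AE x in mu. x \<in> R0 \<longrightarrow> P x)"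
    by (subst AE_restrict_space_iff) simp_all
  also have "\<dots> \<longleftrightarrow> (AE x in mu. P x)"
    using mu_not_zero by (auto elim: eventually_elim2 eventually_mono)
  finally show ?thesis .
qed

section \<open>Extension of the semigroup to L^2\<close>

lemma bounded_square_integrable:
  fixes f :: "real \<Rightarrow> real"
  assumes [measurable]: "f \<in> borel_measurable borel" and B: "\<And>x. \<bar>f x\<bar> \<le> B"
  shows "f \<in> square_integrable mu"
  using integrable_mult_bounded[OF assms(1,1) B B] by (simp add: square_integrable_def power2_eq_square)

lemma L1_le_L2:
  assumes f: "f \<in> square_integrable mu"
  shows "integrable mu (\<lambda>x. \<bar>f x\<bar>)" "(\<integral>x. \<bar>f x\<bar> \<partial>mu) \<le> L2_norm mu f"
proof -
  note [measurable] = square_integrable_measurable[OF f]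
  have one: "(\<lambda>_. 1) \<in> square_integrable mu" by (rule bounded_square_integrable[where B = 1]) auto
  have abs: "(\<lambda>x. \<bar>f x\<bar>) \<in> square_integrable mu" using f by (simp add: square_integrable_def)
  show "integrable mu (\<lambda>x. \<bar>f x\<bar>)" using square_integrable_mult[OF abs one] by simp
  show "(\<integral>x. \<bar>f x\<bar> \<partial>mu) \<le> L2_norm mu f"
    using L2_Cauchy_Schwarz[OF abs one] by (simp add: L2_norm_def mu.prob_space[simplified])
qed

text \<open>Jensen's inequality from the nonnegative variance, if the second moment is finite;
  otherwise the right side is infinite. A finite second moment also makes the expectation defining
  \<open>PT\<close> exist.\<close>

lemma PT_sq_le:
  assumes [measurable]: "f \<in> borel_measurable borel"
  shows "ennreal ((PT t f x)\<^sup>2) \<le> Pn t (\<lambda>y. ennreal ((f y)\<^sup>2)) x"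
    and "Pn t (\<lambda>y. ennreal ((f y)\<^sup>2)) x < \<infinity> \<Longrightarrow>
      integrable M (\<lambda>\<omega>. if alive_tc (pth x \<omega>) t then f (tc (pth x \<omega>) t) else 0)"
proof -
  define h where "h = (\<lambda>\<omega>. if alive_tc (pth x \<omega>) t then f (tc (pth x \<omega>) t) else 0)"
  have [measurable]: "h \<in> borel_measurable M" unfolding h_def by measurable
  have Pn: "Pn t (\<lambda>y. ennreal ((f y)\<^sup>2)) x = (\<integral>\<^sup>+\<omega>. ennreal ((h \<omega>)\<^sup>2) \<partial>M)"
    unfolding Pn_def h_def by (intro nn_integral_cong) (auto simp: indicator_def)
  have h2: "integrable M (\<lambda>\<omega>. (h \<omega>)\<^sup>2)" if fin: "Pn t (\<lambda>y. ennreal ((f y)\<^sup>2)) x < \<infinity>"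
    using fin unfolding Pn by (intro integrableI_nonneg) auto
  have h1: "integrable M h" if fin: "Pn t (\<lambda>y. ennreal ((f y)\<^sup>2)) x < \<infinity>"
    using square_integrable_imp_integrable[OF _ h2[OF fin]] by simp
  then show "Pn t (\<lambda>y. ennreal ((f y)\<^sup>2)) x < \<infinity> \<Longrightarrow>
      integrable M (\<lambda>\<omega>. if alive_tc (pth x \<omega>) t then f (tc (pth x \<omega>) t) else 0)"
    unfolding h_def .
  show "ennreal ((PT t f x)\<^sup>2) \<le> Pn t (\<lambda>y. ennreal ((f y)\<^sup>2)) x"
  proof (cases "Pn t (\<lambda>y. ennreal ((f y)\<^sup>2)) x < \<infinity>")
    case True
    have "0 \<le> variance h" by (rule variance_positive)
    also have "variance h = expectation (\<lambda>\<omega>. (h \<omega>)\<^sup>2) - (expectation h)\<^sup>2"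
      by (rule variance_eq[OF h1[OF True] h2[OF True]])
    finally have "(PT t f x)\<^sup>2 \<le> expectation (\<lambda>\<omega>. (h \<omega>)\<^sup>2)"
      unfolding PT_def h_def[symmetric] by simp
    then show ?thesis unfolding Pn using h2[OF True] by (simp add: nn_integral_eq_integral ennreal_leI)
  qed (simp add: not_less top_unique)
qed

lemma PT_L2_nn:
  assumes [measurable]: "f \<in> borel_measurable borel" and t: "0 \<le> t"
  shows "(\<integral>\<^sup>+x. ennreal ((PT t f x)\<^sup>2) \<partial>mu) \<le> (\<integral>\<^sup>+x. ennreal ((f x)\<^sup>2) \<partial>mu)"
proof -
  have "(\<integral>\<^sup>+x. ennreal ((PT t f x)\<^sup>2) \<partial>mu) \<le> (\<integral>\<^sup>+x. Pn t (\<lambda>y. ennreal ((f y)\<^sup>2)) x \<partial>mu)"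
    by (intro nn_integral_mono PT_sq_le(1)) measurable
  also have "\<dots> \<le> (\<integral>\<^sup>+x. ennreal ((f x)\<^sup>2) \<partial>mu)" by (rule contraction[OF _ t]) measurable
  finally show ?thesis .
qed

lemma PT_L2:
  assumes f: "f \<in> square_integrable mu" and t: "0 \<le> t"
  shows "PT t f \<in> square_integrable mu" "L2_norm mu (PT t f) \<le> L2_norm mu f"
proof -
  have [measurable]: "f \<in> borel_measurable borel" using square_integrable_measurable[OF f] by simp
  have le: "(\<integral>\<^sup>+x. ennreal ((PT t f x)\<^sup>2) \<partial>mu) \<le> ennreal ((L2_norm mu f)\<^sup>2)"
    using PT_L2_nn[of f t] t by (simp add: L2_norm_sq[OF f])
  show P: "PT t f \<in> square_integrable mu"
    using le by (intro square_integrableI) (auto intro: le_less_trans)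
  show "L2_norm mu (PT t f) \<le> L2_norm mu f" by (rule L2_norm_le[OF P le L2_norm_nonneg])
qed

text \<open>For unbounded \<open>f\<close> the expectation may fail to exist from some starting
  points. Contraction applied to the square of \<open>f\<close> shows that these are null, so
  linearity can hold almost everywhere.\<close>

lemma PT_integrable_AE:
  assumes f: "f \<in> square_integrable mu" and t: "0 \<le> t"
  shows "AE x in mu. integrable M (\<lambda>\<omega>. if alive_tc (pth x \<omega>) t then f (tc (pth x \<omega>) t) else 0)"
proof -
  have [measurable]: "f \<in> borel_measurable borel" using square_integrable_measurable[OF f] by simp
  have "(\<integral>\<^sup>+x. Pn t (\<lambda>y. ennreal ((f y)\<^sup>2)) x \<partial>mu) \<le> ennreal ((L2_norm mu f)\<^sup>2)"
    using contraction[OF _ t, of "\<lambda>y. ennreal ((f y)\<^sup>2)"] by (simp add: L2_norm_sq[OF f])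
  then have "(\<integral>\<^sup>+x. Pn t (\<lambda>y. ennreal ((f y)\<^sup>2)) x \<partial>mu) \<noteq> \<infinity>" by (auto simp: top_unique)
  then have "AE x in mu. Pn t (\<lambda>y. ennreal ((f y)\<^sup>2)) x \<noteq> \<infinity>" by (intro nn_integral_PInf_AE) auto
  then show ?thesis by eventually_elim (auto intro!: PT_sq_le(2) simp: less_top)
qed

lemma PT_linear_AE:
  assumes f: "f \<in> square_integrable mu" and g: "g \<in> square_integrable mu" and t: "0 \<le> t"
  shows "AE x in mu. PT t (\<lambda>y. a * f y + b * g y) x = a * PT t f x + b * PT t g x"
  using PT_integrable_AE[OF f t] PT_integrable_AE[OF g t]
proof eventually_elim
  case (elim x)
  have "PT t (\<lambda>y. a * f y + b * g y) x = (\<integral>\<omega>. a * (if alive_tc (pth x \<omega>) t then f (tc (pth x \<omega>) t) else 0)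
      + b * (if alive_tc (pth x \<omega>) t then g (tc (pth x \<omega>) t) else 0) \<partial>M)"
    unfolding PT_def by (intro Bochner_Integration.integral_cong) auto
  also have "\<dots> = a * PT t f x + b * PT t g x" unfolding PT_def using elim by simp
  finally show ?case .
qed

lemma PT_cong_AE:
  assumes f: "f \<in> square_integrable mu" and g: "g \<in> square_integrable mu" and t: "0 \<le> t"
    and eq: "AE x in mu. f x = g x"
  shows "AE x in mu. PT t f x = PT t g x"
proof -
  have [measurable]: "f \<in> borel_measurable borel" "g \<in> borel_measurable borel"
    using square_integrable_measurable[OF f] square_integrable_measurable[OF g] by simp_all
  let ?d = "\<lambda>x. 1 * f x + (- 1) * g x"
  have "(\<integral>\<^sup>+x. ennreal ((PT t ?d x)\<^sup>2) \<partial>mu) \<le> (\<integral>\<^sup>+x. ennreal ((?d x)\<^sup>2) \<partial>mu)" by (rule PT_L2_nn[OF _ t]) measurable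
  also have "\<dots> = (\<integral>\<^sup>+x. 0 \<partial>mu)" using eq by (intro nn_integral_cong_AE) auto
  finally have "(\<integral>\<^sup>+x. ennreal ((PT t ?d x)\<^sup>2) \<partial>mu) = 0" by simp
  then have "AE x in mu. ennreal ((PT t ?d x)\<^sup>2) = 0" by (subst (asm) nn_integral_0_iff_AE) auto
  with PT_linear_AE[OF f g t, of 1 "- 1"] show ?thesis by eventually_elim auto
qed

lemma bcont_square_integrable: "bcont f \<Longrightarrow> f \<in> square_integrable mu"
  using bounded_square_integrable[OF bcont_measurable] by (auto simp: bcont_def)

lemma L2_tendsto_dominated:
  assumes [measurable]: "\<And>n::nat. f n \<in> borel_measurable borel" "g \<in> borel_measurable borel"
    and w: "integrable mu w" "\<And>n x. (f n x - g x)\<^sup>2 \<le> w x"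
    and lim: "AE x in mu. (\<lambda>n. f n x) \<longlonglongrightarrow> g x"
  shows "(\<lambda>n. L2_norm mu (\<lambda>x. f n x - g x)) \<longlonglongrightarrow> 0"
proof -
  have "(\<lambda>n. \<integral>x. (f n x - g x)\<^sup>2 \<partial>mu) \<longlonglongrightarrow> (\<integral>x. 0 \<partial>mu)"
  proof (rule integral_dominated_convergence[OF _ _ w(1)])
    show "AE x in mu. (\<lambda>n. (f n x - g x)\<^sup>2) \<longlonglongrightarrow> 0"
      using lim
    proof eventually_elim
      case (elim x)
      have "(\<lambda>n. (f n x - g x)\<^sup>2) \<longlonglongrightarrow> (g x - g x)\<^sup>2"
        by (rule tendsto_power[OF tendsto_diff[OF elim tendsto_const]])
      then show ?case by simp
    qed
    show "AE x in mu. norm ((f n x - g x)\<^sup>2) \<le> w x" for n using w(2) by simp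
  qed auto
  then have "(\<lambda>n. sqrt (\<integral>x. (f n x - g x)\<^sup>2 \<partial>mu)) \<longlonglongrightarrow> sqrt 0" by (intro tendsto_real_sqrt) simp
  then show ?thesis by (simp add: L2_norm_def)
qed

section \<open>Density of the bounded continuous functions\<close>

lemma abs_clamp_le: "0 \<le> c \<Longrightarrow> \<bar>max (- c) (min c y)\<bar> \<le> (c::real)"
  by (simp add: abs_le_iff)

lemma clamp_dist: "\<bar>max (- c) (min c y) - y\<bar> \<le> \<bar>y::real\<bar>" if "0 \<le> c"
  using that by (auto simp: max_def min_def)

text \<open>A Lebesgue measurable function is an almost everywhere limit of continuous ones.
  Clamping these to [-c, c] leaves the limit unchanged and supplies the dominating constant.\<close>

lemma bcont_dense_bounded:
  assumes [measurable]: "h \<in> borel_measurable borel" and c: "0 \<le> c" "\<And>x. \<bar>h x\<bar> \<le> c" and e: "0 < e"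
  obtains g where "bcont g" "L2_norm mu (\<lambda>x. g x - h x) < e"
proof -
  have "h \<in> borel_measurable lebesgue" by (rule measurable_completion) simp
  then have "h measurable_on UNIV" by (intro lebesgue_measurable_imp_measurable_on_real) auto
  then obtain N g where N: "negligible N" and g: "\<And>n. continuous_on UNIV (g n)"
    "\<And>x. x \<notin> N \<Longrightarrow> (\<lambda>n. g n x) \<longlonglongrightarrow> h x"
    unfolding measurable_on_def by auto
  define G where "G n x = max (- c) (min c (g n x))" for n x
  have G: "bcont (G n)" for n
    unfolding bcont_def G_def using abs_clamp_le[OF c(1)] by (auto intro!: continuous_intros g(1))
  have "AE x in lebesgue. x \<notin> N" using N by (intro AE_not_in) (simp add: negligible_iff_null_sets)
  then have "AE x in lborel. x \<notin> N" by (simp add: AE_completion_iff)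
  then have "AE x in mu. x \<notin> N" unfolding mu_eq by (auto simp: AE_density elim: eventually_mono)
  then have lim: "AE x in mu. (\<lambda>n. G n x) \<longlonglongrightarrow> h x"
  proof eventually_elim
    case (elim x)
    have "(\<lambda>n. G n x) \<longlonglongrightarrow> max (- c) (min c (h x))"
      unfolding G_def by (intro tendsto_max tendsto_min tendsto_const g(2) elim)
    moreover have "max (- c) (min c (h x)) = h x" using c(2)[of x] by (auto simp: max_def min_def)
    ultimately show ?case by simp
  qed
  have "(\<lambda>n. L2_norm mu (\<lambda>x. G n x - h x)) \<longlonglongrightarrow> 0"
  proof (rule L2_tendsto_dominated[where w = "\<lambda>_. (2 * c)\<^sup>2"])
    show "(G n x - h x)\<^sup>2 \<le> (2 * c)\<^sup>2" for n x
    proof -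
      have "\<bar>G n x - h x\<bar> \<le> 2 * c" using abs_clamp_le[OF c(1), of "g n x"] c(2)[of x] unfolding G_def by linarith
      then show ?thesis by (rule abs_le_square_iff[THEN iffD1, of _ "2 * c", simplified abs_mult abs_numeral abs_of_nonneg[OF c(1)]])
    qed
  qed (use bcont_measurable[OF G] lim in auto)
  then have "\<forall>\<^sub>F n in sequentially. L2_norm mu (\<lambda>x. G n x - h x) < e" using e by (rule order_tendstoD)
  then obtain n where "L2_norm mu (\<lambda>x. G n x - h x) < e" by (auto simp: eventually_sequentially)
  then show thesis by (intro that[OF G])
qed

lemma bcont_dense:
  assumes f: "f \<in> square_integrable mu" and e: "0 < e"
  obtains g where "bcont g" "L2_norm mu (\<lambda>x. f x - g x) < e"
proof -
  have [measurable]: "f \<in> borel_measurable borel" using square_integrable_measurable[OF f] by simp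
  define h where "h n x = max (- real n) (min (real n) (f x))" for n x
  have [measurable]: "h n \<in> borel_measurable borel" for n unfolding h_def by measurable
  have h_le: "\<bar>h n x\<bar> \<le> real n" for n x unfolding h_def by (rule abs_clamp_le) simp
  have "(\<lambda>n. L2_norm mu (\<lambda>x. h n x - f x)) \<longlonglongrightarrow> 0"
  proof (rule L2_tendsto_dominated[where w = "\<lambda>x. (f x)\<^sup>2"])
    show "integrable mu (\<lambda>x. (f x)\<^sup>2)" using f by (simp add: square_integrable_def)
    show "(h n x - f x)\<^sup>2 \<le> (f x)\<^sup>2" for n x
      using clamp_dist[of "real n" "f x"] unfolding h_def by (simp add: abs_le_square_iff)
    show "AE x in mu. (\<lambda>n. h n x) \<longlonglongrightarrow> f x"
    proof (intro AE_I2 tendsto_eventually)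
      fix x
      obtain k :: nat where "\<bar>f x\<bar> < k" using reals_Archimedean2 by blast
      then show "\<forall>\<^sub>F n in sequentially. h n x = f x"
        unfolding eventually_sequentially h_def by (intro exI[of _ k]) auto
    qed
  qed auto
  then have "\<forall>\<^sub>F n in sequentially. L2_norm mu (\<lambda>x. h n x - f x) < e / 2" using e by (intro order_tendstoD) auto
  then obtain n where n: "L2_norm mu (\<lambda>x. h n x - f x) < e / 2" by (auto simp: eventually_sequentially)
  obtain g where g: "bcont g" "L2_norm mu (\<lambda>x. g x - h n x) < e / 2"
    using bcont_dense_bounded[of "h n" "real n" "e / 2"] h_le e by auto
  have hs: "h n \<in> square_integrable mu" by (rule bounded_square_integrable[where B = "real n"]) (simp_all add: h_le)
  have "L2_norm mu (\<lambda>x. f x - g x) \<le> L2_norm mu (\<lambda>x. f x - h n x) + L2_norm mu (\<lambda>x. h n x - g x)"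
    by (rule L2_norm_diff_triangle[OF f hs bcont_square_integrable[OF g(1)]])
  also have "\<dots> < e"
    using n g(2) unfolding L2_norm_minus_commute[of mu f "h n"] L2_norm_minus_commute[of mu "h n" g] by linarith
  finally show thesis by (intro that[OF g(1)])
qed

section \<open>Compactness of the potential and of the semigroup\<close>

lemma integral_mu: "f \<in> borel_measurable borel \<Longrightarrow> (\<integral>x. f x \<partial>mu) = (\<integral>x. f x * rho x \<partial>lborel)" for f :: "real \<Rightarrow> real"
  unfolding mu_eq using rho_pos by (subst integral_density) (auto simp: less_imp_le mult.commute)

lemma powr_half_square_integrable: "(\<lambda>x. \<bar>x\<bar> powr hp) \<in> square_integrable mu"
proof (rule square_integrableI)
  have sq: "(\<bar>x\<bar> powr hp)\<^sup>2 = \<bar>x\<bar> powr (\<alpha> - 1)" for x :: real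
    by (simp add: power2_eq_square powr_add[symmetric])
  have "(\<integral>\<^sup>+x. ennreal ((\<bar>x\<bar> powr hp)\<^sup>2) \<partial>mu) = (\<integral>\<^sup>+x. ennreal (\<sigma> x powr (- \<alpha>) * \<bar>x\<bar> powr (\<alpha> - 1)) \<partial>lborel)"
    unfolding sq by (subst nn_integral_mu) (auto simp: rho_def ennreal_mult)
  then show "(\<integral>\<^sup>+x. ennreal ((\<bar>x\<bar> powr hp)\<^sup>2) \<partial>mu) < \<infinity>" using I_finite by simp
qed simp

text \<open>Cauchy-Schwarz against |y| powr \<open>hp\<close>, square integrable by the moment
  condition, bounds the size. The Hoelder bound involves the L^1 norm, which on a probability space
  is at most the L^2 norm. The radius 2 is the one in
  \<open>compact_operator_on_L2I\<close>.\<close>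

lemma pot_bounds:
  obtains K where "0 \<le> K"
    "\<And>f x. bcont f \<Longrightarrow> L2_norm mu f \<le> 2 \<Longrightarrow> \<bar>pot f x\<bar> \<le> K * \<bar>x\<bar> powr hp"
    "\<And>f x x'. bcont f \<Longrightarrow> L2_norm mu f \<le> 2 \<Longrightarrow> \<bar>pot f x - pot f x'\<bar> \<le> K * \<bar>x - x'\<bar> powr (\<alpha> - 1)"
proof (rule green_bounds)
  fix C assume C: "C \<ge> 0"
    "\<And>f x. integrable lborel f \<Longrightarrow> (\<And>y. 0 \<le> f y) \<Longrightarrow> integrable lborel (\<lambda>y. f y * \<bar>y\<bar> powr hp) \<Longrightarrow>
       green (\<lambda>y. ennreal (f y)) x \<le> ennreal (C * \<bar>x\<bar> powr hp * (\<integral>y. f y * \<bar>y\<bar> powr hp \<partial>lborel))"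
    "\<And>f g x x'. integrable lborel f \<Longrightarrow> (\<And>y. 0 \<le> f y) \<Longrightarrow> integrable lborel (\<lambda>y. f y * \<bar>y\<bar> powr hp) \<Longrightarrow>
       integrable lborel g \<Longrightarrow> (\<And>y. 0 \<le> g y) \<Longrightarrow> integrable lborel (\<lambda>y. g y * \<bar>y\<bar> powr hp) \<Longrightarrow>
       \<bar>(enn2real (green (\<lambda>y. ennreal (f y)) x) - enn2real (green (\<lambda>y. ennreal (g y)) x)) -
         (enn2real (green (\<lambda>y. ennreal (f y)) x') - enn2real (green (\<lambda>y. ennreal (g y)) x'))\<bar>
       \<le> C * \<bar>x - x'\<bar> powr (\<alpha> - 1) * (\<integral>y. \<bar>f y - g y\<bar> \<partial>lborel)"
  let ?w = "\<lambda>x. \<bar>x\<bar> powr hp :: real"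
  define L where "L = L2_norm mu ?w"
  have L0: "0 \<le> L" unfolding L_def by (rule L2_norm_nonneg)
  have part: "integrable lborel (\<lambda>y. g y * rho y)" "integrable lborel (\<lambda>y. g y * rho y * ?w y)" "\<And>y. 0 \<le> g y * rho y"
    if g: "bcont g" "\<And>y. 0 \<le> g y" for g
  proof -
    obtain B where "\<And>y. \<bar>g y\<bar> \<le> B" using g(1) by (auto simp: bcont_def)
    then show "integrable lborel (\<lambda>y. g y * rho y)" "integrable lborel (\<lambda>y. g y * rho y * ?w y)"
      by (rule weighted_integrable[OF bcont_measurable[OF g(1)]])+
    show "\<And>y. 0 \<le> g y * rho y" using g(2) rho_pos by (simp add: less_imp_le)
  qed
  have bound: "enn2real (green (\<lambda>y. ennreal (g y * rho y)) x) \<le> C * 2 * L * ?w x"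
    if g: "bcont g" "\<And>y. 0 \<le> g y" and g2: "L2_norm mu g \<le> 2" for g x
  proof -
    note [measurable] = bcont_measurable[OF g(1)]
    have "(\<integral>y. g y * rho y * ?w y \<partial>lborel) = (\<integral>y. g y * ?w y \<partial>mu)"
      by (subst integral_mu) (simp_all add: mult_ac)
    also have "\<dots> \<le> L2_norm mu g * L"
      unfolding L_def by (intro L2_Cauchy_Schwarz bcont_square_integrable g powr_half_square_integrable)
    also have "\<dots> \<le> 2 * L" using g2 L0 by (intro mult_right_mono)
    finally have "C * ?w x * (\<integral>y. g y * rho y * ?w y \<partial>lborel) \<le> C * ?w x * (2 * L)"
      using C(1) by (intro mult_left_mono) auto
    then have "green (\<lambda>y. ennreal (g y * rho y)) x \<le> ennreal (C * 2 * L * ?w x)"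
      using C(2)[OF part(1)[OF g] part(3)[OF g] part(2)[OF g], of x] by (elim order_trans) (simp add: ennreal_leI mult_ac)
    then show ?thesis using C(1) L0 by (intro enn2real_leI) auto
  qed
  show thesis
  proof
    \<comment> \<open>One constant for both bounds: the size needs 2 C L, with \<open>L\<close> the
      norm of |x| powr \<open>hp\<close>, and the Hoelder estimate needs 2 C.\<close>
    show "0 \<le> 2 * C * (L + 1)" using C(1) L0 by simp
    fix f x x' assume f: "bcont f" "L2_norm mu f \<le> 2"
    note [measurable] = bcont_measurable[OF f(1)]
    note fs = bcont_square_integrable[OF f(1)]
    let ?p = "\<lambda>x. max 0 (f x)" and ?n = "\<lambda>x. max 0 (- f x)"
    note pn = bcont_pos_neg[OF f(1)]
    have mono: "L2_norm mu g \<le> 2" if g: "bcont g" "\<And>y. \<bar>g y\<bar> \<le> \<bar>f y\<bar>" for g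
    proof -
      have "(\<integral>x. (g x)\<^sup>2 \<partial>mu) \<le> (\<integral>x. (f x)\<^sup>2 \<partial>mu)"
        using fs bcont_square_integrable[OF g(1)] g(2)
        by (intro integral_mono) (simp_all add: square_integrable_def abs_le_square_iff)
      then have "L2_norm mu g \<le> L2_norm mu f" unfolding L2_norm_def by (rule real_sqrt_le_mono)
      then show ?thesis using f(2) by simp
    qed
    have "enn2real (green (\<lambda>y. ennreal (?p y * rho y)) x) \<le> C * 2 * L * ?w x"
      "enn2real (green (\<lambda>y. ennreal (?n y * rho y)) x) \<le> C * 2 * L * ?w x"
      by (intro bound pn mono; simp)+
    then have "\<bar>pot f x\<bar> \<le> C * 2 * L * ?w x"
      unfolding pot_def using enn2real_nonneg[of "green (\<lambda>y. ennreal (?p y * rho y)) x"]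
        enn2real_nonneg[of "green (\<lambda>y. ennreal (?n y * rho y)) x"] by linarith
    also have "\<dots> \<le> 2 * C * (L + 1) * ?w x" using C(1) L0 by (intro mult_right_mono) (auto simp: algebra_simps)
    finally show "\<bar>pot f x\<bar> \<le> 2 * C * (L + 1) * ?w x" .
    have p: "\<And>y. 0 \<le> ?p y" and n: "\<And>y. 0 \<le> ?n y" by auto
    have "(\<integral>y. \<bar>?p y * rho y - ?n y * rho y\<bar> \<partial>lborel) = (\<integral>y. \<bar>f y\<bar> * rho y \<partial>lborel)"
    proof (rule Bochner_Integration.integral_cong)
      fix y
      have "?p y * rho y - ?n y * rho y = f y * rho y" by (auto simp: max_def)
      then show "\<bar>?p y * rho y - ?n y * rho y\<bar> = \<bar>f y\<bar> * rho y" using rho_pos[of y] by (simp add: abs_mult)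
    qed simp
    also have "\<dots> = (\<integral>y. \<bar>f y\<bar> \<partial>mu)" by (subst integral_mu) simp_all
    also have "\<dots> \<le> 2" using L1_le_L2(2)[OF fs] f(2) by simp
    finally have le2: "(\<integral>y. \<bar>?p y * rho y - ?n y * rho y\<bar> \<partial>lborel) \<le> 2" .
    have "\<bar>pot f x - pot f x'\<bar> \<le> C * \<bar>x - x'\<bar> powr (\<alpha> - 1) * (\<integral>y. \<bar>?p y * rho y - ?n y * rho y\<bar> \<partial>lborel)"
      unfolding pot_def
      by (rule C(3)[OF part(1)[OF pn(1) p] part(3)[OF pn(1) p] part(2)[OF pn(1) p] part(1)[OF pn(2) n] part(3)[OF pn(2) n] part(2)[OF pn(2) n]])
    also have "\<dots> \<le> C * \<bar>x - x'\<bar> powr (\<alpha> - 1) * 2" using C(1) le2 by (intro mult_left_mono) auto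
    also have "\<dots> \<le> 2 * C * (L + 1) * \<bar>x - x'\<bar> powr (\<alpha> - 1)"
    proof -
      have "0 \<le> C * L * \<bar>x - x'\<bar> powr (\<alpha> - 1)" using C(1) L0 by simp
      then show ?thesis by (simp add: algebra_simps)
    qed
    finally show "\<bar>pot f x - pot f x'\<bar> \<le> 2 * C * (L + 1) * \<bar>x - x'\<bar> powr (\<alpha> - 1)" .
  qed
qed

text \<open>Defined through positive and negative parts, the potential is not visibly linear;
  linearity is read off the time integral of \<open>PT\<close>.\<close>

lemma pot_diff:
  assumes f: "bcont f" and g: "bcont g"
  shows "pot (\<lambda>y. f y - g y) x = pot f x - pot g x"
proof -
  have "pot (\<lambda>y. f y - g y) x = (\<integral>t. indicator {0..} t * PT t f x - indicator {0..} t * PT t g x \<partial>lborel)"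
    unfolding PT_integral_pot(2)[OF bcont_diff[OF f g], symmetric] PT_bcont_diff[OF f g] right_diff_distrib ..
  also have "\<dots> = pot f x - pot g x"
    using PT_integral_pot[OF f, of x] PT_integral_pot[OF g, of x] by simp
  finally show ?thesis .
qed

lemma pot_measurable:
  assumes "bcont f" shows "pot f \<in> borel_measurable borel"
proof -
  note [measurable] = bcont_measurable[OF assms]
  have "pot f = (\<lambda>x. \<integral>t. indicator {0..} t * PT t f x \<partial>lborel)" by (simp add: PT_integral_pot(2)[OF assms])
  then show ?thesis by simp
qed

text \<open>Arzela-Ascoli on the line: dividing by 1 + |x| powr \<open>hp\<close> gives one bound
  for all x, a diagonal sequence converges at the rationals, and the common Hoelder bound carries
  convergence to every x.\<close>

lemma pot_convergent_subsequence:
  assumes g: "\<And>n::nat. bcont (g n)" "\<And>n. L2_norm mu (g n) \<le> 2"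
  shows "\<exists>r::nat \<Rightarrow> nat. strict_mono r \<and> (\<forall>x. convergent (\<lambda>n. pot (g (r n)) x))"
proof -
  obtain K where K: "0 \<le> K"
    "\<And>f x. bcont f \<Longrightarrow> L2_norm mu f \<le> 2 \<Longrightarrow> \<bar>pot f x\<bar> \<le> K * \<bar>x\<bar> powr hp"
    "\<And>f x x'. bcont f \<Longrightarrow> L2_norm mu f \<le> 2 \<Longrightarrow> \<bar>pot f x - pot f x'\<bar> \<le> K * \<bar>x - x'\<bar> powr (\<alpha> - 1)"
    using pot_bounds by metis
  have b: "norm (pot (g n) x / (1 + \<bar>x\<bar> powr hp)) \<le> K" for n x
  proof -
    have "\<bar>pot (g n) x\<bar> \<le> K * \<bar>x\<bar> powr hp" by (rule K(2)[OF g])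
    also have "\<dots> \<le> K * (1 + \<bar>x\<bar> powr hp)" using K(1) by (intro mult_left_mono) auto
    finally have "\<bar>pot (g n) x\<bar> \<le> K * (1 + \<bar>x\<bar> powr hp)" .
    moreover have "0 < 1 + \<bar>x\<bar> powr hp" by (simp add: add_pos_nonneg)
    ultimately show ?thesis by (simp add: pos_divide_le_eq)
  qed
  obtain r where r: "strict_mono (r :: nat \<Rightarrow> nat)"
    "\<And>x. x \<in> \<rat> \<Longrightarrow> \<exists>l. (\<lambda>n. pot (g (r n)) x / (1 + \<bar>x\<bar> powr hp)) \<longlonglongrightarrow> l"
    using function_convergent_subsequence[OF countable_rat, of "\<lambda>n x. pot (g n) x / (1 + \<bar>x\<bar> powr hp)" K, OF b] by blast
  have rat: "Cauchy (\<lambda>n. pot (g (r n)) q)" if q: "q \<in> \<rat>" for q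
  proof -
    obtain l where "(\<lambda>n. pot (g (r n)) q / (1 + \<bar>q\<bar> powr hp)) \<longlonglongrightarrow> l" using r(2)[OF q] by blast
    then have "(\<lambda>n. pot (g (r n)) q / (1 + \<bar>q\<bar> powr hp) * (1 + \<bar>q\<bar> powr hp)) \<longlonglongrightarrow> l * (1 + \<bar>q\<bar> powr hp)"
      by (rule tendsto_mult[OF _ tendsto_const])
    moreover have "1 + \<bar>q\<bar> powr hp \<noteq> 0" using powr_ge_zero[of "\<bar>q\<bar>" hp] by linarith
    ultimately show ?thesis by (auto intro: LIMSEQ_imp_Cauchy)
  qed
  have "convergent (\<lambda>n. pot (g (r n)) x)" for x
  proof (rule Cauchy_convergent, rule metric_CauchyI)
    fix e :: real assume e: "0 < e"
    \<comment> \<open>Makes the Hoelder error K |x - q| powr (\<alpha> - 1) at most e / 4 when |x -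
      q| is below \<open>d\<close>; two such errors and the Cauchy error at q stay below e.
      \<open>K + 1\<close> avoids division by 0.\<close>
    define c where "c = e / (4 * (K + 1))"
    define d where "d = c powr (1 / (\<alpha> - 1))"
    have p: "0 < c" using e K(1) by (simp add: c_def)
    then have d: "0 < d" by (simp add: d_def)
    obtain q where q: "q \<in> \<rat>" "x < q" "q < x + d" using Rats_dense_in_real[of x "x + d"] d by auto
    have "\<bar>x - q\<bar> powr (\<alpha> - 1) \<le> d powr (\<alpha> - 1)" using q alpha by (intro powr_mono2) auto
    also have "\<dots> = c" using p alpha by (simp add: d_def powr_powr)
    finally have "K * \<bar>x - q\<bar> powr (\<alpha> - 1) \<le> K * c" using K(1) by (intro mult_left_mono)
    also have "\<dots> \<le> e / 4" using K(1) e by (simp add: c_def field_simps)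
    finally have near: "\<bar>pot (g n) x - pot (g n) q\<bar> \<le> e / 4" for n using K(3)[OF g, of n x q] by linarith
    obtain n0 where n0: "\<And>m n. n0 \<le> m \<Longrightarrow> n0 \<le> n \<Longrightarrow> dist (pot (g (r m)) q) (pot (g (r n)) q) < e / 4"
      using metric_CauchyD[OF rat[OF q(1)], of "e / 4"] e by auto
    show "\<exists>M. \<forall>m\<ge>M. \<forall>n\<ge>M. dist (pot (g (r m)) x) (pot (g (r n)) x) < e"
    proof (intro exI[of _ n0] allI impI)
      fix m n assume "n0 \<le> m" "n0 \<le> n"
      then show "dist (pot (g (r m)) x) (pot (g (r n)) x) < e"
        using n0[of m n] near[of "r m"] near[of "r n"] e unfolding dist_real_def by linarith
    qed
  qed
  then show ?thesis using r(1) by blast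
qed

text \<open>Pointwise convergence of the potentials becomes L^2 convergence because a multiple of
  |x| powr \<open>hp\<close> dominates. \<open>smoothing\<close> and Cauchy-Schwarz then bound the
  squared norm of P_t (g m - g n) by the norm of the potential difference over t, the inputs
  differing by at most 4 in norm.\<close>

lemma PT_Cauchy_subsequence:
  assumes g: "\<And>n::nat. bcont (g n)" "\<And>n. L2_norm mu (g n) \<le> 2" and t: "0 < t"
  shows "\<exists>r::nat \<Rightarrow> nat. strict_mono r \<and> (\<forall>e>0. \<exists>n0. \<forall>m\<ge>n0. \<forall>n\<ge>n0. L2_norm mu (\<lambda>x. PT t (g (r m)) x - PT t (g (r n)) x) < e)"
proof -
  obtain K where K: "0 \<le> K"
    "\<And>f x. bcont f \<Longrightarrow> L2_norm mu f \<le> 2 \<Longrightarrow> \<bar>pot f x\<bar> \<le> K * \<bar>x\<bar> powr hp"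
    "\<And>f x x'. bcont f \<Longrightarrow> L2_norm mu f \<le> 2 \<Longrightarrow> \<bar>pot f x - pot f x'\<bar> \<le> K * \<bar>x - x'\<bar> powr (\<alpha> - 1)"
    using pot_bounds by metis
  from pot_convergent_subsequence[where g = g, OF g]
  obtain r :: "nat \<Rightarrow> nat" where r: "strict_mono r" "\<forall>x. convergent (\<lambda>n. pot (g (r n)) x)"
    by (elim exE conjE)
  define H where "H x = lim (\<lambda>n. pot (g (r n)) x)" for x
  have [measurable]: "pot (g n) \<in> borel_measurable borel" for n by (rule pot_measurable[OF g(1)])
  have [measurable]: "H \<in> borel_measurable borel" unfolding H_def by measurable
  have lim: "(\<lambda>n. pot (g (r n)) x) \<longlonglongrightarrow> H x" for x using r(2) by (simp add: H_def convergent_LIMSEQ_iff)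
  have H_le: "\<bar>H x\<bar> \<le> K * \<bar>x\<bar> powr hp" for x
    using K(2)[OF g] by (intro LIMSEQ_le_const2[OF tendsto_rabs[OF lim]]) auto
  have w: "integrable mu (\<lambda>x. (2 * K)\<^sup>2 * (\<bar>x\<bar> powr hp)\<^sup>2)"
    using powr_half_square_integrable by (simp add: square_integrable_def)
  have wK: "(\<lambda>x. K * \<bar>x\<bar> powr hp) \<in> square_integrable mu"
    using square_integrable_lincomb[OF powr_half_square_integrable powr_half_square_integrable, of K 0] by simp
  have sq: "h \<in> square_integrable mu" if [measurable]: "h \<in> borel_measurable borel" and le: "\<And>x. \<bar>h x\<bar> \<le> K * \<bar>x\<bar> powr hp" for h
  proof -
    have le2: "(h x)\<^sup>2 \<le> (K * \<bar>x\<bar> powr hp)\<^sup>2" for x using le[of x] K(1) by (simp add: abs_le_square_iff[symmetric])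
    have "integrable mu (\<lambda>x. (h x)\<^sup>2)"
    proof (rule Bochner_Integration.integrable_bound[of mu "\<lambda>x. (K * \<bar>x\<bar> powr hp)\<^sup>2"])
      show "AE x in mu. norm ((h x)\<^sup>2) \<le> norm ((K * \<bar>x\<bar> powr hp)\<^sup>2)" using le2 by (intro AE_I2) (simp only: real_norm_def abs_power2)
      show "integrable mu (\<lambda>x. (K * \<bar>x\<bar> powr hp)\<^sup>2)" using wK unfolding square_integrable_def by blast
    qed measurable
    then show ?thesis by (simp add: square_integrable_def)
  qed
  have pot_sq: "pot (g n) \<in> square_integrable mu" for n by (rule sq) (use K(2)[OF g] in auto)
  have H_sq: "H \<in> square_integrable mu" by (rule sq) (use H_le in auto)
  have conv: "(\<lambda>n. L2_norm mu (\<lambda>x. pot (g (r n)) x - H x)) \<longlonglongrightarrow> 0"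
  proof (rule L2_tendsto_dominated[OF _ _ w])
    show "(pot (g (r n)) x - H x)\<^sup>2 \<le> (2 * K)\<^sup>2 * (\<bar>x\<bar> powr hp)\<^sup>2" for n x
    proof -
      have "\<bar>pot (g (r n)) x - H x\<bar> \<le> \<bar>2 * K * \<bar>x\<bar> powr hp\<bar>" using K(2)[OF g, of "r n" x] H_le[of x] K(1) by simp
      then show ?thesis by (simp only: abs_le_square_iff power_mult_distrib)
    qed
  qed (use lim in auto)
  have smooth: "(L2_norm mu (\<lambda>x. PT t (g m) x - PT t (g n) x))\<^sup>2 \<le> L2_norm mu (\<lambda>x. pot (g m) x - pot (g n) x) / t" for m n
  proof -
    let ?f = "\<lambda>y. g m y - g n y"
    have f: "bcont ?f" by (intro bcont_diff g)
    have "L2_norm mu ?f \<le> L2_norm mu (g m) + L2_norm mu (\<lambda>x. - g n x)"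
      using L2_norm_triangle[OF bcont_square_integrable[OF g(1)] bcont_square_integrable[of "\<lambda>x. - g n x"], of m] bcont_diff[of "\<lambda>_. 0" "g n"] g(1)
      by (auto simp: bcont_def intro!: continuous_intros)
    then have f4: "L2_norm mu ?f \<le> 4" using g(2)[of m] g(2)[of n] by (simp add: L2_norm_def)
    have "(L2_norm mu (\<lambda>x. PT t (g m) x - PT t (g n) x))\<^sup>2 = (\<integral>x. (PT t ?f x)\<^sup>2 \<partial>mu)"
      unfolding L2_norm_def PT_bcont_diff[OF g(1) g(1)] by simp
    also have "\<dots> \<le> (\<integral>x. ?f x * pot ?f x \<partial>mu) / (4 * t)" by (rule smoothing[OF f t])
    also have "\<dots> \<le> (4 * L2_norm mu (\<lambda>x. pot (g m) x - pot (g n) x)) / (4 * t)"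
    proof (rule divide_right_mono)
      have "(\<integral>x. ?f x * pot ?f x \<partial>mu) \<le> L2_norm mu ?f * L2_norm mu (\<lambda>x. pot (g m) x - pot (g n) x)"
        unfolding pot_diff[OF g(1) g(1)] by (intro L2_Cauchy_Schwarz bcont_square_integrable f square_integrable_diff pot_sq)
      also have "\<dots> \<le> 4 * L2_norm mu (\<lambda>x. pot (g m) x - pot (g n) x)" using f4 by (intro mult_right_mono L2_norm_nonneg)
      finally show "(\<integral>x. ?f x * pot ?f x \<partial>mu) \<le> 4 * L2_norm mu (\<lambda>x. pot (g m) x - pot (g n) x)" .
    qed (use t in simp)
    finally show ?thesis using t by simp
  qed
  have "\<exists>n0. \<forall>m\<ge>n0. \<forall>n\<ge>n0. L2_norm mu (\<lambda>x. PT t (g (r m)) x - PT t (g (r n)) x) < e" if e: "0 < e" for e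
  proof -
    \<comment> \<open>Two potentials within \<open>d\<close> of the limit differ by less than t e^2,
      which after division by t bounds the squared norm by e^2.\<close>
    define d where "d = t * e\<^sup>2 / 2"
    have "0 < d" using t e by (simp add: d_def)
    then have "\<forall>\<^sub>F n in sequentially. L2_norm mu (\<lambda>x. pot (g (r n)) x - H x) < d" using conv by (intro order_tendstoD)
    then obtain n0 where n0: "\<And>n. n0 \<le> n \<Longrightarrow> L2_norm mu (\<lambda>x. pot (g (r n)) x - H x) < d" by (auto simp: eventually_sequentially)
    show ?thesis
    proof (intro exI[of _ n0] allI impI)
      fix m n assume mn: "n0 \<le> m" "n0 \<le> n"
      have "L2_norm mu (\<lambda>x. pot (g (r m)) x - pot (g (r n)) x)
          \<le> L2_norm mu (\<lambda>x. pot (g (r m)) x - H x) + L2_norm mu (\<lambda>x. H x - pot (g (r n)) x)"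
        by (rule L2_norm_diff_triangle[OF pot_sq H_sq pot_sq])
      also have "\<dots> < t * e\<^sup>2"
        using n0[OF mn(1)] n0[OF mn(2)] unfolding L2_norm_minus_commute[of mu H] d_def by linarith
      finally have "L2_norm mu (\<lambda>x. pot (g (r m)) x - pot (g (r n)) x) / t < e\<^sup>2" using t by (simp add: divide_less_eq mult.commute)
      then have "(L2_norm mu (\<lambda>x. PT t (g (r m)) x - PT t (g (r n)) x))\<^sup>2 < e\<^sup>2" using smooth[of "r m" "r n"] by linarith
      then show "L2_norm mu (\<lambda>x. PT t (g (r m)) x - PT t (g (r n)) x) < e" using e by (simp add: power2_less_imp_less)
    qed
  qed
  then show ?thesis using r(1) by blast
qed

text \<open>The operator is prescribed only off the origin, which is null. Keeping it abstract
  separates the analysis of \<open>PT\<close> from its identification with the killed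
  kernel.\<close>

lemma compact_on_L2:
  assumes t: "0 < t"
    and T: "\<And>f x. f \<in> square_integrable N0 \<Longrightarrow> x \<noteq> 0 \<Longrightarrow> T f x = PT t (off0 f) x"
  shows "compact_operator_on_L2 N0 T"
proof -
  have t': "0 \<le> t" using t by simp
  have cutT: "off0 (T f) = off0 (PT t (off0 f))" if "f \<in> square_integrable N0" for f
    using T[OF that] by (auto simp: off0_def)
  have cf: "off0 f \<in> square_integrable mu" if "f \<in> square_integrable N0" for f
    using that by (simp only: N0_square_integrable_iff)
  have meas: "f \<in> borel_measurable borel" if "f \<in> square_integrable mu" for f
    using square_integrable_measurable[OF that] by simp
  have Tsq: "T f \<in> square_integrable N0" if f: "f \<in> square_integrable N0" for f
    unfolding N0_square_integrable_iff cutT[OF f] using PT_L2(1)[OF cf[OF f] t'] by (simp only: square_integrable_off0[OF meas])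
  have AE_N0: "AE x in N0. P x" if P: "AE x in mu. x \<noteq> 0 \<longrightarrow> P x" for P
    unfolding N0_AE_iff using P mu_not_zero by eventually_elim simp
  have lin: "AE x in N0. T (\<lambda>y. a * f y + b * g y) x = a * T f x + b * T g x"
    if f: "f \<in> square_integrable N0" and g: "g \<in> square_integrable N0" for f g a b
  proof (rule AE_N0)
    have c: "off0 (\<lambda>y. a * f y + b * g y) = (\<lambda>y. a * off0 f y + b * off0 g y)" by (auto simp: off0_def)
    show "AE x in mu. x \<noteq> 0 \<longrightarrow> T (\<lambda>y. a * f y + b * g y) x = a * T f x + b * T g x"
      using PT_linear_AE[OF cf[OF f] cf[OF g] t', of a b]
      by eventually_elim (simp add: T f g square_integrable_lincomb[OF f g] c)
  qed
  have cong: "AE x in N0. T f x = T g x"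
    if f: "f \<in> square_integrable N0" and g: "g \<in> square_integrable N0" and eq: "AE x in N0. f x = g x" for f g
  proof (rule AE_N0)
    have "AE x in mu. f x = g x" using eq by (simp only: N0_AE_iff)
    then have "AE x in mu. off0 f x = off0 g x" by eventually_elim (simp add: off0_def)
    from PT_cong_AE[OF cf[OF f] cf[OF g] t' this]
    show "AE x in mu. x \<noteq> 0 \<longrightarrow> T f x = T g x" by eventually_elim (simp add: T f g)
  qed
  show ?thesis
  proof (rule compact_operator_on_L2I)
    show "acts_linearly_on_L2 N0 T"
      unfolding acts_linearly_on_L2_def using Tsq lin cong by blast
    show "L2_norm N0 (T f) \<le> L2_norm N0 f" if f: "f \<in> square_integrable N0" for f
      unfolding N0_L2_norm cutT[OF f] L2_norm_off0[OF meas[OF PT_L2(1)[OF cf[OF f] t']]]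
      by (rule PT_L2(2)[OF cf[OF f] t'])
    have D: "g \<in> square_integrable N0" if g: "bcont g" for g
      using bcont_square_integrable[OF g] by (simp only: N0_square_integrable_iff square_integrable_off0[OF bcont_measurable[OF g]])
    then show "{f. bcont f} \<subseteq> square_integrable N0" by auto
    show "\<exists>g\<in>{f. bcont f}. L2_norm N0 (\<lambda>x. f x - g x) < e" if f: "f \<in> square_integrable N0" and e: "0 < e" for f e
    proof -
      obtain g where g: "bcont g" "L2_norm mu (\<lambda>x. off0 f x - g x) < e" using bcont_dense[OF cf[OF f] e] by blast
      note [measurable] = bcont_measurable[OF g(1)] meas[OF cf[OF f]]
      have "off0 (\<lambda>x. f x - g x) = off0 (\<lambda>x. off0 f x - g x)" by (auto simp: off0_def)
      then have "L2_norm N0 (\<lambda>x. f x - g x) = L2_norm mu (off0 (\<lambda>x. off0 f x - g x))" by (simp only: N0_L2_norm)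
      also have "\<dots> = L2_norm mu (\<lambda>x. off0 f x - g x)" by (rule L2_norm_off0) measurable
      finally show ?thesis using g by auto
    qed
    fix g :: "nat \<Rightarrow> real \<Rightarrow> real" assume g: "\<And>n. g n \<in> {f. bcont f}" "\<And>n. L2_norm N0 (g n) \<le> 2"
    have gb: "bcont (g n)" for n using g(1) by simp
    have g2: "L2_norm mu (g n) \<le> 2" for n using g(2)[of n] by (simp only: N0_L2_norm L2_norm_off0[OF bcont_measurable[OF gb]])
    have eq: "L2_norm N0 (\<lambda>x. T (g m) x - T (g n) x) = L2_norm mu (\<lambda>x. PT t (g m) x - PT t (g n) x)" for m n
    proof -
      note [measurable] = bcont_measurable[OF gb] meas[OF PT_L2(1)[OF cf[OF D[OF gb]] t']]
      have "L2_norm N0 (\<lambda>x. T (g m) x - T (g n) x) = L2_norm mu (\<lambda>x. off0 (T (g m)) x - off0 (T (g n)) x)"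
        unfolding N0_L2_norm by (intro arg_cong[of _ _ "L2_norm mu"]) (auto simp: off0_def)
      also have "\<dots> = L2_norm mu (\<lambda>x. PT t (g m) x - PT t (g n) x)"
        unfolding cutT[OF D[OF gb]]
      proof (rule L2_norm_cong_AE)
        have "AE x in mu. PT t (off0 (g k)) x = PT t (g k) x" for k
          by (intro PT_cong_AE cf D bcont_square_integrable gb t' off0_AE)
        from this[of m] this[of n] mu_not_zero
        show "AE x in mu. off0 (PT t (off0 (g m))) x - off0 (PT t (off0 (g n))) x = PT t (g m) x - PT t (g n) x"
          by eventually_elim (simp add: off0_def)
      qed (simp_all cong: measurable_cong_sets)
      finally show ?thesis .
    qed
    show "\<exists>r::nat \<Rightarrow> nat. strict_mono r \<and> (\<forall>e>0. \<exists>n0. \<forall>m\<ge>n0. \<forall>n\<ge>n0. L2_norm N0 (\<lambda>x. T (g (r m)) x - T (g (r n)) x) < e)"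
      unfolding eq by (rule PT_Cauchy_subsequence[OF gb g2 t])
  qed
qed

subsection \<open>Identification of the killed kernel\<close>

text \<open>Almost every path is killed in finite time and never jumps away from a left limit 0; for
  such paths \<open>hitting_time_iff\<close> compares hitting of 0 with survival.\<close>

lemma killed_event_AE:
  assumes X: "AE \<omega> in M. \<forall>s\<ge>0. X s \<omega> = W s \<omega>" and x: "x \<noteq> 0" and t: "0 < t"
  shows "AE \<omega> in M. (ereal t < hitting_time_zero (\<lambda>s. Y_process \<sigma> \<alpha> X x s \<omega>) \<longleftrightarrow> alive_tc (pth x \<omega>) t)
    \<and> (alive_tc (pth x \<omega>) t \<longrightarrow> Y_process \<sigma> \<alpha> X x t \<omega> = tc (pth x \<omega>) t)"
  using X killed_AE[of x] no_jump_AE[of x]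
proof eventually_elim
  case (elim \<omega>)
  have agree: "Y_process \<sigma> \<alpha> X x s \<omega> = tc (pth x \<omega>) s" if "0 \<le> s" "0 \<le> b" "s < clk (pth x \<omega>) b" for s b
    unfolding Y_process_def using elim(1) that by (intro time_changed_cong[OF skorokhod_W]) auto
  have "ereal t < hitting_time_zero (\<lambda>s. Y_process \<sigma> \<alpha> X x s \<omega>) \<longleftrightarrow> alive_tc (pth x \<omega>) t"
    using elim(2,3) x t agree by (intro hitting_time_iff[OF skorokhod_W]) (auto simp: W_nonpos)
  moreover have "alive_tc (pth x \<omega>) t \<Longrightarrow> Y_process \<sigma> \<alpha> X x t \<omega> = tc (pth x \<omega>) t"
    using alive_tc_iff[OF skorokhod_W, of t x \<omega>] t agree by auto
  ultimately show ?case by blast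
qed

text \<open>\<open>measure_of\<close> reproduces its set function only if that is a measure. Up to
  null sets of the completion the killed events agree with measurable events of the regular version,
  which identifies the set function with the image of \<open>M\<close> restricted to surviving
  paths.\<close>

lemma killed_semigroup_eq:
  assumes X: "AE \<omega> in M. \<forall>s\<ge>0. X s \<omega> = W s \<omega>" and x: "x \<noteq> 0" and t: "0 < t"
    and f: "f \<in> borel_measurable (restrict_space borel R0)"
  shows "killed_semigroup \<sigma> \<alpha> M X t f x = PT t (off0 f) x"
proof -
  let ?R = "restrict_space borel R0 :: real measure"
  let ?a = "\<lambda>\<omega>. alive_tc (pth x \<omega>) t"
  \<comment> \<open>The value 1 on dead paths is an arbitrary nonzero point: it keeps
    \<open>h\<close> inside the punctured line, and these paths carry weight 0 in
    \<open>D\<close>.\<close>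
  define h where "h \<omega> = (if ?a \<omega> then tc (pth x \<omega>) t else 1)" for \<omega>
  define D where "D = density M (\<lambda>\<omega>. ennreal (indicator {\<omega>. ?a \<omega>} \<omega>))"
  have [measurable]: "(\<lambda>\<omega>. indicator {\<omega>. ?a \<omega>} \<omega> :: real) \<in> borel_measurable M"
    unfolding indicator_def mem_Collect_eq by measurable
  have h0: "h \<omega> \<noteq> 0" for \<omega> using alive_tc_nonzero[OF skorokhod_W] t by (simp add: h_def)
  have "h \<in> borel_measurable M" unfolding h_def by measurable
  then have [measurable]: "h \<in> measurable M ?R" by (rule measurable_restrict_space2[rotated]) (simp add: h0)
  have hD: "h \<in> measurable D ?R" unfolding D_def by measurable
  have "killed_kernel \<sigma> \<alpha> M X t x = measure_of (space (distr D ?R h)) (sets (distr D ?R h)) (emeasure (distr D ?R h))"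
    unfolding killed_kernel_def space_distr sets_distr space_restrict_space
  proof (simp only: space_borel Int_UNIV_right, rule measure_of_eq)
    show "sets ?R \<subseteq> Pow R0" using sets.space_closed[of ?R] by (simp add: space_restrict_space)
    fix A assume "A \<in> sigma_sets R0 (sets ?R)"
    then have A [measurable]: "A \<in> sets ?R" using sets.sigma_sets_eq[of ?R] by (simp add: space_restrict_space)
    let ?E = "{\<omega> \<in> space M. ?a \<omega> \<and> h \<omega> \<in> A}"
    have E: "?E \<in> sets M" by measurable
    have "emeasure (completion M) {\<omega> \<in> space M. Y_process \<sigma> \<alpha> X x t \<omega> \<in> A \<and>
        ereal t < hitting_time_zero (\<lambda>s. Y_process \<sigma> \<alpha> X x s \<omega>)} = emeasure (completion M) ?E"
    proof (rule emeasure_eq_AE)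
      show E': "?E \<in> sets (completion M)" using E by (rule sets_completionI_sets)
      have ae: "AE \<omega> in M. \<omega> \<in> space M \<longrightarrow> (Y_process \<sigma> \<alpha> X x t \<omega> \<in> A \<and>
        ereal t < hitting_time_zero (\<lambda>s. Y_process \<sigma> \<alpha> X x s \<omega>) \<longleftrightarrow> \<omega> \<in> ?E)"
        using killed_event_AE[OF X x t] by eventually_elim (auto simp: h_def)
      then show "AE \<omega> in completion M. (\<omega> \<in> {\<omega> \<in> space M. Y_process \<sigma> \<alpha> X x t \<omega> \<in> A \<and>
        ereal t < hitting_time_zero (\<lambda>s. Y_process \<sigma> \<alpha> X x s \<omega>)}) = (\<omega> \<in> ?E)"
        unfolding AE_completion_iff by eventually_elim auto
      then show "{\<omega> \<in> space M. Y_process \<sigma> \<alpha> X x t \<omega> \<in> A \<and>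
        ereal t < hitting_time_zero (\<lambda>s. Y_process \<sigma> \<alpha> X x s \<omega>)} \<in> sets (completion M)"
        by (intro completion.in_sets_AE[OF _ E']) (auto elim: eventually_mono)
    qed
    also have "\<dots> = emeasure M ?E" using E by simp
    also have "\<dots> = (\<integral>\<^sup>+\<omega>. indicator ?E \<omega> \<partial>M)" using E by simp
    also have "\<dots> = (\<integral>\<^sup>+\<omega>. ennreal (indicator {\<omega>. ?a \<omega>} \<omega>) * indicator (h -` A \<inter> space M) \<omega> \<partial>M)"
      by (intro nn_integral_cong) (auto simp: indicator_def)
    also have "\<dots> = emeasure D (h -` A \<inter> space M)"
      unfolding D_def by (rule emeasure_density[symmetric]) measurable
    also have "\<dots> = emeasure (distr D ?R h) A"
      using emeasure_distr[OF hD A] by (simp add: D_def)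
    finally show "emeasure (completion M) {\<omega> \<in> space M. Y_process \<sigma> \<alpha> X x t \<omega> \<in> A \<and>
        ereal t < hitting_time_zero (\<lambda>s. Y_process \<sigma> \<alpha> X x s \<omega>)} = emeasure (distr D ?R h) A" .
  qed
  then have "killed_kernel \<sigma> \<alpha> M X t x = distr D ?R h" by (simp only: measure_of_of_measure)
  then have "killed_semigroup \<sigma> \<alpha> M X t f x = (\<integral>\<omega>. f (h \<omega>) \<partial>D)"
    unfolding killed_semigroup_def using integral_distr[OF hD f] by simp
  also have "\<dots> = (\<integral>\<omega>. indicator {\<omega>. ?a \<omega>} \<omega> *\<^sub>R f (h \<omega>) \<partial>M)"
    unfolding D_def using f by (intro integral_density) auto
  also have "\<dots> = PT t (off0 f) x"
    unfolding PT_def using alive_tc_nonzero[OF skorokhod_W, of t x] t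
    by (intro Bochner_Integration.integral_cong) (auto simp: h_def off0_def indicator_def)
  finally show ?thesis .
qed

end

section \<open>A regular version of the given process\<close>

text \<open>Independence says that the joint law is the product of the marginal laws, and for
  countably many variables neither side sees null sets.\<close>

lemma (in prob_space) indep_vars_cong_AE:
  assumes X: "indep_vars (\<lambda>_. borel) X I"
    and Y: "\<And>i. i \<in> I \<Longrightarrow> Y i \<in> borel_measurable M" and I: "countable I"
    and eq: "\<And>i. i \<in> I \<Longrightarrow> AE \<omega> in M. X i \<omega> = (Y i \<omega> :: real)"
  shows "indep_vars (\<lambda>_. borel) Y I"
proof (cases "I = {}")
  case True
  then show ?thesis using X unfolding indep_vars_def indep_sets_def by simp
next
  case False
  have Xm: "X i \<in> borel_measurable M" if "i \<in> I" for i using X that by (simp add: indep_vars_def)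
  have "distr M (PiM I (\<lambda>_. borel)) (\<lambda>\<omega>. \<lambda>i\<in>I. Y i \<omega>) = distr M (PiM I (\<lambda>_. borel)) (\<lambda>\<omega>. \<lambda>i\<in>I. X i \<omega>)"
  proof (rule distr_cong_AE)
    have "AE \<omega> in M. \<forall>i\<in>I. X i \<omega> = Y i \<omega>" using eq I by (simp add: AE_ball_countable)
    then show "AE \<omega> in M. (\<lambda>i\<in>I. Y i \<omega>) = (\<lambda>i\<in>I. X i \<omega>)" by eventually_elim (auto simp: restrict_def)
  qed (use Xm Y in \<open>auto intro!: measurable_restrict\<close>)
  also have "\<dots> = PiM I (\<lambda>i. distr M borel (X i))"
    using X indep_vars_iff_distr_eq_PiM'[OF False Xm] by simp
  also have "\<dots> = PiM I (\<lambda>i. distr M borel (Y i))"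
    using eq Xm Y by (intro PiM_cong distr_cong_AE) auto
  finally show ?thesis using indep_vars_iff_distr_eq_PiM'[OF False Y] by simp
qed

text \<open>Setting the process to 0 at negative times and off a measurable set of full measure
  makes every path regular on the whole line. Stationarity and symmetry of the increments follow
  from their characteristic functions by uniqueness.\<close>

lemma stable_levy_modification:
  assumes alpha: "1 < \<alpha>" "\<alpha> < 2" and X: "symmetric_stable_process \<alpha> M X"
  obtains W where "stable_levy M W \<alpha>" "AE \<omega> in M. \<forall>s\<ge>0. X s \<omega> = W s \<omega>"
proof -
  have X1: "prob_space M" "\<And>t. 0 \<le> t \<Longrightarrow> X t \<in> borel_measurable M" "AE \<omega> in M. X 0 \<omega> = 0"
    "AE \<omega> in M. cadlag (\<lambda>t. X t \<omega>)"
    "\<And>(n::nat) t. 0 \<le> t 0 \<Longrightarrow> incseq t \<Longrightarrow>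
        prob_space.indep_vars M (\<lambda>_. borel) (\<lambda>i \<omega>. X (t (Suc i)) \<omega> - X (t i) \<omega>) {..<n}"
    "\<And>s t \<xi>. 0 \<le> s \<Longrightarrow> s \<le> t \<Longrightarrow>
        char (distr M borel (\<lambda>\<omega>. X t \<omega> - X s \<omega>)) \<xi> = of_real (exp (- (t - s) * \<bar>\<xi>\<bar> powr \<alpha>))"
    using X unfolding symmetric_stable_process_def by blast+
  interpret prob_space M by (rule X1(1))
  have "AE \<omega> in M. X 0 \<omega> = 0 \<and> cadlag (\<lambda>t. X t \<omega>)" using X1(3,4) by eventually_elim simp
  then obtain N where N: "{\<omega> \<in> space M. \<not> (X 0 \<omega> = 0 \<and> cadlag (\<lambda>t. X t \<omega>))} \<subseteq> N" "emeasure M N = 0" "N \<in> sets M"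
    by (rule AE_E)
  \<comment> \<open>\<open>N\<close> is a measurable null set covering the bad paths; the set of
    good paths itself may fail to be measurable.\<close>
  define A where "A = space M - N"
  have A [measurable]: "A \<in> sets M" using N(3) by (simp add: A_def)
  have A_good: "X 0 \<omega> = 0" "cadlag (\<lambda>t. X t \<omega>)" if "\<omega> \<in> A" for \<omega> using N(1) that by (auto simp: A_def)
  have "AE \<omega> in M. \<omega> \<notin> N" using N by (intro AE_not_in) auto
  then have A_AE: "AE \<omega> in M. \<omega> \<in> A" by (rule AE_mp) (auto simp: A_def)
  define W where "W t \<omega> = (if 0 \<le> t \<and> \<omega> \<in> A then X t \<omega> else 0)" for t \<omega>
  have eqX: "AE \<omega> in M. \<forall>s\<ge>0. X s \<omega> = W s \<omega>" using A_AE by eventually_elim (simp add: W_def)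
  have Wm [measurable]: "W t \<in> borel_measurable M" for t
  proof (cases "0 \<le> t")
    case True
    note [measurable] = X1(2)[OF True]
    show ?thesis using True unfolding W_def by simp
  next
    case False
    then have "W t = (\<lambda>\<omega>. 0)" by (auto simp: W_def)
    then show ?thesis by simp
  qed
  have char_incr: "char (distr M borel (\<lambda>\<omega>. W t \<omega> - W s \<omega>)) \<xi> = of_real (exp (- (t - s) * \<bar>\<xi>\<bar> powr \<alpha>))"
    if st: "0 \<le> s" "s \<le> t" for s t \<xi>
  proof -
    note [measurable] = X1(2)[OF st(1)] X1(2)[OF order_trans[OF st]]
    have "distr M borel (\<lambda>\<omega>. W t \<omega> - W s \<omega>) = distr M borel (\<lambda>\<omega>. X t \<omega> - X s \<omega>)"
    proof (rule distr_cong_AE)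
      show "AE \<omega> in M. W t \<omega> - W s \<omega> = X t \<omega> - X s \<omega>" using eqX by eventually_elim (use st in auto)
    qed auto
    then show ?thesis using X1(6)[OF st] by simp
  qed
  have W0: "W t \<omega> = 0" if "t \<le> 0" for t \<omega> using that A_good(1) by (cases "t = 0") (auto simp: W_def)
  have charW: "char (distr M borel (W t)) \<xi> = of_real (exp (- t * \<bar>\<xi>\<bar> powr \<alpha>))" if "0 \<le> t" for t \<xi>
    using char_incr[of 0 t \<xi>] that by (simp add: W0)
  have rd: "real_distribution (distr M borel Y)" if "Y \<in> borel_measurable M" for Y :: "'a \<Rightarrow> real"
    using that by (rule real_distribution_distr)
  have "stable_levy M W \<alpha>"
  proof unfold_locales
    show "W t \<in> borel_measurable M" for t by (rule Wm)
    show "W t \<omega> = 0" if "t \<le> 0" for t \<omega> using that by (rule W0)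
    show "continuous (at_right t) (\<lambda>s. W s \<omega>)" for t \<omega>
    proof (cases "0 \<le> t \<and> \<omega> \<in> A")
      case True
      then have "continuous (at_right t) (\<lambda>s. X s \<omega>)" using A_good(2)[of \<omega>] by (auto simp: cadlag_def)
      then have "((\<lambda>s. X s \<omega>) \<longlongrightarrow> W t \<omega>) (at_right t)" using True by (simp add: continuous_within W_def)
      moreover have "\<forall>\<^sub>F s in at_right t. X s \<omega> = W s \<omega>"
        unfolding eventually_at_filter using True by (intro always_eventually) (auto simp: W_def)
      ultimately show ?thesis unfolding continuous_within by (rule Lim_transform_eventually)
    next
      case False
      have "\<forall>\<^sub>F s in at_right t. 0 = W s \<omega>"
      proof (cases "\<omega> \<in> A")
        case True
        then have "t < 0" using False by auto
        then have "\<forall>\<^sub>F s in at_right t. s < 0" by (simp add: eventually_at_right_field) (use \<open>t < 0\<close> in blast)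
        then show ?thesis by eventually_elim (simp add: W0)
      qed (simp add: W_def)
      then have "((\<lambda>s. W s \<omega>) \<longlongrightarrow> 0) (at_right t)" by (rule Lim_transform_eventually[OF tendsto_const])
      moreover have "W t \<omega> = 0" using False by (auto simp: W_def)
      ultimately show ?thesis by (simp add: continuous_within)
    qed
    show "\<exists>l. ((\<lambda>s. W s \<omega>) \<longlongrightarrow> l) (at_left t)" for t \<omega>
    proof (cases "0 < t \<and> \<omega> \<in> A")
      case True
      then obtain l where l: "((\<lambda>s. X s \<omega>) \<longlongrightarrow> l) (at_left t)" using A_good(2)[of \<omega>] by (auto simp: cadlag_def)
      have "\<forall>\<^sub>F s in at_left t. 0 < s" unfolding eventually_at_left_field using True by (intro exI[of _ 0]) auto
      then have "\<forall>\<^sub>F s in at_left t. X s \<omega> = W s \<omega>" using True by (auto simp: W_def elim: eventually_mono)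
      with l have "((\<lambda>s. W s \<omega>) \<longlongrightarrow> l) (at_left t)" by (rule Lim_transform_eventually)
      then show ?thesis ..
    next
      case False
      have "\<forall>\<^sub>F s in at_left t. 0 = W s \<omega>"
      proof (cases "\<omega> \<in> A")
        case True
        then have "t \<le> 0" using False by auto
        then show ?thesis unfolding eventually_at_filter by (intro always_eventually) (auto simp: W0)
      qed (simp add: W_def)
      then have "((\<lambda>s. W s \<omega>) \<longlongrightarrow> 0) (at_left t)" by (rule Lim_transform_eventually[OF tendsto_const])
      then show ?thesis ..
    qed
    show "indep_vars (\<lambda>_. borel) (\<lambda>i \<omega>. W (t (Suc i)) \<omega> - W (t i) \<omega>) {..<n}"
      if t: "0 \<le> t 0" "incseq t" for n :: nat and t :: "nat \<Rightarrow> real"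
    proof (rule indep_vars_cong_AE[OF X1(5)[OF t]])
      fix i
      have "0 \<le> t i" "0 \<le> t (Suc i)" using t by (auto intro: order_trans dest: incseqD)
      then show "AE \<omega> in M. X (t (Suc i)) \<omega> - X (t i) \<omega> = W (t (Suc i)) \<omega> - W (t i) \<omega>"
        using eqX by (auto elim: eventually_mono)
    qed auto
    show "distr M borel (\<lambda>\<omega>. W t \<omega> - W s \<omega>) = distr M borel (W (t - s))" if st: "0 \<le> s" "s \<le> t" for s t
      using char_incr[OF st] charW[of "t - s"] st by (intro Levy_uniqueness rd ext) simp_all
    show "distr M borel (\<lambda>\<omega>. - W t \<omega>) = distr M borel (W t)" for t
    proof (cases "0 \<le> t")
      case True
      have "char (distr M borel (\<lambda>\<omega>. - W t \<omega>)) \<xi> = char (distr M borel (W t)) (- \<xi>)" for \<xi>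
        unfolding char_def by (simp add: integral_distr)
      then show ?thesis using charW[OF True] by (intro Levy_uniqueness rd ext) simp_all
    next
      case False
      then have "W t = (\<lambda>\<omega>. 0)" by (auto simp: W_def)
      then show ?thesis by simp
    qed
    show "1 < \<alpha>" "\<alpha> < 2" by (rule alpha)+
    show "char (distr M borel (W t)) \<xi> = of_real (exp (- t * \<bar>\<xi>\<bar> powr \<alpha>))" if "0 \<le> t" for t \<xi>
      using that by (rule charW)
  qed
  then show thesis using eqX by (rule that)
qed

theorem theorem1p1:
  fixes \<alpha> :: real and \<sigma> :: "real \<Rightarrow> real"
    and M :: "'a measure" and X :: "real \<Rightarrow> 'a \<Rightarrow> real"
  assumes alpha: "1 < \<alpha>" "\<alpha> < 2"
    and X: "symmetric_stable_process \<alpha> M X"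
    and sigma_cont: "continuous_on UNIV \<sigma>"
    and sigma_pos: "\<And>x. \<sigma> x > 0"
    and mu_prob: "prob_space (speed_measure \<sigma> \<alpha>)"
    and I_finite: "(\<integral>\<^sup>+x. ennreal (\<sigma> x powr (- \<alpha>) * \<bar>x\<bar> powr (\<alpha> - 1)) \<partial>lborel) < \<infinity>"
  shows "\<forall>t>0. compact_operator_on_L2 (restrict_space (speed_measure \<sigma> \<alpha>) R0)
           (killed_semigroup \<sigma> \<alpha> M X t)"
proof (intro allI impI)
  fix t :: real assume t: "0 < t"
  obtain W where W: "stable_levy M W \<alpha>" "AE \<omega> in M. \<forall>s\<ge>0. X s \<omega> = W s \<omega>"
    by (rule stable_levy_modification[OF alpha X])
  interpret stable_speed M W \<alpha> \<sigma>
    using W(1) mu_prob I_finite sigma_cont sigma_pos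
    by (intro stable_speed.intro stable_clock.intro stable_speed_axioms.intro time_change.intro)
  show "compact_operator_on_L2 (restrict_space (speed_measure \<sigma> \<alpha>) R0) (killed_semigroup \<sigma> \<alpha> M X t)"
  proof (rule compact_on_L2[OF t])
    fix f :: "real \<Rightarrow> real" and x :: real
    assume f: "f \<in> square_integrable N0" and x: "x \<noteq> 0"
    have "f \<in> borel_measurable (restrict_space borel R0)"
      using square_integrable_measurable[OF f] by (simp cong: measurable_cong_sets restrict_space_sets_cong)
    then show "killed_semigroup \<sigma> \<alpha> M X t f x = PT t (off0 f) x"
      by (rule killed_semigroup_eq[OF W(2) x t])
  qed
qed

end
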